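(* Fix $N\in\{1,2,3\}$ and an integer $d\ge 3$. For every $r\in(0,1]$ there exists a constant $\Lambda=\Lambda(r)>1$ with the following property. Let $0<\lambda_1\le\lambda_2\le\cdots\le\lambda_d$ with $\lambda_1/\lambda_2=r$, let $\mu_1,\ldots,\mu_d>0$, and let $b_{ij}=b$ for all $i\ne j$, where $b>\max\{\mu_1,\ldots,\mu_d\}$. If $\lambda_2\Lambda\le\lambda_i$ for some $i\ge 3$, then every ground state solution $\mathbf{u}=(u_1,\ldots,u_d)$ of the system $$-\Delta u_i+\lambda_i u_i=\mu_i u_i^3+u_i\sum_{j\ne i}b\,u_j^2,\qquad u_i\in H^1(\mathbb{R}^N;\mathbb{R}),\quad i=1,\ldots,d,$$ satisfies $u_i\equiv\cdots\equiv u_d\equiv 0$. In particular, if $(\lambda_2,\ldots,\lambda_d)\notin\mathcal{A}_\Lambda$, then $G^*=\emptyset$.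
   Context: Let $1\le N\le 3$, $\lambda_i,\mu_i>0$ for $i=1,\dots,d$, and $b_{ij}=b_{ji}>0$ for $i\neq j$. Consider the system $-\Delta u_i+\lambda_i u_i=\mu_i u_i^3+u_i\sum_{j\neq i}b_{ij}u_j^2$ in $\mathbb{R}^N$, $u_i\in H^1(\mathbb{R}^N;\mathbb{R})$, $i=1,\dots,d$. Its solutions are the critical points of the $C^2$ functional $I_d:(H^1(\mathbb{R}^N))^d\to\mathbb{R}$, $$I_d(\mathbf{u})=\frac12\sum_{i=1}^d\int(|\nabla u_i|^2+\lambda_i u_i^2)-\frac14\sum_{i=1}^d\mu_i\int u_i^4-\frac12\sum_{i<j}b_{ij}\int u_i^2u_j^2 .$$ The ground state level is $c=\inf\{I_d(\mathbf{u}):\mathbf{u}\ne\mathbf{0},\ I_d'(\mathbf{u})=0\}$, and a ground state is an element of $G=\{\mathbf{u}:\mathbf{u}\neq\mathbf{0},\ I_d'(\mathbf{u})=0,\ I_d(\mathbf{u})=c\}$. $G^*=\{\mathbf{u}\in G: u_i\not\equiv0\text{ for every } i=1,\dots,d\}$ is the set of fully nontrivial ground states. For $\alpha>1$ and $k\ge2$, a vector $(a_1,\dots,a_k)\in\mathbb{R}^k$ is $\alpha$-admissible, written $(a_1,\dots,a_k)\in\mathcal{A}_\alpha$, if $\max_{1\le i\le k}a_i<\alpha\min_{1\le i\le k}a_i$. *)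

theory Defs
  imports "HOL-Analysis.Analysis"
begin

subsection \<open>The Sobolev space of square-integrable functions with square-integrable gradient\<close>

definition partial_deriv :: "'n::finite \<Rightarrow> (real^'n \<Rightarrow> real) \<Rightarrow> real^'n \<Rightarrow> real" where
  "partial_deriv k f x = frechet_derivative f (at x) (axis k 1)"

fun C_class :: "nat \<Rightarrow> (real^'n::finite \<Rightarrow> real) \<Rightarrow> bool" where
  "C_class 0 f \<longleftrightarrow> continuous_on UNIV f"
| "C_class (Suc m) f \<longleftrightarrow> f differentiable_on UNIV \<and> (\<forall>k. C_class m (partial_deriv k f))"

definition test_function :: "(real^'n::finite \<Rightarrow> real) \<Rightarrow> bool" where
  "test_function \<phi> \<longleftrightarrow> (\<forall>m. C_class m \<phi>) \<and> compact (closure {x. \<phi> x \<noteq> 0})"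

definition locally_integrable :: "(real^'n::finite \<Rightarrow> 'b::euclidean_space) \<Rightarrow> bool" where
  "locally_integrable f \<longleftrightarrow> (\<forall>K. compact K \<longrightarrow> set_integrable lebesgue K f)"

definition square_integrable :: "(real^'n::finite \<Rightarrow> 'b::euclidean_space) \<Rightarrow> bool" where
  "square_integrable f \<longleftrightarrow>
     f \<in> borel_measurable lebesgue \<and> integrable lebesgue (\<lambda>x. (norm (f x))\<^sup>2)"

definition has_weak_gradient ::
  "(real^'n::finite \<Rightarrow> real) \<Rightarrow> (real^'n \<Rightarrow> real^'n) \<Rightarrow> bool" where
  "has_weak_gradient u g \<longleftrightarrow>
     locally_integrable u \<and> locally_integrable g \<and>
     (\<forall>\<phi> k. test_function \<phi> \<longrightarrow>
        (LINT x|lebesgue. u x * partial_deriv k \<phi> x) = - (LINT x|lebesgue. g x $ k * \<phi> x))"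

text \<open>The weak gradient is unique up to a null set, so the choice below does not affect integrals.\<close>

definition weak_grad :: "(real^'n::finite \<Rightarrow> real) \<Rightarrow> real^'n \<Rightarrow> real^'n" where
  "weak_grad u = (SOME g. has_weak_gradient u g)"

text \<open>
  Elements of the Sobolev space are represented by functions rather than by classes modulo
  equality almost everywhere; hence \<open>u \<equiv> 0\<close> is rendered as vanishing almost everywhere.
\<close>

definition H1 :: "(real^'n::finite \<Rightarrow> real) set" where
  "H1 = {u. square_integrable u \<and> (\<exists>g. has_weak_gradient u g \<and> square_integrable g)}"

definition null_fun :: "(real^'n::finite \<Rightarrow> real) \<Rightarrow> bool" where
  "null_fun u \<longleftrightarrow> (AE x in lebesgue. u x = 0)"

text \<open>
  Vectors with \<open>d\<close> components are functions on \<open>nat\<close> of which only the values at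
  \<open>1, \<dots>, d\<close> matter.
\<close>

definition H1_vec :: "nat \<Rightarrow> (nat \<Rightarrow> real^'n::finite \<Rightarrow> real) set" where
  "H1_vec d = {1..d} \<rightarrow> H1"

definition norm_H1_vec :: "nat \<Rightarrow> (nat \<Rightarrow> real^'n::finite \<Rightarrow> real) \<Rightarrow> real" where
  "norm_H1_vec d u =
     sqrt (\<Sum>i=1..d. LINT x|lebesgue. (norm (weak_grad (u i) x))\<^sup>2 + (u i x)\<^sup>2)"

definition null_vec :: "nat \<Rightarrow> (nat \<Rightarrow> real^'n::finite \<Rightarrow> real) \<Rightarrow> bool" where
  "null_vec d u \<longleftrightarrow> (\<forall>i\<in>{1..d}. null_fun (u i))"


subsection \<open>The functional, its critical points and ground states\<close>

definition energy ::
  "nat \<Rightarrow> (nat \<Rightarrow> real) \<Rightarrow> (nat \<Rightarrow> real) \<Rightarrow> (nat \<Rightarrow> nat \<Rightarrow> real) \<Rightarrow> (nat \<Rightarrow> real^'n::finite \<Rightarrow> real) \<Rightarrow> real" where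
  "energy d lam mu b u =
     1/2 * (\<Sum>i=1..d. LINT x|lebesgue. (norm (weak_grad (u i) x))\<^sup>2 + lam i * (u i x)\<^sup>2)
     - 1/4 * (\<Sum>i=1..d. mu i * (LINT x|lebesgue. (u i x)^4))
     - 1/2 * (\<Sum>i=1..d. \<Sum>j\<in>{i<..d}. b i j * (LINT x|lebesgue. (u i x)\<^sup>2 * (u j x)\<^sup>2))"

text \<open>
  Vanishing of the Frechet derivative of \<open>F\<close> at \<open>u\<close>. The space is not a type of class
  \<open>real_normed_vector\<close>, so the definition of \<open>(F has_derivative (\<lambda>v. 0)) (at u)\<close> is written out.
\<close>

definition critical_point ::
  "nat \<Rightarrow> ((nat \<Rightarrow> real^'n::finite \<Rightarrow> real) \<Rightarrow> real) \<Rightarrow> (nat \<Rightarrow> real^'n \<Rightarrow> real) \<Rightarrow> bool" where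
  "critical_point d F u \<longleftrightarrow> u \<in> H1_vec d \<and>
     (\<forall>\<epsilon>>0. \<exists>\<delta>>0. \<forall>v\<in>H1_vec d. norm_H1_vec d v < \<delta> \<longrightarrow>
        \<bar>F (\<lambda>i x. u i x + v i x) - F u\<bar> \<le> \<epsilon> * norm_H1_vec d v)"

definition nonzero_critical_points ::
  "nat \<Rightarrow> (nat \<Rightarrow> real) \<Rightarrow> (nat \<Rightarrow> real) \<Rightarrow> (nat \<Rightarrow> nat \<Rightarrow> real) \<Rightarrow> (nat \<Rightarrow> real^'n::finite \<Rightarrow> real) set" where
  "nonzero_critical_points d lam mu b =
     {u. \<not> null_vec d u \<and> critical_point d (energy d lam mu b) u}"

definition ground_states ::
  "nat \<Rightarrow> (nat \<Rightarrow> real) \<Rightarrow> (nat \<Rightarrow> real) \<Rightarrow> (nat \<Rightarrow> nat \<Rightarrow> real) \<Rightarrow> (nat \<Rightarrow> real^'n::finite \<Rightarrow> real) set" where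
  "ground_states d lam mu b =
     {u \<in> nonzero_critical_points d lam mu b.
        energy d lam mu b u
          = (INF w \<in> (nonzero_critical_points d lam mu b :: (nat \<Rightarrow> real^'n \<Rightarrow> real) set).
               energy d lam mu b w)}"

definition fully_nontrivial_ground_states ::
  "nat \<Rightarrow> (nat \<Rightarrow> real) \<Rightarrow> (nat \<Rightarrow> real) \<Rightarrow> (nat \<Rightarrow> nat \<Rightarrow> real) \<Rightarrow> (nat \<Rightarrow> real^'n::finite \<Rightarrow> real) set" where
  "fully_nontrivial_ground_states d lam mu b =
     {u \<in> ground_states d lam mu b. \<forall>i\<in>{1..d}. \<not> null_fun (u i)}"

definition admissible :: "real \<Rightarrow> real list set" where
  "admissible \<alpha> = {as. length as \<ge> 2 \<and> Max (set as) < \<alpha> * Min (set as)}"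

end

theory Submission
  imports Defs "HOL-Computational_Algebra.Polynomial" "HOL-Complex_Analysis.Great_Picard"
begin

text \<open>
  Write \<open>Q\<close> for the quadratic and \<open>B\<close> for the quartic part of the functional, so that the energy
  is \<open>Q / 2 - B / 4\<close> and equals \<open>Q / 4\<close> at a critical point. Minimizing \<open>Q\<^sup>2 / B\<close> produces a
  nonzero critical point \<open>W\<close> with \<open>Q W \<le> (Q \<Psi>)\<^sup>2 / B \<Psi>\<close> for any given vector \<open>\<Psi>\<close>. Taking
  \<open>\<Psi> = (\<psi>, \<psi>, 0, \<dots>, 0)\<close> with a bump \<open>\<psi>\<close> rescaled by \<open>sqrt (lam 2)\<close> bounds \<open>Q u\<close>, for every
  ground state \<open>u\<close>, by \<open>C / b\<close> times \<open>lam 2\<close> to the power \<open>2 - N / 2\<close>, where \<open>C\<close> depends on \<open>N\<close>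
  only. Let \<open>q\<close> be the \<open>j\<close>-th summand of \<open>Q u\<close>. Testing the \<open>j\<close>-th equation with its solution and
  using the Sobolev inequality for \<open>L\<^sup>4\<close> on the scale \<open>1 / sqrt (lam i)\<close> yields \<open>q \<le> \<kappa> * q\<close>, where
  \<open>\<kappa>\<close> is a constant times \<open>(lam 2)\<^sup>2 / (lam 1 * lam j)\<close> to the power \<open>(4 - N) / 4\<close>. Hence \<open>q = 0\<close> as
  soon as \<open>lam j / lam 2\<close> is large in terms of \<open>r = lam 1 / lam 2\<close>.

  The analysis rests on the averages of a function over cubes: halving the side \<open>l\<close> changes the
  average by at most \<open>C * l\<close> times the average of the norm of the gradient. Summed over dyadic
  scales this gives the Sobolev inequality, and it shows that a function with small averages has
  small \<open>L\<^sup>4\<close> norm. A minimizing sequence can therefore be translated so that it does not vanish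
  in the limit; its first variation tends to zero, and the weak limit is the critical point.
\<close>

subsection \<open>Smooth bump functions\<close>

text \<open>Existence of a ground state is not at stake: any nonzero critical point of low energy
  bounds the infimum from above, and that is what the component estimate consumes. Accordingly no
  strong convergence of the minimizing sequence is proved; even after translation, mass may escape
  to infinity. It suffices that the weak limit \<open>w\<close> is nonzero, solves the limit
  equation with multiplier \<open>m\<close>, the limit of \<open>Q\<close>, and has
  \<open>Q w\<close> at most \<open>m\<close>. Rescaling by \<open>sqrt m\<close> then gives
  \<open>W\<close> with the required bound.

  The constant must not depend on \<open>b\<close> or the \<open>mu i\<close>. Two equal components
  create the cross term \<open>2 * b\<close> in the quartic part, so the energy bound carries
  \<open>1 / b\<close>; the equation of a component carries coefficients at most \<open>b\<close>,
  and the two cancel. What remains compares \<open>lam 2\<close>, the scale of the test vector, with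
  \<open>lam 1\<close>, the worst scale among the other components, and with \<open>lam j\<close>.
  Since \<open>lam 1 = r * lam 2\<close>, this is where \<open>r\<close> enters.\<close>

lemma partial_deriv_eq:
  "(f has_derivative f') (at x) \<Longrightarrow> partial_deriv k f x = f' (axis k 1)"
  unfolding partial_deriv_def using frechet_derivative_at by metis

text \<open>For functions that are easy to differentiate along one coordinate line but whose full
  derivative would be tedious to write out.\<close>

lemma partial_deriv_eq_DERIV:
  assumes "f differentiable (at x)"
    and "((\<lambda>t. f (x + t *\<^sub>R axis k 1)) has_real_derivative D) (at 0)"
  shows "partial_deriv k f x = D"
proof -
  let ?f' = "frechet_derivative f (at x)"
  have f': "(f has_derivative ?f') (at x)"
    using assms(1) frechet_derivative_works by blast
  have "((\<lambda>t. x + t *\<^sub>R axis k (1::real)) has_derivative (\<lambda>t. t *\<^sub>R axis k 1)) (at 0)"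
    by (auto intro!: derivative_eq_intros)
  then have "((\<lambda>t. f (x + t *\<^sub>R axis k 1)) has_derivative (\<lambda>t. ?f' (t *\<^sub>R axis k 1))) (at 0)"
    by (rule has_derivative_compose) (use f' in simp)
  moreover have "((\<lambda>t. f (x + t *\<^sub>R axis k 1)) has_derivative (\<lambda>t. D * t)) (at 0)"
    using assms(2) by (simp add: has_field_derivative_def)
  ultimately have "(\<lambda>t. ?f' (t *\<^sub>R axis k 1)) = (\<lambda>t. D * t)"
    by (rule has_derivative_unique)
  from fun_cong[OF this, of 1] show ?thesis
    by (simp add: partial_deriv_def)
qed

lemma C_class_SucI:
  assumes "\<And>x. (f has_derivative f' x) (at x)" and "\<And>k. C_class m (\<lambda>x. f' x (axis k 1))"
  shows "C_class (Suc m) f"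
proof -
  have "partial_deriv k f = (\<lambda>x. f' x (axis k 1))" for k
    using assms(1) by (auto simp: partial_deriv_eq)
  moreover have "f differentiable_on UNIV"
    using assms(1) by (auto simp: differentiable_on_def differentiable_def)
  ultimately show ?thesis using assms(2) by simp
qed

text \<open>The product rule keeps one factor undifferentiated, so the induction for products needs
  that factor one class down.\<close>

lemma C_class_SucD: "C_class (Suc m) f \<Longrightarrow> C_class m f"
proof (induction m arbitrary: f)
  case 0
  then show ?case by (simp add: differentiable_imp_continuous_on)
next
  case (Suc m)
  then show ?case by (metis C_class.simps(2))
qed

lemma C_class_const: "C_class m (\<lambda>x. c)"
proof (induction m arbitrary: c)
  case (Suc m)
  show ?case
    by (rule C_class_SucI[where f' = "\<lambda>_ _. 0"]) (auto intro: Suc)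
qed simp

lemma C_class_has_derivative:
  "C_class (Suc m) f \<Longrightarrow> (f has_derivative frechet_derivative f (at x)) (at x)"
  by (simp add: differentiable_on_def frechet_derivative_works[symmetric])

lemma C_class_add: "C_class m f \<Longrightarrow> C_class m g \<Longrightarrow> C_class m (\<lambda>x. f x + g x)"
proof (induction m arbitrary: f g)
  case 0
  then show ?case by (auto intro: continuous_on_add)
next
  case (Suc m)
  show ?case
  proof (rule C_class_SucI)
    show "((\<lambda>x. f x + g x) has_derivative
        (\<lambda>h. frechet_derivative f (at x) h + frechet_derivative g (at x) h)) (at x)" for x
      using Suc.prems by (intro has_derivative_add C_class_has_derivative)
    fix k
    have "C_class m (\<lambda>x. partial_deriv k f x + partial_deriv k g x)"
      using Suc.prems by (intro Suc.IH) auto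
    then show "C_class m (\<lambda>x. frechet_derivative f (at x) (axis k 1) + frechet_derivative g (at x) (axis k 1))"
      by (simp add: partial_deriv_def)
  qed
qed

lemma C_class_mult: "C_class m f \<Longrightarrow> C_class m g \<Longrightarrow> C_class m (\<lambda>x. f x * g x)"
proof (induction m arbitrary: f g)
  case 0
  then show ?case by (auto intro: continuous_on_mult)
next
  case (Suc m)
  show ?case
  proof (rule C_class_SucI)
    show "((\<lambda>x. f x * g x) has_derivative
        (\<lambda>h. f x * frechet_derivative g (at x) h + frechet_derivative f (at x) h * g x)) (at x)" for x
      using Suc.prems by (intro has_derivative_mult C_class_has_derivative)
    fix k
    have "C_class m (\<lambda>x. f x * partial_deriv k g x + partial_deriv k f x * g x)"
      using Suc.prems C_class_SucD[OF Suc.prems(1)] C_class_SucD[OF Suc.prems(2)]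
      by (intro C_class_add Suc.IH) auto
    then show "C_class m (\<lambda>x. f x * frechet_derivative g (at x) (axis k 1) + frechet_derivative f (at x) (axis k 1) * g x)"
      by (simp add: partial_deriv_def)
  qed
qed

lemma C_class_prod:
  "finite J \<Longrightarrow> (\<And>j. j \<in> J \<Longrightarrow> C_class m (f j)) \<Longrightarrow> C_class m (\<lambda>x. \<Prod>j\<in>J. f j x)"
  by (induction J rule: finite_induct) (auto intro: C_class_const C_class_mult)

lemma has_derivative_comp_affine:
  assumes "(f has_derivative f') (at (c *\<^sub>R x + a))"
  shows "((\<lambda>x. f (c *\<^sub>R x + a)) has_derivative (\<lambda>h. c *\<^sub>R f' h)) (at x)"
proof -
  have "((\<lambda>x. c *\<^sub>R x + a) has_derivative (\<lambda>h. c *\<^sub>R h)) (at x)"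
    by (auto intro!: derivative_eq_intros)
  from has_derivative_compose[OF this assms] show ?thesis
    using assms by (simp add: linear_simps(5) has_derivative_bounded_linear)
qed

lemma partial_deriv_affine:
  assumes "f differentiable_on UNIV"
  shows "partial_deriv k (\<lambda>x. f (c *\<^sub>R x + a)) x = c * partial_deriv k f (c *\<^sub>R x + a)"
proof -
  have "(f has_derivative frechet_derivative f (at (c *\<^sub>R x + a))) (at (c *\<^sub>R x + a))"
    using assms by (simp add: differentiable_on_def frechet_derivative_works[symmetric])
  from has_derivative_comp_affine[OF this] show ?thesis
    by (subst partial_deriv_eq) (auto simp: partial_deriv_def)
qed

lemma C_class_affine: "C_class m f \<Longrightarrow> C_class m (\<lambda>x. f (c *\<^sub>R x + a))"
proof (induction m arbitrary: f)
  case 0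
  then show ?case
    by (auto intro!: continuous_on_compose2[of UNIV f UNIV "\<lambda>x. c *\<^sub>R x + a"] continuous_intros)
next
  case (Suc m)
  show ?case
  proof (rule C_class_SucI)
    show "((\<lambda>x. f (c *\<^sub>R x + a)) has_derivative
        (\<lambda>h. c *\<^sub>R frechet_derivative f (at (c *\<^sub>R x + a)) h)) (at x)" for x
      using Suc.prems by (intro has_derivative_comp_affine C_class_has_derivative)
    fix k
    have "C_class m (\<lambda>x. c * partial_deriv k f (c *\<^sub>R x + a))"
      using Suc.prems by (intro C_class_mult C_class_const Suc.IH) auto
    then show "C_class m (\<lambda>x. c *\<^sub>R frechet_derivative f (at (c *\<^sub>R x + a)) (axis k 1))"
      by (simp add: partial_deriv_def)
  qed
qed

section \<open>Smooth cutoffs of boxes built from functions of one variable\<close>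

lemma has_derivative_coord:
  assumes "(h has_real_derivative h') (at (x $ k))"
  shows "((\<lambda>x::real^'n::finite. h (x $ k)) has_derivative (\<lambda>y. h' * y $ k)) (at x)"
proof -
  have "((\<lambda>x::real^'n. x $ k) has_derivative (\<lambda>y. y $ k)) (at x)"
    by (intro bounded_linear_imp_has_derivative bounded_linear_vec_nth)
  from has_derivative_compose[OF this, of h "\<lambda>t. h' * t"] assms show ?thesis
    by (simp add: has_field_derivative_def)
qed

lemma C_class_coord_Suc:
  fixes k :: "'n::finite"
  assumes "\<And>t. (h has_real_derivative h' t) (at t)" and "C_class m (\<lambda>x::real^'n. h' (x $ k))"
  shows "C_class (Suc m) (\<lambda>x::real^'n. h (x $ k))"
proof (rule C_class_SucI)
  show "((\<lambda>x::real^'n. h (x $ k)) has_derivative (\<lambda>y. h' (x $ k) * y $ k)) (at x)" for x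
    using assms(1) by (intro has_derivative_coord)
  show "C_class m (\<lambda>x::real^'n. h' (x $ k) * axis j 1 $ k)" for j
    using assms(2) by (intro C_class_mult C_class_const)
qed

text \<open>The whole sequence of derivatives is the datum, so that the induction on
  \<open>m\<close> can move from \<open>D n\<close> to \<open>D (Suc n)\<close>.\<close>

lemma C_class_coord:
  fixes k :: "'n::finite"
  assumes "\<And>n t. (D n has_real_derivative D (Suc n) t) (at t)"
  shows "C_class m (\<lambda>x::real^'n. D n (x $ k))"
proof (induction m arbitrary: n)
  case 0
  have "continuous_on UNIV (D n)"
    using assms by (meson DERIV_isCont continuous_at_imp_continuous_on)
  then show ?case
    by (auto intro!: continuous_on_compose2[of UNIV "D n" UNIV "\<lambda>x. x $ k"] continuous_intros)
next
  case (Suc m)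
  show ?case
    by (rule C_class_coord_Suc[OF assms Suc])
qed

text \<open>The flat function exp(-1/t) with a polynomial factor in 1/t. This makes the family
  closed under differentiation: the derivative belongs to the polynomial s^2 (p - p') in s = 1/t,
  and \<open>[:0,0,1:]\<close> is s^2.\<close>

definition exp_bump :: "real poly \<Rightarrow> real \<Rightarrow> real" where
  "exp_bump p t = (if t > 0 then poly p (1 / t) * exp (- (1 / t)) else 0)"

lemma tendsto_poly_times_exp:
  fixes p :: "real poly"
  shows "((\<lambda>s. poly p s * exp (- s)) \<longlongrightarrow> 0) at_top"
proof -
  have "((\<lambda>s::real. \<Sum>i\<le>degree p. coeff p i * (s ^ i / exp s)) \<longlongrightarrow> (\<Sum>i\<le>degree p. coeff p i * 0)) at_top"
    by (intro tendsto_intros tendsto_power_div_exp_0)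
  then show ?thesis
    by (simp add: poly_altdef exp_minus sum_divide_distrib[symmetric] field_class.field_divide_inverse sum_distrib_right mult.assoc)
qed

lemma DERIV_exp_bump:
  "(exp_bump p has_real_derivative exp_bump ([:0,0,1:] * (p - pderiv p)) t) (at t)"
proof -
  consider "t > 0" | "t < 0" | "t = 0" by linarith
  then show ?thesis
  proof cases
    case 1
    have "((\<lambda>t. poly p (1 / t) * exp (- (1 / t))) has_real_derivative
        exp_bump ([:0,0,1:] * (p - pderiv p)) t) (at t)"
      using 1 unfolding exp_bump_def
      by (auto intro!: derivative_eq_intros DERIV_chain2[OF poly_DERIV] simp: field_simps power2_eq_square)
    moreover have "eventually (\<lambda>t. exp_bump p t = poly p (1 / t) * exp (- (1 / t))) (nhds t)"
      using 1 eventually_nhds_in_open[of "{0<..}" t] by (auto elim!: eventually_mono simp: exp_bump_def)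
    ultimately show ?thesis
      by (subst DERIV_cong_ev[OF refl _ refl]) auto
  next
    case 2
    have "((\<lambda>t. 0) has_real_derivative exp_bump ([:0,0,1:] * (p - pderiv p)) t) (at t)"
      using 2 by (auto simp: exp_bump_def)
    moreover have "eventually (\<lambda>t. exp_bump p t = 0) (nhds t)"
      using 2 eventually_nhds_in_open[of "{..<0}" t] by (auto elim!: eventually_mono simp: exp_bump_def)
    ultimately show ?thesis
      by (subst DERIV_cong_ev[OF refl _ refl]) auto
  next
    case 3
    have "((\<lambda>h. exp_bump p h / h) \<longlongrightarrow> 0) (at_left 0)"
      by (rule tendsto_eventually) (auto simp: eventually_at_filter exp_bump_def)
    moreover have "((\<lambda>h. exp_bump p h / h) \<longlongrightarrow> 0) (at_right 0)"
    proof (rule Lim_transform_eventually)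
      \<comment> \<open>With s = 1/h the difference quotient at 0 is s p(s) exp(-s), and
        \<open>pCons 0 p\<close> is the polynomial s p(s).\<close>
      show "((\<lambda>h. poly (pCons 0 p) (inverse h) * exp (- inverse h)) \<longlongrightarrow> 0) (at_right 0)"
        by (rule filterlim_compose[OF tendsto_poly_times_exp filterlim_inverse_at_top_right])
      show "\<forall>\<^sub>F h in at_right 0. poly (pCons 0 p) (inverse h) * exp (- inverse h) = exp_bump p h / h"
        by (auto simp: eventually_at_filter exp_bump_def field_simps)
    qed
    ultimately have "((\<lambda>h. exp_bump p h / h) \<longlongrightarrow> 0) (at 0)"
      by (simp add: filterlim_split_at)
    then show ?thesis
      using 3 by (simp add: DERIV_def exp_bump_def)
  qed
qed

lemma C_class_exp_bump:
  fixes k :: "'n::finite"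
  shows "C_class m (\<lambda>x::real^'n. exp_bump 1 (c * x $ k + e))"
proof -
  \<comment> \<open>\<open>q n\<close> is the polynomial of the n-th derivative; the chain rule
    contributes the factor \<open>c ^ n\<close> in \<open>D n\<close>.\<close>
  define q where "q = (\<lambda>n. ((\<lambda>p. [:0,0,1:] * (p - pderiv p)) ^^ n) (1 :: real poly))"
  define D where "D = (\<lambda>n t. c ^ n * exp_bump (q n) (c * t + e))"
  have "(D n has_real_derivative D (Suc n) t) (at t)" for n t
    unfolding D_def
    by (auto intro!: derivative_eq_intros DERIV_chain2[OF DERIV_exp_bump] simp: q_def)
  from C_class_coord[of D, OF this, of m 0 k] show ?thesis
    by (simp add: D_def q_def)
qed

text \<open>The factor \<open>Suc n\<close> steepens both flanks while the support stays in the
  closed interval, so these functions tend to the indicator of the open interval.\<close>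

definition interval_bump :: "nat \<Rightarrow> real \<Rightarrow> real \<Rightarrow> real \<Rightarrow> real" where
  "interval_bump n a b t = exp_bump 1 (real (Suc n) * (t - a)) * exp_bump 1 (real (Suc n) * (b - t))"

lemma exp_bump_1_bounds: "0 \<le> exp_bump 1 t" "exp_bump 1 t \<le> 1"
  by (auto simp: exp_bump_def)

lemma interval_bump_bounds: "0 \<le> interval_bump n a b t" "interval_bump n a b t \<le> 1"
  by (auto simp: interval_bump_def exp_bump_1_bounds intro: mult_le_one)

lemma interval_bump_eq_0: "\<not> (a < t \<and> t < b) \<Longrightarrow> interval_bump n a b t = 0"
  by (auto simp: interval_bump_def exp_bump_def zero_less_mult_iff)

lemma interval_bump_shift: "interval_bump n (a + s) (b + s) t = interval_bump n a b (t - s)"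
proof -
  have "t - (a + s) = t - s - a" "b + s - t = b - (t - s)" by auto
  then show ?thesis unfolding interval_bump_def by metis
qed

lemma tendsto_exp_bump_scaled:
  assumes "c > 0"
  shows "(\<lambda>n. exp_bump 1 (real (Suc n) * c)) \<longlonglongrightarrow> 1"
proof -
  have "(\<lambda>n. exp (- ((1 / c) * (1 / real (Suc n))))) \<longlonglongrightarrow> exp (- ((1 / c) * 0))"
    by (intro tendsto_intros LIMSEQ_Suc lim_1_over_n)
  then show ?thesis
    using assms by (simp add: exp_bump_def mult.commute)
qed

lemma tendsto_interval_bump:
  "(\<lambda>n. interval_bump n a b t) \<longlonglongrightarrow> (if a < t \<and> t < b then 1 else 0)"
proof (cases "a < t \<and> t < b")
  case True
  then have "(\<lambda>n. interval_bump n a b t) \<longlonglongrightarrow> 1 * 1"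
    unfolding interval_bump_def by (intro tendsto_mult tendsto_exp_bump_scaled) auto
  with True show ?thesis by simp
qed (auto simp: interval_bump_eq_0)

lemma C_class_interval_bump: "C_class m (\<lambda>x::real^'n::finite. interval_bump n a b (x $ k))"
proof -
  have "C_class m (\<lambda>x::real^'n. exp_bump 1 (real (Suc n) * x $ k + (- real (Suc n) * a))
      * exp_bump 1 (- real (Suc n) * x $ k + real (Suc n) * b))"
    by (intro C_class_mult C_class_exp_bump)
  moreover have "c * x + (- c * a) = c * (x - a)" "- c * x + c * b = c * (b - x)" for c x :: real
    by (simp_all add: right_diff_distrib)
  ultimately show ?thesis
    unfolding interval_bump_def by (simp only:)
qed

lemma continuous_interval_bump: "isCont (interval_bump n a b) t"
proof -
  have "isCont (exp_bump 1) t" for t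
    by (rule DERIV_isCont[OF DERIV_exp_bump])
  then have *: "isCont (\<lambda>t. exp_bump 1 (f t)) t" if "isCont f t" for f :: "real \<Rightarrow> real" and t
    using isCont_o2[OF that] by blast
  show ?thesis
    unfolding interval_bump_def[abs_def] by (intro isCont_mult *) (auto intro!: continuous_intros)
qed

definition box_bump :: "nat \<Rightarrow> real^'n::finite \<Rightarrow> real^'n \<Rightarrow> real^'n \<Rightarrow> real" where
  "box_bump n a b x = (\<Prod>j\<in>UNIV. interval_bump n (a $ j) (b $ j) (x $ j))"

lemma box_bump_bounds: "0 \<le> box_bump n a b x" "box_bump n a b x \<le> 1"
  by (auto simp: box_bump_def interval_bump_bounds intro: prod_nonneg prod_le_1)

lemma box_bump_eq_0: "x \<notin> box a b \<Longrightarrow> box_bump n a b x = 0"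
  by (auto simp: box_bump_def mem_box_cart intro: interval_bump_eq_0)

lemma tendsto_box_bump: "(\<lambda>n. box_bump n a b x) \<longlonglongrightarrow> indicator (box a b) x"
proof -
  have "(\<lambda>n. box_bump n a b x) \<longlonglongrightarrow> (\<Prod>j\<in>UNIV. if a $ j < x $ j \<and> x $ j < b $ j then 1 else 0)"
    unfolding box_bump_def by (intro tendsto_prod tendsto_interval_bump)
  also have "(\<Prod>j\<in>UNIV. if a $ j < x $ j \<and> x $ j < b $ j then 1 else 0) = (indicator (box a b) x :: real)"
    by (auto simp: indicator_def mem_box_cart)
  finally show ?thesis .
qed

lemma test_functionI:
  assumes "\<And>m. C_class m \<phi>" and "\<And>x. \<phi> x \<noteq> 0 \<Longrightarrow> x \<in> cbox a b"
  shows "test_function \<phi>"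
proof -
  have "bounded {x. \<phi> x \<noteq> 0}"
    by (rule bounded_subset[OF bounded_cbox[of a b]]) (use assms(2) in auto)
  then show ?thesis
    using assms(1) by (simp add: test_function_def compact_closure)
qed

lemma test_function_box_bump: "test_function (box_bump n a b)"
proof (rule test_functionI[of _ a b])
  show "C_class m (box_bump n a b)" for m
    unfolding box_bump_def[abs_def] by (rule C_class_prod[OF finite C_class_interval_bump])
  show "box_bump n a b x \<noteq> 0 \<Longrightarrow> x \<in> cbox a b" for x
    by (metis box_bump_eq_0 box_subset_cbox subsetD)
qed

text \<open>A bump minus its translate in direction \<open>k\<close> has integral zero along every
  line in that direction. Its primitive along these lines is therefore compactly supported: a smooth
  version of the tent between two adjacent boxes.\<close>

lemma box_shift_test_function:
  fixes a b :: "real^'n::finite"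
  assumes "s > 0"
  obtains \<Phi> where "test_function \<Phi>"
    and "\<And>x. partial_deriv k \<Phi> x = box_bump n a b x - box_bump n (a + s *\<^sub>R axis k 1) (b + s *\<^sub>R axis k 1) x"
    and "\<And>x. \<bar>\<Phi> x\<bar> \<le> s"
    and "\<And>x. x \<notin> cbox a (b + s *\<^sub>R axis k 1) \<Longrightarrow> \<Phi> x = 0"
proof -
  let ?\<beta> = "interval_bump n (a $ k) (b $ k)"
  have "\<exists>E. \<forall>t. -\<infinity> < ereal t \<longrightarrow> ereal t < \<infinity> \<longrightarrow> (E has_vector_derivative ?\<beta> t) (at t)"
    by (rule einterval_antiderivative) (simp_all add: continuous_interval_bump)
  then obtain E where E: "\<And>t. (E has_real_derivative ?\<beta> t) (at t)"
    unfolding has_real_derivative_iff_has_vector_derivative by auto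
  define e where "e = (\<lambda>t. E t - E (t - s))"
  have e': "(e has_real_derivative (?\<beta> t - ?\<beta> (t - s))) (at t)" for t
    unfolding e_def by (auto intro!: derivative_eq_intros E DERIV_chain2[OF E])
  \<comment> \<open>A single mean value identity yields both the bounds of the tent by
    \<open>s\<close> and its vanishing outside the box.\<close>
  have mvt: "\<exists>z. t - s < z \<and> z < t \<and> e t = s * ?\<beta> z" for t
    using MVT2[of "t - s" t E ?\<beta>] E assms by (auto simp: e_def)
  have e_bounds: "0 \<le> e t \<and> e t \<le> s" for t
    using mvt[of t] assms interval_bump_bounds by (auto intro: mult_left_le)
  have e0: "e t = 0" if "t \<le> a $ k \<or> b $ k \<le> t - s" for t
    using mvt[of t] that interval_bump_eq_0 by force
  define P where "P = (\<lambda>x::real^'n. \<Prod>j\<in>UNIV - {k}. interval_bump n (a $ j) (b $ j) (x $ j))"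
  have P_bounds: "0 \<le> P x" "P x \<le> 1" for x
    by (auto simp: P_def interval_bump_bounds intro: prod_nonneg prod_le_1)
  define \<Phi> where "\<Phi> = (\<lambda>x. e (x $ k) * P x)"
  have Phi0: "\<Phi> x = 0" if x: "x \<notin> cbox a (b + s *\<^sub>R axis k 1)" for x
  proof -
    obtain j where j: "x $ j < a $ j \<or> (b + s *\<^sub>R axis k 1) $ j < x $ j"
      using x by (auto simp: mem_box_cart not_le)
    show ?thesis
    proof (cases "j = k")
      case True
      then show ?thesis using j e0[of "x $ k"] by (auto simp: \<Phi>_def axis_def)
    next
      case False
      then have "interval_bump n (a $ j) (b $ j) (x $ j) = 0"
        using j by (intro interval_bump_eq_0) (auto simp: axis_def)
      then show ?thesis using False by (auto simp: \<Phi>_def P_def)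
    qed
  qed
  have cl: "C_class m (\<lambda>x::real^'n. e (x $ k))" for m
  proof (rule C_class_SucD, rule C_class_coord_Suc[OF e'])
    have "C_class m (\<lambda>x::real^'n. ?\<beta> (x $ k) + (- 1) * interval_bump n (a $ k + s) (b $ k + s) (x $ k))"
      by (intro C_class_add C_class_mult C_class_const C_class_interval_bump)
    then show "C_class m (\<lambda>x::real^'n. ?\<beta> (x $ k) - ?\<beta> (x $ k - s))"
      by (simp add: interval_bump_shift)
  qed
  have cl\<Phi>: "C_class m \<Phi>" for m
    unfolding \<Phi>_def P_def by (intro C_class_mult cl C_class_prod C_class_interval_bump) auto
  show thesis
  proof
    show "test_function \<Phi>"
      using Phi0 by (intro test_functionI[of _ a "b + s *\<^sub>R axis k 1"] cl\<Phi>) blast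
    show "\<bar>\<Phi> x\<bar> \<le> s" for x
      using e_bounds[of "x $ k"] P_bounds[of x] mult_mono[of "e (x $ k)" s "P x" 1]
      by (auto simp: \<Phi>_def abs_mult)
    show "partial_deriv k \<Phi> x = box_bump n a b x - box_bump n (a + s *\<^sub>R axis k 1) (b + s *\<^sub>R axis k 1) x" for x
    proof (rule partial_deriv_eq_DERIV)
      show "\<Phi> differentiable at x"
        using cl\<Phi>[of 1] by (simp add: differentiable_on_def)
      have P: "P (x + t *\<^sub>R axis k 1) = P x" for t
        unfolding P_def by (intro prod.cong) (auto simp: axis_def)
      have coord: "(x + t *\<^sub>R axis k 1) $ k = x $ k + t" for t
        by (simp add: axis_def)
      have "((\<lambda>t. e (x $ k + t) * P x) has_real_derivative (?\<beta> (x $ k) - ?\<beta> (x $ k - s)) * P x) (at 0)"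
        by (auto intro!: derivative_eq_intros DERIV_chain2[OF e'])
      also have "(\<lambda>t. e (x $ k + t) * P x) = (\<lambda>t. \<Phi> (x + t *\<^sub>R axis k 1))"
        by (simp add: \<Phi>_def P coord)
      also have "(?\<beta> (x $ k) - ?\<beta> (x $ k - s)) * P x
          = box_bump n a b x - box_bump n (a + s *\<^sub>R axis k 1) (b + s *\<^sub>R axis k 1) x"
      proof -
        have "(\<Prod>j\<in>UNIV - {k}. interval_bump n ((a + s *\<^sub>R axis k 1) $ j) ((b + s *\<^sub>R axis k 1) $ j) (x $ j)) = P x"
          unfolding P_def by (intro prod.cong) (auto simp: axis_def)
        then show ?thesis
          by (simp add: box_bump_def P_def prod.remove[of UNIV k] interval_bump_shift left_diff_distrib)
      qed
      finally show "((\<lambda>t. \<Phi> (x + t *\<^sub>R axis k 1)) has_real_derivative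
          box_bump n a b x - box_bump n (a + s *\<^sub>R axis k 1) (b + s *\<^sub>R axis k 1) x) (at 0)" .
    qed
  qed (use Phi0 in auto)
qed

subsection \<open>Weak gradients and averages over cubes\<close>

lemma locally_integrable_cbox: "locally_integrable f \<Longrightarrow> set_integrable lebesgue (cbox a b) f"
  by (simp add: locally_integrable_def)

lemma locally_integrable_box: "locally_integrable f \<Longrightarrow> set_integrable lebesgue (box a b) f"
  by (rule set_integrable_subset[OF locally_integrable_cbox[of f a b]]) (auto simp: box_subset_cbox)

lemma locally_integrable_measurable:
  fixes f :: "real^'n::finite \<Rightarrow> 'b::euclidean_space"
  assumes "locally_integrable f"
  shows "f \<in> borel_measurable lebesgue"
proof (rule borel_measurable_LIMSEQ_metric)
  let ?B = "\<lambda>n. cball (0::real^'n) (real n)"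
  show "(\<lambda>x. indicator (?B n) x *\<^sub>R f x) \<in> borel_measurable lebesgue" for n
    using assms compact_cball[of "0::real^'n" "real n"]
    unfolding locally_integrable_def set_integrable_def by (meson borel_measurable_integrable)
  fix x :: "real^'n"
  have "\<forall>\<^sub>F n in sequentially. indicator (?B n) x *\<^sub>R f x = f x"
    using eventually_ge_at_top[of "nat \<lceil>norm x\<rceil>"]
    by eventually_elim (auto simp: indicator_def)
  then show "(\<lambda>n. indicator (?B n) x *\<^sub>R f x) \<longlonglongrightarrow> f x"
    by (rule tendsto_eventually)
qed

lemma locally_integrable_nth: "locally_integrable g \<Longrightarrow> locally_integrable (\<lambda>x. g x $ k)"
  unfolding locally_integrable_def set_integrable_def
  using integrable_bounded_linear[OF bounded_linear_vec_nth] by fastforce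

lemma locally_integrable_norm: "locally_integrable g \<Longrightarrow> locally_integrable (\<lambda>x. norm (g x))"
  unfolding locally_integrable_def by (auto intro: set_integrable_norm)

lemma integrable_locally_times_bounded:
  fixes f w :: "real^'n::finite \<Rightarrow> real"
  assumes "locally_integrable f" and [measurable]: "w \<in> borel_measurable lebesgue"
    and bd: "\<And>x. \<bar>w x\<bar> \<le> B" and z: "\<And>x. x \<notin> cbox a b \<Longrightarrow> w x = 0"
  shows "integrable lebesgue (\<lambda>x. f x * w x)"
    and "\<bar>LINT x|lebesgue. f x * w x\<bar> \<le> B * (LINT x:cbox a b|lebesgue. \<bar>f x\<bar>)"
proof -
  note [measurable] = locally_integrable_measurable[OF assms(1)]
  have i: "integrable lebesgue (\<lambda>x. B * (indicator (cbox a b) x * \<bar>f x\<bar>))"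
    using locally_integrable_cbox[OF locally_integrable_norm[OF assms(1)], of a b]
    by (auto simp: set_integrable_def)
  have le: "\<bar>f x * w x\<bar> \<le> B * (indicator (cbox a b) x * \<bar>f x\<bar>)" for x
    using bd[of x] z[of x] by (auto simp: indicator_def abs_mult mult.commute[of B] intro: mult_left_mono)
  show int: "integrable lebesgue (\<lambda>x. f x * w x)"
  proof (rule Bochner_Integration.integrable_bound[OF i])
    show "AE x in lebesgue. norm (f x * w x) \<le> norm (B * (indicator (cbox a b) x * \<bar>f x\<bar>))"
      using le by (auto intro!: AE_I2 order_trans[OF _ abs_ge_self])
  qed measurable
  have "\<bar>LINT x|lebesgue. f x * w x\<bar> \<le> (LINT x|lebesgue. \<bar>f x * w x\<bar>)"
    by (rule integral_abs_bound)
  also have "\<dots> \<le> (LINT x|lebesgue. B * (indicator (cbox a b) x * \<bar>f x\<bar>))"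
    using le by (intro integral_mono integrable_abs int i)
  finally show "\<bar>LINT x|lebesgue. f x * w x\<bar> \<le> B * (LINT x:cbox a b|lebesgue. \<bar>f x\<bar>)"
    by (simp add: set_lebesgue_integral_def)
qed

lemma test_function_continuous: "test_function \<phi> \<Longrightarrow> continuous_on UNIV \<phi>"
  unfolding test_function_def by (metis C_class.simps(1))

lemma continuous_measurable_lebesgue:
  fixes f :: "real^'n::finite \<Rightarrow> 'b::euclidean_space"
  shows "continuous_on UNIV f \<Longrightarrow> f \<in> borel_measurable lebesgue"
  by (rule measurable_completion) (simp add: borel_measurable_continuous_onI)

lemma compactly_supported_bounds:
  fixes f :: "real^'n::finite \<Rightarrow> real"
  assumes "continuous_on UNIV f" "compact (closure {x. f x \<noteq> 0})"
  obtains a B where "\<And>x. x \<notin> cbox (-a) a \<Longrightarrow> f x = 0" "\<And>x. \<bar>f x\<bar> \<le> B"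
proof -
  have "bounded {x. f x \<noteq> 0}"
    using assms(2) by (simp add: compact_closure)
  then obtain a where a: "{x. f x \<noteq> 0} \<subseteq> cbox (-a) a"
    using bounded_subset_cbox_symmetric by blast
  have "bounded (f ` cbox (-a) a)"
    by (intro compact_imp_bounded compact_continuous_image continuous_on_subset[OF assms(1)]) auto
  then obtain B where B: "\<forall>x\<in>cbox (-a) a. \<bar>f x\<bar> \<le> B"
    by (auto simp: bounded_iff)
  have "\<bar>f x\<bar> \<le> max B 0" for x
  proof (cases "x \<in> cbox (-a) a")
    case False
    then have "f x = 0" using a by blast
    then show ?thesis by simp
  qed (use B in force)
  with a show thesis by (intro that[of a "max B 0"]) auto
qed

lemma test_function_partial_deriv:
  assumes "test_function \<phi>"
  shows "test_function (partial_deriv k \<phi>)"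
  unfolding test_function_def
proof
  show "\<forall>m. C_class m (partial_deriv k \<phi>)"
    using assms unfolding test_function_def by (metis C_class.simps(2))
  have "partial_deriv k \<phi> x = 0" if x: "x \<notin> closure {x. \<phi> x \<noteq> 0}" for x
  proof -
    have "((\<lambda>x. 0) has_derivative (\<lambda>h. 0)) (at x)" by simp
    moreover have "open (- closure {x. \<phi> x \<noteq> 0})" by auto
    ultimately have "(\<phi> has_derivative (\<lambda>h. 0)) (at x)"
      by (rule has_derivative_transform_within_open) (use x closure_subset[of "{x. \<phi> x \<noteq> 0}"] in auto)
    then show ?thesis by (simp add: partial_deriv_eq)
  qed
  then have "{x. partial_deriv k \<phi> x \<noteq> 0} \<subseteq> closure {x. \<phi> x \<noteq> 0}" by auto
  then have "closure {x. partial_deriv k \<phi> x \<noteq> 0} \<subseteq> closure {x. \<phi> x \<noteq> 0}"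
    by (simp add: closure_minimal)
  then show "compact (closure {x. partial_deriv k \<phi> x \<noteq> 0})"
    using assms compact_closure bounded_subset unfolding test_function_def
    by (meson closure_subset compact_imp_bounded)
qed

lemma test_function_measurable: "test_function \<phi> \<Longrightarrow> \<phi> \<in> borel_measurable lebesgue"
  by (intro continuous_measurable_lebesgue test_function_continuous)

lemma test_function_bounds:
  assumes "test_function \<phi>"
  obtains a B where "\<And>x. x \<notin> cbox (-a) a \<Longrightarrow> \<phi> x = 0" "\<And>x. \<bar>\<phi> x\<bar> \<le> B"
  using compactly_supported_bounds[OF test_function_continuous[OF assms]] assms
  unfolding test_function_def by blast

lemma integrable_locally_times_test:
  assumes "locally_integrable f" "test_function \<phi>"
  shows "integrable lebesgue (\<lambda>x. f x * \<phi> x)"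
proof -
  obtain a B where "\<And>x. x \<notin> cbox (-a) a \<Longrightarrow> \<phi> x = 0" "\<And>x. \<bar>\<phi> x\<bar> \<le> B"
    using test_function_bounds[OF assms(2)] by blast
  then show ?thesis
    using integrable_locally_times_bounded(1)[OF assms(1) test_function_measurable[OF assms(2)], of B "-a" a]
    by blast
qed

lemma tendsto_integral_box_bump:
  assumes "locally_integrable v"
  shows "(\<lambda>n. LINT x|lebesgue. v x * box_bump n a b x) \<longlonglongrightarrow> (LINT x:box a b|lebesgue. v x)"
  unfolding set_lebesgue_integral_def
proof (rule integral_dominated_convergence[where w = "\<lambda>x. indicator (cbox a b) x * \<bar>v x\<bar>"])
  show "(\<lambda>x. indicat_real (box a b) x *\<^sub>R v x) \<in> borel_measurable lebesgue"
    using locally_integrable_box[OF assms, of a b] unfolding set_integrable_def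
    by (rule borel_measurable_integrable)
  show "(\<lambda>x. v x * box_bump n a b x) \<in> borel_measurable lebesgue" for n
    by (intro borel_measurable_times locally_integrable_measurable[OF assms]
        test_function_measurable[OF test_function_box_bump])
  show "integrable lebesgue (\<lambda>x. indicator (cbox a b) x * \<bar>v x\<bar>)"
    using locally_integrable_cbox[OF locally_integrable_norm[OF assms], of a b]
    by (auto simp: set_integrable_def)
  show "AE x in lebesgue. (\<lambda>n. v x * box_bump n a b x) \<longlonglongrightarrow> indicat_real (box a b) x *\<^sub>R v x"
    by (auto intro!: AE_I2 tendsto_eq_intros tendsto_box_bump)
  show "AE x in lebesgue. norm (v x * box_bump n a b x) \<le> indicat_real (cbox a b) x * \<bar>v x\<bar>" for n
  proof (rule AE_I2)
    fix x
    show "norm (v x * box_bump n a b x) \<le> indicat_real (cbox a b) x * \<bar>v x\<bar>"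
    proof (cases "x \<in> cbox a b")
      case False
      then have "box_bump n a b x = 0"
        using box_bump_eq_0[of x a b n] box_subset_cbox[of a b] by blast
      then show ?thesis by simp
    qed (use box_bump_bounds[of n a b x] in \<open>auto simp: abs_mult intro: mult_left_le\<close>)
  qed
qed

section \<open>Comparison of averages over shifted boxes\<close>

lemma has_weak_gradientD:
  assumes "has_weak_gradient u g"
  shows "locally_integrable u" "locally_integrable g"
    "test_function \<phi> \<Longrightarrow> (LINT x|lebesgue. u x * partial_deriv k \<phi> x) = - (LINT x|lebesgue. g x $ k * \<phi> x)"
  using assms by (auto simp: has_weak_gradient_def)

text \<open>
  The gap between the averages of \<open>u\<close> over two adjacent boxes is the pairing of the weak gradient
  with a tent function; the smooth approximation of that tent is the test function used here.
\<close>

lemma box_shift_estimate: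
  fixes a b :: "real^'n::finite"
  assumes wg: "has_weak_gradient u g" and s: "s > 0"
  shows "\<bar>(LINT x:box a b|lebesgue. u x) - (LINT x:box (a + s *\<^sub>R axis k 1) (b + s *\<^sub>R axis k 1)|lebesgue. u x)\<bar>
    \<le> s * (LINT x:cbox a (b + s *\<^sub>R axis k 1)|lebesgue. norm (g x))"
proof -
  note u = has_weak_gradientD(1)[OF wg] and g = has_weak_gradientD(2)[OF wg]
  define a' where "a' = a + s *\<^sub>R axis k 1"
  define b' where "b' = b + s *\<^sub>R axis k 1"
  have bound: "\<bar>(LINT x|lebesgue. u x * box_bump n a b x) - (LINT x|lebesgue. u x * box_bump n a' b' x)\<bar>
      \<le> s * (LINT x:cbox a b'|lebesgue. norm (g x))" for n
  proof -
    obtain \<Phi> where \<Phi>: "test_function \<Phi>"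
      "\<And>x. partial_deriv k \<Phi> x = box_bump n a b x - box_bump n a' b' x"
      "\<And>x. \<bar>\<Phi> x\<bar> \<le> s" "\<And>x. x \<notin> cbox a b' \<Longrightarrow> \<Phi> x = 0"
      using box_shift_test_function[OF s, of k n a b] unfolding a'_def b'_def by metis
    have "(LINT x|lebesgue. u x * box_bump n a b x) - (LINT x|lebesgue. u x * box_bump n a' b' x)
        = (LINT x|lebesgue. u x * partial_deriv k \<Phi> x)"
      by (simp add: \<Phi>(2) right_diff_distrib integrable_locally_times_test[OF u test_function_box_bump])
    also have "\<bar>\<dots>\<bar> = \<bar>LINT x|lebesgue. g x $ k * \<Phi> x\<bar>"
      using has_weak_gradientD(3)[OF wg \<Phi>(1), of k] by simp
    also have "\<dots> \<le> s * (LINT x:cbox a b'|lebesgue. \<bar>g x $ k\<bar>)"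
      by (rule integrable_locally_times_bounded(2)[OF locally_integrable_nth[OF g]
            test_function_measurable[OF \<Phi>(1)] \<Phi>(3,4)])
    also have "(LINT x:cbox a b'|lebesgue. \<bar>g x $ k\<bar>) \<le> (LINT x:cbox a b'|lebesgue. norm (g x))"
      by (intro set_integral_mono locally_integrable_cbox locally_integrable_norm[OF g]
          locally_integrable_norm[OF locally_integrable_nth[OF g], unfolded real_norm_def] component_le_norm_cart)
    finally show ?thesis using s by simp
  qed
  have "(\<lambda>n. \<bar>(LINT x|lebesgue. u x * box_bump n a b x) - (LINT x|lebesgue. u x * box_bump n a' b' x)\<bar>)
      \<longlonglongrightarrow> \<bar>(LINT x:box a b|lebesgue. u x) - (LINT x:box a' b'|lebesgue. u x)\<bar>"
    by (intro tendsto_intros tendsto_integral_box_bump u)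
  from LIMSEQ_le_const2[OF this] bound show ?thesis
    unfolding a'_def b'_def by blast
qed

text \<open>Bridge to the gauge integral, in which the splitting of boxes and the differentiation
  theorem are available; it also identifies open and closed boxes.\<close>

lemma set_integral_box_cbox:
  fixes v :: "real^'n::finite \<Rightarrow> real"
  assumes "locally_integrable v"
  shows "(LINT x:box a b|lebesgue. v x) = integral (cbox a b) v"
    and "(LINT x:cbox a b|lebesgue. v x) = integral (cbox a b) v"
    and "v integrable_on cbox a b"
  using set_lebesgue_integral_eq_integral[OF locally_integrable_box[OF assms, of a b]]
    set_lebesgue_integral_eq_integral[OF locally_integrable_cbox[OF assms, of a b]]
  by (auto simp: integral_open_interval)

section \<open>Averages over cubes and Lebesgue points\<close>

lemma One_nth [simp]: "(One :: real^'n::finite) $ i = 1"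
proof -
  have "(One :: real^'n) \<bullet> axis i 1 = 1"
    by (simp add: inner_sum_left_Basis axis_in_Basis_iff)
  then show ?thesis by (simp add: inner_axis)
qed

text \<open>\<open>One\<close> abbreviates the sum over \<open>Basis\<close>; this is the form of a
  component of \<open>One\<close> once \<open>sum_component\<close> has been applied.\<close>

lemma sum_Basis_nth [simp]: "(\<Sum>x\<in>(Basis :: (real^'n::finite) set). x $ i) = 1"
  using One_nth[where 'n = 'n, of i] by (simp only: sum_component)

text \<open>The base point is the lower corner of the cube, which fits \<open>integrable_ccontinuous_explicit\<close>.\<close>

definition avg :: "real \<Rightarrow> (real^'n::finite \<Rightarrow> real) \<Rightarrow> real^'n \<Rightarrow> real" where
  "avg l v x = (LINT y:cbox x (x + l *\<^sub>R One)|lebesgue. v y) / l ^ CARD('n)"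

text \<open>Lebesgue's differentiation theorem along dyadic cubes. It lets averages determine a
  function almost everywhere, both for the uniqueness of weak gradients and for the identification
  of limits.\<close>

lemma AE_avg_tendsto:
  fixes v :: "real^'n::finite \<Rightarrow> real"
  assumes "locally_integrable v" "l > 0"
  shows "AE x in lebesgue. (\<lambda>n. avg (l / 2 ^ n) v x) \<longlonglongrightarrow> v x"
proof -
  obtain N where N: "negligible N" and
    d: "\<And>x e. \<lbrakk>x \<notin> N; 0 < e\<rbrakk> \<Longrightarrow> \<exists>d>0. \<forall>h. 0 < h \<and> h < d \<longrightarrow>
         norm (integral (cbox x (x + h *\<^sub>R One)) v /\<^sub>R h ^ DIM(real^'n) - v x) < e"
    using integrable_ccontinuous_explicit[of v] set_integral_box_cbox(3)[OF assms(1)] by blast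
  have "(\<lambda>n. avg (l / 2 ^ n) v x) \<longlonglongrightarrow> v x" if x: "x \<notin> N" for x
  proof (rule metric_LIMSEQ_I)
    fix e :: real assume "e > 0"
    from d[OF x this] obtain d where "d > 0"
      and d: "\<And>h. 0 < h \<Longrightarrow> h < d \<Longrightarrow> norm (integral (cbox x (x + h *\<^sub>R One)) v /\<^sub>R h ^ DIM(real^'n) - v x) < e"
      by blast
    have "(\<lambda>n. l * (1 / 2) ^ n) \<longlonglongrightarrow> l * 0"
      by (intro tendsto_mult tendsto_const LIMSEQ_power_zero) auto
    then have "\<forall>\<^sub>F n in sequentially. l * (1 / 2) ^ n < d"
      using \<open>d > 0\<close> by (simp add: order_tendstoD(2))
    then obtain M where M: "\<And>n. n \<ge> M \<Longrightarrow> l * (1 / 2) ^ n < d"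
      by (auto simp: eventually_sequentially)
    have avg_eq: "avg h v x = integral (cbox x (x + h *\<^sub>R One)) v /\<^sub>R h ^ DIM(real^'n)" for h
      by (simp add: avg_def set_integral_box_cbox(2)[OF assms(1)] divide_inverse_commute)
    have "dist (avg (l / 2 ^ n) v x) (v x) < e" if "n \<ge> M" for n
      unfolding avg_eq dist_norm using M[OF that] assms(2)
      by (intro d) (simp_all add: power_one_over)
    then show "\<exists>M. \<forall>n\<ge>M. dist (avg (l / 2 ^ n) v x) (v x) < e" by blast
  qed
  moreover have "AE x in lebesgue. x \<notin> N"
    using N by (intro AE_not_in) (simp add: negligible_iff_null_sets)
  ultimately show ?thesis by (auto elim: AE_mp)
qed

text \<open>Fundamental lemma of the calculus of variations. Testing with \<open>box_bump\<close>
  gives integral zero over every box, hence zero averages, and these converge back to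
  \<open>v\<close>.\<close>

lemma AE_zero_if_test_integrals_zero:
  fixes v :: "real^'n::finite \<Rightarrow> real"
  assumes v: "locally_integrable v" and 0: "\<And>\<phi>. test_function \<phi> \<Longrightarrow> (LINT x|lebesgue. v x * \<phi> x) = 0"
  shows "AE x in lebesgue. v x = 0"
proof -
  have "(LINT x:box a b|lebesgue. v x) = 0" for a b
    using tendsto_integral_box_bump[OF v, of a b] 0[OF test_function_box_bump]
    by (simp add: LIMSEQ_const_iff)
  then have "integral (cbox a b) v = 0" for a b
    by (simp add: set_integral_box_cbox(1)[OF v])
  then have "avg l v x = 0" for l x
    by (simp add: avg_def set_integral_box_cbox(2)[OF v])
  then have "AE x in lebesgue. (\<lambda>n::nat. 0) \<longlonglongrightarrow> v x"
    using AE_avg_tendsto[OF v, of 1] by simp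
  then show ?thesis
    by eventually_elim (simp add: LIMSEQ_const_iff)
qed

lemma weak_gradient_unique:
  fixes u :: "real^'n::finite \<Rightarrow> real"
  assumes "has_weak_gradient u g" "has_weak_gradient u g'"
  shows "AE x in lebesgue. g x = g' x"
proof -
  note g = locally_integrable_nth[OF has_weak_gradientD(2)[OF assms(1)]]
    and g' = locally_integrable_nth[OF has_weak_gradientD(2)[OF assms(2)]]
  have "AE x in lebesgue. g x $ k - g' x $ k = 0" for k
  proof (rule AE_zero_if_test_integrals_zero)
    show "locally_integrable (\<lambda>x. g x $ k - g' x $ k)"
      using g[of k] g'[of k] by (auto simp: locally_integrable_def intro: set_integral_diff)
    fix \<phi> :: "real^'n \<Rightarrow> real" assume \<phi>: "test_function \<phi>"
    show "(LINT x|lebesgue. (g x $ k - g' x $ k) * \<phi> x) = 0"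
      using has_weak_gradientD(3)[OF assms(1) \<phi>, of k] has_weak_gradientD(3)[OF assms(2) \<phi>, of k]
        integrable_locally_times_test[OF g \<phi>, of k] integrable_locally_times_test[OF g' \<phi>, of k]
      by (simp add: left_diff_distrib)
  qed
  then have "AE x in lebesgue. \<forall>k. g x $ k - g' x $ k = 0"
    by (simp add: AE_all_countable)
  then show ?thesis by eventually_elim (simp add: vec_eq_iff)
qed

subsection \<open>The Sobolev inequality in dimension at most three\<close>

lemma integral_cbox_split_half:
  fixes u :: "real^'n::finite \<Rightarrow> real"
  assumes u: "\<And>a b. u integrable_on cbox a b" and h: "\<And>j. h $ j > 0" and s: "s = h $ k / 2"
  shows "integral (cbox x (x + h)) u = integral (cbox x (x + (\<chi> j. if j = k then h $ j / 2 else h $ j))) u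
     + integral (cbox (x + s *\<^sub>R axis k 1) (x + h)) u"
proof -
  have 1: "cbox x (x + h) \<inter> {y. y \<bullet> axis k 1 \<le> x $ k + s} = cbox x (x + (\<chi> j. if j = k then h $ j / 2 else h $ j))"
  proof (rule set_eqI)
    fix y
    have "(y \<in> cbox x (x + h) \<and> y $ k \<le> x $ k + s)
      \<longleftrightarrow> (\<forall>j. x $ j \<le> y $ j \<and> y $ j \<le> x $ j + (if j = k then h $ j / 2 else h $ j))"
    proof (intro iffI allI conjI)
      fix j assume "y \<in> cbox x (x + h) \<and> y $ k \<le> x $ k + s"
      then show "x $ j \<le> y $ j" "y $ j \<le> x $ j + (if j = k then h $ j / 2 else h $ j)"
        using s by (auto simp: mem_box_cart)
    next
      assume *: "\<forall>j. x $ j \<le> y $ j \<and> y $ j \<le> x $ j + (if j = k then h $ j / 2 else h $ j)"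
      show "y $ k \<le> x $ k + s" using *[rule_format, of k] s by simp
      have "y $ j \<le> x $ j + h $ j" for j
        using *[rule_format, of j] h[of j] by (cases "j = k") auto
      with * show "y \<in> cbox x (x + h)" by (simp add: mem_box_cart)
    qed
    then show "y \<in> cbox x (x + h) \<inter> {y. y \<bullet> axis k 1 \<le> x $ k + s}
        \<longleftrightarrow> y \<in> cbox x (x + (\<chi> j. if j = k then h $ j / 2 else h $ j))"
      by (simp add: inner_axis mem_box_cart)
  qed
  have 2: "cbox x (x + h) \<inter> {y. x $ k + s \<le> y \<bullet> axis k 1} = cbox (x + s *\<^sub>R axis k 1) (x + h)"
  proof (rule set_eqI)
    fix y
    have "(y \<in> cbox x (x + h) \<and> x $ k + s \<le> y $ k)
      \<longleftrightarrow> (\<forall>j. x $ j + (if j = k then s else 0) \<le> y $ j \<and> y $ j \<le> x $ j + h $ j)"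
    proof (intro iffI allI conjI)
      fix j assume "y \<in> cbox x (x + h) \<and> x $ k + s \<le> y $ k"
      then show "x $ j + (if j = k then s else 0) \<le> y $ j" "y $ j \<le> x $ j + h $ j"
        by (auto simp: mem_box_cart)
    next
      assume *: "\<forall>j. x $ j + (if j = k then s else 0) \<le> y $ j \<and> y $ j \<le> x $ j + h $ j"
      show "x $ k + s \<le> y $ k" using *[rule_format, of k] by simp
      have "x $ j \<le> y $ j" for j
        using *[rule_format, of j] h[of j] s by (cases "j = k") auto
      with * show "y \<in> cbox x (x + h)" by (simp add: mem_box_cart)
    qed
    moreover have "(s *\<^sub>R axis k 1) $ j = (if j = k then s else 0)" for j
      by (simp add: axis_def)
    ultimately show "y \<in> cbox x (x + h) \<inter> {y. x $ k + s \<le> y \<bullet> axis k 1}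
        \<longleftrightarrow> y \<in> cbox (x + s *\<^sub>R axis k 1) (x + h)"
      by (simp add: inner_axis mem_box_cart)
  qed
  show ?thesis
    using integral_split[OF u, of "axis k 1" x "x + h" "x $ k + s"] 1 2
    by (simp add: axis_in_Basis_iff)
qed

text \<open>With \<open>V1\<close> and \<open>V2\<close> the integrals over the two halves and
  \<open>P\<close> the full volume, the averages differ by
  \<open>V1 / (P / 2) - (V1 + V2) / P = (V1 - V2) / P\<close>. The halves are translates of each
  other by half a side, so \<open>box_shift_estimate\<close> applies.\<close>

lemma box_average_halving_step:
  fixes x h :: "real^'n::finite"
  assumes wg: "has_weak_gradient u g" and h: "\<And>j. h $ j > 0"
    and h': "h' = (\<chi> j. if j = k then h $ j / 2 else h $ j)"
  shows "\<bar>integral (cbox x (x + h')) u / (\<Prod>j\<in>UNIV. h' $ j) - integral (cbox x (x + h)) u / (\<Prod>j\<in>UNIV. h $ j)\<bar>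
    \<le> (h $ k / 2) / (\<Prod>j\<in>UNIV. h $ j) * integral (cbox x (x + h)) (\<lambda>y. norm (g y))"
proof -
  note u = has_weak_gradientD(1)[OF wg] and g = locally_integrable_norm[OF has_weak_gradientD(2)[OF wg]]
  define s where "s = h $ k / 2"
  define P where "P = (\<Prod>j\<in>UNIV. h $ j)"
  have P: "P > 0" unfolding P_def using h by (intro prod_pos) auto
  have "(\<Prod>j\<in>UNIV - {k}. h' $ j) = (\<Prod>j\<in>UNIV - {k}. h $ j)"
    by (intro prod.cong) (auto simp: h')
  then have P': "(\<Prod>j\<in>UNIV. h' $ j) = P / 2"
    by (simp add: P_def prod.remove[of UNIV k] h')
  have hs: "x + h' + s *\<^sub>R axis k 1 = x + h"
    by (auto simp: vec_eq_iff h' s_def axis_def)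
  define V1 where "V1 = integral (cbox x (x + h')) u"
  define V2 where "V2 = integral (cbox (x + s *\<^sub>R axis k 1) (x + h)) u"
  have "s > 0" using h[of k] by (simp add: s_def)
  from box_shift_estimate[OF wg this, of x "x + h'" k]
  have est: "\<bar>V1 - V2\<bar> \<le> s * integral (cbox x (x + h)) (\<lambda>y. norm (g y))"
    unfolding hs set_integral_box_cbox(1)[OF u] set_integral_box_cbox(2)[OF g] V1_def V2_def .
  have "integral (cbox x (x + h)) u = V1 + V2"
    unfolding V1_def V2_def h' by (intro integral_cbox_split_half set_integral_box_cbox(3)[OF u] h s_def)
  then have "V1 / (P / 2) - integral (cbox x (x + h)) u / P = (V1 - V2) / P"
    using P by (simp add: field_simps)
  then have "\<bar>V1 / (P / 2) - integral (cbox x (x + h)) u / P\<bar> = \<bar>V1 - V2\<bar> / P"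
    using P by simp
  also have "\<dots> \<le> s * integral (cbox x (x + h)) (\<lambda>y. norm (g y)) / P"
    using est P by (simp add: divide_right_mono)
  finally show ?thesis
    unfolding P' V1_def[symmetric] P_def[symmetric] s_def by simp
qed

text \<open>The sides are halved one coordinate at a time. Each of the \<open>CARD('n)\<close> steps
  divides by a volume not smaller than that of the half cube; this is the origin of the factors
  \<open>CARD('n)\<close> and \<open>2 ^ CARD('n)\<close>.\<close>

lemma avg_halving:
  fixes x :: "real^'n::finite"
  assumes wg: "has_weak_gradient u g" and l: "l > 0"
  shows "\<bar>avg (l / 2) u x - avg l u x\<bar> \<le> (real CARD('n) * 2 ^ CARD('n)) * l * avg l (\<lambda>y. norm (g y)) x"
proof -
  note u = has_weak_gradientD(1)[OF wg] and g = locally_integrable_norm[OF has_weak_gradientD(2)[OF wg]]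
  \<comment> \<open>Side lengths of the intermediate box in which the coordinates in
    \<open>S\<close> have already been halved.\<close>
  define h where "h = (\<lambda>S. \<chi> j::'n. if j \<in> S then l / 2 else l)"
  define A where "A = (\<lambda>S. integral (cbox x (x + h S)) u / (\<Prod>j\<in>UNIV. h S $ j))"
  define I where "I = integral (cbox x (x + l *\<^sub>R One)) (\<lambda>y. norm (g y))"
  define C where "C = (l / 2) / (l / 2) ^ CARD('n) * I"
  have hpos: "h S $ j > 0" for S j using l by (simp add: h_def)
  have I: "I \<ge> 0" unfolding I_def by (rule integral_nonneg) (auto intro: set_integral_box_cbox(3)[OF g])
  have step: "\<bar>A (insert k S) - A S\<bar> \<le> C" if "k \<notin> S" for k S
  proof -
    have hk: "h (insert k S) = (\<chi> j. if j = k then h S $ j / 2 else h S $ j)"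
      using that by (auto simp: h_def vec_eq_iff)
    have "(\<Prod>j\<in>(UNIV::'n set). l / 2) \<le> (\<Prod>j\<in>UNIV. h S $ j)"
      by (rule prod_mono) (use l in \<open>auto simp: h_def\<close>)
    then have P: "(l / 2) ^ CARD('n) \<le> (\<Prod>j\<in>UNIV. h S $ j)" by simp
    have "cbox x (x + h S) \<subseteq> cbox x (x + l *\<^sub>R One)"
    proof
      fix y assume y: "y \<in> cbox x (x + h S)"
      have "y $ j \<le> x $ j + l" for j
      proof -
        have "h S $ j \<le> l" using l by (simp add: h_def)
        moreover have "y $ j \<le> x $ j + h S $ j" using y by (simp add: mem_box_cart)
        ultimately show ?thesis by linarith
      qed
      with y show "y \<in> cbox x (x + l *\<^sub>R One)"
        by (simp add: mem_box_cart)
    qed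
    then have IS: "integral (cbox x (x + h S)) (\<lambda>y. norm (g y)) \<le> I"
      unfolding I_def by (rule integral_subset_le) (auto intro: set_integral_box_cbox(3)[OF g])
    have "\<bar>A (insert k S) - A S\<bar> \<le> (h S $ k / 2) / (\<Prod>j\<in>UNIV. h S $ j) * integral (cbox x (x + h S)) (\<lambda>y. norm (g y))"
      unfolding A_def by (rule box_average_halving_step[OF wg hpos hk])
    also have "\<dots> \<le> (l / 2) / (l / 2) ^ CARD('n) * I"
    proof (rule mult_mono[OF _ IS])
      show "h S $ k / 2 / (\<Prod>j\<in>UNIV. h S $ j) \<le> l / 2 / (l / 2) ^ CARD('n)"
        by (rule frac_le) (use that l P in \<open>auto simp: h_def\<close>)
      show "0 \<le> integral (cbox x (x + h S)) (\<lambda>y. norm (g y))"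
        by (rule integral_nonneg) (auto intro: set_integral_box_cbox(3)[OF g])
    qed (use l in auto)
    finally show ?thesis by (simp add: C_def)
  qed
  have "finite S \<Longrightarrow> \<bar>A S - A {}\<bar> \<le> real (card S) * C" for S
  proof (induction S rule: finite_induct)
    case (insert k S)
    then show ?case using step[of k S] by (simp add: algebra_simps)
  qed simp
  from this[of UNIV] have main: "\<bar>A UNIV - A {}\<bar> \<le> real CARD('n) * C" by simp
  have h0: "h {} = l *\<^sub>R One" and h1: "h UNIV = (l / 2) *\<^sub>R One"
    by (auto simp: h_def vec_eq_iff)
  have A0: "A {} = avg l u x" and A1: "A UNIV = avg (l / 2) u x"
    unfolding A_def avg_def set_integral_box_cbox(2)[OF u] h0 h1 by simp_all
  have C: "C = (l / 2) * 2 ^ CARD('n) * avg l (\<lambda>y. norm (g y)) x"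
    unfolding C_def avg_def set_integral_box_cbox(2)[OF g] I_def by (simp add: power_divide)
  have avg_nonneg: "avg l (\<lambda>y. norm (g y)) x \<ge> 0"
    unfolding avg_def set_integral_box_cbox(2)[OF g] using I l by (simp add: I_def)
  have "real CARD('n) * C \<le> (real CARD('n) * 2 ^ CARD('n)) * l * avg l (\<lambda>y. norm (g y)) x"
    unfolding C using avg_nonneg l by (simp add: mult_right_mono)
  with main show ?thesis unfolding A0 A1 by linarith
qed

section \<open>Averages as integral operators, and Fubini\<close>

lemma integrable_locally_integrable:
  "integrable lebesgue f \<Longrightarrow> locally_integrable f"
  unfolding locally_integrable_def set_integrable_def
  by (auto intro!: integrable_mult_indicator dest: borel_compact)

text \<open>The incidence relation between a base point and the points of its cube. Being closed in
  the product it gives joint measurability, and its sections in either variable are cubes.\<close>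

definition cube_rel :: "real \<Rightarrow> ((real^'n::finite) \<times> (real^'n)) set" where
  "cube_rel l = {p. \<forall>i. fst p $ i \<le> snd p $ i \<and> snd p $ i \<le> fst p $ i + l}"

lemma cube_rel_iff: "(x, y) \<in> cube_rel l \<longleftrightarrow> y \<in> cbox x (x + l *\<^sub>R One)"
  by (auto simp: cube_rel_def mem_box_cart)

lemma cube_rel_iff': "(x, y) \<in> cube_rel l \<longleftrightarrow> x \<in> cbox (y - l *\<^sub>R One) y"
  by (auto simp: cube_rel_def mem_box_cart algebra_simps)

lemma cube_rel_sets [measurable]: "cube_rel l \<in> sets (lborel \<Otimes>\<^sub>M lborel)"
proof -
  have "closed (cube_rel l)"
    unfolding cube_rel_def
    by (intro closed_Collect_all closed_Collect_conj closed_Collect_le continuous_intros)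
  then have "cube_rel l \<in> sets (borel \<Otimes>\<^sub>M borel)"
    unfolding borel_prod by (rule borel_closed)
  then show ?thesis
    by (simp cong: sets_pair_measure_cong)
qed

lemma emeasure_cube: "l \<ge> 0 \<Longrightarrow> emeasure lborel (cbox (y - l *\<^sub>R One) (y::real^'n::finite)) = ennreal (l ^ CARD('n))"
  by (subst emeasure_lborel_cbox) (simp_all add: inner_diff_left)

text \<open>Fubini is applied to the product of two copies of \<open>lborel\<close>; a Lebesgue
  measurable function enters through a Borel function equal to it almost everywhere.\<close>

lemma borel_representative:
  fixes u :: "real^'n::finite \<Rightarrow> real"
  assumes "u \<in> borel_measurable lebesgue"
  obtains u' where "u' \<in> borel_measurable lborel" "AE x in lebesgue. u x = u' x"
  using completion_ex_borel_measurable_real[OF assms] AE_completion by blast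

lemma avg_measurable:
  fixes u :: "real^'n::finite \<Rightarrow> real"
  assumes u: "locally_integrable u"
  shows "avg l u \<in> borel_measurable lebesgue"
proof -
  obtain u' where u'[measurable]: "u' \<in> borel_measurable lborel" and eq: "AE x in lebesgue. u x = u' x"
    using borel_representative[OF locally_integrable_measurable[OF u]] by blast
  have "avg l u x = (LINT y|lborel. indicat_real (cube_rel l) (x, y) * u' y) / l ^ CARD('n)" for x
  proof -
    have m: "(\<lambda>y. indicat_real (cbox x (x + l *\<^sub>R One)) y * u' y) \<in> borel_measurable lborel"
      by measurable
    have "(LINT y:cbox x (x + l *\<^sub>R One)|lebesgue. u y) = (LINT y|lebesgue. indicat_real (cbox x (x + l *\<^sub>R One)) y * u' y)"
      unfolding set_lebesgue_integral_def real_scaleR_def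
    proof (rule integral_cong_AE)
      show "AE y in lebesgue. indicat_real (cbox x (x + l *\<^sub>R One)) y * u y = indicat_real (cbox x (x + l *\<^sub>R One)) y * u' y"
        using eq by eventually_elim simp
      show "(\<lambda>y. indicat_real (cbox x (x + l *\<^sub>R One)) y * u y) \<in> borel_measurable lebesgue"
        by (intro borel_measurable_times borel_measurable_indicator locally_integrable_measurable[OF u]) simp
    qed (rule measurable_completion[OF m])
    also have "\<dots> = (LINT y|lborel. indicat_real (cbox x (x + l *\<^sub>R One)) y * u' y)"
      by (rule integral_completion[OF m])
    also have "\<dots> = (LINT y|lborel. indicat_real (cube_rel l) (x, y) * u' y)"
      by (intro Bochner_Integration.integral_cong) (auto simp: indicator_def cube_rel_iff)
    finally show ?thesis by (simp add: avg_def)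
  qed
  then have "avg l u = (\<lambda>x. (LINT y|lborel. indicat_real (cube_rel l) (x, y) * u' y) / l ^ CARD('n))" by blast
  moreover have "(\<lambda>x. (LINT y|lborel. indicat_real (cube_rel l) (x, y) * u' y) / l ^ CARD('n)) \<in> borel_measurable lborel"
    by measurable
  ultimately show ?thesis by (metis measurable_completion)
qed

text \<open>By Fubini: the base points whose cube contains a given \<open>y\<close> fill a cube of
  volume \<open>l ^ CARD('n)\<close>, which cancels the normalization of \<open>avg\<close>.\<close>

lemma nn_integral_avg:
  fixes h :: "real^'n::finite \<Rightarrow> real"
  assumes h: "integrable lebesgue h" and nn: "\<And>x. h x \<ge> 0" and l: "l > 0"
  shows "(\<integral>\<^sup>+x. ennreal (avg l h x) \<partial>lebesgue) = ennreal (LINT x|lebesgue. h x)"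
proof -
  let ?N = "CARD('n)"
  obtain h0 where h0[measurable]: "h0 \<in> borel_measurable lborel" and eq: "AE x in lebesgue. h x = h0 x"
    using borel_representative[OF borel_measurable_integrable[OF h]] by blast
  note hl = integrable_locally_integrable[OF h]
  have avg_eq: "ennreal (avg l h x) = (\<integral>\<^sup>+y. ennreal (h0 y) * indicator (cube_rel l) (x, y) \<partial>lborel) * ennreal (1 / l ^ ?N)" for x
  proof -
    have "(\<integral>\<^sup>+y. ennreal (h0 y) * indicator (cube_rel l) (x, y) \<partial>lborel)
        = (\<integral>\<^sup>+y. ennreal (h0 y) * indicator (cube_rel l) (x, y) \<partial>lebesgue)"
      by (simp add: nn_integral_completion)
    also have "\<dots> = (\<integral>\<^sup>+y. ennreal (indicat_real (cbox x (x + l *\<^sub>R One)) y *\<^sub>R h y) \<partial>lebesgue)"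
      by (rule nn_integral_cong_AE) (use eq in eventually_elim, auto simp: indicator_def cube_rel_iff)
    also have "\<dots> = ennreal (LINT y:cbox x (x + l *\<^sub>R One)|lebesgue. h y)"
      unfolding set_lebesgue_integral_def
      by (rule nn_integral_eq_integral) (use locally_integrable_cbox[OF hl] nn in \<open>auto simp: set_integrable_def\<close>)
    finally show ?thesis
      using l nn by (simp add: avg_def ennreal_mult''[symmetric])
  qed
  have "(\<integral>\<^sup>+x. ennreal (avg l h x) \<partial>lebesgue)
      = (\<integral>\<^sup>+x. (\<integral>\<^sup>+y. ennreal (h0 y) * indicator (cube_rel l) (x, y) \<partial>lborel) * ennreal (1 / l ^ ?N) \<partial>lborel)"
    by (simp add: avg_eq nn_integral_completion)
  also have "\<dots> = (\<integral>\<^sup>+x. (\<integral>\<^sup>+y. ennreal (h0 y) * indicator (cube_rel l) (x, y) \<partial>lborel) \<partial>lborel) * ennreal (1 / l ^ ?N)"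
    by (intro nn_integral_multc) measurable
  also have "(\<integral>\<^sup>+x. (\<integral>\<^sup>+y. ennreal (h0 y) * indicator (cube_rel l) (x, y) \<partial>lborel) \<partial>lborel)
      = (\<integral>\<^sup>+y. (\<integral>\<^sup>+x. ennreal (h0 y) * indicator (cube_rel l) (x, y) \<partial>lborel) \<partial>lborel)"
    by (rule lborel_pair.Fubini'[symmetric]) measurable
  also have "\<dots> = (\<integral>\<^sup>+y. ennreal (h0 y) * ennreal (l ^ ?N) \<partial>lborel)"
  proof (rule nn_integral_cong)
    fix y :: "real^'n"
    have "(\<integral>\<^sup>+x. ennreal (h0 y) * indicator (cube_rel l) (x, y) \<partial>lborel)
        = (\<integral>\<^sup>+x. ennreal (h0 y) * indicator (cbox (y - l *\<^sub>R One) y) x \<partial>lborel)"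
      by (intro nn_integral_cong) (auto simp: indicator_def cube_rel_iff')
    also have "\<dots> = ennreal (h0 y) * ennreal (l ^ ?N)"
      using l by (simp add: nn_integral_cmult_indicator emeasure_cube)
    finally show "(\<integral>\<^sup>+x. ennreal (h0 y) * indicator (cube_rel l) (x, y) \<partial>lborel) = ennreal (h0 y) * ennreal (l ^ ?N)" .
  qed
  also have "\<dots> = (\<integral>\<^sup>+y. ennreal (h0 y) \<partial>lborel) * ennreal (l ^ ?N)"
    by (intro nn_integral_multc) measurable
  also have "(\<integral>\<^sup>+y. ennreal (h0 y) \<partial>lborel) = (\<integral>\<^sup>+y. ennreal (h y) \<partial>lebesgue)"
    unfolding nn_integral_completion[of lborel, symmetric]
    by (rule nn_integral_cong_AE) (use eq in eventually_elim, auto)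
  also have "\<dots> = ennreal (LINT x|lebesgue. h x)"
    using h nn by (simp add: nn_integral_eq_integral)
  finally show ?thesis
    using l nn by (simp add: ennreal_mult''[symmetric] mult.assoc)
qed

lemma avg_nonneg:
  "(\<And>x. h x \<ge> 0) \<Longrightarrow> l > 0 \<Longrightarrow> avg l h x \<ge> 0"
  unfolding avg_def set_lebesgue_integral_def
  by (intro divide_nonneg_pos integral_nonneg_AE) auto

lemma avg_le_integral:
  fixes h :: "real^'n::finite \<Rightarrow> real"
  assumes h: "integrable lebesgue h" and nn: "\<And>x. h x \<ge> 0" and l: "l > 0"
  shows "avg l h x \<le> (LINT x|lebesgue. h x) / l ^ CARD('n)"
proof -
  have "(LINT y:cbox x (x + l *\<^sub>R One)|lebesgue. h y) \<le> (LINT x|lebesgue. h x)"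
    unfolding set_lebesgue_integral_def
    by (rule integral_mono[OF _ h])
      (use locally_integrable_cbox[OF integrable_locally_integrable[OF h]] nn in \<open>auto simp: set_integrable_def indicator_def\<close>)
  then show ?thesis using l by (simp add: avg_def divide_right_mono)
qed

text \<open>In the square, one factor is bounded uniformly by \<open>avg_le_integral\<close> and the
  other is integrated by \<open>nn_integral_avg\<close>.\<close>

lemma nn_integral_avg_square:
  fixes h :: "real^'n::finite \<Rightarrow> real"
  assumes h: "integrable lebesgue h" and nn: "\<And>x. h x \<ge> 0" and l: "l > 0"
  shows "(\<integral>\<^sup>+x. ennreal ((avg l h x)\<^sup>2) \<partial>lebesgue) \<le> ennreal ((LINT x|lebesgue. h x)\<^sup>2 / l ^ CARD('n))"
proof -
  define I where "I = (LINT x|lebesgue. h x)"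
  have I: "I \<ge> 0" unfolding I_def using nn by (intro integral_nonneg_AE) auto
  have [measurable]: "avg l h \<in> borel_measurable lebesgue"
    by (intro avg_measurable integrable_locally_integrable h)
  have "(avg l h x)\<^sup>2 \<le> I / l ^ CARD('n) * avg l h x" for x
    unfolding power2_eq_square I_def
    by (intro mult_right_mono avg_le_integral h nn l avg_nonneg)
  then have "(\<integral>\<^sup>+x. ennreal ((avg l h x)\<^sup>2) \<partial>lebesgue) \<le> (\<integral>\<^sup>+x. ennreal (I / l ^ CARD('n)) * ennreal (avg l h x) \<partial>lebesgue)"
    using I l by (intro nn_integral_mono) (simp add: ennreal_mult''[symmetric] avg_nonneg nn)
  also have "\<dots> = ennreal (I / l ^ CARD('n)) * ennreal I"
    by (subst nn_integral_cmult) (use nn_integral_avg[OF assms] in \<open>auto simp: I_def\<close>)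
  also have "\<dots> = ennreal (I\<^sup>2 / l ^ CARD('n))"
    using I by (simp add: ennreal_mult''[symmetric] power2_eq_square)
  finally show ?thesis by (simp add: I_def)
qed

text \<open>Jensen's inequality, obtained by integrating the square of \<open>f - c\<close> over the
  cube, where \<open>c\<close> is the average itself.\<close>

lemma avg_square_le:
  fixes f :: "real^'n::finite \<Rightarrow> real"
  assumes f: "locally_integrable f" and f2: "locally_integrable (\<lambda>x. (f x)\<^sup>2)" and l: "l > 0"
  shows "(avg l f x)\<^sup>2 \<le> avg l (\<lambda>x. (f x)\<^sup>2) x"
proof -
  define Q where "Q = cbox x (x + l *\<^sub>R One)"
  define c where "c = avg l f x"
  define V where "V = l ^ CARD('n)"
  have V: "V > 0" using l by (simp add: V_def)
  have "cbox x (x + l *\<^sub>R One) \<noteq> {}"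
    using l by (auto simp: box_ne_empty inner_simps)
  then have cont: "measure lborel (cbox x (x + l *\<^sub>R One)) = V"
    by (subst content_cbox_cart) (auto simp: V_def)
  have i1: "f integrable_on Q" and i2: "(\<lambda>x. (f x)\<^sup>2) integrable_on Q"
    unfolding Q_def by (rule set_integral_box_cbox(3)[OF f], rule set_integral_box_cbox(3)[OF f2])
  have c: "integral Q f = c * V" and s: "integral Q (\<lambda>x. (f x)\<^sup>2) = avg l (\<lambda>x. (f x)\<^sup>2) x * V"
    using l by (simp_all add: c_def avg_def V_def Q_def set_integral_box_cbox(2)[OF f] set_integral_box_cbox(2)[OF f2])
  have i3: "(\<lambda>x. 2 * c * f x) integrable_on Q" using integrable_on_mult_right[OF i1] by blast
  have i4: "(\<lambda>x. c\<^sup>2) integrable_on Q" unfolding Q_def by (rule integrable_const)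
  have "0 \<le> integral Q (\<lambda>x. (f x)\<^sup>2 - 2 * c * f x + c\<^sup>2)"
  proof (rule integral_nonneg)
    show "(\<lambda>x. (f x)\<^sup>2 - 2 * c * f x + c\<^sup>2) integrable_on Q"
      by (intro integrable_add integrable_diff i2 i3 i4)
    show "0 \<le> (f x)\<^sup>2 - 2 * c * f x + c\<^sup>2" for x
      using zero_le_power2[of "f x - c"] by (simp add: power2_diff algebra_simps)
  qed
  also have "\<dots> = integral Q (\<lambda>x. (f x)\<^sup>2) - integral Q (\<lambda>x. 2 * c * f x) + integral Q (\<lambda>x. c\<^sup>2)"
    by (simp add: integral_add integral_diff integrable_diff i2 i3 i4)
  also have "integral Q (\<lambda>x. 2 * c * f x) = 2 * c * (c * V)"
    by (simp add: c)
  also have "integral Q (\<lambda>x. c\<^sup>2) = V * c\<^sup>2"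
    unfolding Q_def by (simp add: cont)
  finally have "0 \<le> (avg l (\<lambda>x. (f x)\<^sup>2) x - c\<^sup>2) * V"
    unfolding s by (simp add: power2_eq_square algebra_simps)
  then show ?thesis using V by (simp add: zero_le_mult_iff c_def)
qed


text \<open>Says that the norm of \<open>f\<close> in L4 is at most \<open>A\<close>. The extended
  integral makes finiteness part of the statement, and no root of an integral has to be
  handled.\<close>

definition L4_bound :: "(real^'n::finite \<Rightarrow> real) \<Rightarrow> real \<Rightarrow> bool" where
  "L4_bound f A \<longleftrightarrow> f \<in> borel_measurable lebesgue \<and> 0 \<le> A \<and>
     (\<integral>\<^sup>+x. ennreal ((f x) ^ 4) \<partial>lebesgue) \<le> ennreal (A ^ 4)"

text \<open>Convexity of the fourth power between \<open>x / (1 - t)\<close> and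
  \<open>y / t\<close>. The choice \<open>t = 1/2\<close> gives the factor 8 that recurs
  later.\<close>

lemma quartic_convex:
  fixes x y t :: real
  assumes "0 < t" "t < 1"
  shows "(x + y) ^ 4 \<le> x ^ 4 / (1 - t) ^ 3 + y ^ 4 / t ^ 3"
proof -
  have "((1 - t) *\<^sub>R (x / (1 - t)) + t *\<^sub>R (y / t)) ^ 4 \<le> (1 - t) * (x / (1 - t)) ^ 4 + t * (y / t) ^ 4"
    by (rule convex_onD[OF convex_power_even[of 4]]) (use assms in auto)
  also have "(1 - t) *\<^sub>R (x / (1 - t)) + t *\<^sub>R (y / t) = x + y"
    using assms by simp
  also have "(1 - t) * (x / (1 - t)) ^ 4 = x ^ 4 / (1 - t) ^ 3"
    using assms by (simp add: power_divide power4_eq_xxxx power3_eq_cube)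
  also have "t * (y / t) ^ 4 = y ^ 4 / t ^ 3"
    using assms by (simp add: power_divide power4_eq_xxxx power3_eq_cube)
  finally show ?thesis .
qed

lemma L4_bound_cong_AE:
  assumes "L4_bound f A" "AE x in lebesgue. g x = f x" "g \<in> borel_measurable lebesgue"
  shows "L4_bound g A"
proof -
  have "(\<integral>\<^sup>+x. ennreal ((g x) ^ 4) \<partial>lebesgue) = (\<integral>\<^sup>+x. ennreal ((f x) ^ 4) \<partial>lebesgue)"
    by (rule nn_integral_cong_AE) (use assms(2) in eventually_elim, simp)
  then show ?thesis using assms by (simp add: L4_bound_def)
qed

lemma L4_bound_0_AE:
  assumes "L4_bound f 0"
  shows "AE x in lebesgue. f x = 0"
proof -
  have [measurable]: "f \<in> borel_measurable lebesgue" using assms by (simp add: L4_bound_def)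
  have "(\<integral>\<^sup>+x. ennreal ((f x) ^ 4) \<partial>lebesgue) = 0" using assms by (simp add: L4_bound_def)
  then have "AE x in lebesgue. ennreal ((f x) ^ 4) = 0"
    by (subst (asm) nn_integral_0_iff_AE) auto
  then show ?thesis
    by eventually_elim (simp add: ennreal_eq_0_iff power_le_zero_eq)
qed

text \<open>Convexity of the fourth power with the weights \<open>A / (A + B)\<close> and \<open>B / (A + B)\<close>.\<close>

lemma L4_bound_add:
  assumes f: "L4_bound f A" and g: "L4_bound g B"
  shows "L4_bound (\<lambda>x. f x + g x) (A + B)"
proof -
  have [measurable]: "f \<in> borel_measurable lebesgue" "g \<in> borel_measurable lebesgue"
    using assms by (auto simp: L4_bound_def)
  have AB: "A \<ge> 0" "B \<ge> 0" using assms by (auto simp: L4_bound_def)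
  have m: "(\<lambda>x. f x + g x) \<in> borel_measurable lebesgue" by measurable
  show ?thesis
  proof (cases "A = 0 \<or> B = 0")
    \<comment> \<open>Here one of the two weights would be zero; the function with bound zero
      vanishes almost everywhere instead.\<close>
    case True
    then show ?thesis
    proof
      assume "A = 0"
      then have "AE x in lebesgue. f x + g x = g x" using L4_bound_0_AE[of f] f by auto
      from L4_bound_cong_AE[OF g this m] show ?thesis using \<open>A = 0\<close> by simp
    next
      assume "B = 0"
      then have "AE x in lebesgue. f x + g x = f x" using L4_bound_0_AE[of g] g by auto
      from L4_bound_cong_AE[OF f this m] show ?thesis using \<open>B = 0\<close> by simp
    qed
  next
    case False
    then have pos: "A > 0" "B > 0" using AB by auto
    define t where "t = B / (A + B)"
    have t: "0 < t" "t < 1" "1 - t = A / (A + B)" using pos by (auto simp: t_def field_simps)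
    have "(\<integral>\<^sup>+x. ennreal ((f x + g x) ^ 4) \<partial>lebesgue)
        \<le> (\<integral>\<^sup>+x. ennreal (1 / (1 - t) ^ 3) * ennreal ((f x) ^ 4) + ennreal (1 / t ^ 3) * ennreal ((g x) ^ 4) \<partial>lebesgue)"
    proof (rule nn_integral_mono)
      fix x
      show "ennreal ((f x + g x) ^ 4) \<le> ennreal (1 / (1 - t) ^ 3) * ennreal ((f x) ^ 4) + ennreal (1 / t ^ 3) * ennreal ((g x) ^ 4)"
        using quartic_convex[OF t(1,2), of "f x" "g x"] t
        by (simp add: ennreal_mult''[symmetric] ennreal_plus[symmetric] del: ennreal_plus)
    qed
    also have "\<dots> = ennreal (1 / (1 - t) ^ 3) * (\<integral>\<^sup>+x. ennreal ((f x) ^ 4) \<partial>lebesgue)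
        + ennreal (1 / t ^ 3) * (\<integral>\<^sup>+x. ennreal ((g x) ^ 4) \<partial>lebesgue)"
      by (simp add: nn_integral_add nn_integral_cmult)
    also have "\<dots> \<le> ennreal (1 / (1 - t) ^ 3) * ennreal (A ^ 4) + ennreal (1 / t ^ 3) * ennreal (B ^ 4)"
      using f g by (intro add_mono mult_left_mono) (auto simp: L4_bound_def)
    also have "\<dots> = ennreal (A ^ 4 / (1 - t) ^ 3 + B ^ 4 / t ^ 3)"
      using t by (simp add: ennreal_mult''[symmetric] ennreal_plus[symmetric] del: ennreal_plus)
    also have "A ^ 4 / (1 - t) ^ 3 = A * (A + B) ^ 3"
      using pos by (simp add: t(3) power_divide power4_eq_xxxx power3_eq_cube)
    also have "B ^ 4 / t ^ 3 = B * (A + B) ^ 3"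
      using pos by (simp add: t_def power_divide power4_eq_xxxx power3_eq_cube)
    also have "A * (A + B) ^ 3 + B * (A + B) ^ 3 = (A + B) ^ 4"
      by (simp add: power4_eq_xxxx power3_eq_cube algebra_simps)
    finally show ?thesis using m AB by (simp add: L4_bound_def)
  qed
qed

lemma L4_bound_mono: "L4_bound f A \<Longrightarrow> A \<le> B \<Longrightarrow> L4_bound f B"
  unfolding L4_bound_def by (meson ennreal_leI order_trans power_mono)

lemma L4_bound_Fatou:
  assumes f: "\<And>n. L4_bound (f n) A" and lim: "AE x in lebesgue. (\<lambda>n. f n x) \<longlonglongrightarrow> F x"
    and F: "F \<in> borel_measurable lebesgue"
  shows "L4_bound F A"
proof -
  have [measurable]: "f n \<in> borel_measurable lebesgue" for n using f by (simp add: L4_bound_def)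
  have "(\<integral>\<^sup>+x. ennreal ((F x) ^ 4) \<partial>lebesgue) = (\<integral>\<^sup>+x. liminf (\<lambda>n. ennreal ((f n x) ^ 4)) \<partial>lebesgue)"
  proof (rule nn_integral_cong_AE, use lim in eventually_elim)
    fix x assume "(\<lambda>n. f n x) \<longlonglongrightarrow> F x"
    then have "(\<lambda>n. ennreal ((f n x) ^ 4)) \<longlonglongrightarrow> ennreal ((F x) ^ 4)"
      by (intro tendsto_ennrealI tendsto_power)
    from lim_imp_Liminf[OF trivial_limit_sequentially this]
    show "ennreal ((F x) ^ 4) = liminf (\<lambda>n. ennreal ((f n x) ^ 4))" by (rule sym)
  qed
  also have "\<dots> \<le> liminf (\<lambda>n. \<integral>\<^sup>+x. ennreal ((f n x) ^ 4) \<partial>lebesgue)"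
    by (rule nn_integral_liminf) measurable
  also have "\<dots> \<le> liminf (\<lambda>n::nat. ennreal (A ^ 4))"
    by (rule Liminf_mono) (use f in \<open>simp add: L4_bound_def\<close>)
  also have "\<dots> = ennreal (A ^ 4)"
    by (rule Liminf_const[OF trivial_limit_sequentially])
  finally show ?thesis using f F by (simp add: L4_bound_def)
qed

text \<open>Common pattern of the two estimates to come: \<open>f\<close> is an average, with
  \<open>h\<close> the square of the function, or a dyadic increment, with \<open>h\<close> the
  squared norm of the gradient.\<close>

lemma L4_boundI_avg:
  fixes f h :: "real^'n::finite \<Rightarrow> real"
  assumes h: "integrable lebesgue h" "\<And>x. h x \<ge> 0" and l: "l > 0"
    and f: "f \<in> borel_measurable lebesgue" "\<And>x. (f x)\<^sup>2 \<le> c * avg l h x" and c: "c \<ge> 0" and A: "A \<ge> 0"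
    and le: "c\<^sup>2 * ((LINT x|lebesgue. h x)\<^sup>2 / l ^ CARD('n)) \<le> A ^ 4"
  shows "L4_bound f A"
proof -
  have [measurable]: "avg l h \<in> borel_measurable lebesgue"
    by (intro avg_measurable integrable_locally_integrable h)
  have p4: "(f x) ^ 4 \<le> c\<^sup>2 * (avg l h x)\<^sup>2" for x
    using power_mono[OF f(2), of x 2] by (simp add: power_mult_distrib flip: power_mult)
  have "(\<integral>\<^sup>+x. ennreal ((f x) ^ 4) \<partial>lebesgue) \<le> (\<integral>\<^sup>+x. ennreal (c\<^sup>2) * ennreal ((avg l h x)\<^sup>2) \<partial>lebesgue)"
    using p4 by (intro nn_integral_mono) (simp add: ennreal_mult''[symmetric])
  also have "\<dots> = ennreal (c\<^sup>2) * (\<integral>\<^sup>+x. ennreal ((avg l h x)\<^sup>2) \<partial>lebesgue)"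
    by (rule nn_integral_cmult) measurable
  also have "\<dots> \<le> ennreal (c\<^sup>2) * ennreal ((LINT x|lebesgue. h x)\<^sup>2 / l ^ CARD('n))"
    by (intro mult_left_mono nn_integral_avg_square h l) auto
  also have "\<dots> = ennreal (c\<^sup>2 * ((LINT x|lebesgue. h x)\<^sup>2 / l ^ CARD('n)))"
    using l by (intro ennreal_mult''[symmetric]) simp
  also have "\<dots> \<le> ennreal (A ^ 4)" using le by (rule ennreal_leI)
  finally show ?thesis using f A by (simp add: L4_bound_def)
qed

section \<open>The L4 norms of averages and of oscillations\<close>

lemma square_integrable_norm:
  "square_integrable f \<Longrightarrow> integrable lebesgue (\<lambda>x. (norm (f x))\<^sup>2)"
  by (simp add: square_integrable_def)

lemma avg_L4_bound:
  fixes u :: "real^'n::finite \<Rightarrow> real"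
  assumes u: "locally_integrable u" "square_integrable u" and l: "l > 0"
    and A: "A \<ge> 0" "(LINT x|lebesgue. (u x)\<^sup>2)\<^sup>2 / l ^ CARD('n) \<le> A ^ 4"
  shows "L4_bound (avg l u) A"
proof (rule L4_boundI_avg[where c = 1 and h = "\<lambda>x. (u x)\<^sup>2"])
  show i: "integrable lebesgue (\<lambda>x. (u x)\<^sup>2)" using square_integrable_norm[OF u(2)] by simp
  show "avg l u \<in> borel_measurable lebesgue" by (rule avg_measurable[OF u(1)])
  show "(avg l u x)\<^sup>2 \<le> 1 * avg l (\<lambda>x. (u x)\<^sup>2) x" for x
    using avg_square_le[OF u(1) integrable_locally_integrable[OF i] l] by simp
qed (use assms in auto)

lemma avg_halving_L4_bound:
  fixes u :: "real^'n::finite \<Rightarrow> real"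
  assumes wg: "has_weak_gradient u g" "square_integrable g" and l: "l > 0"
    and N: "CARD('n) \<le> 4"
  shows "L4_bound (\<lambda>x. avg (l / 2) u x - avg l u x)
     (real CARD('n) * 2 ^ CARD('n) * root 4 (l ^ (4 - CARD('n))) * sqrt (LINT x|lebesgue. (norm (g x))\<^sup>2))"
    (is "L4_bound _ ?A")
proof -
  define K where "K = real CARD('n) * 2 ^ CARD('n)"
  define G where "G = (LINT x|lebesgue. (norm (g x))\<^sup>2)"
  have G: "G \<ge> 0" unfolding G_def by (intro integral_nonneg_AE) auto
  have K: "K \<ge> 0" by (simp add: K_def)
  note u = has_weak_gradientD(1)[OF wg(1)] and g = locally_integrable_norm[OF has_weak_gradientD(2)[OF wg(1)]]
  show ?thesis
  proof (rule L4_boundI_avg[where c = "(K * l)\<^sup>2" and h = "\<lambda>x. (norm (g x))\<^sup>2"])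
    show i: "integrable lebesgue (\<lambda>x. (norm (g x))\<^sup>2)" using square_integrable_norm[OF wg(2)] .
    show "(\<lambda>x. avg (l / 2) u x - avg l u x) \<in> borel_measurable lebesgue"
      by (intro borel_measurable_diff avg_measurable u)
    show "(avg (l / 2) u x - avg l u x)\<^sup>2 \<le> (K * l)\<^sup>2 * avg l (\<lambda>x. (norm (g x))\<^sup>2) x" for x
    proof -
      have "(avg (l / 2) u x - avg l u x)\<^sup>2 = \<bar>avg (l / 2) u x - avg l u x\<bar>\<^sup>2" by simp
      also have "\<dots> \<le> (K * l * avg l (\<lambda>y. norm (g y)) x)\<^sup>2"
        using avg_halving[OF wg(1) l, of x] by (intro power_mono) (auto simp: K_def)
      also have "\<dots> = (K * l)\<^sup>2 * (avg l (\<lambda>y. norm (g y)) x)\<^sup>2" by (rule power_mult_distrib)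
      also have "\<dots> \<le> (K * l)\<^sup>2 * avg l (\<lambda>x. (norm (g x))\<^sup>2) x"
        by (intro mult_left_mono avg_square_le g integrable_locally_integrable i l) auto
      finally show ?thesis .
    qed
    \<comment> \<open>Origin of the exponent: \<open>l ^ 4\<close> comes from the halving estimate,
      the division by \<open>l ^ CARD('n)\<close> from
      \<open>nn_integral_avg_square\<close>.\<close>
    have ll: "l ^ 4 / l ^ CARD('n) = l ^ (4 - CARD('n))"
      using l N by (simp add: power_diff)
    have "?A ^ 4 = K ^ 4 * l ^ (4 - CARD('n)) * (sqrt G) ^ 4"
      using l by (simp add: power_mult_distrib K_def G_def)
    also have "(sqrt G) ^ 4 = G\<^sup>2"
      using G by (simp add: power4_eq_xxxx power2_eq_square)
    also have "K ^ 4 * l ^ (4 - CARD('n)) * G\<^sup>2 = ((K * l)\<^sup>2)\<^sup>2 * (G\<^sup>2 / l ^ CARD('n))"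
      by (simp add: ll[symmetric] power_mult_distrib flip: power_mult)
    finally show "((K * l)\<^sup>2)\<^sup>2 * ((LINT x|lebesgue. (norm (g x))\<^sup>2)\<^sup>2 / l ^ CARD('n)) \<le> ?A ^ 4"
      by (simp add: G_def)
    show "?A \<ge> 0" using l G by (simp add: G_def)
  qed (use l in auto)
qed

text \<open>Sum of the geometric series of dyadic increments. The ratio
  \<open>root 4 (1 / 2)\<close> is the one for dimension three and bounds the ratios in lower
  dimensions.\<close>

definition osc_const :: "'n::finite itself \<Rightarrow> real" where
  "osc_const _ = real CARD('n) * 2 ^ CARD('n) / (1 - root 4 (1 / 2))"

lemma osc_const_pos: "osc_const TYPE('n::finite) > 0"
proof -
  have "root 4 (1 / 2) < root 4 1" by (rule real_root_less_mono) auto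
  then show ?thesis by (simp add: osc_const_def)
qed

text \<open>
  Summation of the dyadic increments; the exponent \<open>4 - N > 0\<close> makes the series geometric,
  which is where the restriction on the dimension enters.
\<close>

lemma avg_osc_L4_bound:
  fixes u :: "real^'n::finite \<Rightarrow> real"
  assumes wg: "has_weak_gradient u g" "square_integrable g" and l: "l > 0"
    and N: "CARD('n) \<le> 3"
  shows "L4_bound (\<lambda>x. u x - avg l u x)
     (osc_const TYPE('n) * root 4 (l ^ (4 - CARD('n))) * sqrt (LINT x|lebesgue. (norm (g x))\<^sup>2))"
proof -
  define K where "K = real CARD('n) * 2 ^ CARD('n)"
  define G where "G = sqrt (LINT x|lebesgue. (norm (g x))\<^sup>2)"
  define \<rho> where "\<rho> = root 4 (1 / 2)"
  define C where "C = K * root 4 (l ^ (4 - CARD('n))) * G"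
  have \<rho>: "0 < \<rho>" "\<rho> < 1" using real_root_less_mono[of 4 "1/2" 1] by (auto simp: \<rho>_def)
  have G: "G \<ge> 0" unfolding G_def by (auto intro!: integral_nonneg_AE)
  have C: "C \<ge> 0" using G l by (simp add: C_def K_def)
  note u = has_weak_gradientD(1)[OF wg(1)]
  have step: "L4_bound (\<lambda>x. avg (l / 2 ^ Suc n) u x - avg (l / 2 ^ n) u x) (C * \<rho> ^ n)" for n
  proof -
    have "(l / 2 ^ n) ^ (4 - CARD('n)) = l ^ (4 - CARD('n)) * ((1 / 2) ^ n) ^ (4 - CARD('n))"
      by (simp add: power_divide power_one_over)
    also have "\<dots> \<le> l ^ (4 - CARD('n)) * ((1 / 2) ^ n) ^ 1"
      using N l by (intro mult_left_mono power_decreasing power_le_one) auto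
    finally have "root 4 ((l / 2 ^ n) ^ (4 - CARD('n))) \<le> root 4 (l ^ (4 - CARD('n)) * (1 / 2) ^ n)"
      by simp
    also have "\<dots> = root 4 (l ^ (4 - CARD('n))) * \<rho> ^ n"
      by (simp add: real_root_mult real_root_power \<rho>_def)
    finally have "K * root 4 ((l / 2 ^ n) ^ (4 - CARD('n))) * G \<le> K * (root 4 (l ^ (4 - CARD('n))) * \<rho> ^ n) * G"
      using G by (intro mult_right_mono mult_left_mono) (auto simp: K_def)
    then have "K * root 4 ((l / 2 ^ n) ^ (4 - CARD('n))) * G \<le> C * \<rho> ^ n"
      by (simp add: C_def mult_ac)
    moreover have "L4_bound (\<lambda>x. avg (l / 2 ^ n / 2) u x - avg (l / 2 ^ n) u x) (K * root 4 ((l / 2 ^ n) ^ (4 - CARD('n))) * G)"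
      unfolding K_def G_def using N l by (intro avg_halving_L4_bound wg) auto
    ultimately have "L4_bound (\<lambda>x. avg (l / 2 ^ n / 2) u x - avg (l / 2 ^ n) u x) (C * \<rho> ^ n)"
      using L4_bound_mono by blast
    then show ?thesis by (simp add: mult.commute)
  qed
  have sum: "L4_bound (\<lambda>x. avg (l / 2 ^ n) u x - avg l u x) (C * (\<Sum>k<n. \<rho> ^ k))" for n
  proof (induction n)
    case 0
    show ?case by (simp add: L4_bound_def)
  next
    case (Suc n)
    from L4_bound_add[OF step[of n] Suc] show ?case by (simp add: algebra_simps)
  qed
  have "C * (\<Sum>k<n. \<rho> ^ k) \<le> C * (1 / (1 - \<rho>))" for n
    using \<rho> C by (intro mult_left_mono) (auto simp: sum_gp_strict divide_right_mono)
  then have "L4_bound (\<lambda>x. avg (l / 2 ^ n) u x - avg l u x) (C * (1 / (1 - \<rho>)))" for n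
    using sum L4_bound_mono by blast
  then have "L4_bound (\<lambda>x. u x - avg l u x) (C * (1 / (1 - \<rho>)))"
  proof (rule L4_bound_Fatou)
    show "AE x in lebesgue. (\<lambda>n. avg (l / 2 ^ n) u x - avg l u x) \<longlonglongrightarrow> u x - avg l u x"
      using AE_avg_tendsto[OF u l] by eventually_elim (intro tendsto_intros)
    show "(\<lambda>x. u x - avg l u x) \<in> borel_measurable lebesgue"
      by (intro borel_measurable_diff avg_measurable locally_integrable_measurable u)
  qed
  then show ?thesis by (simp add: C_def K_def G_def \<rho>_def osc_const_def)
qed

lemma L4_bound_integral:
  assumes "L4_bound f A"
  shows "integrable lebesgue (\<lambda>x. (f x) ^ 4)" "(LINT x|lebesgue. (f x) ^ 4) \<le> A ^ 4"
proof -
  have [measurable]: "f \<in> borel_measurable lebesgue" and le: "(\<integral>\<^sup>+x. ennreal ((f x) ^ 4) \<partial>lebesgue) \<le> ennreal (A ^ 4)"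
    using assms by (auto simp: L4_bound_def)
  show i: "integrable lebesgue (\<lambda>x. (f x) ^ 4)"
    by (rule integrableI_nonneg) (use le in \<open>auto simp: top_unique less_top intro: le_less_trans\<close>)
  have "ennreal (LINT x|lebesgue. (f x) ^ 4) \<le> ennreal (A ^ 4)"
    using le nn_integral_eq_integral[OF i] by simp
  then show "(LINT x|lebesgue. (f x) ^ 4) \<le> A ^ 4" by (simp add: ennreal_le_iff)
qed

text \<open>The function is split into its oscillation around the averages, controlled by the
  gradient, and the averages, controlled by the L2 norm. The scale \<open>l\<close> stays free: at
  \<open>l = 1 / sqrt m\<close> the bracket becomes the quadratic form with mass \<open>m\<close>,
  and the prefactor decays in \<open>m\<close>. This decay is what later kills a component with
  large \<open>lam j\<close>.\<close>

lemma Sobolev_L4: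
  fixes u :: "real^'n::finite \<Rightarrow> real"
  assumes wg: "has_weak_gradient u g" "square_integrable g" "square_integrable u" and l: "l > 0"
    and N: "CARD('n) \<le> 3"
  shows "integrable lebesgue (\<lambda>x. (u x) ^ 4)"
    and "(LINT x|lebesgue. (u x) ^ 4) \<le> 8 * (osc_const TYPE('n) ^ 4 + 1) * l ^ (4 - CARD('n)) *
      ((LINT x|lebesgue. (norm (g x))\<^sup>2) + (LINT x|lebesgue. (u x)\<^sup>2) / l\<^sup>2)\<^sup>2"
proof -
  define G where "G = (LINT x|lebesgue. (norm (g x))\<^sup>2)"
  define U where "U = (LINT x|lebesgue. (u x)\<^sup>2)"
  define K where "K = osc_const TYPE('n)"
  have G: "G \<ge> 0" unfolding G_def by (auto intro!: integral_nonneg_AE)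
  have U: "U \<ge> 0" unfolding U_def by (auto intro!: integral_nonneg_AE)
  have K: "K > 0" unfolding K_def by (rule osc_const_pos)
  note u = has_weak_gradientD(1)[OF wg(1)]
  define A where "A = K * root 4 (l ^ (4 - CARD('n))) * sqrt G"
  define B where "B = root 4 (U\<^sup>2 / l ^ CARD('n))"
  have "L4_bound (\<lambda>x. u x - avg l u x) A"
    unfolding A_def K_def G_def by (rule avg_osc_L4_bound[OF wg(1,2) l N])
  moreover have "L4_bound (avg l u) B"
    by (rule avg_L4_bound[OF u wg(3) l]) (use l in \<open>auto simp: B_def U_def\<close>)
  ultimately have "L4_bound (\<lambda>x. u x - avg l u x + avg l u x) (A + B)"
    by (rule L4_bound_add)
  then have b: "L4_bound u (A + B)" by simp
  show "integrable lebesgue (\<lambda>x. (u x) ^ 4)" by (rule L4_bound_integral(1)[OF b])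
  have A4: "A ^ 4 = K ^ 4 * l ^ (4 - CARD('n)) * G\<^sup>2"
    using l G by (simp add: A_def power_mult_distrib power4_eq_xxxx[of "sqrt G"] power2_eq_square[of G])
  have "l ^ 4 = l ^ (4 - CARD('n)) * l ^ CARD('n)"
    using N by (simp flip: power_add)
  then have B4: "B ^ 4 = l ^ (4 - CARD('n)) * (U / l\<^sup>2)\<^sup>2"
    using l by (simp add: B_def power_divide flip: power_mult)
  have "(LINT x|lebesgue. (u x) ^ 4) \<le> (A + B) ^ 4" by (rule L4_bound_integral(2)[OF b])
  also have "\<dots> \<le> 8 * (A ^ 4 + B ^ 4)"
    using quartic_convex[of "1/2" A B] by (simp add: power_one_over)
  also have "\<dots> \<le> 8 * ((K ^ 4 + 1) * l ^ (4 - CARD('n)) * (G + U / l\<^sup>2)\<^sup>2)"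
  proof -
    have "G\<^sup>2 \<le> (G + U / l\<^sup>2)\<^sup>2" "(U / l\<^sup>2)\<^sup>2 \<le> (G + U / l\<^sup>2)\<^sup>2"
      using G U by (auto intro!: power_mono)
    then have "K ^ 4 * l ^ (4 - CARD('n)) * G\<^sup>2 \<le> K ^ 4 * l ^ (4 - CARD('n)) * (G + U / l\<^sup>2)\<^sup>2"
      "l ^ (4 - CARD('n)) * (U / l\<^sup>2)\<^sup>2 \<le> l ^ (4 - CARD('n)) * (G + U / l\<^sup>2)\<^sup>2"
      using l K by (auto intro!: mult_left_mono)
    then show ?thesis unfolding A4 B4 by (simp add: distrib_right)
  qed
  finally show "(LINT x|lebesgue. (u x) ^ 4) \<le> 8 * (osc_const TYPE('n) ^ 4 + 1) * l ^ (4 - CARD('n)) *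
      ((LINT x|lebesgue. (norm (g x))\<^sup>2) + (LINT x|lebesgue. (u x)\<^sup>2) / l\<^sup>2)\<^sup>2"
    unfolding K_def G_def U_def by (simp only: mult.assoc)
qed

subsection \<open>The space of functions with square-integrable gradient\<close>

lemma lebesgue_affine:
  fixes t :: "'a::euclidean_space"
  assumes "c \<noteq> 0"
  shows "(\<lambda>x. c *\<^sub>R x + t) \<in> lebesgue \<rightarrow>\<^sub>M lebesgue"
    and "lebesgue = density (distr lebesgue lebesgue (\<lambda>x. c *\<^sub>R x + t)) (\<lambda>_. ennreal (\<bar>c\<bar> ^ DIM('a)))"
proof -
  have eq: "t + (\<Sum>j\<in>Basis. (c * (x \<bullet> j)) *\<^sub>R j) = c *\<^sub>R x + t" for x :: 'a
    unfolding scaleR_scaleR[symmetric] scaleR_sum_right[symmetric] euclidean_representation by simp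
  show "(\<lambda>x. c *\<^sub>R x + t) \<in> lebesgue \<rightarrow>\<^sub>M lebesgue"
    using lebesgue_affine_measurable[of "\<lambda>_. c" t] assms unfolding eq by simp
  show "lebesgue = density (distr lebesgue lebesgue (\<lambda>x. c *\<^sub>R x + t)) (\<lambda>_. ennreal (\<bar>c\<bar> ^ DIM('a)))"
    using lebesgue_affine_euclidean[of "\<lambda>_. c" t] assms unfolding eq by (simp add: ennreal_power)
qed

lemma lebesgue_affine_integral:
  fixes f :: "real^'n::finite \<Rightarrow> 'b::euclidean_space"
  assumes c: "c \<noteq> 0" and f: "f \<in> borel_measurable lebesgue"
  shows "(\<lambda>x. f (c *\<^sub>R x + t)) \<in> borel_measurable lebesgue"
    and "integrable lebesgue (\<lambda>x. f (c *\<^sub>R x + t)) \<longleftrightarrow> integrable lebesgue f"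
    and "(LINT x|lebesgue. f (c *\<^sub>R x + t)) = (LINT x|lebesgue. f x) /\<^sub>R \<bar>c\<bar> ^ CARD('n)"
proof -
  let ?T = "\<lambda>x. c *\<^sub>R x + t :: real^'n"
  let ?k = "\<bar>c\<bar> ^ CARD('n)"
  note T = lebesgue_affine(1)[OF c, of t] and eq = lebesgue_affine(2)[OF c, of t]
  have k: "?k > 0" using c by simp
  have f': "f \<in> borel_measurable (distr lebesgue lebesgue ?T)" using f by simp
  show "(\<lambda>x. f (c *\<^sub>R x + t)) \<in> borel_measurable lebesgue"
    by (rule measurable_compose[OF T f])
  have "integrable lebesgue f \<longleftrightarrow> integrable (density (distr lebesgue lebesgue ?T) (\<lambda>_. ennreal ?k)) f"
    using eq by simp
  also have "\<dots> \<longleftrightarrow> integrable (distr lebesgue lebesgue ?T) (\<lambda>x. ?k *\<^sub>R f x)"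
    using k by (intro integrable_density[OF f']) auto
  also have "\<dots> \<longleftrightarrow> integrable lebesgue (\<lambda>x. ?k *\<^sub>R f (?T x))"
    by (intro integrable_distr_eq[OF T]) (use f in measurable)
  also have "\<dots> \<longleftrightarrow> integrable lebesgue (\<lambda>x. f (?T x))"
  proof
    assume "integrable lebesgue (\<lambda>x. ?k *\<^sub>R f (?T x))"
    then have "integrable lebesgue (\<lambda>x. inverse ?k *\<^sub>R ?k *\<^sub>R f (?T x))"
      by (rule integrable_scaleR_right)
    then show "integrable lebesgue (\<lambda>x. f (?T x))" using k by simp
  qed (rule integrable_scaleR_right)
  finally show "integrable lebesgue (\<lambda>x. f (c *\<^sub>R x + t)) \<longleftrightarrow> integrable lebesgue f" by simp
  have "(LINT x|lebesgue. f x) = integral\<^sup>L (density (distr lebesgue lebesgue ?T) (\<lambda>_. ennreal ?k)) f"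
    using eq by simp
  also have "\<dots> = (LINT x|distr lebesgue lebesgue ?T. ?k *\<^sub>R f x)"
    using k by (intro integral_density[OF f']) auto
  also have "\<dots> = (LINT x|lebesgue. ?k *\<^sub>R f (?T x))"
    by (intro integral_distr[OF T]) (use f in measurable)
  finally show "(LINT x|lebesgue. f (c *\<^sub>R x + t)) = (LINT x|lebesgue. f x) /\<^sub>R ?k"
    using c by simp
qed

lemma test_function_affine:
  assumes "test_function \<phi>" "c \<noteq> 0"
  shows "test_function (\<lambda>x. \<phi> (c *\<^sub>R x + a))"
proof -
  have "{x. \<phi> (c *\<^sub>R x + a) \<noteq> 0} \<subseteq> (\<lambda>y. (1 / c) *\<^sub>R y) ` ((\<lambda>y. - a + y) ` {x. \<phi> x \<noteq> 0})"
  proof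
    fix x assume "x \<in> {x. \<phi> (c *\<^sub>R x + a) \<noteq> 0}"
    then show "x \<in> (\<lambda>y. (1 / c) *\<^sub>R y) ` ((\<lambda>y. - a + y) ` {x. \<phi> x \<noteq> 0})"
      using assms(2) by (intro image_eqI[of _ _ "c *\<^sub>R x"] image_eqI[of _ _ "c *\<^sub>R x + a"]) auto
  qed
  moreover have "bounded ((\<lambda>y. (1 / c) *\<^sub>R y) ` ((\<lambda>y. - a + y) ` {x. \<phi> x \<noteq> 0}))"
    using assms(1) by (intro bounded_scaling bounded_translation) (simp add: test_function_def compact_closure)
  ultimately have "bounded {x. \<phi> (c *\<^sub>R x + a) \<noteq> 0}" by (rule bounded_subset[rotated])
  then show ?thesis
    using assms(1) by (simp add: test_function_def compact_closure C_class_affine)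
qed

lemma test_function_differentiable: "test_function \<phi> \<Longrightarrow> \<phi> differentiable_on UNIV"
  unfolding test_function_def by (metis C_class.simps(2))

lemma locally_integrable_affine:
  fixes f :: "real^'n::finite \<Rightarrow> 'b::euclidean_space"
  assumes f: "locally_integrable f" and c: "c \<noteq> 0"
  shows "locally_integrable (\<lambda>x. f (c *\<^sub>R x + a))"
  unfolding locally_integrable_def set_integrable_def
proof (intro allI impI)
  fix K :: "(real^'n) set" assume K: "compact K"
  let ?T = "\<lambda>x. c *\<^sub>R x + a"
  have "compact (?T ` K)" by (intro compact_continuous_image K continuous_intros)
  then have i: "integrable lebesgue (\<lambda>y. indicat_real (?T ` K) y *\<^sub>R f y)"
    using f by (simp add: locally_integrable_def set_integrable_def)
  have "indicat_real K x = indicat_real (?T ` K) (?T x)" for x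
    using c by (auto simp: indicator_def)
  then show "integrable lebesgue (\<lambda>x. indicat_real K x *\<^sub>R f (?T x))"
    using lebesgue_affine_integral(2)[OF c borel_measurable_integrable[OF i], of a] i by simp
qed

lemma has_weak_gradient_affine:
  fixes u :: "real^'n::finite \<Rightarrow> real"
  assumes wg: "has_weak_gradient u g" and c: "c \<noteq> 0"
  shows "has_weak_gradient (\<lambda>x. u (c *\<^sub>R x + a)) (\<lambda>x. c *\<^sub>R g (c *\<^sub>R x + a))"
  unfolding has_weak_gradient_def
proof (intro conjI allI impI)
  note u = has_weak_gradientD(1)[OF wg] and g = has_weak_gradientD(2)[OF wg]
  show "locally_integrable (\<lambda>x. u (c *\<^sub>R x + a))" by (rule locally_integrable_affine[OF u c])
  have "set_integrable lebesgue K (\<lambda>x. c *\<^sub>R g (c *\<^sub>R x + a))" if "compact K" for K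
    using locally_integrable_affine[OF g c, of a] that
    unfolding locally_integrable_def by (metis set_integrable_scaleR_right)
  then show "locally_integrable (\<lambda>x. c *\<^sub>R g (c *\<^sub>R x + a))"
    by (simp add: locally_integrable_def)
  fix \<phi> :: "real^'n \<Rightarrow> real" and k assume \<phi>: "test_function \<phi>"
  \<comment> \<open>The test function is pulled back by the inverse map, so that the identity for
    \<open>u\<close> can be used before changing variables.\<close>
  define \<psi> where "\<psi> = (\<lambda>y. \<phi> ((1 / c) *\<^sub>R y + (- (1 / c) *\<^sub>R a)))"
  have \<psi>: "test_function \<psi>"
    unfolding \<psi>_def using c by (intro test_function_affine \<phi>) auto
  have \<phi>_eq: "\<phi> x = \<psi> (c *\<^sub>R x + a)" for x
    using c by (simp add: \<psi>_def scaleR_add_right)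
  have "partial_deriv k \<phi> x = c * partial_deriv k \<psi> (c *\<^sub>R x + a)" for x
    unfolding \<phi>_eq[abs_def] by (rule partial_deriv_affine[OF test_function_differentiable[OF \<psi>]])
  moreover define F where "F = (\<lambda>y. c * (u y * partial_deriv k \<psi> y))"
  ultimately have 1: "(LINT x|lebesgue. u (c *\<^sub>R x + a) * partial_deriv k \<phi> x) = (LINT x|lebesgue. F (c *\<^sub>R x + a))"
    by (simp add: mult_ac)
  have F: "F \<in> borel_measurable lebesgue"
    unfolding F_def
    by (intro borel_measurable_times borel_measurable_const
        locally_integrable_measurable[OF u] test_function_measurable test_function_partial_deriv \<psi>)
  define H where "H = (\<lambda>y. c * (g y $ k * \<psi> y))"
  have H: "H \<in> borel_measurable lebesgue"
    unfolding H_def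
    by (intro borel_measurable_times borel_measurable_const
        locally_integrable_measurable[OF locally_integrable_nth[OF g]] test_function_measurable \<psi>)
  have 2: "(LINT y|lebesgue. F y) = - (LINT y|lebesgue. H y)"
    using has_weak_gradientD(3)[OF wg \<psi>, of k] by (simp add: F_def H_def)
  have 3: "(LINT x|lebesgue. (c *\<^sub>R g (c *\<^sub>R x + a)) $ k * \<phi> x) = (LINT x|lebesgue. H (c *\<^sub>R x + a))"
    by (simp add: H_def \<phi>_eq mult_ac)
  show "(LINT x|lebesgue. u (c *\<^sub>R x + a) * partial_deriv k \<phi> x)
      = - (LINT x|lebesgue. (c *\<^sub>R g (c *\<^sub>R x + a)) $ k * \<phi> x)"
    unfolding 1 3 lebesgue_affine_integral(3)[OF c F] lebesgue_affine_integral(3)[OF c H] 2 by simp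
qed

section \<open>Square-integrable functions\<close>

lemma square_integrable_scaleR:
  fixes f :: "real^'n::finite \<Rightarrow> 'b::euclidean_space"
  assumes "square_integrable f"
  shows "square_integrable (\<lambda>x. c *\<^sub>R f x)"
  using assms unfolding square_integrable_def by (auto simp: power_mult_distrib intro!: borel_measurable_scaleR)

lemma square_integrable_inner:
  fixes f g :: "real^'n::finite \<Rightarrow> 'b::euclidean_space"
  assumes "square_integrable f" "square_integrable g"
  shows "integrable lebesgue (\<lambda>x. f x \<bullet> g x)"
proof (rule Bochner_Integration.integrable_bound)
  show "integrable lebesgue (\<lambda>x. (norm (f x))\<^sup>2 + (norm (g x))\<^sup>2)"
    using assms by (simp add: square_integrable_def)
  show "(\<lambda>x. f x \<bullet> g x) \<in> borel_measurable lebesgue"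
    using assms by (auto simp: square_integrable_def)
  have "\<bar>f x \<bullet> g x\<bar> \<le> (norm (f x))\<^sup>2 + (norm (g x))\<^sup>2" for x
  proof -
    have "\<bar>f x \<bullet> g x\<bar> \<le> norm (f x) * norm (g x)" by (rule Cauchy_Schwarz_ineq2)
    also have "\<dots> \<le> (norm (f x))\<^sup>2 + (norm (g x))\<^sup>2"
      using sum_squares_bound[of "norm (f x)" "norm (g x)"] mult_nonneg_nonneg[OF norm_ge_zero[of "f x"] norm_ge_zero[of "g x"]]
      by linarith
    finally show ?thesis .
  qed
  then show "AE x in lebesgue. norm (f x \<bullet> g x) \<le> norm ((norm (f x))\<^sup>2 + (norm (g x))\<^sup>2)"
    by simp
qed

lemma square_integrable_add:
  fixes f g :: "real^'n::finite \<Rightarrow> 'b::euclidean_space"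
  assumes "square_integrable f" "square_integrable g"
  shows "square_integrable (\<lambda>x. f x + g x)"
proof -
  have "(norm (f x + g x))\<^sup>2 = (norm (f x))\<^sup>2 + 2 * (f x \<bullet> g x) + (norm (g x))\<^sup>2" for x
    by (simp add: power2_norm_eq_inner inner_add inner_commute)
  then show ?thesis
    using assms square_integrable_inner[OF assms] by (auto simp: square_integrable_def intro!: borel_measurable_add)
qed

lemma square_integrable_cong_AE:
  fixes f g :: "real^'n::finite \<Rightarrow> 'b::euclidean_space"
  assumes "square_integrable f" "AE x in lebesgue. g x = f x" "g \<in> borel_measurable lebesgue"
  shows "square_integrable g"
proof -
  have [measurable]: "f \<in> borel_measurable lebesgue" "g \<in> borel_measurable lebesgue"
    using assms by (auto simp: square_integrable_def)
  have "integrable lebesgue (\<lambda>x. (norm (g x))\<^sup>2) \<longleftrightarrow> integrable lebesgue (\<lambda>x. (norm (f x))\<^sup>2)"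
    by (rule integrable_cong_AE) (use assms(2) in \<open>measurable, eventually_elim, simp\<close>)
  then show ?thesis using assms by (simp add: square_integrable_def)
qed

lemma square_integrable_locally:
  fixes f :: "real^'n::finite \<Rightarrow> 'b::euclidean_space"
  assumes "square_integrable f"
  shows "locally_integrable f"
  unfolding locally_integrable_def set_integrable_def
proof (intro allI impI)
  fix K :: "(real^'n) set" assume K: "compact K"
  show "integrable lebesgue (\<lambda>x. indicat_real K x *\<^sub>R f x)"
  proof (rule Bochner_Integration.integrable_bound)
    have "integrable lebesgue (indicat_real K)"
      using lmeasurable_compact[OF K] by (intro integrable_real_indicator) (auto simp: fmeasurable_def)
    then show "integrable lebesgue (\<lambda>x. indicat_real K x + (norm (f x))\<^sup>2)"
      using assms by (simp add: square_integrable_def)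
    show "(\<lambda>x. indicat_real K x *\<^sub>R f x) \<in> borel_measurable lebesgue"
      using assms K by (auto intro!: borel_measurable_scaleR borel_measurable_indicator simp: square_integrable_def borel_compact)
    have "norm (f x) \<le> 1 + (norm (f x))\<^sup>2" for x
      using sum_squares_bound[of "norm (f x)" 1] norm_ge_zero[of "f x"]
      unfolding mult_1_right power_one by linarith
    then show "AE x in lebesgue. norm (indicat_real K x *\<^sub>R f x) \<le> norm (indicat_real K x + (norm (f x))\<^sup>2)"
      by (auto simp: indicator_def)
  qed
qed

lemma square_integrable_affine:
  fixes f :: "real^'n::finite \<Rightarrow> 'b::euclidean_space"
  assumes "square_integrable f" "c \<noteq> 0"
  shows "square_integrable (\<lambda>x. f (c *\<^sub>R x + a))"
proof -
  have "(\<lambda>x. (norm (f x))\<^sup>2) \<in> borel_measurable lebesgue"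
    using assms(1) unfolding square_integrable_def by (blast intro: borel_measurable_integrable)
  then show ?thesis
    using assms lebesgue_affine_integral(1)[of c f a] lebesgue_affine_integral(2)[of c "\<lambda>x. (norm (f x))\<^sup>2" a]
    by (simp add: square_integrable_def)
qed

lemma test_function_square_integrable:
  assumes "test_function \<phi>"
  shows "square_integrable \<phi>"
proof -
  obtain a B where a: "\<And>x. x \<notin> cbox (-a) a \<Longrightarrow> \<phi> x = 0" and B: "\<And>x. \<bar>\<phi> x\<bar> \<le> B"
    using test_function_bounds[OF assms] by blast
  note [measurable] = test_function_measurable[OF assms]
  have "integrable lebesgue (\<lambda>x. (\<phi> x)\<^sup>2)"
  proof (rule Bochner_Integration.integrable_bound)
    have "integrable lebesgue (indicat_real (cbox (-a) a))"
      by (intro integrable_real_indicator) (auto simp: emeasure_lborel_cbox_eq)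
    then show "integrable lebesgue (\<lambda>x. B\<^sup>2 * indicat_real (cbox (-a) a) x)" by simp
    have "(\<phi> x)\<^sup>2 \<le> B\<^sup>2" for x using B[of x] power_mono[of "\<bar>\<phi> x\<bar>" B 2] by simp
    then show "AE x in lebesgue. norm ((\<phi> x)\<^sup>2) \<le> norm (B\<^sup>2 * indicat_real (cbox (-a) a) x)"
      using a by (auto simp: indicator_def)
  qed measurable
  then show ?thesis using test_function_measurable[OF assms] by (simp add: square_integrable_def)
qed

lemma quadratic_nonneg_imp:
  fixes a b c :: real
  assumes "\<And>t. 0 \<le> a + 2 * t * b + t\<^sup>2 * c"
  shows "b\<^sup>2 \<le> a * c"
proof (cases "c = 0")
  case True
  show ?thesis
  proof (cases "b = 0")
    case False
    \<comment> \<open>At this point the affine function \<open>a + 2 * t * b\<close> has the value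
      -1.\<close>
    then show ?thesis using assms[of "- (a + 1) / (2 * b)"] True by (simp add: field_simps)
  qed (use True in simp)
next
  case False
  moreover have "c \<ge> 0"
  proof (rule ccontr)
    assume "\<not> c \<ge> 0"
    then have c: "c < 0" by simp
    \<comment> \<open>Large enough that \<open>t * c\<close> outweighs the constant and the linear
      term together; the summand 1 ensures that \<open>t\<close> is at least 1.\<close>
    define t where "t = (\<bar>a\<bar> + 2 * \<bar>b\<bar> + 1) / (- c) + 1"
    have "0 \<le> (\<bar>a\<bar> + 2 * \<bar>b\<bar> + 1) / (- c)" using c by (intro divide_nonneg_pos) auto
    then have t: "t \<ge> 1" unfolding t_def by linarith
    have "(t - 1) * (- c) = \<bar>a\<bar> + 2 * \<bar>b\<bar> + 1" using c by (simp add: t_def)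
    then have ct: "t * c \<le> - (\<bar>a\<bar> + 2 * \<bar>b\<bar> + 1)" using c by (simp add: algebra_simps)
    have "t\<^sup>2 * c = t * (t * c)" by (simp add: power2_eq_square)
    also have "\<dots> \<le> t * (- (\<bar>a\<bar> + 2 * \<bar>b\<bar> + 1))" using ct t by (intro mult_left_mono) auto
    finally have "t\<^sup>2 * c \<le> - (t * \<bar>a\<bar>) - 2 * (t * \<bar>b\<bar>) - t" by (simp add: algebra_simps)
    moreover have "a \<le> t * \<bar>a\<bar>" using t mult_right_mono[of 1 t "\<bar>a\<bar>"] by simp
    moreover have "t * b \<le> t * \<bar>b\<bar>" using t by (intro mult_left_mono) auto
    ultimately have "a + 2 * t * b + t\<^sup>2 * c < 0" using t by linarith
    with assms[of t] show False by simp
  qed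
  ultimately have c: "c > 0" by simp
  have "0 \<le> a + 2 * (- b / c) * b + (- b / c)\<^sup>2 * c" by (rule assms)
  also have "\<dots> = (a * c - b\<^sup>2) / c" using c by (simp add: field_simps power2_eq_square)
  finally show ?thesis using c by (simp add: zero_le_divide_iff)
qed

lemma Cauchy_Schwarz_L2:
  fixes f g :: "real^'n::finite \<Rightarrow> real"
  assumes "square_integrable f" "square_integrable g"
  shows "(LINT x|lebesgue. f x * g x)\<^sup>2 \<le> (LINT x|lebesgue. (f x)\<^sup>2) * (LINT x|lebesgue. (g x)\<^sup>2)"
proof (rule quadratic_nonneg_imp)
  fix t :: real
  have i: "integrable lebesgue (\<lambda>x. (f x)\<^sup>2)" "integrable lebesgue (\<lambda>x. (g x)\<^sup>2)" "integrable lebesgue (\<lambda>x. f x * g x)"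
    using assms square_integrable_inner[OF assms] by (auto simp: square_integrable_def)
  have "0 \<le> (LINT x|lebesgue. (f x + t * g x)\<^sup>2)" by (intro integral_nonneg_AE) auto
  also have "(\<lambda>x. (f x + t * g x)\<^sup>2) = (\<lambda>x. (f x)\<^sup>2 + 2 * t * (f x * g x) + t\<^sup>2 * (g x)\<^sup>2)"
    by (auto simp: power2_eq_square algebra_simps)
  also have "(LINT x|lebesgue. (f x)\<^sup>2 + 2 * t * (f x * g x) + t\<^sup>2 * (g x)\<^sup>2)
      = (LINT x|lebesgue. (f x)\<^sup>2) + 2 * t * (LINT x|lebesgue. f x * g x) + t\<^sup>2 * (LINT x|lebesgue. (g x)\<^sup>2)"
    using i by simp
  finally show "0 \<le> (LINT x|lebesgue. (f x)\<^sup>2) + 2 * t * (LINT x|lebesgue. f x * g x) + t\<^sup>2 * (LINT x|lebesgue. (g x)\<^sup>2)" .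
qed

section \<open>The space H1 and its inner products\<close>

lemma weak_grad_H1:
  assumes "u \<in> H1"
  shows "has_weak_gradient u (weak_grad u)" "square_integrable (weak_grad u)" "square_integrable u"
proof -
  obtain g where g: "has_weak_gradient u g" "square_integrable g" and u: "square_integrable u"
    using assms by (auto simp: H1_def)
  show wg: "has_weak_gradient u (weak_grad u)"
    unfolding weak_grad_def by (rule someI[of "has_weak_gradient u", OF g(1)])
  \<comment> \<open>The choice in \<open>weak_grad\<close> ranges over all weak gradients; square
    integrability is carried over from the witness in \<open>H1\<close> by uniqueness.\<close>
  show "square_integrable (weak_grad u)"
    by (rule square_integrable_cong_AE[OF g(2) weak_gradient_unique[OF wg g(1)]
          locally_integrable_measurable[OF has_weak_gradientD(2)[OF wg]]])
  show "square_integrable u" by (rule u)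
qed

lemma H1_I:
  assumes "has_weak_gradient u g" "square_integrable g" "square_integrable u"
  shows "u \<in> H1" "AE x in lebesgue. weak_grad u x = g x"
proof -
  show u: "u \<in> H1" using assms by (auto simp: H1_def)
  show "AE x in lebesgue. weak_grad u x = g x"
    by (rule weak_gradient_unique[OF weak_grad_H1(1)[OF u] assms(1)])
qed

text \<open>One operation covering sums, differences, multiples and midpoints, so that closure and
  gradient rules are proved once.\<close>

definition lc :: "real \<Rightarrow> ('a \<Rightarrow> real) \<Rightarrow> real \<Rightarrow> ('a \<Rightarrow> real) \<Rightarrow> 'a \<Rightarrow> real" where
  "lc a u b v = (\<lambda>x. a * u x + b * v x)"

lemma has_weak_gradient_lc:
  fixes u v :: "real^'n::finite \<Rightarrow> real"
  assumes u: "has_weak_gradient u g" and v: "has_weak_gradient v h"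
  shows "has_weak_gradient (lc a u b v) (\<lambda>x. a *\<^sub>R g x + b *\<^sub>R h x)"
  unfolding has_weak_gradient_def
proof (intro conjI allI impI)
  show "locally_integrable (lc a u b v)"
    using has_weak_gradientD(1)[OF u] has_weak_gradientD(1)[OF v]
    unfolding locally_integrable_def lc_def by (auto intro!: set_integral_add)
  have "set_integrable lebesgue K (\<lambda>x. a *\<^sub>R g x + b *\<^sub>R h x)" if "compact K" for K
    using has_weak_gradientD(2)[OF u] has_weak_gradientD(2)[OF v] that
    unfolding locally_integrable_def by (intro set_integral_add(1) set_integrable_scaleR_right) auto
  then show "locally_integrable (\<lambda>x. a *\<^sub>R g x + b *\<^sub>R h x)" by (simp add: locally_integrable_def)
  fix \<phi> :: "real^'n \<Rightarrow> real" and k assume \<phi>: "test_function \<phi>"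
  note \<phi>' = test_function_partial_deriv[OF \<phi>, of k]
  have "(LINT x|lebesgue. lc a u b v x * partial_deriv k \<phi> x)
     = a * (LINT x|lebesgue. u x * partial_deriv k \<phi> x) + b * (LINT x|lebesgue. v x * partial_deriv k \<phi> x)"
    using integrable_locally_times_test[OF has_weak_gradientD(1)[OF u] \<phi>'] integrable_locally_times_test[OF has_weak_gradientD(1)[OF v] \<phi>']
    by (simp add: lc_def distrib_right mult.assoc)
  also have "\<dots> = - (a * (LINT x|lebesgue. g x $ k * \<phi> x) + b * (LINT x|lebesgue. h x $ k * \<phi> x))"
    using has_weak_gradientD(3)[OF u \<phi>, of k] has_weak_gradientD(3)[OF v \<phi>, of k] by simp
  also have "a * (LINT x|lebesgue. g x $ k * \<phi> x) + b * (LINT x|lebesgue. h x $ k * \<phi> x)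
      = (LINT x|lebesgue. (a *\<^sub>R g x + b *\<^sub>R h x) $ k * \<phi> x)"
    using integrable_locally_times_test[OF locally_integrable_nth[OF has_weak_gradientD(2)[OF u]] \<phi>, of k]
      integrable_locally_times_test[OF locally_integrable_nth[OF has_weak_gradientD(2)[OF v]] \<phi>, of k]
    by (simp add: distrib_right mult.assoc)
  finally show "(LINT x|lebesgue. lc a u b v x * partial_deriv k \<phi> x)
      = - (LINT x|lebesgue. (a *\<^sub>R g x + b *\<^sub>R h x) $ k * \<phi> x)" .
qed

lemma H1_lc:
  assumes "u \<in> H1" "v \<in> H1"
  shows "lc a u b v \<in> H1" "AE x in lebesgue. weak_grad (lc a u b v) x = a *\<^sub>R weak_grad u x + b *\<^sub>R weak_grad v x"
proof -
  note u = weak_grad_H1[OF assms(1)] and v = weak_grad_H1[OF assms(2)]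
  have "square_integrable (lc a u b v)"
    using square_integrable_add[OF square_integrable_scaleR[OF u(3)] square_integrable_scaleR[OF v(3)]]
    by (simp add: lc_def)
  note * = H1_I[OF has_weak_gradient_lc[OF u(1) v(1)] square_integrable_add[OF square_integrable_scaleR[OF u(2)] square_integrable_scaleR[OF v(2)]] this]
  show "lc a u b v \<in> H1" "AE x in lebesgue. weak_grad (lc a u b v) x = a *\<^sub>R weak_grad u x + b *\<^sub>R weak_grad v x"
    by (rule *)+
qed

lemma H1_affine:
  assumes "u \<in> H1" "c \<noteq> 0"
  shows "(\<lambda>x. u (c *\<^sub>R x + a)) \<in> H1"
    "AE x in lebesgue. weak_grad (\<lambda>x. u (c *\<^sub>R x + a)) x = c *\<^sub>R weak_grad u (c *\<^sub>R x + a)"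
proof -
  note u = weak_grad_H1[OF assms(1)]
  note * = H1_I[OF has_weak_gradient_affine[OF u(1) assms(2), of a]
     square_integrable_scaleR[OF square_integrable_affine[OF u(2) assms(2)]] square_integrable_affine[OF u(3) assms(2)]]
  show "(\<lambda>x. u (c *\<^sub>R x + a)) \<in> H1"
    "AE x in lebesgue. weak_grad (\<lambda>x. u (c *\<^sub>R x + a)) x = c *\<^sub>R weak_grad u (c *\<^sub>R x + a)"
    by (rule *)+
qed

text \<open>For \<open>c = lam i\<close> this is the bilinear form of the linear part of the i-th
  equation; for \<open>c = 1\<close> it induces the norm in which critical points are
  defined.\<close>

definition ip :: "real \<Rightarrow> (real^'n::finite \<Rightarrow> real) \<Rightarrow> (real^'n \<Rightarrow> real) \<Rightarrow> real" where
  "ip c u v = (LINT x|lebesgue. weak_grad u x \<bullet> weak_grad v x + c * (u x * v x))"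

lemma ip_integrable:
  assumes "u \<in> H1" "v \<in> H1"
  shows "integrable lebesgue (\<lambda>x. weak_grad u x \<bullet> weak_grad v x)" "integrable lebesgue (\<lambda>x. u x * v x)"
  using square_integrable_inner[OF weak_grad_H1(2)[OF assms(1)] weak_grad_H1(2)[OF assms(2)]]
    square_integrable_inner[OF weak_grad_H1(3)[OF assms(1)] weak_grad_H1(3)[OF assms(2)]]
  by auto

lemma ip_eq:
  assumes "u \<in> H1" "v \<in> H1"
  shows "ip c u v = (LINT x|lebesgue. weak_grad u x \<bullet> weak_grad v x) + c * (LINT x|lebesgue. u x * v x)"
  using ip_integrable[OF assms] by (simp add: ip_def)

lemma ip_self:
  assumes "u \<in> H1"
  shows "ip c u u = (LINT x|lebesgue. (norm (weak_grad u x))\<^sup>2) + c * (LINT x|lebesgue. (u x)\<^sup>2)"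
  unfolding ip_eq[OF assms assms] power2_norm_eq_inner by (simp add: power2_eq_square)

lemma ip_commute: "ip c u v = ip c v u"
  by (simp add: ip_def inner_commute mult.commute)

lemma ip_lc_left:
  assumes "u \<in> H1" "v \<in> H1" "w \<in> H1"
  shows "ip c (lc a u b v) w = a * ip c u w + b * ip c v w"
proof -
  have m: "weak_grad z \<in> borel_measurable lebesgue" if "z \<in> H1" for z :: "real^'n \<Rightarrow> real"
    using weak_grad_H1(2)[OF that] by (simp add: square_integrable_def)
  have "(LINT x|lebesgue. weak_grad (lc a u b v) x \<bullet> weak_grad w x)
      = (LINT x|lebesgue. a * (weak_grad u x \<bullet> weak_grad w x) + b * (weak_grad v x \<bullet> weak_grad w x))"
  proof (rule integral_cong_AE)
    show "AE x in lebesgue. weak_grad (lc a u b v) x \<bullet> weak_grad w x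
        = a * (weak_grad u x \<bullet> weak_grad w x) + b * (weak_grad v x \<bullet> weak_grad w x)"
      using H1_lc(2)[OF assms(1,2), of a b] by eventually_elim (simp add: inner_add_left)
  qed (use m[OF H1_lc(1)[OF assms(1,2)]] m[OF assms(1)] m[OF assms(2)] m[OF assms(3)] in auto)
  also have "\<dots> = a * (LINT x|lebesgue. weak_grad u x \<bullet> weak_grad w x) + b * (LINT x|lebesgue. weak_grad v x \<bullet> weak_grad w x)"
    using ip_integrable[OF assms(1,3)] ip_integrable[OF assms(2,3)] by simp
  finally have 1: "(LINT x|lebesgue. weak_grad (lc a u b v) x \<bullet> weak_grad w x)
     = a * (LINT x|lebesgue. weak_grad u x \<bullet> weak_grad w x) + b * (LINT x|lebesgue. weak_grad v x \<bullet> weak_grad w x)" .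
  have 2: "(LINT x|lebesgue. lc a u b v x * w x) = a * (LINT x|lebesgue. u x * w x) + b * (LINT x|lebesgue. v x * w x)"
    using ip_integrable[OF assms(1,3)] ip_integrable[OF assms(2,3)] by (simp add: lc_def distrib_right mult.assoc)
  show ?thesis
    unfolding ip_eq[OF H1_lc(1)[OF assms(1,2)] assms(3)] ip_eq[OF assms(1,3)] ip_eq[OF assms(2,3)] 1 2
    by (simp add: algebra_simps)
qed

lemma ip_lc_right:
  assumes "u \<in> H1" "v \<in> H1" "w \<in> H1"
  shows "ip c w (lc a u b v) = a * ip c w u + b * ip c w v"
  using ip_lc_left[OF assms] by (simp add: ip_commute)

lemma ip_lc_self:
  assumes "u \<in> H1" "v \<in> H1"
  shows "ip c (lc a u b v) (lc a u b v) = a\<^sup>2 * ip c u u + 2 * a * b * ip c u v + b\<^sup>2 * ip c v v"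
  using assms by (simp add: ip_lc_left ip_lc_right H1_lc(1) ip_commute[of c v u] power2_eq_square algebra_simps)

lemma ip_nonneg: "c \<ge> 0 \<Longrightarrow> ip c u u \<ge> 0"
  unfolding ip_def by (intro integral_nonneg_AE) auto

lemma ip_Cauchy_Schwarz:
  assumes "u \<in> H1" "v \<in> H1" "c \<ge> 0"
  shows "(ip c u v)\<^sup>2 \<le> ip c u u * ip c v v"
proof (rule quadratic_nonneg_imp)
  fix t :: real
  show "0 \<le> ip c u u + 2 * t * ip c u v + t\<^sup>2 * ip c v v"
    using ip_nonneg[OF assms(3), of "lc 1 u t v"] assms by (simp add: ip_lc_self)
qed

lemma ip_zero_imp_null:
  assumes u: "u \<in> H1" and c: "c > 0" and 0: "ip c u u \<le> 0"
  shows "null_fun u"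
proof -
  have i: "integrable lebesgue (\<lambda>x. (u x)\<^sup>2)"
    using weak_grad_H1(3)[OF u] by (simp add: square_integrable_def)
  have "(LINT x|lebesgue. (norm (weak_grad u x))\<^sup>2) \<ge> 0" "(LINT x|lebesgue. (u x)\<^sup>2) \<ge> 0"
    by (auto intro!: integral_nonneg_AE)
  with 0 c have "(LINT x|lebesgue. (u x)\<^sup>2) = 0"
    unfolding ip_self[OF u] by (smt (verit) mult_pos_pos)
  then have "AE x in lebesgue. (u x)\<^sup>2 = 0"
    by (subst (asm) integral_nonneg_eq_0_iff_AE[OF i]) auto
  then show ?thesis unfolding null_fun_def by eventually_elim simp
qed

lemma ip_mono: "u \<in> H1 \<Longrightarrow> c \<le> c' \<Longrightarrow> ip c u u \<le> ip c' u u"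
  by (auto simp: ip_self intro!: mult_right_mono integral_nonneg_AE)

text \<open>The factor 1 keeps the shape of the affine lemmas, which then apply without
  rewriting.\<close>

definition shift :: "real^'n::finite \<Rightarrow> (real^'n \<Rightarrow> real) \<Rightarrow> real^'n \<Rightarrow> real" where
  "shift a u = (\<lambda>x. u (1 *\<^sub>R x + a))"

lemma shift_H1: "u \<in> H1 \<Longrightarrow> shift a u \<in> H1"
  unfolding shift_def by (rule H1_affine) auto

lemma ip_affine_self:
  fixes u :: "real^'n::finite \<Rightarrow> real"
  assumes u: "u \<in> H1" and s: "s > 0"
  shows "ip c (\<lambda>x. u (s *\<^sub>R x + a)) (\<lambda>x. u (s *\<^sub>R x + a)) =
    (s\<^sup>2 * (LINT x|lebesgue. (norm (weak_grad u x))\<^sup>2) + c * (LINT x|lebesgue. (u x)\<^sup>2)) / s ^ CARD('n)"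
proof -
  let ?v = "\<lambda>x. u (s *\<^sub>R x + a)"
  have v: "?v \<in> H1" using u s by (intro H1_affine) auto
  have [measurable]: "weak_grad u \<in> borel_measurable lebesgue" "u \<in> borel_measurable lebesgue" "weak_grad ?v \<in> borel_measurable lebesgue"
    using weak_grad_H1[OF u] weak_grad_H1[OF v] by (auto simp: square_integrable_def)
  have sc: "(LINT x|lebesgue. f (s *\<^sub>R x + a)) = (LINT x|lebesgue. f x) / s ^ CARD('n)"
    if "f \<in> borel_measurable lebesgue" for f :: "real^'n \<Rightarrow> real"
    using lebesgue_affine_integral(3)[OF _ that, of s a] s by (simp add: divide_inverse_commute)
  have 1: "(LINT x|lebesgue. (norm (weak_grad ?v x))\<^sup>2) = (LINT x|lebesgue. (\<lambda>y. s\<^sup>2 * (norm (weak_grad u y))\<^sup>2) (s *\<^sub>R x + a))"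
  proof (rule integral_cong_AE)
    show "AE x in lebesgue. (norm (weak_grad ?v x))\<^sup>2 = (\<lambda>y. s\<^sup>2 * (norm (weak_grad u y))\<^sup>2) (s *\<^sub>R x + a)"
      using H1_affine(2)[OF u, of s a] s by (auto simp: power_mult_distrib elim: eventually_mono)
    show "(\<lambda>x. (\<lambda>y. s\<^sup>2 * (norm (weak_grad u y))\<^sup>2) (s *\<^sub>R x + a)) \<in> borel_measurable lebesgue"
      by (rule lebesgue_affine_integral(1)) (use s in auto)
  qed measurable
  have 2: "(LINT x|lebesgue. (?v x)\<^sup>2) = (LINT x|lebesgue. (u x)\<^sup>2) / s ^ CARD('n)"
    by (rule sc) measurable
  show ?thesis
    unfolding ip_self[OF v] 1 2 by (subst sc) (auto simp: add_divide_distrib)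
qed

subsection \<open>Completeness and weak limits\<close>

lemma square_integrable_diff:
  fixes f g :: "real^'n::finite \<Rightarrow> 'b::euclidean_space"
  assumes "square_integrable f" "square_integrable g"
  shows "square_integrable (\<lambda>x. f x - g x)"
  using square_integrable_add[OF assms(1) square_integrable_scaleR[OF assms(2), of "-1"]] by simp

lemma square_integrable_nn:
  fixes f :: "real^'n::finite \<Rightarrow> 'b::euclidean_space"
  assumes "square_integrable f"
  shows "(\<integral>\<^sup>+x. ennreal ((norm (f x))\<^sup>2) \<partial>lebesgue) = ennreal (LINT x|lebesgue. (norm (f x))\<^sup>2)"
  by (rule nn_integral_eq_integral) (use assms in \<open>auto simp: square_integrable_def\<close>)

text \<open>Riesz-Fischer. Along a subsequence the squared increments have integrals at most
  (1/8)^k, so they remain summable after weighting by 4^k. Where the weighted sum is finite, the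
  increments are bounded by a multiple of (1/2)^k and the subsequence converges. Fatou's lemma
  transfers the Cauchy bound to the limit.\<close>

lemma L2_complete:
  fixes f :: "nat \<Rightarrow> real^'n::finite \<Rightarrow> 'b::euclidean_space"
  assumes sq: "\<And>n. square_integrable (f n)"
    and cauchy: "\<And>e. e > 0 \<Longrightarrow> \<exists>N. \<forall>m\<ge>N. \<forall>n\<ge>N. (LINT x|lebesgue. (norm (f m x - f n x))\<^sup>2) < e"
  obtains F where "square_integrable F" "(\<lambda>n. LINT x|lebesgue. (norm (f n x - F x))\<^sup>2) \<longlonglongrightarrow> 0"
proof -
  have [measurable]: "f n \<in> borel_measurable lebesgue" for n
    using sq by (simp add: square_integrable_def)
  have "\<forall>k. \<exists>N. \<forall>m\<ge>N. \<forall>n\<ge>N. (LINT x|lebesgue. (norm (f m x - f n x))\<^sup>2) < (1 / 8) ^ k"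
    using cauchy by simp
  then obtain N where N: "\<And>k m n. m \<ge> N k \<Longrightarrow> n \<ge> N k \<Longrightarrow> (LINT x|lebesgue. (norm (f m x - f n x))\<^sup>2) < (1 / 8) ^ k"
    by metis
  have N': "(\<integral>\<^sup>+x. ennreal ((norm (f m x - f n x))\<^sup>2) \<partial>lebesgue) \<le> ennreal ((1 / 8) ^ k)"
    if "m \<ge> N k" "n \<ge> N k" for k m n
    unfolding square_integrable_nn[OF square_integrable_diff[OF sq sq]]
    using N[OF that] by (intro ennreal_leI) simp
  \<comment> \<open>Summing the thresholds makes \<open>r j\<close> exceed every \<open>N k\<close>
    with \<open>k\<close> at most \<open>j\<close>, although \<open>N\<close> need not be
    monotone.\<close>
  define r where "r = (\<lambda>k. \<Sum>i\<le>k. N i)"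
  have r: "N k \<le> r j" if "k \<le> j" for k j
    unfolding r_def using that by (intro member_le_sum) auto
  define D where "D = (\<lambda>k x. norm (f (r (Suc k)) x - f (r k) x))"
  have [measurable]: "D k \<in> borel_measurable lebesgue" for k unfolding D_def by measurable
  have "(\<integral>\<^sup>+x. (\<Sum>k. ennreal (4 ^ k * (D k x)\<^sup>2)) \<partial>lebesgue) = (\<Sum>k. \<integral>\<^sup>+x. ennreal (4 ^ k * (D k x)\<^sup>2) \<partial>lebesgue)"
    by (rule nn_integral_suminf) measurable
  also have "\<dots> \<le> (\<Sum>k. ennreal ((1 / 2) ^ k))"
  proof (rule suminf_le)
    fix k
    have "(\<integral>\<^sup>+x. ennreal (4 ^ k * (D k x)\<^sup>2) \<partial>lebesgue) = (\<integral>\<^sup>+x. ennreal (4 ^ k) * ennreal ((D k x)\<^sup>2) \<partial>lebesgue)"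
      by (intro nn_integral_cong) (rule ennreal_mult, auto)
    also have "\<dots> = ennreal (4 ^ k) * (\<integral>\<^sup>+x. ennreal ((D k x)\<^sup>2) \<partial>lebesgue)"
      by (rule nn_integral_cmult) measurable
    also have "\<dots> \<le> ennreal (4 ^ k) * ennreal ((1 / 8) ^ k)"
      unfolding D_def by (intro mult_left_mono N' r) auto
    also have "\<dots> = ennreal (4 ^ k * (1 / 8) ^ k)" by (rule ennreal_mult[symmetric]) auto
    also have "4 ^ k * (1 / 8) ^ k = ((1 / 2) ^ k :: real)" by (simp flip: power_mult_distrib)
    finally show "(\<integral>\<^sup>+x. ennreal (4 ^ k * (D k x)\<^sup>2) \<partial>lebesgue) \<le> ennreal ((1 / 2) ^ k)" .
  qed auto
  also have "\<dots> = ennreal (\<Sum>k. (1 / 2) ^ k)"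
    by (rule suminf_ennreal2) (auto intro: summable_geometric)
  also have "\<dots> < \<infinity>" by simp
  finally have fin: "(\<integral>\<^sup>+x. (\<Sum>k. ennreal (4 ^ k * (D k x)\<^sup>2)) \<partial>lebesgue) \<noteq> \<infinity>" by simp
  have AE1: "AE x in lebesgue. (\<Sum>k. ennreal (4 ^ k * (D k x)\<^sup>2)) \<noteq> \<infinity>"
    by (rule nn_integral_PInf_AE[OF _ fin]) measurable
  have conv: "convergent (\<lambda>k. f (r k) x)" if "(\<Sum>k. ennreal (4 ^ k * (D k x)\<^sup>2)) \<noteq> \<infinity>" for x
  proof -
    define B where "B = enn2real (\<Sum>k. ennreal (4 ^ k * (D k x)\<^sup>2))"
    have B: "B \<ge> 0" "(\<Sum>k. ennreal (4 ^ k * (D k x)\<^sup>2)) = ennreal B"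
      using that by (simp_all add: B_def ennreal_enn2real_if)
    have "D k x \<le> sqrt B * (1 / 2) ^ k" for k
    proof -
      have "(\<Sum>i\<in>{k}. ennreal (4 ^ i * (D i x)\<^sup>2)) \<le> (\<Sum>k. ennreal (4 ^ k * (D k x)\<^sup>2))"
        by (rule sum_le_suminf) auto
      then have "ennreal (4 ^ k * (D k x)\<^sup>2) \<le> ennreal B"
        unfolding B(2) by simp
      then have "4 ^ k * (D k x)\<^sup>2 \<le> B" using ennreal_le_iff[OF B(1)] by blast
      moreover have "(4::real) ^ k = 2 ^ k * 2 ^ k"
        by (simp flip: power_mult_distrib)
      then have "4 ^ k * (D k x)\<^sup>2 = (2 ^ k * D k x)\<^sup>2"
        by (simp add: power2_eq_square)
      ultimately have "2 ^ k * D k x \<le> sqrt B" by (simp add: real_le_rsqrt)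
      then show ?thesis by (simp add: field_simps power_one_over)
    qed
    then have le: "norm (f (r (Suc k)) x - f (r k) x) \<le> sqrt B * (1 / 2) ^ k" for k
      by (simp add: D_def)
    have "summable (\<lambda>k. sqrt B * (1 / 2) ^ k)"
      by (rule summable_mult, rule summable_geometric) simp
    then have "summable (\<lambda>k. f (r (Suc k)) x - f (r k) x)"
      by (rule summable_comparison_test'[of _ 0]) (rule le)
    then have "(\<lambda>n. \<Sum>k<n. f (r (Suc k)) x - f (r k) x) \<longlonglongrightarrow> (\<Sum>k. f (r (Suc k)) x - f (r k) x)"
      by (rule summable_LIMSEQ)
    then have "(\<lambda>n. f (r 0) x + (\<Sum>k<n. f (r (Suc k)) x - f (r k) x)) \<longlonglongrightarrow> f (r 0) x + (\<Sum>k. f (r (Suc k)) x - f (r k) x)"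
      by (rule tendsto_add[OF tendsto_const])
    moreover have "f (r 0) x + (\<Sum>k<n. f (r (Suc k)) x - f (r k) x) = f (r n) x" for n
      by (simp add: sum_lessThan_telescope[of "\<lambda>k. f (r k) x"])
    ultimately show ?thesis by (auto simp: convergent_def)
  qed
  define F where "F = (\<lambda>x. lim (\<lambda>k. f (r k) x))"
  have F[measurable]: "F \<in> borel_measurable lebesgue" unfolding F_def by measurable
  have lim: "AE x in lebesgue. (\<lambda>k. f (r k) x) \<longlonglongrightarrow> F x"
    using AE1 by eventually_elim (use conv in \<open>auto simp: F_def convergent_LIMSEQ_iff\<close>)
  have bound: "(\<integral>\<^sup>+x. ennreal ((norm (f n x - F x))\<^sup>2) \<partial>lebesgue) \<le> ennreal ((1 / 8) ^ j)" if n: "n \<ge> N j" for n j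
  proof -
    have "(\<integral>\<^sup>+x. ennreal ((norm (f n x - F x))\<^sup>2) \<partial>lebesgue)
        = (\<integral>\<^sup>+x. liminf (\<lambda>k. ennreal ((norm (f n x - f (r k) x))\<^sup>2)) \<partial>lebesgue)"
    proof (rule nn_integral_cong_AE, use lim in eventually_elim)
      fix x assume "(\<lambda>k. f (r k) x) \<longlonglongrightarrow> F x"
      then have "(\<lambda>k. ennreal ((norm (f n x - f (r k) x))\<^sup>2)) \<longlonglongrightarrow> ennreal ((norm (f n x - F x))\<^sup>2)"
        by (intro tendsto_ennrealI tendsto_intros)
      from lim_imp_Liminf[OF trivial_limit_sequentially this]
      show "ennreal ((norm (f n x - F x))\<^sup>2) = liminf (\<lambda>k. ennreal ((norm (f n x - f (r k) x))\<^sup>2))" by (rule sym)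
    qed
    also have "\<dots> \<le> liminf (\<lambda>k. \<integral>\<^sup>+x. ennreal ((norm (f n x - f (r k) x))\<^sup>2) \<partial>lebesgue)"
      by (rule nn_integral_liminf) measurable
    also have "\<dots> \<le> liminf (\<lambda>k::nat. ennreal ((1 / 8) ^ j))"
    proof (rule Liminf_mono)
      show "\<forall>\<^sub>F k in sequentially. (\<integral>\<^sup>+x. ennreal ((norm (f n x - f (r k) x))\<^sup>2) \<partial>lebesgue) \<le> ennreal ((1 / 8) ^ j)"
        using eventually_ge_at_top[of j] by eventually_elim (intro N' n r)
    qed
    also have "\<dots> = ennreal ((1 / 8) ^ j)" by (rule Liminf_const[OF trivial_limit_sequentially])
    finally show ?thesis .
  qed
  have diff: "square_integrable (\<lambda>x. f n x - F x)" if "n \<ge> N 0" for n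
  proof -
    have "integrable lebesgue (\<lambda>x. (norm (f n x - F x))\<^sup>2)"
      by (rule integrableI_nonneg) (use bound[OF that] in \<open>auto intro: le_less_trans\<close>)
    then show ?thesis by (auto simp: square_integrable_def)
  qed
  show thesis
  proof
    have "square_integrable (\<lambda>x. f (N 0) x - (f (N 0) x - F x))"
      by (intro square_integrable_diff sq diff) simp
    then show "square_integrable F" by simp
    then have sqd: "square_integrable (\<lambda>x. f n x - F x)" for n by (intro square_integrable_diff sq)
    show "(\<lambda>n. LINT x|lebesgue. (norm (f n x - F x))\<^sup>2) \<longlonglongrightarrow> 0"
    proof (rule LIMSEQ_I)
      fix e :: real assume "e > 0"
      then obtain j where j: "(1 / 8) ^ j < e" using real_arch_pow_inv[of e "1/8"] by auto
      have "norm ((LINT x|lebesgue. (norm (f n x - F x))\<^sup>2) - 0) < e" if "n \<ge> N j" for n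
      proof -
        have "ennreal (LINT x|lebesgue. (norm (f n x - F x))\<^sup>2) \<le> ennreal ((1 / 8) ^ j)"
          using bound[OF that] unfolding square_integrable_nn[OF sqd] .
        then have "(LINT x|lebesgue. (norm (f n x - F x))\<^sup>2) \<le> (1 / 8) ^ j" by (simp add: ennreal_le_iff)
        moreover have "(LINT x|lebesgue. (norm (f n x - F x))\<^sup>2) \<ge> 0" by (auto intro!: integral_nonneg_AE)
        ultimately show ?thesis using j by simp
      qed
      then show "\<exists>no. \<forall>n\<ge>no. norm ((LINT x|lebesgue. (norm (f n x - F x))\<^sup>2) - 0) < e" by blast
    qed
  qed
qed

lemma tendsto_L2_product:
  fixes f :: "nat \<Rightarrow> real^'n::finite \<Rightarrow> real"
  assumes f: "\<And>n. square_integrable (f n)" and F: "square_integrable F" and p: "square_integrable p"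
    and lim: "(\<lambda>n. LINT x|lebesgue. (f n x - F x)\<^sup>2) \<longlonglongrightarrow> 0"
  shows "(\<lambda>n. LINT x|lebesgue. f n x * p x) \<longlonglongrightarrow> (LINT x|lebesgue. F x * p x)"
proof -
  have "(\<lambda>n. (LINT x|lebesgue. (f n x - F x)\<^sup>2) * (LINT x|lebesgue. (p x)\<^sup>2)) \<longlonglongrightarrow> 0 * (LINT x|lebesgue. (p x)\<^sup>2)"
    by (intro tendsto_intros lim)
  then have "(\<lambda>n. (LINT x|lebesgue. (f n x - F x)\<^sup>2) * (LINT x|lebesgue. (p x)\<^sup>2)) \<longlonglongrightarrow> 0" by simp
  then have "(\<lambda>n. (LINT x|lebesgue. (f n x - F x) * p x)\<^sup>2) \<longlonglongrightarrow> 0"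
    by (rule tendsto_sandwich[OF _ _ tendsto_const, rotated 2])
      (auto intro!: always_eventually Cauchy_Schwarz_L2 square_integrable_diff f F p)
  then have "(\<lambda>n. sqrt ((LINT x|lebesgue. (f n x - F x) * p x)\<^sup>2)) \<longlonglongrightarrow> sqrt 0"
    by (rule tendsto_real_sqrt)
  then have "(\<lambda>n. (LINT x|lebesgue. (f n x - F x) * p x)) \<longlonglongrightarrow> 0"
    by (simp add: tendsto_rabs_zero_iff)
  moreover have "(LINT x|lebesgue. (f n x - F x) * p x) = (LINT x|lebesgue. f n x * p x) - (LINT x|lebesgue. F x * p x)" for n
    using square_integrable_inner[OF f[of n] p] square_integrable_inner[OF F p] by (simp add: left_diff_distrib)
  ultimately show ?thesis by (simp add: LIM_zero_iff)
qed

lemma ip_diff_self: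
  assumes "u \<in> H1" "v \<in> H1"
  shows "ip c (lc 1 u (-1) v) (lc 1 u (-1) v)
    = (LINT x|lebesgue. (norm (weak_grad u x - weak_grad v x))\<^sup>2) + c * (LINT x|lebesgue. (u x - v x)\<^sup>2)"
proof -
  have "(LINT x|lebesgue. (norm (weak_grad (lc 1 u (-1) v) x))\<^sup>2) = (LINT x|lebesgue. (norm (weak_grad u x - weak_grad v x))\<^sup>2)"
  proof (rule integral_cong_AE)
    show "AE x in lebesgue. (norm (weak_grad (lc 1 u (-1) v) x))\<^sup>2 = (norm (weak_grad u x - weak_grad v x))\<^sup>2"
      using H1_lc(2)[OF assms, of 1 "-1"] by eventually_elim simp
  qed (use weak_grad_H1(2)[OF assms(1)] weak_grad_H1(2)[OF assms(2)] weak_grad_H1(2)[OF H1_lc(1)[OF assms, of 1 "-1"]]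
      in \<open>auto simp: square_integrable_def\<close>)
  then show ?thesis
    using ip_self[OF H1_lc(1)[OF assms, of 1 "-1"], of c] by (simp add: lc_def)
qed

text \<open>Functions and gradients converge separately in L2. The identity defining a weak gradient
  survives both limits, so the limit of the gradients is the gradient of the limit.\<close>

lemma H1_complete:
  fixes V :: "nat \<Rightarrow> real^'n::finite \<Rightarrow> real"
  assumes V: "\<And>n. V n \<in> H1" and c: "c > 0"
    and cauchy: "\<And>e. e > 0 \<Longrightarrow> \<exists>N. \<forall>m\<ge>N. \<forall>n\<ge>N. ip c (lc 1 (V m) (-1) (V n)) (lc 1 (V m) (-1) (V n)) < e"
  obtains w where "w \<in> H1" "(\<lambda>n. ip c (lc 1 (V n) (-1) w) (lc 1 (V n) (-1) w)) \<longlonglongrightarrow> 0"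
proof -
  have nn: "(LINT x|lebesgue. (norm (weak_grad (V m) x - weak_grad (V n) x))\<^sup>2) \<ge> 0"
    "(LINT x|lebesgue. (V m x - V n x)\<^sup>2) \<ge> 0" for m n
    by (auto intro!: integral_nonneg_AE)
  note V1 = weak_grad_H1[OF V]
  have "\<exists>N. \<forall>m\<ge>N. \<forall>n\<ge>N. (LINT x|lebesgue. (norm (weak_grad (V m) x - weak_grad (V n) x))\<^sup>2) < e" if "e > 0" for e
    using cauchy[OF that] nn c unfolding ip_diff_self[OF V V]
    by (meson add_le_cancel_left le_add_same_cancel1 le_less_trans mult_nonneg_nonneg less_imp_le)
  then obtain g where g: "square_integrable g" and glim: "(\<lambda>n. LINT x|lebesgue. (norm (weak_grad (V n) x - g x))\<^sup>2) \<longlonglongrightarrow> 0"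
    using L2_complete[of "\<lambda>n. weak_grad (V n)"] V1(2) by blast
  have "\<exists>N. \<forall>m\<ge>N. \<forall>n\<ge>N. (LINT x|lebesgue. (norm (V m x - V n x))\<^sup>2) < e" if "e > 0" for e
  proof -
    have "c * e > 0" using c that by simp
    from cauchy[OF this] obtain N where N: "\<And>m n. m \<ge> N \<Longrightarrow> n \<ge> N \<Longrightarrow>
       (LINT x|lebesgue. (norm (weak_grad (V m) x - weak_grad (V n) x))\<^sup>2) + c * (LINT x|lebesgue. (V m x - V n x)\<^sup>2) < c * e"
      unfolding ip_diff_self[OF V V] by blast
    have "(LINT x|lebesgue. (V m x - V n x)\<^sup>2) < e" if "m \<ge> N" "n \<ge> N" for m n
    proof -
      have "c * (LINT x|lebesgue. (V m x - V n x)\<^sup>2) < c * e"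
        using N[OF that] nn(1)[of m n] by linarith
      then show ?thesis using c by simp
    qed
    then show ?thesis by auto
  qed
  then obtain w where w: "square_integrable w" and wlim: "(\<lambda>n. LINT x|lebesgue. (norm (V n x - w x))\<^sup>2) \<longlonglongrightarrow> 0"
    using L2_complete[of V] V1(3) by blast
  have nth: "square_integrable (\<lambda>x. h x $ k)" if "square_integrable h" for h :: "real^'n \<Rightarrow> real^'n" and k
  proof -
    have m: "(\<lambda>x. h x $ k) \<in> borel_measurable lebesgue"
      using locally_integrable_measurable[OF locally_integrable_nth[OF square_integrable_locally[OF that]]] .
    have "integrable lebesgue (\<lambda>x. (h x $ k)\<^sup>2)"
    proof (rule Bochner_Integration.integrable_bound)
      show "integrable lebesgue (\<lambda>x. (norm (h x))\<^sup>2)" using that by (simp add: square_integrable_def)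
      show "(\<lambda>x. (h x $ k)\<^sup>2) \<in> borel_measurable lebesgue" using m by measurable
      have "(h x $ k)\<^sup>2 \<le> (norm (h x))\<^sup>2" for x
        using component_le_norm_cart[of "h x" k] power_mono[of "\<bar>h x $ k\<bar>" "norm (h x)" 2] by simp
      then show "AE x in lebesgue. norm ((h x $ k)\<^sup>2) \<le> norm ((norm (h x))\<^sup>2)" by simp
    qed
    with m show ?thesis by (simp add: square_integrable_def)
  qed
  have wg: "has_weak_gradient w g"
    unfolding has_weak_gradient_def
  proof (intro conjI allI impI square_integrable_locally w g)
    fix \<phi> :: "real^'n \<Rightarrow> real" and k assume \<phi>: "test_function \<phi>"
    have "(\<lambda>n. LINT x|lebesgue. V n x * partial_deriv k \<phi> x) \<longlonglongrightarrow> (LINT x|lebesgue. w x * partial_deriv k \<phi> x)"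
      using wlim by (intro tendsto_L2_product V1(3) w test_function_square_integrable test_function_partial_deriv \<phi>) simp
    moreover have "(\<lambda>n. - (LINT x|lebesgue. weak_grad (V n) x $ k * \<phi> x)) \<longlonglongrightarrow> - (LINT x|lebesgue. g x $ k * \<phi> x)"
    proof (intro tendsto_minus tendsto_L2_product nth V1(2) g test_function_square_integrable \<phi>)
      show "(\<lambda>n. LINT x|lebesgue. (weak_grad (V n) x $ k - g x $ k)\<^sup>2) \<longlonglongrightarrow> 0"
      proof (rule tendsto_sandwich[OF _ _ tendsto_const glim])
        show "\<forall>\<^sub>F n in sequentially. 0 \<le> (LINT x|lebesgue. (weak_grad (V n) x $ k - g x $ k)\<^sup>2)"
          by (auto intro!: always_eventually integral_nonneg_AE)
        have "(LINT x|lebesgue. (weak_grad (V n) x $ k - g x $ k)\<^sup>2) \<le> (LINT x|lebesgue. (norm (weak_grad (V n) x - g x))\<^sup>2)" for n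
        proof (rule integral_mono)
          note d = square_integrable_diff[OF V1(2)[of n] g]
          show "integrable lebesgue (\<lambda>x. (norm (weak_grad (V n) x - g x))\<^sup>2)" using d by (simp add: square_integrable_def)
          show "integrable lebesgue (\<lambda>x. (weak_grad (V n) x $ k - g x $ k)\<^sup>2)"
            using nth[OF d, of k] by (simp add: square_integrable_def)
          show "(weak_grad (V n) x $ k - g x $ k)\<^sup>2 \<le> (norm (weak_grad (V n) x - g x))\<^sup>2" for x
            using component_le_norm_cart[of "weak_grad (V n) x - g x" k]
              power_mono[of "\<bar>(weak_grad (V n) x - g x) $ k\<bar>" "norm (weak_grad (V n) x - g x)" 2] by simp
        qed
        then show "\<forall>\<^sub>F n in sequentially. (LINT x|lebesgue. (weak_grad (V n) x $ k - g x $ k)\<^sup>2) \<le> (LINT x|lebesgue. (norm (weak_grad (V n) x - g x))\<^sup>2)"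
          by simp
      qed
    qed
    moreover have "(LINT x|lebesgue. V n x * partial_deriv k \<phi> x) = - (LINT x|lebesgue. weak_grad (V n) x $ k * \<phi> x)" for n
      by (rule has_weak_gradientD(3)[OF V1(1) \<phi>])
    ultimately show "(LINT x|lebesgue. w x * partial_deriv k \<phi> x) = - (LINT x|lebesgue. g x $ k * \<phi> x)"
      by (simp add: LIMSEQ_unique)
  qed
  note wH = H1_I[OF wg g w]
  have "(LINT x|lebesgue. (norm (weak_grad (V n) x - weak_grad w x))\<^sup>2) = (LINT x|lebesgue. (norm (weak_grad (V n) x - g x))\<^sup>2)" for n
  proof (rule integral_cong_AE)
    show "AE x in lebesgue. (norm (weak_grad (V n) x - weak_grad w x))\<^sup>2 = (norm (weak_grad (V n) x - g x))\<^sup>2"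
      using wH(2) by eventually_elim simp
  qed (use V1(2)[of n] weak_grad_H1(2)[OF wH(1)] g in \<open>auto simp: square_integrable_def\<close>)
  then have "(\<lambda>n. ip c (lc 1 (V n) (-1) w) (lc 1 (V n) (-1) w)) \<longlonglongrightarrow> 0 + c * 0"
    unfolding ip_diff_self[OF V wH(1)] using glim wlim by (intro tendsto_intros) auto
  then show thesis using that wH(1) by simp
qed

text \<open>Midpoints instead of general convex combinations: the parallelogram law refers to
  nothing else.\<close>

inductive_set mid_tail :: "(nat \<Rightarrow> 'a \<Rightarrow> real) \<Rightarrow> nat \<Rightarrow> ('a \<Rightarrow> real) set" for U n where
  base: "k \<ge> n \<Longrightarrow> U k \<in> mid_tail U n"
| mid: "u \<in> mid_tail U n \<Longrightarrow> v \<in> mid_tail U n \<Longrightarrow> lc (1 / 2) u (1 / 2) v \<in> mid_tail U n"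

lemma mid_tail_antimono: "u \<in> mid_tail U m \<Longrightarrow> n \<le> m \<Longrightarrow> u \<in> mid_tail U n"
  by (induction rule: mid_tail.induct) (auto intro: mid_tail.intros)

text \<open>
  Mazur's lemma replaces weak compactness: almost minimal elements of the midpoint-closed tails
  form a Cauchy sequence by the parallelogram law, and affine continuous functionals that converge
  along the sequence also converge along them.
\<close>

lemma weak_limit_H1:
  fixes U :: "nat \<Rightarrow> real^'n::finite \<Rightarrow> real"
  assumes U: "\<And>n. U n \<in> H1" and c: "c > 0" and M: "\<And>n. ip c (U n) (U n) \<le> M"
  obtains w where "w \<in> H1"
    and "\<And>\<eta> K L. (\<And>u v. u \<in> H1 \<Longrightarrow> v \<in> H1 \<Longrightarrow> \<eta> (lc (1 / 2) u (1 / 2) v) = (\<eta> u + \<eta> v) / 2) \<Longrightarrow>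
       (\<And>u v. u \<in> H1 \<Longrightarrow> v \<in> H1 \<Longrightarrow> \<bar>\<eta> u - \<eta> v\<bar> \<le> K * sqrt (ip c (lc 1 u (-1) v) (lc 1 u (-1) v))) \<Longrightarrow>
       (\<lambda>n. \<eta> (U n)) \<longlonglongrightarrow> L \<Longrightarrow> \<eta> w = (L::real)"
proof -
  let ?q = "\<lambda>u. ip c u u"
  have qn: "?q u \<ge> 0" for u using c by (simp add: ip_nonneg)
  have TH: "u \<in> H1" if "u \<in> mid_tail U n" for u n
    using that by (induction rule: mid_tail.induct) (auto intro: U H1_lc(1))
  have par: "?q (lc 1 u (-1) v) = 2 * ?q u + 2 * ?q v - 4 * ?q (lc (1 / 2) u (1 / 2) v)" if "u \<in> H1" "v \<in> H1" for u v
    using that by (simp add: ip_lc_self power_divide)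
  have TM: "?q u \<le> M" if "u \<in> mid_tail U n" for u n
    using that
  proof (induction rule: mid_tail.induct)
    case (mid u v)
    then show ?case using par[OF TH TH, of u n v n] qn[of "lc 1 u (-1) v"] by simp
  qed (use M in simp)
  \<comment> \<open>Minimal values over the tails. They increase because the tails shrink and are
    bounded by \<open>M\<close>, hence converge.\<close>
  define a where "a = (\<lambda>n. Inf (?q ` mid_tail U n))"
  have ne: "?q ` mid_tail U n \<noteq> {}" for n using mid_tail.base[of n n U] by auto
  have bdd: "bdd_below (?q ` mid_tail U n)" for n using qn by (intro bdd_belowI[of _ 0]) auto
  have a_le: "a n \<le> ?q u" if "u \<in> mid_tail U n" for u n
    unfolding a_def using bdd that by (intro cInf_lower) auto
  have inc: "incseq a"
    unfolding a_def by (intro incseq_SucI cInf_superset_mono ne bdd image_mono) (auto intro: mid_tail_antimono)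
  have aM: "a n \<le> M" for n using a_le[OF mid_tail.base[of n n U]] M[of n] by simp
  have "\<exists>v\<in>mid_tail U n. ?q v < a n + 1 / real (Suc n)" for n
    using cInf_lessD[OF ne, of n "a n + 1 / real (Suc n)"] by (auto simp: a_def)
  then obtain V where V: "\<And>n. V n \<in> mid_tail U n" and Va: "\<And>n. ?q (V n) < a n + 1 / real (Suc n)"
    by metis
  note VH = TH[OF V]
  \<comment> \<open>The midpoint of \<open>V m\<close> and \<open>V n\<close> still lies in the k-th
    tail, so its value is at least \<open>a k\<close>; the parallelogram law turns this into a bound
    on the distance.\<close>
  have dist: "?q (lc 1 (V m) (-1) (V n)) < 2 * (a m - a k) + 2 * (a n - a k) + 4 / real (Suc k)"
    if "m \<ge> k" "n \<ge> k" for m n k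
  proof -
    have "a k \<le> ?q (lc (1 / 2) (V m) (1 / 2) (V n))"
      by (intro a_le mid_tail.mid mid_tail_antimono[OF V] that)
    moreover have "1 / real (Suc m) \<le> 1 / real (Suc k)" "1 / real (Suc n) \<le> 1 / real (Suc k)"
      using that by (auto intro!: divide_left_mono)
    ultimately show ?thesis
      using par[OF VH[of m] VH[of n]] Va[of m] Va[of n] by (simp only: times_divide_eq_right) (smt (verit) add_divide_distrib)
  qed
  obtain A where A: "a \<longlonglongrightarrow> A" using incseq_convergent[OF inc] aM by blast
  have aA: "a n \<le> A" for n using incseq_le[OF inc A] .
  have cauchy: "\<exists>N. \<forall>m\<ge>N. \<forall>n\<ge>N. ?q (lc 1 (V m) (-1) (V n)) < e" if "e > 0" for e
  proof -
    have "(\<lambda>k. 4 * (A - a k) + 4 * (1 / real (Suc k))) \<longlonglongrightarrow> 4 * (A - A) + 4 * 0"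
      by (intro tendsto_intros A LIMSEQ_Suc lim_1_over_n)
    then have "\<forall>\<^sub>F k in sequentially. 4 * (A - a k) + 4 * (1 / real (Suc k)) < e"
      using that by (intro order_tendstoD(2)) auto
    then obtain k where k: "4 * (A - a k) + 4 * (1 / real (Suc k)) < e"
      by (auto simp: eventually_sequentially)
    have "?q (lc 1 (V m) (-1) (V n)) < e" if "m \<ge> k" "n \<ge> k" for m n
      using dist[OF that] k aA[of m] aA[of n] by simp
    then show ?thesis by blast
  qed
  obtain w where w: "w \<in> H1" and wlim: "(\<lambda>n. ?q (lc 1 (V n) (-1) w)) \<longlonglongrightarrow> 0"
    by (rule H1_complete[OF VH c cauchy]) auto
  show thesis
  proof (rule that[OF w])
    fix \<eta> :: "(real^'n \<Rightarrow> real) \<Rightarrow> real" and K L :: real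
    assume aff: "\<And>u v. u \<in> H1 \<Longrightarrow> v \<in> H1 \<Longrightarrow> \<eta> (lc (1 / 2) u (1 / 2) v) = (\<eta> u + \<eta> v) / 2"
      and lip: "\<And>u v. u \<in> H1 \<Longrightarrow> v \<in> H1 \<Longrightarrow> \<bar>\<eta> u - \<eta> v\<bar> \<le> K * sqrt (?q (lc 1 u (-1) v))"
      and lim: "(\<lambda>n. \<eta> (U n)) \<longlonglongrightarrow> L"
    have "(\<lambda>n. K * sqrt (?q (lc 1 (V n) (-1) w))) \<longlonglongrightarrow> K * sqrt 0"
      by (intro tendsto_intros wlim)
    then have "(\<lambda>n. \<eta> (V n) - \<eta> w) \<longlonglongrightarrow> 0"
      by (intro Lim_null_comparison[of "\<lambda>n. \<eta> (V n) - \<eta> w" "\<lambda>n. K * sqrt (?q (lc 1 (V n) (-1) w))"])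
        (auto intro!: always_eventually lip VH w)
    then have 1: "(\<lambda>n. \<eta> (V n)) \<longlonglongrightarrow> \<eta> w" by (simp add: LIM_zero_iff)
    have "(\<lambda>n. \<eta> (V n)) \<longlonglongrightarrow> L"
    proof (rule LIMSEQ_I)
      fix e :: real assume "e > 0"
      then have "e / 2 > 0" by simp
      from LIMSEQ_D[OF lim this] obtain N where N: "\<And>n. n \<ge> N \<Longrightarrow> \<bar>\<eta> (U n) - L\<bar> < e / 2" by auto
      \<comment> \<open>An affine condition of this kind is preserved by midpoints and therefore
        spreads from the sequence to the whole tail.\<close>
      have "\<bar>\<eta> u - L\<bar> < e / 2" if "u \<in> mid_tail U N" for u
        using that
      proof (induction rule: mid_tail.induct)
        case (mid u v)
        have "\<bar>(y + z) / 2 - L\<bar> < e / 2" if "\<bar>y - L\<bar> < e / 2" "\<bar>z - L\<bar> < e / 2" for y z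
          using that by argo
        from this[OF mid.IH] show ?case
          unfolding aff[OF TH[OF mid.hyps(1)] TH[OF mid.hyps(2)]] .
      qed (use N in auto)
      then have "norm (\<eta> (V n) - L) < e" if "n \<ge> N" for n
        using mid_tail_antimono[OF V that] \<open>e > 0\<close> by fastforce
      then show "\<exists>no. \<forall>n\<ge>no. norm (\<eta> (V n) - L) < e" by blast
    qed
    with 1 show "\<eta> w = L" by (rule LIMSEQ_unique)
  qed
qed

subsection \<open>Critical points of the functional\<close>

text \<open>The parameter \<open>ty\<close> only names the index type, that is, the dimension.\<close>

locale cubic_system =
  fixes ty :: "'n::finite itself" and d :: nat and lam mu :: "nat \<Rightarrow> real" and b :: real
  assumes dim: "CARD('n) \<le> 3" and d_pos: "d \<ge> 1"
    and lam_pos: "i \<in> {1..d} \<Longrightarrow> 0 < lam i"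
    and mu_pos: "i \<in> {1..d} \<Longrightarrow> 0 < mu i" and mu_less: "i \<in> {1..d} \<Longrightarrow> mu i < b"
begin

text \<open>With the \<open>mu i\<close> on the diagonal, the quartic part of the energy becomes a
  quarter of one symmetric double sum.\<close>

definition coup :: "nat \<Rightarrow> nat \<Rightarrow> real" where
  "coup i j = (if i = j then mu i else b)"

lemma b_pos: "b > 0"
  using mu_pos[of 1] mu_less[of 1] d_pos by simp

lemma coup_bounds: "i \<in> {1..d} \<Longrightarrow> 0 < coup i j" "i \<in> {1..d} \<Longrightarrow> coup i j \<le> b"
  using mu_pos[of i] mu_less[of i] b_pos by (auto simp: coup_def)

lemma coup_commute: "coup i j = coup j i"
  by (simp add: coup_def)

section \<open>Pointwise polynomial estimates for the vector of values\<close>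

definition sq :: "(nat \<Rightarrow> real) \<Rightarrow> real" where
  "sq x = (\<Sum>i=1..d. (x i)\<^sup>2)"

definition quart :: "(nat \<Rightarrow> real) \<Rightarrow> real" where
  "quart x = (\<Sum>i=1..d. \<Sum>j=1..d. coup i j * ((x i)\<^sup>2 * (x j)\<^sup>2))"

text \<open>A quarter of the derivative of \<open>quart\<close> at \<open>x\<close> in direction
  \<open>y\<close>.\<close>

definition tri :: "(nat \<Rightarrow> real) \<Rightarrow> (nat \<Rightarrow> real) \<Rightarrow> real" where
  "tri x y = (\<Sum>i=1..d. \<Sum>j=1..d. coup i j * (x i * y i * (x j)\<^sup>2))"

lemma sq_times_sq: "sq x * sq y = (\<Sum>i=1..d. \<Sum>j=1..d. (x i)\<^sup>2 * (y j)\<^sup>2)"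
  by (simp add: sq_def sum_product)

lemma sq_times_sq': "sq x * sq y = (\<Sum>i=1..d. \<Sum>j=1..d. (y i)\<^sup>2 * (x j)\<^sup>2)"
  using sq_times_sq[of y x] by (simp add: mult.commute)

lemma tri_commute_sum: "tri x y = (\<Sum>i=1..d. \<Sum>j=1..d. coup i j * (x j * y j * (x i)\<^sup>2))"
  unfolding tri_def by (subst sum.swap) (simp add: coup_commute)

lemma tri_self: "tri x x = quart x"
  by (simp add: tri_def quart_def power2_eq_square)

lemma quart_nonneg: "quart x \<ge> 0"
  unfolding quart_def by (intro sum_nonneg mult_nonneg_nonneg less_imp_le[OF coup_bounds(1)]) auto

lemma quart_le: "quart x \<le> b * (sq x)\<^sup>2"
proof -
  have "quart x \<le> (\<Sum>i=1..d. \<Sum>j=1..d. b * ((x i)\<^sup>2 * (x j)\<^sup>2))"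
    unfolding quart_def by (intro sum_mono mult_right_mono coup_bounds(2)) auto
  also have "\<dots> = b * (sq x)\<^sup>2"
    by (simp add: power2_eq_square[of "sq x"] sq_times_sq sum_distrib_left)
  finally show ?thesis .
qed

lemma quart_expand:
  "\<bar>quart (\<lambda>i. x i + y i) - quart x - 4 * tri x y\<bar> \<le> b * (8 * (sq x * sq y) + 3 * (sq y)\<^sup>2)"
proof -
  define R where "R = (\<lambda>i j. (x i)\<^sup>2 * (y j)\<^sup>2 + (y i)\<^sup>2 * (x j)\<^sup>2 + 4 * (x i * y j) * (y i * x j)
     + 2 * (x i * y j) * (y i * y j) + 2 * (y i * x j) * (y i * y j) + (y i)\<^sup>2 * (y j)\<^sup>2)"
  have id: "(x i + y i)\<^sup>2 * (x j + y j)\<^sup>2 = (x i)\<^sup>2 * (x j)\<^sup>2 + 2 * (x i * y i * (x j)\<^sup>2) + 2 * (x j * y j * (x i)\<^sup>2) + R i j" for i j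
    unfolding R_def by (simp add: power2_eq_square algebra_simps)
  have "quart (\<lambda>i. x i + y i) = quart x + 2 * tri x y + 2 * tri x y + (\<Sum>i=1..d. \<Sum>j=1..d. coup i j * R i j)"
    unfolding id quart_def by (subst (2) tri_commute_sum)
      (simp add: tri_def distrib_left sum.distrib sum_distrib_left mult.assoc mult.left_commute[of _ 2])
  then have eq: "quart (\<lambda>i. x i + y i) - quart x - 4 * tri x y = (\<Sum>i=1..d. \<Sum>j=1..d. coup i j * R i j)"
    by simp
  have Rb: "\<bar>R i j\<bar> \<le> 4 * ((x i)\<^sup>2 * (y j)\<^sup>2) + 4 * ((y i)\<^sup>2 * (x j)\<^sup>2) + 3 * ((y i)\<^sup>2 * (y j)\<^sup>2)" for i j
  proof -
    \<comment> \<open>In these three products the remainder is a quadratic form; bounding each mixed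
      term by two squares gives the coefficients 4, 4 and 3.\<close>
    define p q s where "p = x i * y j" and "q = y i * x j" and "s = y i * y j"
    have "R i j = p\<^sup>2 + q\<^sup>2 + 4 * p * q + 2 * p * s + 2 * q * s + s\<^sup>2"
      by (simp add: R_def p_def q_def s_def power_mult_distrib)
    moreover have "\<bar>2 * p * q\<bar> \<le> p\<^sup>2 + q\<^sup>2" "\<bar>2 * p * s\<bar> \<le> p\<^sup>2 + s\<^sup>2" "\<bar>2 * q * s\<bar> \<le> q\<^sup>2 + s\<^sup>2"
      using sum_squares_bound[of "\<bar>p\<bar>" "\<bar>q\<bar>"] sum_squares_bound[of "\<bar>p\<bar>" "\<bar>s\<bar>"] sum_squares_bound[of "\<bar>q\<bar>" "\<bar>s\<bar>"]
      by (simp_all add: abs_mult)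
    moreover have "p\<^sup>2 \<ge> 0" "q\<^sup>2 \<ge> 0" "s\<^sup>2 \<ge> 0" by auto
    ultimately have "\<bar>R i j\<bar> \<le> 4 * p\<^sup>2 + 4 * q\<^sup>2 + 3 * s\<^sup>2" by linarith
    then show ?thesis by (simp add: p_def q_def s_def power_mult_distrib)
  qed
  have "\<bar>\<Sum>i=1..d. \<Sum>j=1..d. coup i j * R i j\<bar> \<le> (\<Sum>i=1..d. \<bar>\<Sum>j=1..d. coup i j * R i j\<bar>)"
    by (rule sum_abs)
  also have "\<dots> \<le> (\<Sum>i=1..d. \<Sum>j=1..d. \<bar>coup i j * R i j\<bar>)"
    by (intro sum_mono sum_abs)
  also have "\<dots> \<le> (\<Sum>i=1..d. \<Sum>j=1..d. b * (4 * ((x i)\<^sup>2 * (y j)\<^sup>2) + 4 * ((y i)\<^sup>2 * (x j)\<^sup>2) + 3 * ((y i)\<^sup>2 * (y j)\<^sup>2)))"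
  proof (intro sum_mono)
    fix i j assume i: "i \<in> {1..d}"
    show "\<bar>coup i j * R i j\<bar> \<le> b * (4 * ((x i)\<^sup>2 * (y j)\<^sup>2) + 4 * ((y i)\<^sup>2 * (x j)\<^sup>2) + 3 * ((y i)\<^sup>2 * (y j)\<^sup>2))"
      unfolding abs_mult using coup_bounds[OF i, of j] b_pos by (intro mult_mono Rb) auto
  qed
  also have "\<dots> = b * (4 * (sq x * sq y) + 4 * (sq x * sq y) + 3 * (sq y * sq y))"
    by (subst (2) sq_times_sq')
      (simp add: sq_times_sq distrib_left sum.distrib sum_distrib_left mult.left_commute[of _ b])
  finally show ?thesis unfolding eq by (simp add: power2_eq_square)
qed

text \<open>Young's inequality with a free parameter: a small multiple of the term in
  \<open>x\<close> against a large multiple of the term in \<open>y\<close>. In the limit argument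
  \<open>x\<close> varies along a sequence bounded in L4 while \<open>y\<close> is fixed and serves
  as dominating function.\<close>

lemma tri_bound:
  assumes t: "t > 0"
  shows "\<bar>tri x y\<bar> \<le> b * (2 * t * (sq x)\<^sup>2 + (sq y)\<^sup>2 / (64 * t ^ 3))"
proof -
  have young: "A * B \<le> e * A\<^sup>2 + B\<^sup>2 / (4 * e)" if "e > 0" for A B e :: real
  proof -
    have "0 \<le> (2 * e * A - B)\<^sup>2 / (4 * e)" using that by simp
    also have "\<dots> = e * A\<^sup>2 + B\<^sup>2 / (4 * e) - A * B"
      using that by (simp add: field_simps power2_eq_square)
    finally show ?thesis by simp
  qed
  have "\<bar>tri x y\<bar> \<le> (\<Sum>i=1..d. \<Sum>j=1..d. \<bar>coup i j * (x i * y i * (x j)\<^sup>2)\<bar>)"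
    unfolding tri_def by (intro order_trans[OF sum_abs] sum_mono sum_abs)
  also have "\<dots> \<le> (\<Sum>i=1..d. \<Sum>j=1..d. b * (t * ((x i)\<^sup>2 * (x j)\<^sup>2) + ((y i)\<^sup>2 * (x j)\<^sup>2) / (4 * t)))"
  proof (intro sum_mono)
    fix i j assume i: "i \<in> {1..d}"
    have "\<bar>x i * y i * (x j)\<^sup>2\<bar> = \<bar>x i\<bar> * \<bar>y i\<bar> * (x j)\<^sup>2" by (simp add: abs_mult)
    also have "\<dots> \<le> (t * \<bar>x i\<bar>\<^sup>2 + \<bar>y i\<bar>\<^sup>2 / (4 * t)) * (x j)\<^sup>2"
      by (intro mult_right_mono young t) auto
    also have "\<dots> = t * ((x i)\<^sup>2 * (x j)\<^sup>2) + ((y i)\<^sup>2 * (x j)\<^sup>2) / (4 * t)"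
      by (simp add: distrib_right mult.assoc)
    finally show "\<bar>coup i j * (x i * y i * (x j)\<^sup>2)\<bar> \<le> b * (t * ((x i)\<^sup>2 * (x j)\<^sup>2) + ((y i)\<^sup>2 * (x j)\<^sup>2) / (4 * t))"
      unfolding abs_mult[of "coup i j"] using coup_bounds[OF i, of j] b_pos by (intro mult_mono) auto
  qed
  also have "\<dots> = b * (t * (sq x)\<^sup>2 + (sq x * sq y) / (4 * t))"
    by (simp add: sq_times_sq' power2_eq_square[of "sq x"] distrib_left sum.distrib sum_distrib_left
        sum_divide_distrib mult.left_commute[of _ b])
  also have "\<dots> \<le> b * (2 * t * (sq x)\<^sup>2 + (sq y)\<^sup>2 / (64 * t ^ 3))"
  proof (rule mult_left_mono)
    \<comment> \<open>The parameter \<open>4 * t\<^sup>2\<close> is chosen so that, after division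
      by \<open>4 * t\<close>, the first term is again \<open>t * (sq x)\<^sup>2\<close>.\<close>
    have "sq x * sq y \<le> (4 * t\<^sup>2) * (sq x)\<^sup>2 + (sq y)\<^sup>2 / (4 * (4 * t\<^sup>2))"
      using t by (intro young) auto
    then have "(sq x * sq y) / (4 * t) \<le> ((4 * t\<^sup>2) * (sq x)\<^sup>2 + (sq y)\<^sup>2 / (4 * (4 * t\<^sup>2))) / (4 * t)"
      using t by (intro divide_right_mono) auto
    also have "\<dots> = t * (sq x)\<^sup>2 + (sq y)\<^sup>2 / (64 * t ^ 3)"
      using t by (simp add: add_divide_distrib power2_eq_square[of t] power3_eq_cube)
    finally show "t * (sq x)\<^sup>2 + (sq x * sq y) / (4 * t) \<le> 2 * t * (sq x)\<^sup>2 + (sq y)\<^sup>2 / (64 * t ^ 3)" by simp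
  qed (use b_pos in simp)
  finally show ?thesis .
qed

lemma sq_square_le: "(sq x)\<^sup>2 \<le> real d * (\<Sum>i=1..d. (x i) ^ 4)"
proof -
  have "(\<Sum>i=1..d. (x i)\<^sup>2 * 1)\<^sup>2 \<le> (\<Sum>i=1..d. ((x i)\<^sup>2)\<^sup>2) * (\<Sum>i=1..d. 1\<^sup>2)"
    by (rule Cauchy_Schwarz_ineq_sum)
  then show ?thesis by (simp add: sq_def mult.commute flip: power_mult)
qed

section \<open>The integrated forms on vectors of H1 functions\<close>

abbreviation V :: "(nat \<Rightarrow> real^'n \<Rightarrow> real) set" where "V \<equiv> H1_vec d"

abbreviation at_pt :: "(nat \<Rightarrow> real^'n \<Rightarrow> real) \<Rightarrow> real^'n \<Rightarrow> nat \<Rightarrow> real" where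
  "at_pt u x \<equiv> \<lambda>i. u i x"

definition Q :: "(nat \<Rightarrow> real^'n \<Rightarrow> real) \<Rightarrow> real" where
  "Q u = (\<Sum>i=1..d. ip (lam i) (u i) (u i))"

definition B :: "(nat \<Rightarrow> real^'n \<Rightarrow> real) \<Rightarrow> real" where
  "B u = (LINT x|lebesgue. quart (at_pt u x))"

text \<open>A quarter of the derivative of \<open>B\<close> at \<open>u\<close> in direction
  \<open>v\<close>: cubic in \<open>u\<close>, linear in \<open>v\<close>.\<close>

definition T :: "(nat \<Rightarrow> real^'n \<Rightarrow> real) \<Rightarrow> (nat \<Rightarrow> real^'n \<Rightarrow> real) \<Rightarrow> real" where
  "T u v = (LINT x|lebesgue. tri (at_pt u x) (at_pt v x))"

definition S4 :: "(nat \<Rightarrow> real^'n \<Rightarrow> real) \<Rightarrow> real" where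
  "S4 u = (LINT x|lebesgue. (sq (at_pt u x))\<^sup>2)"

lemma V_H1: "u \<in> V \<Longrightarrow> i \<in> {1..d} \<Longrightarrow> u i \<in> H1"
  by (auto simp: H1_vec_def)

lemma V_I: "(\<And>i. i \<in> {1..d} \<Longrightarrow> u i \<in> H1) \<Longrightarrow> u \<in> V"
  by (auto simp: H1_vec_def)

lemma H1_measurable: "f \<in> H1 \<Longrightarrow> f \<in> borel_measurable lebesgue"
  using weak_grad_H1(3) by (auto simp: square_integrable_def)

lemma V_measurable: "u \<in> V \<Longrightarrow> i \<in> {1..d} \<Longrightarrow> u i \<in> borel_measurable lebesgue"
  by (intro H1_measurable V_H1)

lemma H1_quartic_integrable: "(f :: real^'n \<Rightarrow> real) \<in> H1 \<Longrightarrow> integrable lebesgue (\<lambda>x. (f x) ^ 4)"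
  by (rule Sobolev_L4(1)[of _ _ 1]) (use dim in \<open>auto intro: weak_grad_H1\<close>)

lemma sq_measurable: "u \<in> V \<Longrightarrow> (\<lambda>x. sq (at_pt u x)) \<in> borel_measurable lebesgue"
  unfolding sq_def by (intro borel_measurable_sum borel_measurable_power V_measurable)

lemma quart_measurable: "u \<in> V \<Longrightarrow> (\<lambda>x. quart (at_pt u x)) \<in> borel_measurable lebesgue"
  unfolding quart_def
  by (intro borel_measurable_sum borel_measurable_times borel_measurable_const borel_measurable_power V_measurable)

lemma tri_measurable: "u \<in> V \<Longrightarrow> v \<in> V \<Longrightarrow> (\<lambda>x. tri (at_pt u x) (at_pt v x)) \<in> borel_measurable lebesgue"
  unfolding tri_def
  by (intro borel_measurable_sum borel_measurable_times borel_measurable_const borel_measurable_power V_measurable)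

lemma sq2_integrable:
  assumes "u \<in> V"
  shows "integrable lebesgue (\<lambda>x. (sq (at_pt u x))\<^sup>2)"
proof (rule Bochner_Integration.integrable_bound)
  show "integrable lebesgue (\<lambda>x. real d * (\<Sum>i=1..d. (u i x) ^ 4))"
    using assms by (intro integrable_mult_right Bochner_Integration.integrable_sum H1_quartic_integrable V_H1)
  show "(\<lambda>x. (sq (at_pt u x))\<^sup>2) \<in> borel_measurable lebesgue"
    by (intro borel_measurable_power sq_measurable assms)
  show "AE x in lebesgue. norm ((sq (at_pt u x))\<^sup>2) \<le> norm (real d * (\<Sum>i=1..d. (u i x) ^ 4))"
    using sq_square_le[of "at_pt u _"] by (auto intro!: AE_I2 order_trans[OF _ abs_ge_self])
qed

lemma S4_nonneg: "S4 u \<ge> 0"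
  unfolding S4_def by (auto intro!: integral_nonneg_AE)

lemma quart_integrable:
  assumes "u \<in> V"
  shows "integrable lebesgue (\<lambda>x. quart (at_pt u x))"
proof (rule Bochner_Integration.integrable_bound)
  show "integrable lebesgue (\<lambda>x. b * (sq (at_pt u x))\<^sup>2)" by (intro integrable_mult_right sq2_integrable assms)
  show "AE x in lebesgue. norm (quart (at_pt u x)) \<le> norm (b * (sq (at_pt u x))\<^sup>2)"
    using quart_le quart_nonneg by (auto intro!: AE_I2 order_trans[OF _ abs_ge_self])
qed (rule quart_measurable[OF assms])

lemma tri_integrable:
  assumes "u \<in> V" "v \<in> V"
  shows "integrable lebesgue (\<lambda>x. tri (at_pt u x) (at_pt v x))"
proof (rule Bochner_Integration.integrable_bound)
  show "integrable lebesgue (\<lambda>x. b * (2 * 1 * (sq (at_pt u x))\<^sup>2 + (sq (at_pt v x))\<^sup>2 / (64 * 1 ^ 3)))"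
    by (intro integrable_mult_right Bochner_Integration.integrable_add integrable_divide sq2_integrable assms)
  show "AE x in lebesgue. norm (tri (at_pt u x) (at_pt v x)) \<le> norm (b * (2 * 1 * (sq (at_pt u x))\<^sup>2 + (sq (at_pt v x))\<^sup>2 / (64 * 1 ^ 3)))"
    using tri_bound[of 1] by (auto intro!: AE_I2 order_trans[OF _ abs_ge_self])
qed (rule tri_measurable[OF assms])

lemma Q_nonneg: "Q u \<ge> 0"
  unfolding Q_def by (intro sum_nonneg ip_nonneg less_imp_le[OF lam_pos])

lemma ip_le_Q: "i \<in> {1..d} \<Longrightarrow> ip (lam i) (u i) (u i) \<le> Q u"
  unfolding Q_def by (rule member_le_sum) (simp_all add: ip_nonneg less_imp_le[OF lam_pos])

lemma B_nonneg: "B u \<ge> 0"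
  unfolding B_def by (intro integral_nonneg_AE) (auto simp: quart_nonneg)

lemma B_le: "u \<in> V \<Longrightarrow> B u \<le> b * S4 u"
  unfolding B_def S4_def integral_mult_right_zero[symmetric]
  by (intro integral_mono quart_integrable integrable_mult_right sq2_integrable quart_le)

lemma S4_bound: "\<exists>K>0. \<forall>u\<in>V. S4 u \<le> K * (Q u)\<^sup>2"
proof -
  define c where "c = Min (lam ` {1..d})"
  have cpos: "c > 0" using lam_pos d_pos by (simp add: c_def)
  have cle: "c \<le> lam i" if "i \<in> {1..d}" for i using that by (simp add: c_def)
  \<comment> \<open>At this scale the bracket in the Sobolev inequality is \<open>ip c\<close>,
    which is below every summand's own form because \<open>c\<close> is the smallest of the
    \<open>lam i\<close>.\<close>
  define l where "l = 1 / sqrt c"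
  have l: "l > 0" "1 / l\<^sup>2 = c" using cpos by (auto simp: l_def power_divide)
  define S where "S = 8 * (osc_const TYPE('n) ^ 4 + 1) * l ^ (4 - CARD('n))"
  have S: "S > 0" using l osc_const_pos[where 'n = 'n] by (auto simp: S_def intro!: mult_pos_pos add_pos_pos)
  have "S4 u \<le> (real d * (real d * S)) * (Q u)\<^sup>2" if u: "u \<in> V" for u
  proof -
    have "S4 u \<le> (LINT x|lebesgue. real d * (\<Sum>i=1..d. (u i x) ^ 4))"
      unfolding S4_def by (intro integral_mono sq2_integrable u integrable_mult_right
          Bochner_Integration.integrable_sum H1_quartic_integrable V_H1[OF u] sq_square_le)
    also have "\<dots> = real d * (\<Sum>i=1..d. LINT x|lebesgue. (u i x) ^ 4)"
      by (simp add: Bochner_Integration.integral_sum H1_quartic_integrable V_H1[OF u])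
    also have "\<dots> \<le> real d * (\<Sum>i=1..d. S * (Q u)\<^sup>2)"
    proof (intro mult_left_mono sum_mono)
      fix i assume i: "i \<in> {1..d}"
      note ui = V_H1[OF u i]
      have "(LINT x|lebesgue. (u i x) ^ 4) \<le> S * ((LINT x|lebesgue. (norm (weak_grad (u i) x))\<^sup>2) + (LINT x|lebesgue. (u i x)\<^sup>2) / l\<^sup>2)\<^sup>2"
        unfolding S_def by (intro Sobolev_L4(2) weak_grad_H1 ui l(1) dim)
      also have "(LINT x|lebesgue. (norm (weak_grad (u i) x))\<^sup>2) + (LINT x|lebesgue. (u i x)\<^sup>2) / l\<^sup>2 = ip c (u i) (u i)"
        using l(2) by (simp add: ip_self[OF ui] divide_inverse mult.commute)
      also have "S * (ip c (u i) (u i))\<^sup>2 \<le> S * (Q u)\<^sup>2"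
        using S ip_mono[OF ui cle[OF i]] ip_le_Q[OF i, of u] cpos
        by (intro mult_left_mono power_mono ip_nonneg) auto
      finally show "(LINT x|lebesgue. (u i x) ^ 4) \<le> S * (Q u)\<^sup>2" .
    qed simp
    also have "\<dots> = (real d * (real d * S)) * (Q u)\<^sup>2" by simp
    finally show ?thesis .
  qed
  moreover have "real d * (real d * S) > 0" using S d_pos by simp
  ultimately show ?thesis by blast
qed

lemma B_expand_S4:
  assumes u: "u \<in> V" and v: "v \<in> V" and w: "\<And>i x. i \<in> {1..d} \<Longrightarrow> w i x = u i x + v i x"
  shows "\<bar>B w - B u - 4 * T u v\<bar> \<le> b * (8 * sqrt (S4 u * S4 v) + 3 * S4 v)"
proof -
  have w': "quart (at_pt w x) = quart (\<lambda>i. u i x + v i x)" for x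
    unfolding quart_def by (intro sum.cong) (auto simp: w)
  have wV: "w \<in> V"
  proof (rule V_I)
    fix i assume i: "i \<in> {1..d}"
    have "w i = lc 1 (u i) 1 (v i)" using w[OF i] by (auto simp: lc_def)
    then show "w i \<in> H1" using H1_lc(1)[OF V_H1[OF u i] V_H1[OF v i]] by simp
  qed
  let ?s = "\<lambda>u x. sq (at_pt u x)"
  have sqi: "square_integrable (?s u)" if "u \<in> V" for u
    using sq2_integrable[OF that] sq_measurable[OF that] by (simp add: square_integrable_def)
  have uv: "integrable lebesgue (\<lambda>x. ?s u x * ?s v x)"
    using square_integrable_inner[OF sqi[OF u] sqi[OF v]] by simp
  have "(LINT x|lebesgue. ?s u x * ?s v x)\<^sup>2 \<le> S4 u * S4 v"
    unfolding S4_def by (rule Cauchy_Schwarz_L2[OF sqi[OF u] sqi[OF v]])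
  then have CS: "(LINT x|lebesgue. ?s u x * ?s v x) \<le> sqrt (S4 u * S4 v)"
    by (rule real_le_rsqrt)
  note i = quart_integrable[OF wV] quart_integrable[OF u] tri_integrable[OF u v]
  have "B w - B u - 4 * T u v = (LINT x|lebesgue. quart (at_pt w x) - quart (at_pt u x) - 4 * tri (at_pt u x) (at_pt v x))"
    unfolding B_def T_def using i by simp
  then have "\<bar>B w - B u - 4 * T u v\<bar> \<le> (LINT x|lebesgue. \<bar>quart (at_pt w x) - quart (at_pt u x) - 4 * tri (at_pt u x) (at_pt v x)\<bar>)"
    by (simp only: integral_abs_bound)
  also have "\<dots> \<le> (LINT x|lebesgue. b * (8 * (?s u x * ?s v x) + 3 * (?s v x)\<^sup>2))"
  proof (rule integral_mono)
    show "integrable lebesgue (\<lambda>x. \<bar>quart (at_pt w x) - quart (at_pt u x) - 4 * tri (at_pt u x) (at_pt v x)\<bar>)"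
      by (rule integrable_abs, rule Bochner_Integration.integrable_diff[OF Bochner_Integration.integrable_diff[OF i(1,2)] integrable_mult_right[OF i(3)]])
    show "integrable lebesgue (\<lambda>x. b * (8 * (?s u x * ?s v x) + 3 * (?s v x)\<^sup>2))"
      by (rule integrable_mult_right, rule Bochner_Integration.integrable_add[OF integrable_mult_right[OF uv] integrable_mult_right[OF sq2_integrable[OF v]]])
    show "\<bar>quart (at_pt w x) - quart (at_pt u x) - 4 * tri (at_pt u x) (at_pt v x)\<bar> \<le> b * (8 * (?s u x * ?s v x) + 3 * (?s v x)\<^sup>2)" for x
      using quart_expand[of "at_pt u x" "at_pt v x"] unfolding w'[of x] .
  qed
  also have "\<dots> = b * (8 * (LINT x|lebesgue. ?s u x * ?s v x) + 3 * S4 v)"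
    using uv sq2_integrable[OF v] by (simp add: S4_def)
  also have "\<dots> \<le> b * (8 * sqrt (S4 u * S4 v) + 3 * S4 v)"
    using CS b_pos by simp
  finally show ?thesis .
qed

lemma B_expand: "\<exists>C>0. \<forall>u\<in>V. \<forall>v\<in>V. \<forall>w. (\<forall>i\<in>{1..d}. \<forall>x. w i x = u i x + v i x) \<longrightarrow>
    \<bar>B w - B u - 4 * T u v\<bar> \<le> C * (Q u * Q v + (Q v)\<^sup>2)"
proof -
  obtain K where K: "K > 0" "\<And>u. u \<in> V \<Longrightarrow> S4 u \<le> K * (Q u)\<^sup>2" using S4_bound by blast
  have "\<bar>B w - B u - 4 * T u v\<bar> \<le> 8 * b * K * (Q u * Q v + (Q v)\<^sup>2)"
    if u: "u \<in> V" and v: "v \<in> V" and w: "\<And>i x. i \<in> {1..d} \<Longrightarrow> w i x = u i x + v i x" for u v w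
  proof -
    have "S4 u * S4 v \<le> (K * (Q u)\<^sup>2) * (K * (Q v)\<^sup>2)"
      using K by (intro mult_mono K(2) u v S4_nonneg) auto
    also have "\<dots> = (K * (Q u * Q v))\<^sup>2" by (simp add: power2_eq_square mult_ac)
    finally have "sqrt (S4 u * S4 v) \<le> K * (Q u * Q v)"
      by (intro real_le_lsqrt) (use K(1) Q_nonneg in auto)
    moreover have "3 * S4 v \<le> 8 * (K * (Q v)\<^sup>2)"
      using K(2)[OF v] S4_nonneg[of v] by linarith
    ultimately have "b * (8 * sqrt (S4 u * S4 v) + 3 * S4 v) \<le> b * (8 * (K * (Q u * Q v)) + 8 * (K * (Q v)\<^sup>2))"
      using b_pos by (intro mult_left_mono add_mono) auto
    also have "\<dots> = 8 * b * K * (Q u * Q v + (Q v)\<^sup>2)" by (simp add: algebra_simps)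
    finally show ?thesis using B_expand_S4[OF u v w] by linarith
  qed
  moreover have "8 * b * K > 0" using b_pos K(1) by simp
  ultimately show ?thesis by blast
qed

lemma T_self: "T u u = B u"
  by (simp add: T_def B_def tri_self)

definition single :: "nat \<Rightarrow> (real^'n \<Rightarrow> real) \<Rightarrow> nat \<Rightarrow> real^'n \<Rightarrow> real" where
  "single i \<phi> = (\<lambda>k. if k = i then \<phi> else (\<lambda>x. 0))"

lemma zero_H1: "(\<lambda>x. 0) \<in> (H1 :: (real^'n \<Rightarrow> real) set)" and weak_grad_zero: "AE x in lebesgue. weak_grad (\<lambda>x::real^'n. 0) x = 0"
proof -
  have 1: "has_weak_gradient (\<lambda>x::real^'n. 0) (\<lambda>x. 0)"
    by (simp add: has_weak_gradient_def locally_integrable_def)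
  have 2: "square_integrable (\<lambda>x::real^'n. 0 :: real^'n)" "square_integrable (\<lambda>x::real^'n. 0 :: real)"
    by (simp_all add: square_integrable_def)
  show "(\<lambda>x. 0) \<in> (H1 :: (real^'n \<Rightarrow> real) set)" "AE x in lebesgue. weak_grad (\<lambda>x::real^'n. 0) x = 0"
    by (rule H1_I[OF 1 2])+
qed

lemma ip_zero_right: "ip c u (\<lambda>x::real^'n. 0) = 0"
  unfolding ip_def by (rule integral_eq_zero_AE) (use weak_grad_zero in eventually_elim, simp)

lemma single_V: "\<phi> \<in> H1 \<Longrightarrow> single i \<phi> \<in> V"
  by (intro V_I) (auto simp: single_def zero_H1)

lemma Q_single: "i \<in> {1..d} \<Longrightarrow> Q (single i \<phi>) = ip (lam i) \<phi> \<phi>"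
proof -
  assume i: "i \<in> {1..d}"
  have "Q (single i \<phi>) = (\<Sum>k=1..d. if k = i then ip (lam i) \<phi> \<phi> else 0)"
    unfolding Q_def by (intro sum.cong) (auto simp: single_def ip_zero_right)
  then show ?thesis using i by simp
qed

lemma tri_single_sum: "tri x y = (\<Sum>i=1..d. tri x (\<lambda>k. if k = i then y i else 0))"
proof -
  have "tri x (\<lambda>k. if k = i then y i else 0) = (\<Sum>j=1..d. coup i j * (x i * y i * (x j)\<^sup>2))" if "i \<in> {1..d}" for i
  proof -
    have "tri x (\<lambda>k. if k = i then y i else 0) = (\<Sum>k=1..d. if k = i then (\<Sum>j=1..d. coup i j * (x i * y i * (x j)\<^sup>2)) else 0)"
      unfolding tri_def by (intro sum.cong) auto
    then show ?thesis using that by simp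
  qed
  then show ?thesis by (simp add: tri_def)
qed

lemma T_single_sum:
  assumes u: "u \<in> V" and v: "v \<in> V"
  shows "T u v = (\<Sum>i=1..d. T u (single i (v i)))"
proof -
  have e: "tri (at_pt u x) (at_pt (single i (v i)) x) = tri (at_pt u x) (\<lambda>k. if k = i then v i x else 0)" for i x
    by (simp add: single_def if_distrib[of "\<lambda>f. f x"] cong: if_cong)
  have "T u v = (LINT x|lebesgue. (\<Sum>i=1..d. tri (at_pt u x) (at_pt (single i (v i)) x)))"
    unfolding T_def e by (subst tri_single_sum) simp
  also have "\<dots> = (\<Sum>i=1..d. T u (single i (v i)))"
    unfolding T_def by (intro Bochner_Integration.integral_sum tri_integrable u single_V V_H1[OF v])
  finally show ?thesis .
qed

lemma sum_symmetric_split: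
  fixes a :: "nat \<Rightarrow> nat \<Rightarrow> real"
  assumes "\<And>i j. a i j = a j i"
  shows "(\<Sum>i=1..d. \<Sum>j=1..d. a i j) = (\<Sum>i=1..d. a i i) + 2 * (\<Sum>i=1..d. \<Sum>j\<in>{i<..d}. a i j)"
proof -
  have "(\<Sum>j=1..d. a i j) = a i i + (\<Sum>j=1..d. if i < j then a i j else 0) + (\<Sum>j=1..d. if j < i then a i j else 0)"
    if "i \<in> {1..d}" for i
  proof -
    have "(\<Sum>j=1..d. a i j) = (\<Sum>j=1..d. (if j = i then a i i else 0) + (if i < j then a i j else 0) + (if j < i then a i j else 0))"
      by (intro sum.cong) auto
    then show ?thesis using that by (simp add: sum.distrib)
  qed
  then have "(\<Sum>i=1..d. \<Sum>j=1..d. a i j) = (\<Sum>i=1..d. a i i) + (\<Sum>i=1..d. \<Sum>j=1..d. if i < j then a i j else 0)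
      + (\<Sum>i=1..d. \<Sum>j=1..d. if j < i then a i j else 0)"
    by (simp add: sum.distrib)
  also have "(\<Sum>i=1..d. \<Sum>j=1..d. if j < i then a i j else 0) = (\<Sum>i=1..d. \<Sum>j=1..d. if i < j then a i j else 0)"
    by (subst sum.swap) (use assms in \<open>simp cong: if_cong\<close>)
  also have "(\<Sum>i=1..d. \<Sum>j=1..d. if i < j then a i j else 0) = (\<Sum>i=1..d. \<Sum>j\<in>{i<..d}. a i j)"
  proof (rule sum.cong[OF refl])
    fix i assume "i \<in> {1..d}"
    then have "{j \<in> {1..d}. i < j} = {i<..d}" by auto
    then show "(\<Sum>j=1..d. if i < j then a i j else 0) = (\<Sum>j\<in>{i<..d}. a i j)"
      by (simp flip: sum.inter_filter)
  qed
  finally show ?thesis by simp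
qed

lemma H1_square_product_integrable:
  assumes "f \<in> (H1 :: (real^'n \<Rightarrow> real) set)" "g \<in> H1"
  shows "integrable lebesgue (\<lambda>x. (f x)\<^sup>2 * (g x)\<^sup>2)"
    and "(LINT x|lebesgue. (f x)\<^sup>2 * (g x)\<^sup>2)\<^sup>2 \<le> (LINT x|lebesgue. (f x) ^ 4) * (LINT x|lebesgue. (g x) ^ 4)"
proof -
  have s: "square_integrable (\<lambda>x. (f x)\<^sup>2)" if "f \<in> H1" for f :: "real^'n \<Rightarrow> real"
    using H1_quartic_integrable[OF that] H1_measurable[OF that] by (simp add: square_integrable_def flip: power_mult)
  show "integrable lebesgue (\<lambda>x. (f x)\<^sup>2 * (g x)\<^sup>2)"
    using square_integrable_inner[OF s[OF assms(1)] s[OF assms(2)]] by simp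
  show "(LINT x|lebesgue. (f x)\<^sup>2 * (g x)\<^sup>2)\<^sup>2 \<le> (LINT x|lebesgue. (f x) ^ 4) * (LINT x|lebesgue. (g x) ^ 4)"
    using Cauchy_Schwarz_L2[OF s[OF assms(1)] s[OF assms(2)]] by (simp flip: power_mult)
qed

section \<open>The energy in terms of the two forms; critical points as weak solutions\<close>

lemma energy_eq:
  assumes u: "u \<in> V"
  shows "energy d lam mu (\<lambda>_ _. b) u = Q u / 2 - B u / 4"
proof -
  define a where "a = (\<lambda>i j. coup i j * (LINT x|lebesgue. (u i x)\<^sup>2 * (u j x)\<^sup>2))"
  have "B u = (\<Sum>i=1..d. \<Sum>j=1..d. a i j)"
  proof -
    have i: "integrable lebesgue (\<lambda>x. coup i j * ((u i x)\<^sup>2 * (u j x)\<^sup>2))" if "i \<in> {1..d}" "j \<in> {1..d}" for i j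
      by (intro integrable_mult_right H1_square_product_integrable(1) V_H1[OF u] that)
    have "B u = (\<Sum>i=1..d. LINT x|lebesgue. (\<Sum>j=1..d. coup i j * ((u i x)\<^sup>2 * (u j x)\<^sup>2)))"
      unfolding B_def quart_def by (intro Bochner_Integration.integral_sum Bochner_Integration.integrable_sum i)
    also have "\<dots> = (\<Sum>i=1..d. \<Sum>j=1..d. LINT x|lebesgue. coup i j * ((u i x)\<^sup>2 * (u j x)\<^sup>2))"
      by (intro sum.cong refl Bochner_Integration.integral_sum i)
    finally show ?thesis by (simp add: a_def)
  qed
  also have "\<dots> = (\<Sum>i=1..d. a i i) + 2 * (\<Sum>i=1..d. \<Sum>j\<in>{i<..d}. a i j)"
    by (rule sum_symmetric_split) (simp add: a_def coup_commute mult.commute)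
  also have "(\<Sum>i=1..d. a i i) = (\<Sum>i=1..d. mu i * (LINT x|lebesgue. (u i x) ^ 4))"
    by (simp add: a_def coup_def flip: power_add)
  also have "(\<Sum>i=1..d. \<Sum>j\<in>{i<..d}. a i j) = (\<Sum>i=1..d. \<Sum>j\<in>{i<..d}. b * (LINT x|lebesgue. (u i x)\<^sup>2 * (u j x)\<^sup>2))"
    by (intro sum.cong) (auto simp: a_def coup_def)
  finally have B: "B u = (\<Sum>i=1..d. mu i * (LINT x|lebesgue. (u i x) ^ 4))
     + 2 * (\<Sum>i=1..d. \<Sum>j\<in>{i<..d}. b * (LINT x|lebesgue. (u i x)\<^sup>2 * (u j x)\<^sup>2))" .
  have Q: "Q u = (\<Sum>i=1..d. LINT x|lebesgue. (norm (weak_grad (u i) x))\<^sup>2 + lam i * (u i x)\<^sup>2)"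
    unfolding Q_def ip_def power2_norm_eq_inner by (simp add: power2_eq_square)
  show ?thesis unfolding energy_def B Q by (simp add: field_simps)
qed

lemma norm_H1_vec_eq: "norm_H1_vec d (v :: nat \<Rightarrow> real^'n \<Rightarrow> real) = sqrt (\<Sum>i=1..d. ip 1 (v i) (v i))"
  unfolding norm_H1_vec_def ip_def power2_norm_eq_inner by (simp add: power2_eq_square)

lemma Q_le_norm: "\<exists>L>0. \<forall>v\<in>V. Q v \<le> L * (norm_H1_vec d v)\<^sup>2"
proof -
  \<comment> \<open>Critical points are defined with mass 1 in the norm, the Taylor remainder is
    bounded with masses \<open>lam i\<close>. The maximum covers the masses, the 1 covers the
    gradients, which have weight 1 in both.\<close>
  define L where "L = max 1 (Max (lam ` {1..d}))"
  have L: "1 \<le> L" "i \<in> {1..d} \<Longrightarrow> lam i \<le> L" for i by (auto simp: L_def intro: max.coboundedI2)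
  have "Q v \<le> L * (norm_H1_vec d v)\<^sup>2" if v: "v \<in> V" for v
  proof -
    have "(norm_H1_vec d v)\<^sup>2 = (\<Sum>i=1..d. ip 1 (v i) (v i))"
      by (simp add: norm_H1_vec_eq sum_nonneg ip_nonneg)
    moreover have "Q v \<le> (\<Sum>i=1..d. L * ip 1 (v i) (v i))"
      unfolding Q_def
    proof (rule sum_mono)
      fix i assume i: "i \<in> {1..d}"
      have nn: "(LINT x|lebesgue. (norm (weak_grad (v i) x))\<^sup>2) \<ge> 0" "(LINT x|lebesgue. (v i x)\<^sup>2) \<ge> 0"
        by (auto intro!: integral_nonneg_AE)
      have "1 * (LINT x|lebesgue. (norm (weak_grad (v i) x))\<^sup>2) \<le> L * (LINT x|lebesgue. (norm (weak_grad (v i) x))\<^sup>2)"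
        "lam i * (LINT x|lebesgue. (v i x)\<^sup>2) \<le> L * (LINT x|lebesgue. (v i x)\<^sup>2)"
        by (rule mult_right_mono[OF L(1) nn(1)], rule mult_right_mono[OF L(2)[OF i] nn(2)])
      then show "ip (lam i) (v i) (v i) \<le> L * ip 1 (v i) (v i)"
        by (simp add: ip_self[OF V_H1[OF v i]] distrib_left)
    qed
    ultimately show ?thesis by (simp add: sum_distrib_left)
  qed
  moreover have "L > 0" using L(1) by simp
  ultimately show ?thesis by blast
qed

text \<open>The system in weak form, tested with all of H1; \<open>single i\<close> isolates the
  i-th equation.\<close>

definition weak_solution :: "(nat \<Rightarrow> real^'n \<Rightarrow> real) \<Rightarrow> bool" where
  "weak_solution u \<longleftrightarrow> u \<in> V \<and> (\<forall>i\<in>{1..d}. \<forall>\<phi>\<in>H1. ip (lam i) (u i) \<phi> = T u (single i \<phi>))"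

lemma energy_expand:
  "\<exists>C>0. \<forall>u\<in>V. \<forall>v\<in>V. \<bar>energy d lam mu (\<lambda>_ _. b) (\<lambda>i x. u i x + v i x) - energy d lam mu (\<lambda>_ _. b) u
      - ((\<Sum>i=1..d. ip (lam i) (u i) (v i)) - T u v)\<bar> \<le> Q v + C * (Q u * Q v + (Q v)\<^sup>2)"
proof -
  obtain C where C: "C > 0" and exp: "\<And>u v w. u \<in> V \<Longrightarrow> v \<in> V \<Longrightarrow> (\<forall>i\<in>{1..d}. \<forall>x. w i x = u i x + v i x) \<Longrightarrow>
     \<bar>B w - B u - 4 * T u v\<bar> \<le> C * (Q u * Q v + (Q v)\<^sup>2)" using B_expand by blast
  have "\<bar>energy d lam mu (\<lambda>_ _. b) (\<lambda>i x. u i x + v i x) - energy d lam mu (\<lambda>_ _. b) u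
      - ((\<Sum>i=1..d. ip (lam i) (u i) (v i)) - T u v)\<bar> \<le> Q v + C * (Q u * Q v + (Q v)\<^sup>2)"
    if u: "u \<in> V" and v: "v \<in> V" for u v
  proof -
    define w where "w = (\<lambda>i x. u i x + v i x)"
    have wl: "w i = lc 1 (u i) 1 (v i)" for i by (simp add: w_def lc_def)
    have w: "w \<in> V" unfolding wl[abs_def] by (intro V_I H1_lc(1) V_H1[OF u] V_H1[OF v])
    have "Q w = (\<Sum>i=1..d. ip (lam i) (u i) (u i) + 2 * ip (lam i) (u i) (v i) + ip (lam i) (v i) (v i))"
      unfolding Q_def by (intro sum.cong) (simp_all add: wl ip_lc_self V_H1[OF u] V_H1[OF v])
    also have "\<dots> = Q u + 2 * (\<Sum>i=1..d. ip (lam i) (u i) (v i)) + Q v"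
      by (simp add: Q_def sum.distrib sum_distrib_left)
    finally have Qw: "Q w = Q u + 2 * (\<Sum>i=1..d. ip (lam i) (u i) (v i)) + Q v" .
    have e: "\<bar>B w - B u - 4 * T u v\<bar> \<le> C * (Q u * Q v + (Q v)\<^sup>2)"
      by (rule exp[OF u v]) (simp add: w_def)
    have nn: "0 \<le> C * (Q u * Q v + (Q v)\<^sup>2)" using C Q_nonneg by simp
    have "energy d lam mu (\<lambda>_ _. b) w - energy d lam mu (\<lambda>_ _. b) u - ((\<Sum>i=1..d. ip (lam i) (u i) (v i)) - T u v)
      = Q v / 2 - (B w - B u - 4 * T u v) / 4"
      unfolding energy_eq[OF u] energy_eq[OF w] Qw by (simp add: field_simps)
    moreover have "\<bar>X\<bar> \<le> q + P" if "X = q / 2 - E / 4" "\<bar>E\<bar> \<le> P" "0 \<le> P" "0 \<le> q" for X q E P :: real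
      using that by argo
    ultimately show ?thesis
      using e nn Q_nonneg[of v] unfolding w_def[symmetric] by blast
  qed
  with C show ?thesis by blast
qed

lemma weak_solution_critical:
  assumes "weak_solution u"
  shows "critical_point d (energy d lam mu (\<lambda>_ _. b)) u"
  unfolding critical_point_def
proof (intro conjI allI impI)
  show u: "u \<in> V" using assms by (simp add: weak_solution_def)
  fix \<epsilon> :: real assume \<epsilon>: "\<epsilon> > 0"
  obtain C where C: "C > 0" and exp: "\<And>u v. u \<in> V \<Longrightarrow> v \<in> V \<Longrightarrow>
     \<bar>energy d lam mu (\<lambda>_ _. b) (\<lambda>i x. u i x + v i x) - energy d lam mu (\<lambda>_ _. b) u
      - ((\<Sum>i=1..d. ip (lam i) (u i) (v i)) - T u v)\<bar> \<le> Q v + C * (Q u * Q v + (Q v)\<^sup>2)" using energy_expand by blast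
  obtain L where L: "L > 0" and QL: "\<And>v. v \<in> V \<Longrightarrow> Q v \<le> L * (norm_H1_vec d v)\<^sup>2" using Q_le_norm by blast
  \<comment> \<open>For \<open>v\<close> of norm at most 1, the Taylor remainder is at most
    \<open>D\<close> times the square of the norm.\<close>
  define D where "D = L + C * (Q u * L + L\<^sup>2)"
  have D: "D > 0" unfolding D_def using L C Q_nonneg[of u] by (intro add_pos_nonneg) auto
  define \<delta> where "\<delta> = min 1 (\<epsilon> / D)"
  have \<delta>: "\<delta> > 0" using D \<epsilon> by (simp add: \<delta>_def)
  have "\<bar>energy d lam mu (\<lambda>_ _. b) (\<lambda>i x. u i x + v i x) - energy d lam mu (\<lambda>_ _. b) u\<bar> \<le> \<epsilon> * norm_H1_vec d v"
    if v: "v \<in> V" and n: "norm_H1_vec d v < \<delta>" for v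
  proof -
    define n where "n = norm_H1_vec d v"
    have n0: "n \<ge> 0" unfolding n_def norm_H1_vec_eq by (simp add: sum_nonneg ip_nonneg)
    have n1: "n \<le> 1" "n \<le> \<epsilon> / D" using n by (auto simp: n_def \<delta>_def)
    have n2: "n\<^sup>2 \<le> 1" using n0 n1 by (simp add: power_le_one)
    have q: "Q v \<le> L * n\<^sup>2" using QL[OF v] by (simp add: n_def)
    have "(Q v)\<^sup>2 \<le> (L * n\<^sup>2)\<^sup>2" by (intro power_mono q Q_nonneg)
    also have "\<dots> = L\<^sup>2 * (n\<^sup>2 * n\<^sup>2)"
      by (simp only: power_mult_distrib power2_eq_square[of "n\<^sup>2"])
    also have "\<dots> \<le> L\<^sup>2 * n\<^sup>2"
      using mult_right_mono[OF n2, of "n\<^sup>2"] by (intro mult_left_mono) auto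
    finally have q2: "(Q v)\<^sup>2 \<le> L\<^sup>2 * n\<^sup>2" .
    have "T u v = (\<Sum>i=1..d. ip (lam i) (u i) (v i))"
      unfolding T_single_sum[OF u v] using assms V_H1[OF v] by (intro sum.cong) (auto simp: weak_solution_def)
    then have "\<bar>energy d lam mu (\<lambda>_ _. b) (\<lambda>i x. u i x + v i x) - energy d lam mu (\<lambda>_ _. b) u\<bar> \<le> Q v + C * (Q u * Q v + (Q v)\<^sup>2)"
      using exp[OF u v] by simp
    also have "\<dots> \<le> L * n\<^sup>2 + C * (Q u * (L * n\<^sup>2) + L\<^sup>2 * n\<^sup>2)"
      using C Q_nonneg[of u] by (intro add_mono mult_left_mono q q2) auto
    also have "\<dots> = D * n * n" by (simp add: D_def power2_eq_square algebra_simps)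
    also have "\<dots> \<le> \<epsilon> * n"
      using n1(2) D n0 by (intro mult_right_mono) (simp_all add: field_simps)
    finally show ?thesis by (simp add: n_def)
  qed
  with \<delta> show "\<exists>\<delta>>0. \<forall>v\<in>V. norm_H1_vec d v < \<delta> \<longrightarrow>
      \<bar>energy d lam mu (\<lambda>_ _. b) (\<lambda>i x. u i x + v i x) - energy d lam mu (\<lambda>_ _. b) u\<bar> \<le> \<epsilon> * norm_H1_vec d v" by blast
qed

lemma ip_scale: "\<phi> \<in> H1 \<Longrightarrow> \<psi> \<in> H1 \<Longrightarrow> ip c \<psi> (\<lambda>x. t * \<phi> x) = t * ip c \<psi> (\<phi> :: real^'n \<Rightarrow> real)"
  "\<phi> \<in> H1 \<Longrightarrow> ip c (\<lambda>x. t * \<phi> x) (\<lambda>x. t * \<phi> x) = t\<^sup>2 * ip c \<phi> \<phi>"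
  "\<phi> \<in> H1 \<Longrightarrow> (\<lambda>x. t * \<phi> x) \<in> H1"
proof -
  have e: "(\<lambda>x. t * \<phi> x) = lc t \<phi> 0 \<phi>" by (simp add: lc_def)
  show "\<phi> \<in> H1 \<Longrightarrow> \<psi> \<in> H1 \<Longrightarrow> ip c \<psi> (\<lambda>x. t * \<phi> x) = t * ip c \<psi> (\<phi> :: real^'n \<Rightarrow> real)"
    unfolding e by (simp add: ip_lc_right)
  show "\<phi> \<in> H1 \<Longrightarrow> ip c (\<lambda>x. t * \<phi> x) (\<lambda>x. t * \<phi> x) = t\<^sup>2 * ip c \<phi> \<phi>"
    unfolding e by (simp add: ip_lc_self)
  show "\<phi> \<in> H1 \<Longrightarrow> (\<lambda>x. t * \<phi> x) \<in> H1"
    unfolding e by (rule H1_lc(1))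
qed

lemma tri_scale_right: "tri x (\<lambda>i. t * y i) = t * tri x y"
  by (simp add: tri_def sum_distrib_left mult_ac)

text \<open>The definition of a critical point is applied along the ray \<open>t * \<phi>\<close> in
  one component. The defect \<open>A\<close> of the equation is the linear coefficient there, and
  dividing by \<open>t\<close> leaves it smaller than any positive number.\<close>

lemma critical_weak_solution:
  assumes crit: "critical_point d (energy d lam mu (\<lambda>_ _. b)) u"
  shows "weak_solution u"
  unfolding weak_solution_def
proof (intro conjI ballI)
  show u: "u \<in> V" using crit by (simp add: critical_point_def)
  fix i and \<phi> :: "real^'n \<Rightarrow> real" assume i: "i \<in> {1..d}" and \<phi>: "\<phi> \<in> H1"
  obtain C where C: "C > 0" and exp: "\<And>u v. u \<in> V \<Longrightarrow> v \<in> V \<Longrightarrow>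
     \<bar>energy d lam mu (\<lambda>_ _. b) (\<lambda>i x. u i x + v i x) - energy d lam mu (\<lambda>_ _. b) u
      - ((\<Sum>i=1..d. ip (lam i) (u i) (v i)) - T u v)\<bar> \<le> Q v + C * (Q u * Q v + (Q v)\<^sup>2)" using energy_expand by blast
  define A where "A = ip (lam i) (u i) \<phi> - T u (single i \<phi>)"
  define q where "q = ip (lam i) \<phi> \<phi>"
  define n where "n = sqrt (ip 1 \<phi> \<phi>)"
  have q0: "q \<ge> 0" unfolding q_def using lam_pos[OF i] by (intro ip_nonneg) simp
  have n0: "n \<ge> 0" by (simp add: n_def ip_nonneg)
  define D where "D = q + C * (Q u * q + q\<^sup>2)"
  have D: "D \<ge> 0" unfolding D_def using q0 C Q_nonneg[of u] by (intro add_nonneg_nonneg mult_nonneg_nonneg) auto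
  have main: "t * \<bar>A\<bar> \<le> \<epsilon> * (t * n) + D * t\<^sup>2"
    if t: "0 < t" "t \<le> 1" and bound: "\<bar>energy d lam mu (\<lambda>_ _. b) (\<lambda>k x. u k x + single i (\<lambda>x. t * \<phi> x) k x) - energy d lam mu (\<lambda>_ _. b) u\<bar> \<le> \<epsilon> * (t * n)"
    for t \<epsilon>
  proof -
    define v where "v = single i (\<lambda>x. t * \<phi> x)"
    have v: "v \<in> V" unfolding v_def by (intro single_V ip_scale(3) \<phi>)
    have Qv: "Q v = t\<^sup>2 * q" by (simp add: v_def Q_single[OF i] ip_scale(2)[OF \<phi>] q_def)
    have "(\<Sum>k=1..d. ip (lam k) (u k) (v k)) = (\<Sum>k=1..d. if k = i then t * ip (lam i) (u i) \<phi> else 0)"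
      by (intro sum.cong) (auto simp: v_def single_def ip_zero_right ip_scale(1)[OF \<phi> V_H1[OF u i]])
    also have "\<dots> = t * ip (lam i) (u i) \<phi>" using i by simp
    finally have 1: "(\<Sum>k=1..d. ip (lam k) (u k) (v k)) = t * ip (lam i) (u i) \<phi>" .
    have "at_pt v x = (\<lambda>k. t * at_pt (single i \<phi>) x k)" for x
      by (auto simp: v_def single_def)
    then have 2: "T u v = t * T u (single i \<phi>)" by (simp add: T_def tri_scale_right)
    have "\<bar>energy d lam mu (\<lambda>_ _. b) (\<lambda>k x. u k x + v k x) - energy d lam mu (\<lambda>_ _. b) u - t * A\<bar> \<le> Q v + C * (Q u * Q v + (Q v)\<^sup>2)"
      using exp[OF u v] unfolding 1 2 A_def by (simp add: right_diff_distrib)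
    moreover have "(Q v)\<^sup>2 \<le> t\<^sup>2 * q\<^sup>2"
    proof -
      have "t\<^sup>2 \<le> 1" using t by (simp add: power_le_one)
      then have "t\<^sup>2 * (t\<^sup>2 * q\<^sup>2) \<le> 1 * (t\<^sup>2 * q\<^sup>2)" by (intro mult_right_mono) auto
      then show ?thesis unfolding Qv by (simp add: power_mult_distrib power2_eq_square[of "t\<^sup>2"] mult.assoc)
    qed
    then have "Q v + C * (Q u * Q v + (Q v)\<^sup>2) \<le> t\<^sup>2 * q + C * (Q u * (t\<^sup>2 * q) + t\<^sup>2 * q\<^sup>2)"
      using C by (simp add: Qv)
    moreover have "t\<^sup>2 * q + C * (Q u * (t\<^sup>2 * q) + t\<^sup>2 * q\<^sup>2) = D * t\<^sup>2"
      by (simp add: D_def algebra_simps)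
    ultimately have "\<bar>t * A\<bar> \<le> \<epsilon> * (t * n) + D * t\<^sup>2"
      using bound unfolding v_def[symmetric] by linarith
    then show ?thesis using t by (simp add: abs_mult)
  qed
  have "\<bar>A\<bar> \<le> e" if e: "e > 0" for e
  proof -
    define \<epsilon> where "\<epsilon> = e / (2 * (n + 1))"
    have \<epsilon>: "\<epsilon> > 0" "\<epsilon> * n \<le> e / 2" using e n0 by (auto simp: \<epsilon>_def field_simps)
    obtain \<delta> where \<delta>: "\<delta> > 0" and cr: "\<And>v. v \<in> V \<Longrightarrow> norm_H1_vec d v < \<delta> \<Longrightarrow>
        \<bar>energy d lam mu (\<lambda>_ _. b) (\<lambda>i x. u i x + v i x) - energy d lam mu (\<lambda>_ _. b) u\<bar> \<le> \<epsilon> * norm_H1_vec d v"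
      using crit \<epsilon>(1) unfolding critical_point_def by blast
    \<comment> \<open>Small enough that the increment stays within \<open>\<delta>\<close> and that
      the quadratic term costs at most half of \<open>e\<close>; adding 1 keeps the denominators
      positive.\<close>
    define t where "t = min (min 1 (\<delta> / (2 * (n + 1)))) (e / (2 * (D + 1)))"
    have t: "0 < t" "t \<le> 1" "t \<le> \<delta> / (2 * (n + 1))" "t \<le> e / (2 * (D + 1))"
      using \<delta> e n0 D by (auto simp: t_def)
    have tn: "t * n < \<delta>"
    proof -
      have "t * (2 * (n + 1)) \<le> \<delta>" using t(3) n0 by (simp add: pos_le_divide_eq)
      moreover have "t * (2 * (n + 1)) = 2 * (t * n) + 2 * t" by (simp add: algebra_simps)
      moreover have "t * n \<ge> 0" using t n0 by simp
      ultimately show ?thesis using t(1) by linarith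
    qed
    have tD: "D * t \<le> e / 2"
    proof -
      have "t * (2 * (D + 1)) \<le> e" using t(4) D by (simp add: pos_le_divide_eq)
      moreover have "t * (2 * (D + 1)) = 2 * (D * t) + 2 * t" by (simp add: algebra_simps)
      ultimately show ?thesis using t(1) by linarith
    qed
    define v where "v = single i (\<lambda>x. t * \<phi> x)"
    have v: "v \<in> V" unfolding v_def by (intro single_V ip_scale(3) \<phi>)
    have "(\<Sum>k=1..d. ip 1 (v k) (v k)) = (\<Sum>k=1..d. if k = i then t\<^sup>2 * ip 1 \<phi> \<phi> else 0)"
      by (intro sum.cong) (auto simp: v_def single_def ip_zero_right ip_scale(2)[OF \<phi>])
    also have "\<dots> = t\<^sup>2 * ip 1 \<phi> \<phi>" using i by simp
    finally have nv: "norm_H1_vec d v = t * n"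
      using t(1) by (simp add: norm_H1_vec_eq n_def real_sqrt_mult)
    have "t * \<bar>A\<bar> \<le> \<epsilon> * (t * n) + D * t\<^sup>2"
      using main[OF t(1,2), of \<epsilon>, folded v_def] cr[OF v, unfolded nv, OF tn] by blast
    also have "\<dots> = t * (\<epsilon> * n + D * t)" by (simp add: power2_eq_square algebra_simps)
    finally have "\<bar>A\<bar> \<le> \<epsilon> * n + D * t" using t(1) by simp
    then show ?thesis using \<epsilon>(2) tD by linarith
  qed
  then have "\<bar>A\<bar> \<le> 0" using dense_le[of "0::real"] field_le_epsilon[of "\<bar>A\<bar>" 0] by simp
  then show "ip (lam i) (u i) \<phi> = T u (single i \<phi>)" by (simp add: A_def)
qed

text \<open>Testing every equation with its own component and summing gives the Nehari
  identity.\<close>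

lemma weak_solution_energy:
  assumes "weak_solution u"
  shows "Q u = B u" "energy d lam mu (\<lambda>_ _. b) u = Q u / 4"
proof -
  have u: "u \<in> V" using assms by (simp add: weak_solution_def)
  have "B u = (\<Sum>i=1..d. T u (single i (u i)))"
    unfolding T_self[symmetric] by (rule T_single_sum[OF u u])
  also have "\<dots> = Q u"
    unfolding Q_def using assms V_H1[OF u] by (intro sum.cong) (auto simp: weak_solution_def)
  finally show "Q u = B u" by simp
  then show "energy d lam mu (\<lambda>_ _. b) u = Q u / 4" by (simp add: energy_eq[OF u])
qed

end

subsection \<open>Minimizing sequences\<close>

lemma avg_shift:
  fixes u :: "real^'n::finite \<Rightarrow> real"
  assumes "locally_integrable u"
  shows "avg l (shift a u) x = avg l u (x + a)"
proof -
  define F where "F = (\<lambda>y. indicat_real (cbox (x + a) (x + a + l *\<^sub>R One)) y *\<^sub>R u y)"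
  have F: "F \<in> borel_measurable lebesgue"
    using locally_integrable_cbox[OF assms, of "x + a" "x + a + l *\<^sub>R One"]
    unfolding F_def set_integrable_def by (rule borel_measurable_integrable)
  have "indicat_real (cbox x (x + l *\<^sub>R One)) y = indicat_real (cbox (x + a) (x + a + l *\<^sub>R One)) (1 *\<^sub>R y + a)" for y
    by (auto simp: indicator_def mem_box_cart algebra_simps)
  then have "(LINT y:cbox x (x + l *\<^sub>R One)|lebesgue. shift a u y) = (LINT y|lebesgue. F (1 *\<^sub>R y + a))"
    by (simp add: set_lebesgue_integral_def F_def shift_def)
  also have "\<dots> = (LINT y|lebesgue. F y)"
    using lebesgue_affine_integral(3)[OF _ F, of 1 a] by simp
  finally show ?thesis by (simp add: avg_def F_def set_lebesgue_integral_def)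
qed

context cubic_system
begin

section \<open>Homogeneity, translation invariance and the minimization problem\<close>

definition P :: "(nat \<Rightarrow> real^'n \<Rightarrow> real) \<Rightarrow> (nat \<Rightarrow> real^'n \<Rightarrow> real) \<Rightarrow> real" where
  "P u v = (\<Sum>i=1..d. ip (lam i) (u i) (v i))"

lemma V_add_scaled: "u \<in> V \<Longrightarrow> v \<in> V \<Longrightarrow> (\<lambda>i x. u i x + t * v i x) \<in> V"
proof -
  assume uv: "u \<in> V" "v \<in> V"
  have e: "(\<lambda>x. u i x + t * v i x) = lc 1 (u i) t (v i)" for i by (simp add: lc_def)
  show ?thesis unfolding e by (intro V_I H1_lc(1) V_H1[OF uv(1)] V_H1[OF uv(2)])
qed

lemma Q_add_scaled:
  assumes u: "u \<in> V" and v: "v \<in> V"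
  shows "Q (\<lambda>i x. u i x + t * v i x) = Q u + 2 * t * P u v + t\<^sup>2 * Q v"
proof -
  have "(\<lambda>x. u i x + t * v i x) = lc 1 (u i) t (v i)" for i by (simp add: lc_def)
  then have "Q (\<lambda>i x. u i x + t * v i x)
      = (\<Sum>i=1..d. ip (lam i) (u i) (u i) + 2 * t * ip (lam i) (u i) (v i) + t\<^sup>2 * ip (lam i) (v i) (v i))"
    unfolding Q_def by (intro sum.cong refl) (simp add: ip_lc_self V_H1[OF u] V_H1[OF v])
  then show ?thesis by (simp add: Q_def P_def sum.distrib sum_distrib_left)
qed

lemma P_Cauchy_Schwarz:
  assumes "u \<in> V" "v \<in> V"
  shows "(P u v)\<^sup>2 \<le> Q u * Q v"
proof (rule quadratic_nonneg_imp)
  fix t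
  show "0 \<le> Q u + 2 * t * P u v + t\<^sup>2 * Q v"
    using Q_nonneg[of "\<lambda>i x. u i x + t * v i x"] unfolding Q_add_scaled[OF assms] .
qed

lemma V_scale: "u \<in> V \<Longrightarrow> (\<lambda>i x. s * u i x) \<in> V"
  by (rule V_I, rule ip_scale(3), rule V_H1)

lemma Q_scale: "u \<in> V \<Longrightarrow> Q (\<lambda>i x. s * u i x) = s\<^sup>2 * Q u"
  unfolding Q_def sum_distrib_left by (rule sum.cong, rule refl, rule ip_scale(2), rule V_H1)

lemma B_scale: "B (\<lambda>i x. s * u i x) = s ^ 4 * B u"
proof -
  have "quart (\<lambda>i. s * x i) = s ^ 4 * quart x" for x
    unfolding quart_def by (simp add: sum_distrib_left power_mult_distrib power4_eq_xxxx power2_eq_square mult_ac)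
  then show ?thesis by (simp add: B_def)
qed

lemma T_scale_left: "T (\<lambda>i x. s * u i x) v = s ^ 3 * T u v"
proof -
  have "tri (\<lambda>i. s * x i) y = s ^ 3 * tri x y" for x y
    unfolding tri_def by (simp add: sum_distrib_left power_mult_distrib power3_eq_cube power2_eq_square mult_ac)
  then show ?thesis by (simp add: T_def)
qed

lemma T_scale_right: "T u (\<lambda>i x. t * v i x) = t * T u v"
  by (simp add: T_def tri_scale_right)

lemma V_shift: "u \<in> V \<Longrightarrow> (\<lambda>i. shift a (u i)) \<in> V"
  by (rule V_I, rule shift_H1, rule V_H1)

lemma ip_shift: "u \<in> H1 \<Longrightarrow> ip c (shift a u) (shift a u) = ip c u (u :: real^'n \<Rightarrow> real)"
  unfolding shift_def by (subst ip_affine_self) (auto simp: ip_self)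

lemma Q_shift: "u \<in> V \<Longrightarrow> Q (\<lambda>i. shift a (u i)) = Q u"
  unfolding Q_def by (rule sum.cong, rule refl, rule ip_shift, rule V_H1)

lemma B_shift:
  assumes "u \<in> V"
  shows "B (\<lambda>i. shift a (u i)) = B u"
  using lebesgue_affine_integral(3)[OF _ quart_measurable[OF assms], of 1 a] by (simp add: B_def shift_def)

lemma lam_min: "\<exists>c>0. \<forall>i\<in>{1..d}. c \<le> lam i"
  using lam_pos d_pos by (intro exI[of _ "Min (lam ` {1..d})"]) auto

lemma L2_le_Q: "\<exists>C>0. \<forall>u\<in>V. \<forall>i\<in>{1..d}. (LINT x|lebesgue. (u i x)\<^sup>2) \<le> C * Q u"
proof -
  obtain c where c: "c > 0" "\<And>i. i \<in> {1..d} \<Longrightarrow> c \<le> lam i" using lam_min by blast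
  have "(LINT x|lebesgue. (u i x)\<^sup>2) \<le> (1 / c) * Q u" if u: "u \<in> V" and i: "i \<in> {1..d}" for u i
  proof -
    have nn: "(LINT x|lebesgue. (norm (weak_grad (u i) x))\<^sup>2) \<ge> 0" "(LINT x|lebesgue. (u i x)\<^sup>2) \<ge> 0"
      by (auto intro!: integral_nonneg_AE)
    have "c * (LINT x|lebesgue. (u i x)\<^sup>2) \<le> lam i * (LINT x|lebesgue. (u i x)\<^sup>2)"
      by (rule mult_right_mono[OF c(2)[OF i] nn(2)])
    also have "\<dots> \<le> Q u" using ip_le_Q[OF i, of u] nn(1) unfolding ip_self[OF V_H1[OF u i]] by linarith
    finally show ?thesis using c(1) by (simp add: field_simps)
  qed
  with c(1) show ?thesis by (intro exI[of _ "1 / c"]) auto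
qed

lemma grad_le_Q:
  assumes u: "u \<in> V" and i: "i \<in> {1..d}"
  shows "(LINT x|lebesgue. (norm (weak_grad (u i) x))\<^sup>2) \<le> Q u"
proof -
  have "lam i * (LINT x|lebesgue. (u i x)\<^sup>2) \<ge> 0"
    using lam_pos[OF i] by (intro mult_nonneg_nonneg) (auto intro!: integral_nonneg_AE)
  then show ?thesis using ip_le_Q[OF i, of u] by (simp add: ip_self[OF V_H1[OF u i]])
qed

text \<open>Numerator and denominator are both homogeneous of degree four, so a minimizing sequence
  can be normalized to \<open>B u = 1\<close>.\<close>

definition ground_quotient :: real where
  "ground_quotient = Inf {(Q u)\<^sup>2 / B u |u. u \<in> V \<and> B u > 0}"

lemma B_le_Q: "\<exists>K>0. \<forall>u\<in>V. B u \<le> K * (Q u)\<^sup>2"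
proof -
  obtain K where K: "K > 0" "\<And>u. u \<in> V \<Longrightarrow> S4 u \<le> K * (Q u)\<^sup>2" using S4_bound by blast
  have "B u \<le> (b * K) * (Q u)\<^sup>2" if "u \<in> V" for u
    using order_trans[OF B_le[OF that] mult_left_mono[OF K(2)[OF that], of b]] b_pos by (simp add: mult.assoc)
  then show ?thesis using K(1) b_pos by (intro exI[of _ "b * K"]) auto
qed

lemma ground_quotient_le:
  assumes "u \<in> V"
  shows "ground_quotient * B u \<le> (Q u)\<^sup>2"
proof (cases "B u > 0")
  case True
  have "ground_quotient \<le> (Q u)\<^sup>2 / B u"
    unfolding ground_quotient_def
    by (rule cInf_lower) (use assms True in \<open>auto intro!: bdd_belowI[of _ 0]\<close>)
  then show ?thesis using True by (simp add: field_simps)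
next
  case False
  then have "B u = 0" using B_nonneg[of u] by simp
  then show ?thesis by simp
qed

lemma ground_quotient_pos:
  assumes "\<Psi> \<in> V" "B \<Psi> > 0"
  shows "ground_quotient > 0"
proof -
  obtain K where K: "K > 0" "\<And>u. u \<in> V \<Longrightarrow> B u \<le> K * (Q u)\<^sup>2" using B_le_Q by blast
  have "1 / K \<le> ground_quotient"
    unfolding ground_quotient_def
  proof (rule cInf_greatest)
    show "{(Q u)\<^sup>2 / B u |u. u \<in> V \<and> B u > 0} \<noteq> {}" using assms by auto
    fix y assume "y \<in> {(Q u)\<^sup>2 / B u |u. u \<in> V \<and> B u > 0}"
    then obtain u where u: "u \<in> V" "B u > 0" "y = (Q u)\<^sup>2 / B u" by auto
    have "1 / K * B u \<le> (Q u)\<^sup>2"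
      using K(1) K(2)[OF u(1)] by (simp add: pos_divide_le_eq mult.commute)
    then show "1 / K \<le> y" unfolding u(3) pos_le_divide_eq[OF u(2)] .
  qed
  then show ?thesis using K(1) by (meson divide_pos_pos less_le_trans zero_less_one)
qed

lemma minimizing_sequence:
  assumes "\<Psi> \<in> V" "B \<Psi> > 0"
  obtains u where "\<And>n::nat. u n \<in> V" "\<And>n. B (u n) = 1" "\<And>n. (Q (u n))\<^sup>2 \<le> ground_quotient + 1 / real (Suc n)"
proof -
  have "\<exists>u\<in>V. B u = 1 \<and> (Q u)\<^sup>2 \<le> ground_quotient + 1 / real (Suc n)" for n
  proof -
    have "\<exists>y\<in>{(Q u)\<^sup>2 / B u |u. u \<in> V \<and> B u > 0}. y < ground_quotient + 1 / real (Suc n)"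
      unfolding ground_quotient_def by (rule cInf_lessD) (use assms in auto)
    then obtain u where u: "u \<in> V" "B u > 0" "(Q u)\<^sup>2 / B u < ground_quotient + 1 / real (Suc n)" by blast
    define s where "s = 1 / root 4 (B u)"
    have s4: "s ^ 4 = 1 / B u" using u(2) by (simp add: s_def power_divide)
    have "B (\<lambda>i x. s * u i x) = 1" using u(2) by (simp add: B_scale s4)
    moreover have "(Q (\<lambda>i x. s * u i x))\<^sup>2 = (Q u)\<^sup>2 / B u"
      by (simp add: Q_scale[OF u(1)] power_mult_distrib s4 flip: power_mult)
    ultimately show ?thesis using V_scale[OF u(1), of s] u(3) by (intro bexI[of _ "\<lambda>i x. s * u i x"]) auto
  qed
  then show thesis using that by metis
qed

text \<open>
  Since \<open>Q\<^sup>2 - ground_quotient * B\<close> is nonnegative and almost zero along a minimizing sequence,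
  its first variation tends to zero: no separate construction of a Palais-Smale sequence is needed.
\<close>

lemma first_variation_tendsto_0:
  assumes u: "\<And>n::nat. u n \<in> V" and B1: "\<And>n. B (u n) = 1"
    and Qn: "\<And>n. (Q (u n))\<^sup>2 \<le> ground_quotient + 1 / real (Suc n)"
    and v: "v \<in> V" and M0: "ground_quotient \<ge> 0"
  shows "(\<lambda>n. Q (u n) * P (u n) v - ground_quotient * T (u n) v) \<longlonglongrightarrow> 0"
proof -
  define M where "M = ground_quotient"
  obtain C where C: "C > 0" and exp: "\<And>u v w. u \<in> V \<Longrightarrow> v \<in> V \<Longrightarrow> (\<forall>i\<in>{1..d}. \<forall>x. w i x = u i x + v i x) \<Longrightarrow>
     \<bar>B w - B u - 4 * T u v\<bar> \<le> C * (Q u * Q v + (Q v)\<^sup>2)" using B_expand by blast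
  define R where "R = sqrt (M + 1)"
  have QR: "Q (u n) \<le> R" for n
  proof -
    have "1 / real (Suc n) \<le> 1" by simp
    then have "(Q (u n))\<^sup>2 \<le> M + 1" using Qn[of n] unfolding M_def by linarith
    then show ?thesis unfolding R_def by (rule real_le_rsqrt)
  qed
  have R: "R \<ge> 0" using QR[of 0] Q_nonneg[of "u 0"] by simp
  define r where "r = Q v"
  have r: "r \<ge> 0" by (simp add: r_def Q_nonneg)
  \<comment> \<open>Bound on the coefficient of \<open>t\<^sup>2\<close> for
    \<open>\<bar>t\<bar>\<close> at most 1, uniform in \<open>n\<close>.\<close>
  define D where "D = 6 * R * r + 4 * (1 + R * r) * r + r\<^sup>2 + M * (C * (R * r + r\<^sup>2))"
  have D: "D \<ge> 0" unfolding D_def using R r C M0 by (simp add: M_def)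
  define X where "X = (\<lambda>n. Q (u n) * P (u n) v - M * T (u n) v)"
  \<comment> \<open>Comparison of \<open>u n + t v\<close> with the infimum, ordered by powers of
    \<open>t\<close>: the constant term is the defect of \<open>u n\<close>, the linear coefficient
    is \<open>4 * X n\<close>.\<close>
  have main: "0 \<le> 1 / real (Suc n) + 4 * t * X n + t\<^sup>2 * D" if t: "\<bar>t\<bar> \<le> 1" for n t
  proof -
    define q p where "q = Q (u n)" and "p = P (u n) v"
    define w where "w = (\<lambda>i x. u n i x + t * v i x)"
    have q: "0 \<le> q" "q \<le> R" by (simp_all add: q_def QR Q_nonneg)
    have t2: "t\<^sup>2 \<le> 1" using t by (simp add: abs_square_le_1)
    have pp: "p\<^sup>2 \<le> R * r"
      using P_Cauchy_Schwarz[OF u v, of n] q(2) r mult_right_mono[of q R r] by (simp add: q_def p_def r_def)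
    have absp: "\<bar>p\<bar> \<le> 1 + R * r"
      using sum_squares_bound[of "\<bar>p\<bar>" 1] pp abs_ge_zero[of p] by simp
    have "\<bar>B w - B (u n) - 4 * T (u n) (\<lambda>i x. t * v i x)\<bar> \<le> C * (Q (u n) * Q (\<lambda>i x. t * v i x) + (Q (\<lambda>i x. t * v i x))\<^sup>2)"
      by (rule exp[OF u V_scale[OF v]]) (simp add: w_def)
    also have "\<dots> = C * (q * (t\<^sup>2 * r) + (t\<^sup>2 * r)\<^sup>2)"
      by (simp add: Q_scale[OF v] q_def r_def)
    also have "\<dots> \<le> C * (R * (t\<^sup>2 * r) + t\<^sup>2 * r\<^sup>2)"
    proof (intro mult_left_mono add_mono mult_right_mono q)
      show "(t\<^sup>2 * r)\<^sup>2 \<le> t\<^sup>2 * r\<^sup>2"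
        using mult_right_mono[OF t2, of "t\<^sup>2 * r\<^sup>2"] by (simp add: power_mult_distrib power2_eq_square[of "t\<^sup>2"] mult.assoc)
    qed (use C r in auto)
    also have "\<dots> = t\<^sup>2 * (C * (R * r + r\<^sup>2))" by (simp add: algebra_simps)
    finally have "\<bar>B w - 1 - 4 * t * T (u n) v\<bar> \<le> t\<^sup>2 * (C * (R * r + r\<^sup>2))"
      by (simp add: B1 T_scale_right mult.assoc)
    then have Bw: "1 + 4 * t * T (u n) v - t\<^sup>2 * (C * (R * r + r\<^sup>2)) \<le> B w" by linarith
    have wV: "w \<in> V" unfolding w_def by (rule V_add_scaled[OF u v])
    have "M * (1 + 4 * t * T (u n) v - t\<^sup>2 * (C * (R * r + r\<^sup>2))) \<le> M * B w"
      using Bw M0 by (intro mult_left_mono) (auto simp: M_def)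
    also have "\<dots> \<le> (Q w)\<^sup>2" unfolding M_def by (rule ground_quotient_le[OF wV])
    also have "Q w = q + 2 * t * p + t\<^sup>2 * r"
      unfolding w_def q_def p_def r_def by (rule Q_add_scaled[OF u v])
    also have "(q + 2 * t * p + t\<^sup>2 * r)\<^sup>2 = q\<^sup>2 + 4 * t * (q * p) + t\<^sup>2 * (4 * p\<^sup>2 + 2 * q * r + 4 * (t * p) * r + t\<^sup>2 * r\<^sup>2)"
      by (simp add: power2_eq_square algebra_simps)
    also have "\<dots> \<le> (M + 1 / real (Suc n)) + 4 * t * (q * p) + t\<^sup>2 * (4 * (R * r) + 2 * R * r + 4 * (1 + R * r) * r + r\<^sup>2)"
    proof -
      have "\<bar>t * p\<bar> \<le> 1 * (1 + R * r)" unfolding abs_mult using t absp by (intro mult_mono) auto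
      then have "t * p \<le> 1 + R * r" by simp
      then have "4 * (t * p) * r \<le> 4 * (1 + R * r) * r" using r by (intro mult_right_mono) auto
      moreover have "2 * q * r \<le> 2 * R * r" using q r by (simp add: mult_right_mono)
      moreover have "t\<^sup>2 * r\<^sup>2 \<le> r\<^sup>2" using mult_right_mono[OF t2, of "r\<^sup>2"] by simp
      ultimately have "4 * p\<^sup>2 + 2 * q * r + 4 * (t * p) * r + t\<^sup>2 * r\<^sup>2 \<le> 4 * (R * r) + 2 * R * r + 4 * (1 + R * r) * r + r\<^sup>2"
        using pp by linarith
      from mult_left_mono[OF this, of "t\<^sup>2"] have "t\<^sup>2 * (4 * p\<^sup>2 + 2 * q * r + 4 * (t * p) * r + t\<^sup>2 * r\<^sup>2)
          \<le> t\<^sup>2 * (4 * (R * r) + 2 * R * r + 4 * (1 + R * r) * r + r\<^sup>2)" by simp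
      moreover have "q\<^sup>2 \<le> M + 1 / real (Suc n)" using Qn[of n] by (simp only: q_def M_def)
      ultimately show ?thesis by (intro add_mono order.refl)
    qed
    finally have "M * (1 + 4 * t * T (u n) v - t\<^sup>2 * (C * (R * r + r\<^sup>2)))
      \<le> (M + 1 / real (Suc n)) + 4 * t * (q * p) + t\<^sup>2 * (4 * (R * r) + 2 * R * r + 4 * (1 + R * r) * r + r\<^sup>2)" .
    then have "0 \<le> 1 / real (Suc n) + 4 * t * (q * p - M * T (u n) v)
      + t\<^sup>2 * (6 * R * r + 4 * (1 + R * r) * r + r\<^sup>2 + M * (C * (R * r + r\<^sup>2)))"
      by (simp add: algebra_simps)
    then show ?thesis by (simp add: X_def D_def q_def p_def)
  qed
  have "X \<longlonglongrightarrow> 0"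
  proof (rule LIMSEQ_I)
    fix e :: real assume e: "e > 0"
    \<comment> \<open>Makes the quadratic term at most \<open>t * e\<close>; for large
      \<open>n\<close> the defect is below \<open>t * e\<close> as well. Using both \<open>t\<close>
      and \<open>-t\<close> then bounds \<open>X n\<close> on both sides.\<close>
    define t where "t = min 1 (e / (D + 1))"
    have t: "0 < t" "t \<le> 1" using e D by (auto simp: t_def)
    have "t * (D + 1) \<le> e" using D by (simp add: t_def min_le_iff_disj flip: pos_le_divide_eq)
    then have tD: "t * D \<le> e" using t by (simp add: distrib_left)
    obtain N where N: "1 / real (Suc N) < t * e" using nat_approx_posE[of "t * e"] t e by (metis inverse_eq_divide mult_pos_pos of_nat_Suc)
    have "norm (X n - 0) < e" if n: "n \<ge> N" for n
    proof -
      have "1 / real (Suc n) \<le> 1 / real (Suc N)" using n by (simp add: frac_le)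
      then have small: "1 / real (Suc n) < t * e" using N by linarith
      have "t\<^sup>2 * D \<le> t * e" using mult_left_mono[OF tD, of t] t by (simp add: power2_eq_square mult.assoc)
      moreover have "0 \<le> 1 / real (Suc n) + 4 * (t * X n) + t\<^sup>2 * D"
        using main[of t n] t by (simp add: mult.assoc)
      moreover have "0 \<le> 1 / real (Suc n) - 4 * (t * X n) + t\<^sup>2 * D"
        using main[of "-t" n] t by (simp add: mult.assoc)
      moreover have "t * e > 0" using t e by simp
      ultimately have "t * X n < t * e" "t * (- e) < t * X n"
        using small unfolding mult_minus_right by linarith+
      then have "X n < e" "- e < X n" using t(1) by (simp_all only: mult_less_cancel_left_pos)
      then show ?thesis by (simp add: abs_less_iff)
    qed
    then show "\<exists>N. \<forall>n\<ge>N. norm (X n - 0) < e" by blast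
  qed
  then show ?thesis by (simp add: X_def M_def)
qed

text \<open>Convergence almost everywhere and a uniform L4 bound are enough, because the last
  argument is fixed. By \<open>tri_bound\<close> the part of the difference that exceeds a small
  multiple of an L1-bounded sequence is dominated by a fixed integrable function, so it tends to
  zero in the mean; the multiple \<open>t\<close> is free.\<close>

lemma T_tendsto:
  assumes u: "\<And>n::nat. u n \<in> V" and S: "\<And>n. S4 (u n) \<le> C" and w: "w \<in> V" and v: "v \<in> V"
    and lim: "AE x in lebesgue. \<forall>i\<in>{1..d}. (\<lambda>n. u n i x) \<longlonglongrightarrow> w i x"
  shows "(\<lambda>n. T (u n) v) \<longlonglongrightarrow> T w v"
proof -
  define \<tau> where "\<tau> = (\<lambda>n x. tri (at_pt (u n) x) (at_pt v x))"
  define \<tau>0 where "\<tau>0 = (\<lambda>x. tri (at_pt w x) (at_pt v x))"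
  define \<sigma> where "\<sigma> = (\<lambda>u x. (sq (at_pt u x))\<^sup>2)"
  have \<tau>: "integrable lebesgue (\<tau> n)" for n unfolding \<tau>_def by (rule tri_integrable[OF u v])
  have \<tau>0: "integrable lebesgue \<tau>0" unfolding \<tau>0_def by (rule tri_integrable[OF w v])
  have \<sigma>: "integrable lebesgue (\<sigma> z)" if "z \<in> V" for z unfolding \<sigma>_def by (rule sq2_integrable[OF that])
  have \<sigma>S: "(LINT x|lebesgue. \<sigma> z x) = S4 z" for z by (simp add: \<sigma>_def S4_def)
  have meas: "\<tau> n \<in> borel_measurable lebesgue" "\<tau>0 \<in> borel_measurable lebesgue"
    "\<sigma> (u n) \<in> borel_measurable lebesgue" "\<sigma> w \<in> borel_measurable lebesgue" for n
    using \<tau> \<tau>0 \<sigma>[OF u] \<sigma>[OF w] by (auto intro: borel_measurable_integrable)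
  have ptw: "AE x in lebesgue. (\<lambda>n. \<tau> n x) \<longlonglongrightarrow> \<tau>0 x"
    using lim
  proof eventually_elim
    case (elim x)
    then show ?case unfolding \<tau>_def \<tau>0_def tri_def
      by (intro tendsto_sum tendsto_mult tendsto_const tendsto_power) auto
  qed
  show ?thesis
  proof (rule LIMSEQ_I)
    fix e :: real assume e: "e > 0"
    have SC: "C + S4 w \<ge> 0" using S[of 0] S4_nonneg[of "u 0"] S4_nonneg[of w] by linarith
    define t where "t = e / (4 * b * (C + S4 w + 1))"
    have t: "t > 0" using e b_pos SC by (simp add: t_def)
    have tb: "2 * b * t * (C + S4 w) \<le> e / 2"
    proof -
      have "4 * b * (C + S4 w + 1) * t = e" using b_pos SC by (simp add: t_def)
      then have "2 * b * t * (C + S4 w) = e / 2 - 2 * b * t" by (simp add: algebra_simps)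
      moreover have "2 * b * t > 0" using b_pos t by simp
      ultimately show ?thesis by linarith
    qed
    \<comment> \<open>The excess over the small multiple, to which dominated convergence applies;
      what is cut off has integral at most \<open>e / 2\<close> by \<open>tb\<close>.\<close>
    define E where "E = (\<lambda>n x. max 0 (\<bar>\<tau> n x - \<tau>0 x\<bar> - 2 * b * t * (\<sigma> (u n) x + \<sigma> w x)))"
    have dom: "E n x \<le> 2 * b / (64 * t ^ 3) * \<sigma> v x" for n x
    proof -
      have "\<bar>\<tau> n x\<bar> \<le> b * (2 * t * \<sigma> (u n) x + \<sigma> v x / (64 * t ^ 3))" "\<bar>\<tau>0 x\<bar> \<le> b * (2 * t * \<sigma> w x + \<sigma> v x / (64 * t ^ 3))"
        unfolding \<tau>_def \<tau>0_def \<sigma>_def by (rule tri_bound[OF t])+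
      then have "\<bar>\<tau> n x - \<tau>0 x\<bar> \<le> b * (2 * t * \<sigma> (u n) x + \<sigma> v x / (64 * t ^ 3)) + b * (2 * t * \<sigma> w x + \<sigma> v x / (64 * t ^ 3))"
        using abs_triangle_ineq4[of "\<tau> n x" "\<tau>0 x"] by linarith
      also have "\<dots> = 2 * b * t * (\<sigma> (u n) x + \<sigma> w x) + 2 * b / (64 * t ^ 3) * \<sigma> v x"
        by (simp add: algebra_simps)
      finally have "\<bar>\<tau> n x - \<tau>0 x\<bar> - 2 * b * t * (\<sigma> (u n) x + \<sigma> w x) \<le> 2 * b / (64 * t ^ 3) * \<sigma> v x" by linarith
      moreover have "0 \<le> 2 * b / (64 * t ^ 3) * \<sigma> v x" using b_pos t by (simp add: \<sigma>_def)
      ultimately show ?thesis by (simp add: E_def)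
    qed
    have Em: "E n \<in> borel_measurable lebesgue" for n
      unfolding E_def using meas by measurable
    have dI: "integrable lebesgue (\<lambda>x. 2 * b / (64 * t ^ 3) * \<sigma> v x)" by (intro integrable_mult_right \<sigma> v)
    have Enn: "E n x \<ge> 0" for n x by (simp add: E_def)
    have dom': "AE x in lebesgue. norm (E n x) \<le> 2 * b / (64 * t ^ 3) * \<sigma> v x" for n
      using dom[of n] Enn[of n] by simp
    have Elim: "AE x in lebesgue. (\<lambda>n. E n x) \<longlonglongrightarrow> 0"
      using ptw
    proof eventually_elim
      case (elim x)
      have "(\<lambda>n. \<bar>\<tau> n x - \<tau>0 x\<bar>) \<longlonglongrightarrow> \<bar>\<tau>0 x - \<tau>0 x\<bar>" by (intro tendsto_intros elim)
      then have 0: "(\<lambda>n. \<bar>\<tau> n x - \<tau>0 x\<bar>) \<longlonglongrightarrow> 0" by simp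
      show ?case
      proof (rule tendsto_sandwich[OF _ _ tendsto_const 0])
        have "0 \<le> 2 * b * t * (\<sigma> (u n) x + \<sigma> w x)" for n using b_pos t by (simp add: \<sigma>_def)
        then show "\<forall>\<^sub>F n in sequentially. E n x \<le> \<bar>\<tau> n x - \<tau>0 x\<bar>" by (simp add: E_def)
      qed (simp add: Enn)
    qed
    have "(\<lambda>n. LINT x|lebesgue. E n x) \<longlonglongrightarrow> (LINT x|lebesgue. 0 * \<sigma> v x)"
      by (rule integral_dominated_convergence[where w = "\<lambda>x. 2 * b / (64 * t ^ 3) * \<sigma> v x"])
        (use Em dI Elim dom' in simp_all)
    then have "(\<lambda>n. LINT x|lebesgue. E n x) \<longlonglongrightarrow> 0" by simp
    from LIMSEQ_D[OF this, of "e / 2"] e obtain N where N: "\<And>n. n \<ge> N \<Longrightarrow> \<bar>LINT x|lebesgue. E n x\<bar> < e / 2" by auto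
    have EI: "integrable lebesgue (E n)" for n
    proof (rule Bochner_Integration.integrable_bound[OF dI Em])
      show "AE x in lebesgue. norm (E n x) \<le> norm (2 * b / (64 * t ^ 3) * \<sigma> v x)"
        using dom'[of n] by eventually_elim (rule order_trans, assumption, simp only: real_norm_def abs_ge_self)
    qed
    have "norm (T (u n) v - T w v) < e" if "n \<ge> N" for n
    proof -
      have "T (u n) v - T w v = (LINT x|lebesgue. \<tau> n x - \<tau>0 x)"
        unfolding T_def \<tau>_def[symmetric] using \<tau>[of n] \<tau>0 by (simp add: \<tau>_def \<tau>0_def)
      then have "\<bar>T (u n) v - T w v\<bar> \<le> (LINT x|lebesgue. \<bar>\<tau> n x - \<tau>0 x\<bar>)"
        by (simp only: integral_abs_bound)
      also have "\<dots> \<le> (LINT x|lebesgue. E n x + 2 * b * t * (\<sigma> (u n) x + \<sigma> w x))"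
      proof (rule integral_mono)
        show "integrable lebesgue (\<lambda>x. \<bar>\<tau> n x - \<tau>0 x\<bar>)"
          by (rule integrable_abs, rule Bochner_Integration.integrable_diff[OF \<tau> \<tau>0])
        show "integrable lebesgue (\<lambda>x. E n x + 2 * b * t * (\<sigma> (u n) x + \<sigma> w x))"
          by (rule Bochner_Integration.integrable_add[OF EI integrable_mult_right[OF Bochner_Integration.integrable_add[OF \<sigma>[OF u] \<sigma>[OF w]]]])
      qed (simp add: E_def)
      also have "\<dots> = (LINT x|lebesgue. E n x) + 2 * b * t * (S4 (u n) + S4 w)"
        using EI[of n] \<sigma>[OF u, of n] \<sigma>[OF w] by (simp add: \<sigma>S)
      also have "\<dots> \<le> (LINT x|lebesgue. E n x) + 2 * b * t * (C + S4 w)"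
        using S[of n] b_pos t by simp
      finally show ?thesis using N[OF that] tb by simp
    qed
    then show "\<exists>N. \<forall>n\<ge>N. norm (T (u n) v - T w v) < e" by blast
  qed
qed

end

subsection \<open>Local compactness\<close>

lemma set_integral_cbox_lc:
  assumes "u \<in> H1" "v \<in> H1"
  shows "(LINT y:cbox p q|lebesgue. lc a u b v y) = a * (LINT y:cbox p q|lebesgue. u y) + b * (LINT y:cbox p q|lebesgue. v y)"
  using locally_integrable_cbox[OF has_weak_gradientD(1)[OF weak_grad_H1(1)[OF assms(1)]], of p q]
    locally_integrable_cbox[OF has_weak_gradientD(1)[OF weak_grad_H1(1)[OF assms(2)]], of p q]
  by (simp add: lc_def)

lemma set_integral_cbox_square_le:
  fixes f :: "real^'n::finite \<Rightarrow> real"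
  assumes "square_integrable f"
  shows "(LINT y:cbox p q|lebesgue. f y)\<^sup>2 \<le> measure lborel (cbox p q) * (LINT y|lebesgue. (f y)\<^sup>2)"
proof -
  let ?i = "indicat_real (cbox p q)"
  have i: "integrable lebesgue ?i"
    by (intro integrable_real_indicator) (auto simp: emeasure_lborel_cbox_eq)
  have sq: "(?i y)\<^sup>2 = ?i y" for y by (simp add: indicator_def)
  have "square_integrable ?i"
    using i borel_measurable_integrable[OF i] by (simp add: square_integrable_def sq)
  from Cauchy_Schwarz_L2[OF this assms] show ?thesis
    by (simp add: sq set_lebesgue_integral_def)
qed

text \<open>Together with linearity this is the form of continuity that \<open>weak_limit_H1\<close>
  asks of a functional.\<close>

lemma set_integral_cbox_lipschitz:
  fixes u v :: "real^'n::finite \<Rightarrow> real"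
  assumes u: "u \<in> H1" and v: "v \<in> H1" and c: "c > 0"
  shows "\<bar>(LINT y:cbox p q|lebesgue. u y) - (LINT y:cbox p q|lebesgue. v y)\<bar>
     \<le> sqrt (measure lborel (cbox p q) / c) * sqrt (ip c (lc 1 u (-1) v) (lc 1 u (-1) v))"
proof -
  let ?w = "lc 1 u (-1) v"
  have w: "?w \<in> H1" by (rule H1_lc(1)[OF u v])
  have nn: "(LINT x|lebesgue. (norm (weak_grad ?w x))\<^sup>2) \<ge> 0" by (auto intro!: integral_nonneg_AE)
  have "(LINT y|lebesgue. (?w y)\<^sup>2) \<le> ip c ?w ?w / c"
    using nn c unfolding ip_self[OF w] by (simp add: field_simps)
  then have "measure lborel (cbox p q) * (LINT y|lebesgue. (?w y)\<^sup>2) \<le> measure lborel (cbox p q) * (ip c ?w ?w / c)"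
    by (intro mult_left_mono) auto
  then have "(LINT y:cbox p q|lebesgue. ?w y)\<^sup>2 \<le> measure lborel (cbox p q) / c * ip c ?w ?w"
    using set_integral_cbox_square_le[OF weak_grad_H1(3)[OF w], of p q] by simp
  then have "sqrt ((LINT y:cbox p q|lebesgue. ?w y)\<^sup>2) \<le> sqrt (measure lborel (cbox p q) / c * ip c ?w ?w)"
    by (rule real_sqrt_le_mono)
  moreover have "(LINT y:cbox p q|lebesgue. ?w y) = (LINT y:cbox p q|lebesgue. u y) - (LINT y:cbox p q|lebesgue. v y)"
    using set_integral_cbox_lc[OF u v, of p q 1 "-1"] by simp
  ultimately show ?thesis by (simp only: real_sqrt_abs real_sqrt_mult)
qed

lemma convergent_of_uniform_approx:
  fixes s :: "nat \<Rightarrow> real"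
  assumes "\<And>e. e > 0 \<Longrightarrow> \<exists>c. convergent c \<and> (\<forall>n. \<bar>s n - c n\<bar> \<le> e)"
  shows "convergent s"
proof -
  have "Cauchy s"
  proof (rule metric_CauchyI)
    fix e :: real assume "e > 0"
    then have e4: "e / 4 > 0" by simp
    from assms[OF this] obtain c where c: "convergent c" "\<And>n. \<bar>s n - c n\<bar> \<le> e / 4" by blast
    obtain N where N: "\<And>m n. m \<ge> N \<Longrightarrow> n \<ge> N \<Longrightarrow> dist (c m) (c n) < e / 4"
      using convergent_Cauchy[OF c(1)] e4 unfolding Cauchy_def by blast
    have "dist (s m) (s n) < e" if "m \<ge> N" "n \<ge> N" for m n
    proof -
      have "\<bar>s m - s n\<bar> \<le> \<bar>s m - c m\<bar> + \<bar>c m - c n\<bar> + \<bar>s n - c n\<bar>" by argo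
      then show ?thesis using c(2)[of m] c(2)[of n] N[OF that] \<open>e > 0\<close> unfolding dist_real_def by argo
    qed
    then show "\<exists>N. \<forall>m\<ge>N. \<forall>n\<ge>N. dist (s m) (s n) < e" by blast
  qed
  then show ?thesis by (rule Cauchy_convergent)
qed

text \<open>The pointwise bound of \<open>\<bar>f\<bar>\<close> by
  \<open>t * f\<^sup>2 + 1 / (4 * t)\<close>, integrated over the part outside the smaller box. It
  gives closeness of box integrals uniformly over functions bounded in L2.\<close>

lemma set_integral_cbox_diff_le:
  fixes f :: "real^'n::finite \<Rightarrow> real"
  assumes f: "square_integrable f" and sub: "cbox x y \<subseteq> cbox p q" and t: "t > 0"
  shows "\<bar>(LINT z:cbox x y|lebesgue. f z) - (LINT z:cbox p q|lebesgue. f z)\<bar>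
    \<le> t * (LINT z|lebesgue. (f z)\<^sup>2) + (measure lborel (cbox p q) - measure lborel (cbox x y)) / (4 * t)"
proof -
  let ?i = "indicat_real (cbox p q)" and ?j = "indicat_real (cbox x y)"
  have i: "integrable lebesgue ?i" and j: "integrable lebesgue ?j"
    by (intro integrable_real_indicator; auto simp: emeasure_lborel_cbox_eq)+
  have fi: "integrable lebesgue (\<lambda>z. ?i z * f z)" and fj: "integrable lebesgue (\<lambda>z. ?j z * f z)"
    using locally_integrable_cbox[OF square_integrable_locally[OF f]] by (auto simp: set_integrable_def)
  have f2: "integrable lebesgue (\<lambda>z. (f z)\<^sup>2)" using f by (simp add: square_integrable_def)
  have pw: "\<bar>?j z * f z - ?i z * f z\<bar> \<le> t * (f z)\<^sup>2 + (?i z - ?j z) / (4 * t)" for z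
  proof -
    have "0 \<le> (2 * t * \<bar>f z\<bar> - 1)\<^sup>2 / (4 * t)" using t by simp
    also have "\<dots> = t * (f z)\<^sup>2 + 1 / (4 * t) - \<bar>f z\<bar>"
      using t by (simp add: field_simps power2_eq_square)
    finally have 1: "\<bar>f z\<bar> \<le> t * (f z)\<^sup>2 + 1 / (4 * t)" by simp
    have 2: "0 \<le> t * (f z)\<^sup>2" using t by simp
    consider "z \<in> cbox x y" "z \<in> cbox p q" | "z \<notin> cbox x y" "z \<in> cbox p q" | "z \<notin> cbox x y" "z \<notin> cbox p q"
      using sub by blast
    then show ?thesis by cases (use 1 2 in auto)
  qed
  have "(LINT z:cbox x y|lebesgue. f z) - (LINT z:cbox p q|lebesgue. f z) = (LINT z|lebesgue. ?j z * f z - ?i z * f z)"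
    using fi fj by (simp add: set_lebesgue_integral_def)
  then have "\<bar>(LINT z:cbox x y|lebesgue. f z) - (LINT z:cbox p q|lebesgue. f z)\<bar> \<le> (LINT z|lebesgue. \<bar>?j z * f z - ?i z * f z\<bar>)"
    by (simp only: integral_abs_bound)
  also have "\<dots> \<le> (LINT z|lebesgue. t * (f z)\<^sup>2 + (?i z - ?j z) / (4 * t))"
  proof (rule integral_mono)
    show "integrable lebesgue (\<lambda>z. \<bar>?j z * f z - ?i z * f z\<bar>)"
      by (rule integrable_abs, rule Bochner_Integration.integrable_diff[OF fj fi])
    show "integrable lebesgue (\<lambda>z. t * (f z)\<^sup>2 + (?i z - ?j z) / (4 * t))"
      by (rule Bochner_Integration.integrable_add[OF integrable_mult_right[OF f2]
            integrable_divide[OF Bochner_Integration.integrable_diff[OF i j]]])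
  qed (rule pw)
  also have "\<dots> = t * (LINT z|lebesgue. (f z)\<^sup>2) + (measure lborel (cbox p q) - measure lborel (cbox x y)) / (4 * t)"
    using f2 i j by (simp add: Bochner_Integration.integral_add integrable_divide Bochner_Integration.integrable_diff)
  finally show ?thesis .
qed

lemma measure_cube: "l \<ge> 0 \<Longrightarrow> measure lborel (cbox x (x + l *\<^sub>R One :: real^'n::finite)) = l ^ CARD('n)"
  using emeasure_cube[of l "x + l *\<^sub>R One"] by (simp add: measure_def)

text \<open>A diagonal sequence handles the countably many boxes with corners in a dense set. An
  arbitrary cube is enclosed in such a box of slightly larger volume, and the error is uniform in
  \<open>n\<close>.\<close>

lemma subsequence_box_integrals_convergent:
  fixes f :: "nat \<Rightarrow> nat \<Rightarrow> real^'n::finite \<Rightarrow> real"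
  assumes f: "\<And>n i. i \<in> I \<Longrightarrow> square_integrable (f n i)"
    and R: "\<And>n i. i \<in> I \<Longrightarrow> (LINT x|lebesgue. (f n i x)\<^sup>2) \<le> R"
  obtains k where "strict_mono k"
    "\<And>i x l. i \<in> I \<Longrightarrow> l > 0 \<Longrightarrow> convergent (\<lambda>n. LINT y:cbox x (x + l *\<^sub>R One)|lebesgue. f (k n) i y)"
proof (cases "I = {}")
  case True
  then show thesis using that[of id] by (simp add: strict_mono_def)
next
  case False
  then obtain i0 where i0: "i0 \<in> I" by blast
  have "0 \<le> (LINT x|lebesgue. (f 0 i0 x)\<^sup>2)" by (auto intro!: integral_nonneg_AE)
  then have R0: "R \<ge> 0" using R[OF i0, of 0] by linarith
  obtain D :: "(real^'n) set" where D: "countable D" "\<And>X. open X \<Longrightarrow> X \<noteq> {} \<Longrightarrow> \<exists>p\<in>D. p \<in> X"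
    using countable_dense_setE by metis
  define v where "v = (\<lambda>p q. measure lborel (cbox p (q::real^'n)))"
  have v0: "v p q \<ge> 0" for p q by (simp add: v_def)
  \<comment> \<open>Division by \<open>1 + v p q\<close> makes the values bounded uniformly in the
    corners, as \<open>function_convergent_subsequence\<close> takes a single bound for all
    indices.\<close>
  define g where "g = (\<lambda>n (i, p, q). (LINT y:cbox p q|lebesgue. f n i y) / (1 + v p q))"
  have gb: "norm (g n z) \<le> 1 + R" if zI: "z \<in> I \<times> D \<times> D" for n z
  proof -
    obtain i p q where z: "z = (i, p, q)" "i \<in> I" using zI by (elim SigmaE) simp
    have "(LINT y:cbox p q|lebesgue. f n i y)\<^sup>2 \<le> v p q * R"
      using set_integral_cbox_square_le[OF f[OF z(2)], of p q n] mult_left_mono[OF R[OF z(2), of n] v0[of p q]]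
      unfolding v_def by linarith
    also have "\<dots> \<le> ((1 + v p q) * (1 + R))\<^sup>2"
    proof -
      have "v p q * R \<le> (1 + v p q) * (1 + R)" using v0[of p q] R0 by (intro mult_mono) auto
      moreover have "1 * 1 \<le> (1 + v p q) * (1 + R)" using v0[of p q] R0 by (intro mult_mono) auto
      then have "(1 + v p q) * (1 + R) \<le> ((1 + v p q) * (1 + R))\<^sup>2"
        by (intro self_le_power) auto
      ultimately show ?thesis by linarith
    qed
    finally have "\<bar>LINT y:cbox p q|lebesgue. f n i y\<bar> \<le> (1 + v p q) * (1 + R)"
      unfolding abs_le_square_iff[symmetric] abs_mult using v0[of p q] R0 by simp
    moreover have "1 + v p q > 0" using v0[of p q] by simp
    ultimately show ?thesis by (simp add: z(1) g_def pos_divide_le_eq mult.commute)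
  qed
  have "countable (I \<times> D \<times> D)" using D(1) by auto
  then obtain k where k: "strict_mono (k :: nat \<Rightarrow> nat)" and kl: "\<And>z. z \<in> I \<times> D \<times> D \<Longrightarrow> \<exists>L. (\<lambda>n. g (k n) z) \<longlonglongrightarrow> L"
    using function_convergent_subsequence[of "I \<times> D \<times> D" g "1 + R"] gb by blast
  show thesis
  proof (rule that[OF k])
    fix i l and x :: "real^'n" assume i: "i \<in> I" and l: "l > (0::real)"
    have D_conv: "convergent (\<lambda>n. LINT y:cbox p q|lebesgue. f (k n) i y)" if pq: "p \<in> D" "q \<in> D" for p q
    proof -
      obtain L where "(\<lambda>n. g (k n) (i, p, q)) \<longlonglongrightarrow> L" using kl[of "(i, p, q)"] i pq by auto
      then have "(\<lambda>n. g (k n) (i, p, q) * (1 + v p q)) \<longlonglongrightarrow> L * (1 + v p q)" by (intro tendsto_intros)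
      moreover have "1 + v p q \<noteq> 0" using v0[of p q] by linarith
      ultimately show ?thesis unfolding convergent_def g_def by auto
    qed
    show "convergent (\<lambda>n. LINT y:cbox x (x + l *\<^sub>R One)|lebesgue. f (k n) i y)"
    proof (rule convergent_of_uniform_approx)
      fix e :: real assume e: "e > 0"
      \<comment> \<open>The L2 term then costs at most \<open>e / 2\<close>; an excess volume of at
        most \<open>2 * t * e\<close>, divided by \<open>4 * t\<close>, costs the other
        half.\<close>
      define t where "t = e / 2 / (R + 1)"
      have t: "t > 0" using e R0 by (simp add: t_def)
      have tR: "t * R \<le> e / 2"
      proof -
        have "R + 1 \<noteq> 0" using R0 by simp
        then have "t * (R + 1) = e / 2" using nonzero_eq_divide_eq[of "R + 1" t "e / 2"] t_def by blast
        then show ?thesis using t by (simp add: distrib_left)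
      qed
      have "(\<lambda>n. (l + 2 * (1 / real (Suc n))) ^ CARD('n) - l ^ CARD('n)) \<longlonglongrightarrow> (l + 2 * 0) ^ CARD('n) - l ^ CARD('n)"
        by (intro tendsto_intros LIMSEQ_Suc lim_1_over_n)
      then have "\<forall>\<^sub>F n in sequentially. (l + 2 * (1 / real (Suc n))) ^ CARD('n) - l ^ CARD('n) < 2 * t * e"
        using t e by (intro order_tendstoD(2)) auto
      then obtain n0 where n0: "(l + 2 * (1 / real (Suc n0))) ^ CARD('n) - l ^ CARD('n) < 2 * t * e"
        by (auto simp: eventually_sequentially)
      define s where "s = 1 / real (Suc n0)"
      have s: "s > 0" by (simp add: s_def)
      let ?y = "x + l *\<^sub>R One"
      have "box (x - s *\<^sub>R One) x \<noteq> {}" "box ?y (?y + s *\<^sub>R One) \<noteq> {}"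
        using s by (auto simp: box_ne_empty inner_simps)
      then obtain p q where pD: "p \<in> D" "p \<in> box (x - s *\<^sub>R One) x" and qD: "q \<in> D" "q \<in> box ?y (?y + s *\<^sub>R One)"
        using D(2) open_box by metis
      have pq: "p $ j < x $ j" "x $ j - s < p $ j" "x $ j + l < q $ j" "q $ j < x $ j + l + s" for j
        using pD(2) qD(2) by (auto simp: mem_box_cart)
      have sub: "cbox x ?y \<subseteq> cbox p q"
      proof
        fix z assume z: "z \<in> cbox x ?y"
        have "p $ j \<le> z $ j \<and> z $ j \<le> q $ j" for j
        proof -
          have "x $ j \<le> z $ j \<and> z $ j \<le> x $ j + l" using z by (simp add: mem_box_cart)
          then show ?thesis using pq[of j] by linarith
        qed
        then show "z \<in> cbox p q" by (simp add: mem_box_cart)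
      qed
      have sub2: "cbox p q \<subseteq> cbox (x - s *\<^sub>R One) ((x - s *\<^sub>R One) + (l + 2 * s) *\<^sub>R One)"
      proof
        fix z assume z: "z \<in> cbox p q"
        have "x $ j - s \<le> z $ j \<and> z $ j \<le> x $ j - s + (l + 2 * s)" for j
        proof -
          have "p $ j \<le> z $ j \<and> z $ j \<le> q $ j" using z by (simp add: mem_box_cart)
          then show ?thesis using pq[of j] by linarith
        qed
        then show "z \<in> cbox (x - s *\<^sub>R One) ((x - s *\<^sub>R One) + (l + 2 * s) *\<^sub>R One)"
          by (simp add: mem_box_cart)
      qed
      have "v p q \<le> (l + 2 * s) ^ CARD('n)"
        unfolding v_def measure_cube[of "l + 2 * s" "x - s *\<^sub>R One", symmetric, OF order.strict_implies_order[OF add_pos_pos[OF l mult_pos_pos[OF zero_less_numeral s]]]]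
        by (rule content_subset[OF sub2])
      then have vd: "v p q - v x ?y \<le> 2 * t * e"
        using n0 l by (simp add: v_def measure_cube s_def)
      have "\<bar>(LINT y:cbox x ?y|lebesgue. f (k n) i y) - (LINT y:cbox p q|lebesgue. f (k n) i y)\<bar> \<le> e" for n
      proof -
        have "\<bar>(LINT y:cbox x ?y|lebesgue. f (k n) i y) - (LINT y:cbox p q|lebesgue. f (k n) i y)\<bar>
            \<le> t * (LINT z|lebesgue. (f (k n) i z)\<^sup>2) + (v p q - v x ?y) / (4 * t)"
          unfolding v_def by (rule set_integral_cbox_diff_le[OF f[OF i] sub t])
        also have "\<dots> \<le> t * R + (2 * t * e) / (4 * t)"
          using R[OF i, of "k n"] t vd by (intro add_mono mult_left_mono divide_right_mono) auto
        also have "\<dots> \<le> e" using tR t by simp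
        finally show ?thesis .
      qed
      then show "\<exists>c. convergent c \<and> (\<forall>n. \<bar>(LINT y:cbox x ?y|lebesgue. f (k n) i y) - c n\<bar> \<le> e)"
        using D_conv[OF pD(1) qD(1)] by blast
    qed
  qed
qed

text \<open>For \<open>l\<close> at most 1 the power \<open>4 - CARD('n)\<close> may be weakened to
  1. The oscillation thus tends to zero with \<open>l\<close>, uniformly over functions with bounded
  gradient norm.\<close>

lemma H1_osc_integral:
  fixes u :: "real^'n::finite \<Rightarrow> real"
  assumes u: "u \<in> H1" and N: "CARD('n) \<le> 3" and l: "0 < l" "l \<le> 1"
    and G: "(LINT x|lebesgue. (norm (weak_grad u x))\<^sup>2) \<le> G"
  shows "integrable lebesgue (\<lambda>x. (u x - avg l u x) ^ 4)"
    and "(LINT x|lebesgue. (u x - avg l u x) ^ 4) \<le> osc_const TYPE('n) ^ 4 * l * G\<^sup>2"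
proof -
  define K where "K = osc_const TYPE('n)"
  define G0 where "G0 = (LINT x|lebesgue. (norm (weak_grad u x))\<^sup>2)"
  have G0: "G0 \<ge> 0" unfolding G0_def by (auto intro!: integral_nonneg_AE)
  have K: "K > 0" unfolding K_def by (rule osc_const_pos)
  have L4: "L4_bound (\<lambda>x. u x - avg l u x) (K * root 4 (l ^ (4 - CARD('n))) * sqrt G0)"
    unfolding K_def G0_def by (rule avg_osc_L4_bound[OF weak_grad_H1(1,2)[OF u] l(1) N])
  show "integrable lebesgue (\<lambda>x. (u x - avg l u x) ^ 4)" by (rule L4_bound_integral(1)[OF L4])
  have "(LINT x|lebesgue. (u x - avg l u x) ^ 4) \<le> (K * root 4 (l ^ (4 - CARD('n))) * sqrt G0) ^ 4"
    by (rule L4_bound_integral(2)[OF L4])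
  also have "\<dots> = K ^ 4 * l ^ (4 - CARD('n)) * G0\<^sup>2"
    using l G0 by (simp add: power_mult_distrib power4_eq_xxxx[of "sqrt G0"] power2_eq_square[of G0])
  also have "\<dots> \<le> K ^ 4 * l ^ 1 * G\<^sup>2"
    using N l G G0 K unfolding G0_def[symmetric]
    by (intro mult_mono power_decreasing power_mono mult_nonneg_nonneg) auto
  finally show "(LINT x|lebesgue. (u x - avg l u x) ^ 4) \<le> osc_const TYPE('n) ^ 4 * l * G\<^sup>2"
    by (simp add: K_def)
qed

lemma avg_square_bound:
  fixes u :: "real^'n::finite \<Rightarrow> real"
  assumes u: "square_integrable u" and l: "l > 0" and G: "(LINT x|lebesgue. (u x)\<^sup>2) \<le> G"
  shows "(avg l u x)\<^sup>2 \<le> G / l ^ CARD('n)"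
proof -
  have i: "integrable lebesgue (\<lambda>x. (u x)\<^sup>2)" using u by (simp add: square_integrable_def)
  have "(avg l u x)\<^sup>2 \<le> avg l (\<lambda>x. (u x)\<^sup>2) x"
    by (rule avg_square_le[OF square_integrable_locally[OF u] integrable_locally_integrable[OF i] l])
  also have "\<dots> \<le> (LINT x|lebesgue. (u x)\<^sup>2) / l ^ CARD('n)"
    by (rule avg_le_integral[OF i _ l]) simp
  also have "\<dots> \<le> G / l ^ CARD('n)" using G l by (simp add: divide_right_mono)
  finally show ?thesis .
qed

lemma quartic_sum_le: "(x + y) ^ 4 \<le> 8 * (x ^ 4 + y ^ 4)" for x y :: real
  using quartic_convex[of "1/2" x y] by (simp add: power_one_over)

text \<open>A form of Rellich's theorem. The difference consists of two oscillations, uniformly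
  small for small \<open>l\<close>, and a difference of averages, which is bounded and tends to zero
  pointwise. The integrable weight provides the dominating function on the unbounded space.\<close>

lemma weighted_L4_tendsto_0:
  fixes f :: "nat \<Rightarrow> real^'n::finite \<Rightarrow> real"
  assumes f: "\<And>n. f n \<in> H1" and w: "w \<in> H1" and N: "CARD('n) \<le> 3"
    and Gf: "\<And>n. (LINT x|lebesgue. (norm (weak_grad (f n) x))\<^sup>2) \<le> G" and Gw: "(LINT x|lebesgue. (norm (weak_grad w x))\<^sup>2) \<le> G"
    and Rf: "\<And>n. (LINT x|lebesgue. (f n x)\<^sup>2) \<le> R" and Rw: "(LINT x|lebesgue. (w x)\<^sup>2) \<le> R"
    and lim: "\<And>l x. l > 0 \<Longrightarrow> (\<lambda>n. avg l (f n) x) \<longlonglongrightarrow> avg l w x"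
    and \<rho>: "integrable lebesgue \<rho>" "\<And>x. 0 \<le> \<rho> x" "\<And>x. \<rho> x \<le> 1"
  shows "integrable lebesgue (\<lambda>x. \<rho> x * (f n x - w x) ^ 4)"
    and "(\<lambda>n. LINT x|lebesgue. \<rho> x * (f n x - w x) ^ 4) \<longlonglongrightarrow> 0"
proof -
  have \<rho>m[measurable]: "\<rho> \<in> borel_measurable lebesgue" using \<rho>(1) by (rule borel_measurable_integrable)
  have fm[measurable]: "f n \<in> borel_measurable lebesgue" for n using weak_grad_H1(3)[OF f] by (auto simp: square_integrable_def)
  have wm[measurable]: "w \<in> borel_measurable lebesgue" using weak_grad_H1(3)[OF w] by (auto simp: square_integrable_def)
  have d4: "integrable lebesgue (\<lambda>x. (f n x - w x) ^ 4)" for n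
    using Sobolev_L4(1)[OF weak_grad_H1(1,2,3)[OF H1_lc(1)[OF f[of n] w, of 1 "-1"]] zero_less_one N] by (simp add: lc_def)
  have weigh: "integrable lebesgue (\<lambda>x. \<rho> x * h x)" if h: "integrable lebesgue h" for h :: "real^'n \<Rightarrow> real"
  proof (rule Bochner_Integration.integrable_bound[OF h])
    show "(\<lambda>x. \<rho> x * h x) \<in> borel_measurable lebesgue" using borel_measurable_integrable[OF h] by measurable
    show "AE x in lebesgue. norm (\<rho> x * h x) \<le> norm (h x)"
      using \<rho>(2,3) by (intro AE_I2) (simp add: abs_mult mult_left_le_one_le)
  qed
  show i1: "integrable lebesgue (\<lambda>x. \<rho> x * (f n x - w x) ^ 4)" for n by (rule weigh[OF d4])
  show "(\<lambda>n. LINT x|lebesgue. \<rho> x * (f n x - w x) ^ 4) \<longlonglongrightarrow> 0"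
  proof (rule LIMSEQ_I)
    fix e :: real assume e: "e > 0"
    define K where "K = osc_const TYPE('n) ^ 4 * G\<^sup>2"
    have K: "K \<ge> 0" unfolding K_def by simp
    \<comment> \<open>The two oscillations enter with factor 64 each and together take less than
      \<open>e / 2\<close>; the averages, below \<open>e / 128\<close> and again with factor 64,
      take the rest.\<close>
    define l where "l = min 1 (e / (256 * (K + 1)))"
    have l: "0 < l" "l \<le> 1" using e K by (auto simp: l_def)
    have "l * (256 * (K + 1)) \<le> e" using K by (simp add: l_def min_le_iff_disj flip: pos_le_divide_eq)
    then have Kl: "256 * (K * l) < e" using l by (simp add: algebra_simps)
    define Af where "Af = (\<lambda>n x. f n x - avg l (f n) x)"
    define Aw where "Aw = (\<lambda>x. w x - avg l w x)"
    define Da where "Da = (\<lambda>n x. avg l (f n) x - avg l w x)"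
    have fl: "locally_integrable (f n)" for n by (rule has_weak_gradientD(1)[OF weak_grad_H1(1)[OF f]])
    have wl: "locally_integrable w" by (rule has_weak_gradientD(1)[OF weak_grad_H1(1)[OF w]])
    have Dam: "Da n \<in> borel_measurable lebesgue" for n
      unfolding Da_def by (intro borel_measurable_diff avg_measurable fl wl)
    have AfI: "integrable lebesgue (\<lambda>x. (Af n x) ^ 4)" "(LINT x|lebesgue. (Af n x) ^ 4) \<le> K * l" for n
      using H1_osc_integral[OF f N l Gf, of n] by (simp_all add: Af_def K_def mult_ac)
    have AwI: "integrable lebesgue (\<lambda>x. (Aw x) ^ 4)" "(LINT x|lebesgue. (Aw x) ^ 4) \<le> K * l"
      using H1_osc_integral[OF w N l Gw] by (simp_all add: Aw_def K_def mult_ac)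
    define C where "C = 16 * (R / l ^ CARD('n))\<^sup>2"
    have DaC: "(Da n x) ^ 4 \<le> C" for n x
    proof -
      have a4: "(avg l z x) ^ 4 \<le> (R / l ^ CARD('n))\<^sup>2" if "square_integrable z" "(LINT x|lebesgue. (z x)\<^sup>2) \<le> R" for z
        using power_mono[OF avg_square_bound[OF that(1) l(1) that(2), of x], of 2] by (simp flip: power_mult)
      have "(Da n x) ^ 4 = (avg l (f n) x + (- avg l w x)) ^ 4" by (simp add: Da_def)
      also have "\<dots> \<le> 8 * ((avg l (f n) x) ^ 4 + (- avg l w x) ^ 4)" by (rule quartic_sum_le)
      also have "\<dots> \<le> C"
        using a4[OF weak_grad_H1(3)[OF f] Rf, of n] a4[OF weak_grad_H1(3)[OF w] Rw] by (simp add: C_def)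
      finally show ?thesis .
    qed
    have \<rho>D_bound: "norm (\<rho> x * (Da n x) ^ 4) \<le> C * \<rho> x" for n x
      using DaC[of n x] \<rho>(2)[of x] by (simp add: abs_mult mult.commute[of "\<rho> x"] mult_right_mono)
    have CI: "integrable lebesgue (\<lambda>x. C * \<rho> x)" by (rule integrable_mult_right[OF \<rho>(1)])
    have \<rho>Dm: "(\<lambda>x. \<rho> x * (Da n x) ^ 4) \<in> borel_measurable lebesgue" for n
      using Dam[of n] \<rho>m by measurable
    have \<rho>DI: "integrable lebesgue (\<lambda>x. \<rho> x * (Da n x) ^ 4)" for n
    proof (rule Bochner_Integration.integrable_bound[OF CI \<rho>Dm])
      show "AE x in lebesgue. norm (\<rho> x * (Da n x) ^ 4) \<le> norm (C * \<rho> x)"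
        using \<rho>D_bound by (intro AE_I2) (metis abs_ge_self order_trans real_norm_def)
    qed
    have "(\<lambda>n. LINT x|lebesgue. \<rho> x * (Da n x) ^ 4) \<longlonglongrightarrow> (LINT x|lebesgue. \<rho> x * 0)"
    proof (rule integral_dominated_convergence[where w = "\<lambda>x. C * \<rho> x"])
      show "AE x in lebesgue. (\<lambda>n. \<rho> x * (Da n x) ^ 4) \<longlonglongrightarrow> \<rho> x * 0"
      proof (intro AE_I2 tendsto_mult tendsto_const)
        fix x
        have "(\<lambda>n. (Da n x) ^ 4) \<longlonglongrightarrow> (avg l w x - avg l w x) ^ 4"
          unfolding Da_def by (intro tendsto_intros lim l)
        then show "(\<lambda>n. (Da n x) ^ 4) \<longlonglongrightarrow> 0" by simp
      qed
    qed (use CI \<rho>Dm \<rho>D_bound in auto)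
    then have "(\<lambda>n. LINT x|lebesgue. \<rho> x * (Da n x) ^ 4) \<longlonglongrightarrow> 0" by simp
    from LIMSEQ_D[OF this, of "e / 128"] e obtain n0 where n0: "\<And>n. n \<ge> n0 \<Longrightarrow> \<bar>LINT x|lebesgue. \<rho> x * (Da n x) ^ 4\<bar> < e / 128" by auto
    have "norm ((LINT x|lebesgue. \<rho> x * (f n x - w x) ^ 4) - 0) < e" if "n \<ge> n0" for n
    proof -
      have pw: "\<rho> x * (f n x - w x) ^ 4 \<le> 64 * (Af n x) ^ 4 + 64 * (Aw x) ^ 4 + 64 * (\<rho> x * (Da n x) ^ 4)" for x
      proof -
        have "(f n x - w x) ^ 4 = ((Af n x + (- Aw x)) + Da n x) ^ 4" by (simp add: Af_def Aw_def Da_def)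
        also have "\<dots> \<le> 8 * ((Af n x + (- Aw x)) ^ 4 + (Da n x) ^ 4)" by (rule quartic_sum_le)
        also have "\<dots> \<le> 8 * (8 * ((Af n x) ^ 4 + (- Aw x) ^ 4) + (Da n x) ^ 4)"
          using quartic_sum_le[of "Af n x" "- Aw x"] by simp
        finally have "(f n x - w x) ^ 4 \<le> 64 * (Af n x) ^ 4 + 64 * (Aw x) ^ 4 + 64 * (Da n x) ^ 4"
          by (simp, smt (verit) zero_le_even_power even_numeral)
        then have "\<rho> x * (f n x - w x) ^ 4 \<le> \<rho> x * (64 * (Af n x) ^ 4 + 64 * (Aw x) ^ 4 + 64 * (Da n x) ^ 4)"
          by (rule mult_left_mono[OF _ \<rho>(2)])
        also have "\<dots> = \<rho> x * (64 * (Af n x) ^ 4 + 64 * (Aw x) ^ 4) + 64 * (\<rho> x * (Da n x) ^ 4)"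
          by (simp add: algebra_simps)
        also have "\<rho> x * (64 * (Af n x) ^ 4 + 64 * (Aw x) ^ 4) \<le> 64 * (Af n x) ^ 4 + 64 * (Aw x) ^ 4"
          using \<rho>(2,3)[of x] by (intro mult_left_le_one_le) auto
        finally show ?thesis by simp
      qed
      have "(LINT x|lebesgue. \<rho> x * (f n x - w x) ^ 4)
          \<le> (LINT x|lebesgue. 64 * (Af n x) ^ 4 + 64 * (Aw x) ^ 4 + 64 * (\<rho> x * (Da n x) ^ 4))"
      proof (rule integral_mono[OF i1 _ pw])
        show "integrable lebesgue (\<lambda>x. 64 * (Af n x) ^ 4 + 64 * (Aw x) ^ 4 + 64 * (\<rho> x * (Da n x) ^ 4))"
          by (rule Bochner_Integration.integrable_add[OF Bochner_Integration.integrable_add[OF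
                integrable_mult_right[OF AfI(1)] integrable_mult_right[OF AwI(1)]] integrable_mult_right[OF \<rho>DI]])
      qed
      also have "\<dots> = 64 * (LINT x|lebesgue. (Af n x) ^ 4) + 64 * (LINT x|lebesgue. (Aw x) ^ 4) + 64 * (LINT x|lebesgue. \<rho> x * (Da n x) ^ 4)"
        using AfI(1)[of n] AwI(1) \<rho>DI[of n] by simp
      also have "\<dots> < e"
        using AfI(2)[of n] AwI(2) n0[OF that] Kl by (simp add: abs_less_iff)
      finally have "(LINT x|lebesgue. \<rho> x * (f n x - w x) ^ 4) < e" .
      moreover have "(LINT x|lebesgue. \<rho> x * (f n x - w x) ^ 4) \<ge> 0"
        using \<rho>(2) by (intro integral_nonneg_AE) auto
      ultimately show ?thesis by simp
    qed
    then show "\<exists>n0. \<forall>n\<ge>n0. norm ((LINT x|lebesgue. \<rho> x * (f n x - w x) ^ 4) - 0) < e" by blast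
  qed
qed

subsection \<open>Existence of a critical point with small energy\<close>

context cubic_system
begin

text \<open>
  If all averages on a fixed scale were small, then the \<open>L\<^sup>4\<close> norm would be small, because the
  oscillation around the averages is controlled by the gradient.
\<close>

lemma nonvanishing:
  assumes R: "R \<ge> 0"
  shows "\<exists>l>0. \<exists>\<delta>>0. \<forall>u\<in>V. B u = 1 \<longrightarrow> Q u \<le> R \<longrightarrow> (\<exists>a. \<delta> \<le> (\<Sum>i=1..d. (avg l (u i) a)\<^sup>2))"
proof -
  obtain C where C: "C > 0" and CQ: "\<And>u i. u \<in> V \<Longrightarrow> i \<in> {1..d} \<Longrightarrow> (LINT x|lebesgue. (u i x)\<^sup>2) \<le> C * Q u"
    using L2_le_Q by blast
  define K where "K = osc_const TYPE('n) ^ 4"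
  have K: "K \<ge> 0" using osc_const_pos[where 'n = 'n] by (simp add: K_def)
  define H where "H = 8 * b * (real d)\<^sup>2"
  have H: "H > 0" using b_pos d_pos by (simp add: H_def)
  \<comment> \<open>The proof by contradiction leads to
    \<open>1 = B u \<le> X * l + Y * \<delta>\<close>; the choices of \<open>l\<close> and
    \<open>\<delta>\<close> make both terms at most 1/4.\<close>
  define X where "X = H * K * R\<^sup>2"
  define Y where "Y = H * C * R"
  have XY: "X \<ge> 0" "Y \<ge> 0" using H K C R by (auto simp: X_def Y_def)
  define l where "l = 1 / (4 * X + 1)"
  define \<delta> where "\<delta> = 1 / (4 * Y + 1)"
  have l: "0 < l" "l \<le> 1" using XY by (auto simp: l_def)
  have \<delta>: "0 < \<delta>" using XY by (auto simp: \<delta>_def)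
  have "\<exists>a. \<delta> \<le> (\<Sum>i=1..d. (avg l (u i) a)\<^sup>2)" if u: "u \<in> V" and B1: "B u = 1" and QR: "Q u \<le> R" for u
  proof (rule ccontr)
    assume "\<not> (\<exists>a. \<delta> \<le> (\<Sum>i=1..d. (avg l (u i) a)\<^sup>2))"
    then have lt: "(\<Sum>i=1..d. (avg l (u i) a)\<^sup>2) \<le> \<delta>" for a by (simp add: not_le less_imp_le)
    have each: "(LINT x|lebesgue. (u i x) ^ 4) \<le> 8 * (K * l * R\<^sup>2 + \<delta> * (C * R))" if i: "i \<in> {1..d}" for i
    proof -
      note ui = V_H1[OF u i]
      have G: "(LINT x|lebesgue. (norm (weak_grad (u i) x))\<^sup>2) \<le> R" using grad_le_Q[OF u i] QR by simp
      note osc = H1_osc_integral[OF ui dim l G]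
      have av: "(avg l (u i) x)\<^sup>2 \<le> \<delta>" for x
        using member_le_sum[of i "{1..d}" "\<lambda>i. (avg l (u i) x)\<^sup>2"] i lt[of x] by fastforce
      have am: "avg l (u i) \<in> borel_measurable lebesgue"
        by (rule avg_measurable[OF has_weak_gradientD(1)[OF weak_grad_H1(1)[OF ui]]])
      have i2: "integrable lebesgue (\<lambda>x. (u i x)\<^sup>2)" using weak_grad_H1(3)[OF ui] by (simp add: square_integrable_def)
      have u2: "(LINT x|lebesgue. (u i x)\<^sup>2) \<le> C * R" using CQ[OF u i] mult_left_mono[OF QR, of C] C by linarith
      have "(\<integral>\<^sup>+x. ennreal ((avg l (u i) x) ^ 4) \<partial>lebesgue) \<le> (\<integral>\<^sup>+x. ennreal \<delta> * ennreal (avg l (\<lambda>x. (u i x)\<^sup>2) x) \<partial>lebesgue)"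
      proof (rule nn_integral_mono)
        fix x
        have sq: "(avg l (u i) x)\<^sup>2 \<le> avg l (\<lambda>x. (u i x)\<^sup>2) x"
          by (rule avg_square_le[OF square_integrable_locally[OF weak_grad_H1(3)[OF ui]] integrable_locally_integrable[OF i2] l(1)])
        have "(avg l (u i) x) ^ 4 = (avg l (u i) x)\<^sup>2 * (avg l (u i) x)\<^sup>2" by (simp add: power4_eq_xxxx power2_eq_square)
        \<comment> \<open>One squared average is at most \<open>\<delta>\<close>; the other is left
          to \<open>nn_integral_avg\<close>, which returns the L2 norm.\<close>
        also have "\<dots> \<le> \<delta> * avg l (\<lambda>x. (u i x)\<^sup>2) x" using av[of x] sq \<delta> by (intro mult_mono) auto
        finally have "ennreal ((avg l (u i) x) ^ 4) \<le> ennreal (\<delta> * avg l (\<lambda>x. (u i x)\<^sup>2) x)" by (rule ennreal_leI)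
        also have "\<dots> = ennreal \<delta> * ennreal (avg l (\<lambda>x. (u i x)\<^sup>2) x)" using \<delta> by (intro ennreal_mult') simp
        finally show "ennreal ((avg l (u i) x) ^ 4) \<le> ennreal \<delta> * ennreal (avg l (\<lambda>x. (u i x)\<^sup>2) x)" .
      qed
      also have "\<dots> = ennreal \<delta> * (\<integral>\<^sup>+x. ennreal (avg l (\<lambda>x. (u i x)\<^sup>2) x) \<partial>lebesgue)"
        by (rule nn_integral_cmult) (intro measurable_compose[OF avg_measurable[OF integrable_locally_integrable[OF i2]] measurable_ennreal])
      also have "\<dots> = ennreal \<delta> * ennreal (LINT x|lebesgue. (u i x)\<^sup>2)"
        by (subst nn_integral_avg[OF i2 _ l(1)]) auto
      also have "\<dots> = ennreal (\<delta> * (LINT x|lebesgue. (u i x)\<^sup>2))" using \<delta> by (intro ennreal_mult'[symmetric]) simp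
      also have "\<dots> \<le> ennreal (\<delta> * (C * R))" using u2 \<delta> by (intro ennreal_leI mult_left_mono) auto
      also have "\<dots> = ennreal ((root 4 (\<delta> * (C * R))) ^ 4)" using \<delta> C R by simp
      finally have L4: "L4_bound (avg l (u i)) (root 4 (\<delta> * (C * R)))"
        using am \<delta> C R by (simp add: L4_bound_def)
      have a4: "integrable lebesgue (\<lambda>x. (avg l (u i) x) ^ 4)" "(LINT x|lebesgue. (avg l (u i) x) ^ 4) \<le> \<delta> * (C * R)"
        using L4_bound_integral[OF L4] \<delta> C R by simp_all
      have "(LINT x|lebesgue. (u i x) ^ 4) \<le> (LINT x|lebesgue. 8 * ((u i x - avg l (u i) x) ^ 4 + (avg l (u i) x) ^ 4))"
      proof (rule integral_mono)
        show "integrable lebesgue (\<lambda>x. (u i x) ^ 4)" by (rule H1_quartic_integrable[OF ui])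
        show "integrable lebesgue (\<lambda>x. 8 * ((u i x - avg l (u i) x) ^ 4 + (avg l (u i) x) ^ 4))"
          by (rule integrable_mult_right[OF Bochner_Integration.integrable_add[OF osc(1) a4(1)]])
        show "(u i x) ^ 4 \<le> 8 * ((u i x - avg l (u i) x) ^ 4 + (avg l (u i) x) ^ 4)" for x
          using quartic_sum_le[of "u i x - avg l (u i) x" "avg l (u i) x"] by simp
      qed
      also have "\<dots> = 8 * ((LINT x|lebesgue. (u i x - avg l (u i) x) ^ 4) + (LINT x|lebesgue. (avg l (u i) x) ^ 4))"
        using osc(1) a4(1) by simp
      also have "\<dots> \<le> 8 * (K * l * R\<^sup>2 + \<delta> * (C * R))"
        using osc(2) a4(2) by (simp add: K_def)
      finally show ?thesis .
    qed
    have "S4 u \<le> (LINT x|lebesgue. real d * (\<Sum>i=1..d. (u i x) ^ 4))"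
      unfolding S4_def by (intro integral_mono sq2_integrable[OF u] integrable_mult_right
          Bochner_Integration.integrable_sum H1_quartic_integrable V_H1[OF u] sq_square_le)
    also have "\<dots> = real d * (\<Sum>i=1..d. LINT x|lebesgue. (u i x) ^ 4)"
      by (simp add: Bochner_Integration.integral_sum H1_quartic_integrable V_H1[OF u])
    also have "\<dots> \<le> real d * (\<Sum>i=1..d. 8 * (K * l * R\<^sup>2 + \<delta> * (C * R)))"
      by (intro mult_left_mono sum_mono each) auto
    also have "\<dots> = (real d)\<^sup>2 * (8 * (K * l * R\<^sup>2 + \<delta> * (C * R)))" by (simp add: power2_eq_square)
    finally have "b * S4 u \<le> b * ((real d)\<^sup>2 * (8 * (K * l * R\<^sup>2 + \<delta> * (C * R))))"
      using b_pos by (intro mult_left_mono) auto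
    also have "\<dots> = X * l + Y * \<delta>" by (simp add: X_def Y_def H_def algebra_simps)
    finally have "1 \<le> X * l + Y * \<delta>" using B_le[OF u] B1 by simp
    moreover have "X * l \<le> 1 / 4" "Y * \<delta> \<le> 1 / 4" using XY by (auto simp: l_def \<delta>_def field_simps)
    ultimately show False by simp
  qed
  then show ?thesis using l(1) \<delta> by blast
qed

lemma P_single: "i \<in> {1..d} \<Longrightarrow> P u (single i \<phi>) = ip (lam i) (u i) \<phi>"
proof -
  assume i: "i \<in> {1..d}"
  have "P u (single i \<phi>) = (\<Sum>k=1..d. if k = i then ip (lam i) (u i) \<phi> else 0)"
    unfolding P_def by (intro sum.cong) (auto simp: single_def ip_zero_right)
  then show ?thesis using i by simp
qed

text \<open>The two families of functionals used later: box integrals identify the limit as a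
  function, inner products carry the equation to it.\<close>

lemma weak_limit_component:
  fixes f :: "nat \<Rightarrow> real^'n \<Rightarrow> real"
  assumes f: "\<And>n. f n \<in> H1" and c: "c > 0" and R: "\<And>n. ip c (f n) (f n) \<le> R"
  obtains w where "w \<in> H1"
    "\<And>p q L. (\<lambda>n. LINT y:cbox p q|lebesgue. f n y) \<longlonglongrightarrow> L \<Longrightarrow> (LINT y:cbox p q|lebesgue. w y) = L"
    "\<And>\<phi> L. \<phi> \<in> H1 \<Longrightarrow> (\<lambda>n. ip c (f n) \<phi>) \<longlonglongrightarrow> L \<Longrightarrow> ip c w \<phi> = L"
proof (rule weak_limit_H1[OF f c R])
  fix w :: "real^'n \<Rightarrow> real"
  assume w: "w \<in> H1"
    and lim: "\<And>\<eta> K L. (\<And>u v. u \<in> H1 \<Longrightarrow> v \<in> H1 \<Longrightarrow> \<eta> (lc (1 / 2) u (1 / 2) v) = (\<eta> u + \<eta> v) / 2) \<Longrightarrow>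
       (\<And>u v. u \<in> H1 \<Longrightarrow> v \<in> H1 \<Longrightarrow> \<bar>\<eta> u - \<eta> v\<bar> \<le> K * sqrt (ip c (lc 1 u (-1) v) (lc 1 u (-1) v))) \<Longrightarrow>
       (\<lambda>n. \<eta> (f n)) \<longlonglongrightarrow> L \<Longrightarrow> \<eta> w = (L::real)"
  show thesis
  proof (rule that[OF w])
    fix p q L assume L: "(\<lambda>n. LINT y:cbox p q|lebesgue. f n y) \<longlonglongrightarrow> L"
    show "(LINT y:cbox p q|lebesgue. w y) = L"
    proof (rule lim[OF _ _ L])
      fix u v :: "real^'n \<Rightarrow> real" assume uv: "u \<in> H1" "v \<in> H1"
      show "(LINT y:cbox p q|lebesgue. lc (1 / 2) u (1 / 2) v y) = ((LINT y:cbox p q|lebesgue. u y) + (LINT y:cbox p q|lebesgue. v y)) / 2"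
        using set_integral_cbox_lc[OF uv, of p q "1 / 2" "1 / 2"] by simp
      show "\<bar>(LINT y:cbox p q|lebesgue. u y) - (LINT y:cbox p q|lebesgue. v y)\<bar>
         \<le> sqrt (measure lborel (cbox p q) / c) * sqrt (ip c (lc 1 u (-1) v) (lc 1 u (-1) v))"
        by (rule set_integral_cbox_lipschitz[OF uv c])
    qed
  next
    fix \<phi> L assume \<phi>: "\<phi> \<in> H1" and L: "(\<lambda>n. ip c (f n) \<phi>) \<longlonglongrightarrow> L"
    show "ip c w \<phi> = L"
    proof (rule lim[OF _ _ L])
      fix u v :: "real^'n \<Rightarrow> real" assume uv: "u \<in> H1" "v \<in> H1"
      show "ip c (lc (1 / 2) u (1 / 2) v) \<phi> = (ip c u \<phi> + ip c v \<phi>) / 2"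
        using ip_lc_left[OF uv \<phi>, of c "1 / 2" "1 / 2"] by simp
      have "(ip c (lc 1 u (-1) v) \<phi>)\<^sup>2 \<le> ip c (lc 1 u (-1) v) (lc 1 u (-1) v) * ip c \<phi> \<phi>"
        by (rule ip_Cauchy_Schwarz[OF H1_lc(1)[OF uv] \<phi>]) (use c in simp)
      then have "sqrt ((ip c (lc 1 u (-1) v) \<phi>)\<^sup>2) \<le> sqrt (ip c (lc 1 u (-1) v) (lc 1 u (-1) v) * ip c \<phi> \<phi>)"
        by (rule real_sqrt_le_mono)
      moreover have "ip c (lc 1 u (-1) v) \<phi> = ip c u \<phi> - ip c v \<phi>"
        using ip_lc_left[OF uv \<phi>, of c 1 "-1"] by simp
      ultimately show "\<bar>ip c u \<phi> - ip c v \<phi>\<bar> \<le> sqrt (ip c \<phi> \<phi>) * sqrt (ip c (lc 1 u (-1) v) (lc 1 u (-1) v))"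
        by (simp add: real_sqrt_mult mult.commute)
    qed
  qed
qed

theorem weak_solution_exists:
  assumes \<Psi>: "\<Psi> \<in> V" "B \<Psi> > 0"
  obtains W where "weak_solution W" "\<not> null_vec d W" "Q W \<le> (Q \<Psi>)\<^sup>2 / B \<Psi>"
proof -
  define M where "M = ground_quotient"
  have M: "M > 0" unfolding M_def by (rule ground_quotient_pos[OF \<Psi>])
  obtain u0 where u0: "\<And>n::nat. u0 n \<in> V" "\<And>n. B (u0 n) = 1" "\<And>n. (Q (u0 n))\<^sup>2 \<le> M + 1 / real (Suc n)"
    using minimizing_sequence[OF \<Psi>] unfolding M_def by blast
  define R where "R = sqrt (M + 1)"
  have R: "R \<ge> 0" using M by (simp add: R_def)
  have bound: "Q z \<le> R" if "(Q z)\<^sup>2 \<le> M + 1 / real (Suc n)" for z n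
  proof -
    have "1 / real (Suc n) \<le> 1" by simp
    then have "(Q z)\<^sup>2 \<le> M + 1" using that by linarith
    then show ?thesis unfolding R_def by (rule real_le_rsqrt)
  qed
  obtain l \<delta> where l: "l > 0" and \<delta>: "\<delta> > 0"
    and nonv: "\<And>u. u \<in> V \<Longrightarrow> B u = 1 \<Longrightarrow> Q u \<le> R \<Longrightarrow> (\<exists>a. \<delta> \<le> (\<Sum>i=1..d. (avg l (u i) a)\<^sup>2))"
    using nonvanishing[OF R] by blast
  have "\<forall>n. \<exists>a. \<delta> \<le> (\<Sum>i=1..d. (avg l (u0 n i) a)\<^sup>2)"
    using nonv[OF u0(1,2) bound[OF u0(3)]] by blast
  then obtain a where a: "\<And>n. \<delta> \<le> (\<Sum>i=1..d. (avg l (u0 n i) (a n))\<^sup>2)" by metis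
  \<comment> \<open>The translation puts the nonvanishing average at the origin, where it can be
    followed to the limit.\<close>
  define u where "u = (\<lambda>n i. shift (a n) (u0 n i))"
  have u: "u n \<in> V" "B (u n) = 1" "(Q (u n))\<^sup>2 \<le> M + 1 / real (Suc n)" for n
    using V_shift[OF u0(1)] B_shift[OF u0(1)] Q_shift[OF u0(1)] u0(2,3) by (simp_all add: u_def)
  have u\<delta>: "\<delta> \<le> (\<Sum>i=1..d. (avg l (u n i) 0)\<^sup>2)" for n
  proof -
    have "avg l (u n i) 0 = avg l (u0 n i) (a n)" if "i \<in> {1..d}" for i
      using avg_shift[OF has_weak_gradientD(1)[OF weak_grad_H1(1)[OF V_H1[OF u0(1) that]]], of l "a n" n 0]
      by (simp add: u_def)
    then show ?thesis using a[of n] by simp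
  qed
  obtain C where C: "C > 0" and CQ: "\<And>u i. u \<in> V \<Longrightarrow> i \<in> {1..d} \<Longrightarrow> (LINT x|lebesgue. (u i x)\<^sup>2) \<le> C * Q u"
    using L2_le_Q by blast
  have L2R: "(LINT x|lebesgue. (u n i x)\<^sup>2) \<le> C * R" if "i \<in> {1..d}" for n i
    using CQ[OF u(1) that, of n] mult_left_mono[OF bound[OF u(3)[of n]], of C] C by linarith
  obtain k where k: "strict_mono k" and kconv: "\<And>i x l. i \<in> {1..d} \<Longrightarrow> l > 0 \<Longrightarrow>
      convergent (\<lambda>n. LINT y:cbox x (x + l *\<^sub>R One)|lebesgue. u (k n) i y)"
    using subsequence_box_integrals_convergent[of "{1..d}" u "C * R"] L2R weak_grad_H1(3)[OF V_H1[OF u(1)]] by metis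
  define u1 where "u1 = (\<lambda>n. u (k n))"
  have u1V: "u1 n \<in> V" for n by (simp add: u1_def u(1))
  have u1R: "Q (u1 n) \<le> R" for n unfolding u1_def by (rule bound[OF u(3)])
  have ipR: "ip (lam i) (u1 n i) (u1 n i) \<le> R" if "i \<in> {1..d}" for n i
    using ip_le_Q[OF that, of "u1 n"] u1R[of n] by linarith
  have "\<exists>w. w \<in> H1 \<and> (\<forall>p q L. (\<lambda>n. LINT y:cbox p q|lebesgue. u1 n i y) \<longlonglongrightarrow> L \<longrightarrow> (LINT y:cbox p q|lebesgue. w y) = L)"
    if i: "i \<in> {1..d}" for i
    using weak_limit_component[of "\<lambda>n. u1 n i" "lam i" R] V_H1[OF u1V i] lam_pos[OF i] ipR[OF i] by metis
  then obtain w1 where w1: "\<And>i. i \<in> {1..d} \<Longrightarrow> w1 i \<in> H1"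
    and w1box: "\<And>i p q L. i \<in> {1..d} \<Longrightarrow> (\<lambda>n. LINT y:cbox p q|lebesgue. u1 n i y) \<longlonglongrightarrow> L \<Longrightarrow> (LINT y:cbox p q|lebesgue. w1 i y) = L"
    by metis
  have box_lim: "(\<lambda>n. LINT y:cbox x (x + s *\<^sub>R One)|lebesgue. u1 n i y) \<longlonglongrightarrow> (LINT y:cbox x (x + s *\<^sub>R One)|lebesgue. w1 i y)"
    if i: "i \<in> {1..d}" and s: "s > 0" for i x s
  proof -
    obtain L where L: "(\<lambda>n. LINT y:cbox x (x + s *\<^sub>R One)|lebesgue. u1 n i y) \<longlonglongrightarrow> L"
      using kconv[OF i s, of x] by (auto simp: convergent_def u1_def)
    with w1box[OF i L] show ?thesis by simp
  qed
  \<comment> \<open>A positive integrable weight: convergence in a single weighted L1 norm gives a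
    subsequence converging almost everywhere on the whole space, without an exhaustion by bounded
    sets.\<close>
  obtain \<rho>0 :: "real^'n \<Rightarrow> real" where \<rho>0: "\<rho>0 \<in> borel_measurable lborel" "\<And>x. \<rho>0 x > 0" "\<And>x. \<rho>0 x \<le> 1" "integrable lborel \<rho>0"
    using sigma_finite_measure.obtain_positive_integrable_function[OF lborel.sigma_finite_measure_axioms] by blast
  have \<rho>: "integrable lebesgue \<rho>0" using \<rho>0(1,4) by (simp add: integrable_completion)
  have wl: "integrable lebesgue (\<lambda>x. \<rho>0 x * (u1 n i x - w1 i x) ^ 4)"
      "(\<lambda>n. LINT x|lebesgue. \<rho>0 x * (u1 n i x - w1 i x) ^ 4) \<longlonglongrightarrow> 0" if i: "i \<in> {1..d}" for i n
  proof -
    define G where "G = max R (LINT x|lebesgue. (norm (weak_grad (w1 i) x))\<^sup>2)"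
    define S where "S = max (C * R) (LINT x|lebesgue. (w1 i x)\<^sup>2)"
    have 1: "(LINT x|lebesgue. (norm (weak_grad (u1 n i) x))\<^sup>2) \<le> G" for n
      using grad_le_Q[OF u1V i, of n] u1R[of n] by (simp add: G_def)
    have 2: "(LINT x|lebesgue. (u1 n i x)\<^sup>2) \<le> S" for n
      using L2R[OF i, of "k n"] by (simp add: S_def u1_def)
    have 3: "(\<lambda>n. avg s (u1 n i) x) \<longlonglongrightarrow> avg s (w1 i) x" if "s > 0" for s x
      unfolding avg_def using that by (intro tendsto_divide tendsto_const box_lim[OF i]) auto
    note * = weighted_L4_tendsto_0[OF V_H1[OF u1V i] w1[OF i] dim 1 _ 2 _ 3 \<rho> less_imp_le[OF \<rho>0(2)] \<rho>0(3)]
    show "integrable lebesgue (\<lambda>x. \<rho>0 x * (u1 n i x - w1 i x) ^ 4)"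
      "(\<lambda>n. LINT x|lebesgue. \<rho>0 x * (u1 n i x - w1 i x) ^ 4) \<longlonglongrightarrow> 0"
      by (rule *; simp add: G_def S_def)+
  qed
  \<comment> \<open>Summing over the components makes one subsequence serve all of them.\<close>
  define h where "h = (\<lambda>n x. \<Sum>i=1..d. \<rho>0 x * (u1 n i x - w1 i x) ^ 4)"
  have hI: "integrable lebesgue (h n)" for n unfolding h_def by (rule Bochner_Integration.integrable_sum) (rule wl(1))
  have hnn: "norm (h n x) = h n x" for n x
    unfolding h_def real_norm_def by (rule abs_of_nonneg, rule sum_nonneg) (simp add: less_imp_le[OF \<rho>0(2)])
  have "(\<lambda>n. \<Sum>i=1..d. LINT x|lebesgue. \<rho>0 x * (u1 n i x - w1 i x) ^ 4) \<longlonglongrightarrow> (\<Sum>i=1..d. 0)"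
    by (rule tendsto_sum) (rule wl(2))
  moreover have "(LINT x|lebesgue. h n x) = (\<Sum>i=1..d. LINT x|lebesgue. \<rho>0 x * (u1 n i x - w1 i x) ^ 4)" for n
    unfolding h_def by (rule Bochner_Integration.integral_sum) (rule wl(1))
  ultimately have "(\<lambda>n. LINT x|lebesgue. norm (h n x)) \<longlonglongrightarrow> 0" unfolding hnn by simp
  then obtain r where r: "strict_mono r" and rAE: "AE x in lebesgue. (\<lambda>n. h (r n) x) \<longlonglongrightarrow> 0"
    using tendsto_L1_AE_subseq[of lebesgue h, OF hI] by blast
  define u2 where "u2 = (\<lambda>n. u1 (r n))"
  have AE1: "AE x in lebesgue. \<forall>i\<in>{1..d}. (\<lambda>n. u2 n i x) \<longlonglongrightarrow> w1 i x"
    using rAE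
  proof eventually_elim
    case (elim x)
    show ?case
    proof
      fix i assume i: "i \<in> {1..d}"
      have "(\<lambda>n. \<rho>0 x * (u2 n i x - w1 i x) ^ 4) \<longlonglongrightarrow> 0"
      proof (rule tendsto_sandwich[OF _ _ tendsto_const elim])
        show "\<forall>\<^sub>F n in sequentially. 0 \<le> \<rho>0 x * (u2 n i x - w1 i x) ^ 4" by (simp add: less_imp_le[OF \<rho>0(2)])
        have "\<rho>0 x * (u2 n i x - w1 i x) ^ 4 \<le> h (r n) x" for n
          unfolding h_def u2_def
          by (rule member_le_sum[OF i, of "\<lambda>i. \<rho>0 x * (u1 (r n) i x - w1 i x) ^ 4"]) (simp_all add: less_imp_le[OF \<rho>0(2)])
        then show "\<forall>\<^sub>F n in sequentially. \<rho>0 x * (u2 n i x - w1 i x) ^ 4 \<le> h (r n) x" by simp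
      qed
      then have "(\<lambda>n. (1 / \<rho>0 x) * (\<rho>0 x * (u2 n i x - w1 i x) ^ 4)) \<longlonglongrightarrow> (1 / \<rho>0 x) * 0"
        by (intro tendsto_mult tendsto_const)
      then have "(\<lambda>n. root 4 ((u2 n i x - w1 i x) ^ 4)) \<longlonglongrightarrow> root 4 0"
        using \<rho>0(2)[of x] by (intro tendsto_real_root) simp
      moreover have "root 4 (y ^ 4) = \<bar>y\<bar>" for y :: real
        using real_root_power_cancel[of 4 "\<bar>y\<bar>"] by simp
      ultimately have "(\<lambda>n. \<bar>u2 n i x - w1 i x\<bar>) \<longlonglongrightarrow> 0" by simp
      then show "(\<lambda>n. u2 n i x) \<longlonglongrightarrow> w1 i x"
        by (simp add: tendsto_rabs_zero_iff LIM_zero_iff)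
    qed
  qed
  have u2V: "u2 n \<in> V" for n by (simp add: u2_def u1V)
  have u2R: "Q (u2 n) \<le> R" for n by (simp add: u2_def u1R)
  have ipR2: "ip (lam i) (u2 n i) (u2 n i) \<le> R" if "i \<in> {1..d}" for n i
    unfolding u2_def by (rule ipR[OF that])
  \<comment> \<open>The weak limit is taken anew. The inner products are only shown to converge
    along \<open>u2\<close>, while \<open>w1\<close> inherits limits of functionals that converge
    along the longer sequence \<open>u1\<close>. Equality of averages then identifies
    \<open>w\<close> with \<open>w1\<close> almost everywhere.\<close>
  have "\<exists>w. w \<in> H1 \<and> (\<forall>p q L. (\<lambda>n. LINT y:cbox p q|lebesgue. u2 n i y) \<longlonglongrightarrow> L \<longrightarrow> (LINT y:cbox p q|lebesgue. w y) = L)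
      \<and> (\<forall>\<phi> L. \<phi> \<in> H1 \<longrightarrow> (\<lambda>n. ip (lam i) (u2 n i) \<phi>) \<longlonglongrightarrow> L \<longrightarrow> ip (lam i) w \<phi> = L)"
    if i: "i \<in> {1..d}" for i
    using weak_limit_component[of "\<lambda>n. u2 n i" "lam i" R] V_H1[OF u2V i] lam_pos[OF i] ipR2[OF i] by metis
  then obtain w where w: "\<And>i. i \<in> {1..d} \<Longrightarrow> w i \<in> H1"
    and wbox: "\<And>i p q L. i \<in> {1..d} \<Longrightarrow> (\<lambda>n. LINT y:cbox p q|lebesgue. u2 n i y) \<longlonglongrightarrow> L \<Longrightarrow> (LINT y:cbox p q|lebesgue. w i y) = L"
    and wip: "\<And>i \<phi> L. i \<in> {1..d} \<Longrightarrow> \<phi> \<in> H1 \<Longrightarrow> (\<lambda>n. ip (lam i) (u2 n i) \<phi>) \<longlonglongrightarrow> L \<Longrightarrow> ip (lam i) (w i) \<phi> = L"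
    by metis
  have wV: "w \<in> V" by (rule V_I) (rule w)
  have avg_eq: "avg s (w i) x = avg s (w1 i) x" if i: "i \<in> {1..d}" and s: "s > 0" for i s x
  proof -
    have "(\<lambda>n. LINT y:cbox x (x + s *\<^sub>R One)|lebesgue. u2 n i y) \<longlonglongrightarrow> (LINT y:cbox x (x + s *\<^sub>R One)|lebesgue. w1 i y)"
      using LIMSEQ_subseq_LIMSEQ[OF box_lim[OF i s] r, of x] by (simp only: comp_def u2_def)
    from wbox[OF i this] show ?thesis by (simp add: avg_def)
  qed
  have "AE x in lebesgue. w i x = w1 i x" if i: "i \<in> {1..d}" for i
  proof -
    have "AE x in lebesgue. (\<lambda>n. avg (1 / 2 ^ n) (w i) x) \<longlonglongrightarrow> w i x"
      by (rule AE_avg_tendsto[OF has_weak_gradientD(1)[OF weak_grad_H1(1)[OF w[OF i]]]]) simp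
    moreover have "AE x in lebesgue. (\<lambda>n. avg (1 / 2 ^ n) (w1 i) x) \<longlonglongrightarrow> w1 i x"
      by (rule AE_avg_tendsto[OF has_weak_gradientD(1)[OF weak_grad_H1(1)[OF w1[OF i]]]]) simp
    ultimately show ?thesis
    proof eventually_elim
      case (elim x)
      then show ?case by (simp add: avg_eq[OF i] LIMSEQ_unique)
    qed
  qed
  then have "AE x in lebesgue. \<forall>i\<in>{1..d}. w i x = w1 i x"
    by (subst AE_ball_countable) auto
  then have AE2: "AE x in lebesgue. \<forall>i\<in>{1..d}. (\<lambda>n. u2 n i x) \<longlonglongrightarrow> w i x"
    using AE1 by eventually_elim simp
  obtain KS where KS: "KS > 0" "\<And>u. u \<in> V \<Longrightarrow> S4 u \<le> KS * (Q u)\<^sup>2" using S4_bound by blast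
  have S4R: "S4 (u2 n) \<le> KS * R\<^sup>2" for n
  proof -
    have "KS * (Q (u2 n))\<^sup>2 \<le> KS * R\<^sup>2"
      using KS(1) u2R[of n] Q_nonneg[of "u2 n"] by (intro mult_left_mono power_mono) auto
    then show ?thesis using KS(2)[OF u2V, of n] by linarith
  qed
  have Tlim: "(\<lambda>n. T (u2 n) v) \<longlonglongrightarrow> T w v" if "v \<in> V" for v
    by (rule T_tendsto[OF u2V S4R wV that AE2])
  have B2: "B (u2 n) = 1" for n by (simp add: u2_def u1_def u(2))
  have Q2: "(Q (u2 n))\<^sup>2 \<le> M + 1 / real (Suc n)" for n
  proof -
    have "n \<le> k (r n)" using seq_suble[OF k, of "r n"] seq_suble[OF r, of n] by linarith
    then have "1 / real (Suc (k (r n))) \<le> 1 / real (Suc n)" by (simp add: frac_le)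
    moreover have "(Q (u2 n))\<^sup>2 \<le> M + 1 / real (Suc (k (r n)))" unfolding u2_def u1_def by (rule u(3))
    ultimately show ?thesis by linarith
  qed
  define m where "m = sqrt M"
  have m: "m > 0" "m\<^sup>2 = M" using M by (simp_all add: m_def)
  have "(\<lambda>n. (Q (u2 n))\<^sup>2) \<longlonglongrightarrow> M"
  proof (rule tendsto_sandwich[OF _ _ tendsto_const])
    show "\<forall>\<^sub>F n in sequentially. M \<le> (Q (u2 n))\<^sup>2"
      using ground_quotient_le[OF u2V] B2 by (simp add: M_def)
    show "\<forall>\<^sub>F n in sequentially. (Q (u2 n))\<^sup>2 \<le> M + 1 / real (Suc n)" using Q2 by simp
    have "(\<lambda>n. M + 1 / real (Suc n)) \<longlonglongrightarrow> M + 0" by (intro tendsto_intros LIMSEQ_Suc lim_1_over_n)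
    then show "(\<lambda>n. M + 1 / real (Suc n)) \<longlonglongrightarrow> M" by simp
  qed
  then have "(\<lambda>n. sqrt ((Q (u2 n))\<^sup>2)) \<longlonglongrightarrow> sqrt M" by (rule tendsto_real_sqrt)
  then have Qlim: "(\<lambda>n. Q (u2 n)) \<longlonglongrightarrow> m" by (simp add: m_def Q_nonneg)
  have Qpos: "Q (u2 n) \<noteq> 0" for n
  proof
    assume "Q (u2 n) = 0"
    then show False using ground_quotient_le[OF u2V, of n] B2[of n] M by (simp add: M_def)
  qed
  \<comment> \<open>The vanishing first variation is divided by \<open>Q (u2 n)\<close>, which tends
    to \<open>m > 0\<close>; the multiplier \<open>M / m\<close> equals \<open>m\<close>.\<close>
  have Plim: "(\<lambda>n. P (u2 n) v) \<longlonglongrightarrow> m * T w v" if v: "v \<in> V" for v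
  proof -
    have "(\<lambda>n. Q (u2 n) * P (u2 n) v - M * T (u2 n) v) \<longlonglongrightarrow> 0"
      unfolding M_def by (rule first_variation_tendsto_0[OF u2V B2 _ v]) (use Q2 M in \<open>simp_all add: M_def\<close>)
    then have "(\<lambda>n. (Q (u2 n) * P (u2 n) v - M * T (u2 n) v + M * T (u2 n) v) / Q (u2 n)) \<longlonglongrightarrow> (0 + M * T w v) / m"
      using m(1) by (intro tendsto_intros Tlim[OF v] Qlim) auto
    moreover have "(0 + M * T w v) / m = m * T w v"
      unfolding m(2)[symmetric] using m(1) by (simp add: power2_eq_square)
    ultimately show ?thesis using Qpos by simp
  qed
  have EL: "ip (lam i) (w i) \<phi> = m * T w (single i \<phi>)" if i: "i \<in> {1..d}" and \<phi>: "\<phi> \<in> H1" for i \<phi>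
    using wip[OF i \<phi>] Plim[OF single_V[OF \<phi>], of i] by (simp add: P_single[OF i])
  have Pww: "P w w = Q w" by (simp add: P_def Q_def)
  have "Q w = m * T w w"
    unfolding T_single_sum[OF wV wV] Q_def sum_distrib_left by (intro sum.cong refl EL w)
  then have "(\<lambda>n. P (u2 n) w) \<longlonglongrightarrow> Q w" using Plim[OF wV] by simp
  \<comment> \<open>Weak lower semicontinuity by hand: \<open>Q\<close> of the difference
    \<open>u2 n - w\<close> is nonnegative, and its expansion tends to
    \<open>m - Q w\<close>.\<close>
  then have "(\<lambda>n. Q (u2 n) + 2 * (-1) * P (u2 n) w + (-1)\<^sup>2 * Q w) \<longlonglongrightarrow> m + 2 * (-1) * Q w + (-1)\<^sup>2 * Q w"
    by (intro tendsto_intros Qlim)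
  moreover have "0 \<le> Q (u2 n) + 2 * (-1) * P (u2 n) w + (-1)\<^sup>2 * Q w" for n
    using Q_nonneg[of "\<lambda>i x. u2 n i x + (-1) * w i x"] unfolding Q_add_scaled[OF u2V wV] .
  ultimately have "0 \<le> m + 2 * (-1) * Q w + (-1)\<^sup>2 * Q w"
    by (intro LIMSEQ_le_const) auto
  then have Qw: "Q w \<le> m" by simp
  have "(\<lambda>n. \<Sum>i=1..d. (avg l (u1 n i) 0)\<^sup>2) \<longlonglongrightarrow> (\<Sum>i=1..d. (avg l (w1 i) 0)\<^sup>2)"
    unfolding avg_def by (intro tendsto_sum tendsto_power tendsto_divide tendsto_const box_lim) (use l in auto)
  then have "\<delta> \<le> (\<Sum>i=1..d. (avg l (w1 i) 0)\<^sup>2)"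
    by (rule LIMSEQ_le_const) (use u\<delta> in \<open>auto simp: u1_def\<close>)
  also have "\<dots> = (\<Sum>i=1..d. (avg l (w i) 0)\<^sup>2)" using avg_eq[OF _ l] by (intro sum.cong) auto
  finally have w\<delta>: "\<delta> \<le> (\<Sum>i=1..d. (avg l (w i) 0)\<^sup>2)" .
  \<comment> \<open>The right side of the equation is cubic and the left side linear, so scaling by
    \<open>sqrt m\<close> absorbs the multiplier. The form \<open>Q\<close> is multiplied by
    \<open>m\<close>, which leads to the bound \<open>m * m = M\<close>.\<close>
  define s where "s = sqrt m"
  have s: "s > 0" "s\<^sup>2 = m" using m(1) by (simp_all add: s_def)
  define W where "W = (\<lambda>i x. s * w i x)"
  have WV: "W \<in> V" unfolding W_def by (rule V_scale[OF wV])
  show thesis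
  proof
    show "weak_solution W"
      unfolding weak_solution_def
    proof (intro conjI ballI WV)
      fix i and \<phi> :: "real^'n \<Rightarrow> real" assume i: "i \<in> {1..d}" and \<phi>: "\<phi> \<in> H1"
      have "ip (lam i) (W i) \<phi> = s * ip (lam i) (w i) \<phi>"
        using ip_scale(1)[OF w[OF i] \<phi>, of "lam i" s] by (simp add: W_def ip_commute)
      also have "\<dots> = s * (s\<^sup>2 * T w (single i \<phi>))" by (simp add: EL[OF i \<phi>] s(2))
      also have "\<dots> = T W (single i \<phi>)"
        unfolding W_def T_scale_left by (simp add: power3_eq_cube power2_eq_square)
      finally show "ip (lam i) (W i) \<phi> = T W (single i \<phi>)" .
    qed
    show "\<not> null_vec d W"
    proof
      assume null: "null_vec d W"
      have "avg l (w i) 0 = 0" if i: "i \<in> {1..d}" for i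
      proof -
        have "AE x in lebesgue. W i x = 0" using null i by (simp add: null_vec_def null_fun_def)
        then have "AE x in lebesgue. indicat_real (cbox 0 (0 + l *\<^sub>R One)) x *\<^sub>R w i x = 0"
          by eventually_elim (use s(1) in \<open>simp add: W_def\<close>)
        then show ?thesis unfolding avg_def set_lebesgue_integral_def by (simp add: integral_eq_zero_AE)
      qed
      then show False using w\<delta> \<delta> by simp
    qed
    have "Q W = m * Q w" unfolding W_def by (simp add: Q_scale[OF wV] s(2))
    also have "\<dots> \<le> m * m" using Qw m(1) by (intro mult_left_mono) auto
    also have "\<dots> = M" using m(2) by (simp add: power2_eq_square)
    also have "\<dots> \<le> (Q \<Psi>)\<^sup>2 / B \<Psi>"
      using ground_quotient_le[OF \<Psi>(1)] \<Psi>(2) by (simp add: M_def pos_le_divide_eq)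
    finally show "Q W \<le> (Q \<Psi>)\<^sup>2 / B \<Psi>" .
  qed
qed

end

subsection \<open>Ground states\<close>

text \<open>Difference quotients have integral zero by translation invariance. They converge to the
  partial derivative and are dominated through the mean value theorem.\<close>

lemma integral_partial_deriv_test_function:
  fixes \<phi> :: "real^'n::finite \<Rightarrow> real"
  assumes \<phi>: "test_function \<phi>"
  shows "(LINT x|lebesgue. partial_deriv k \<phi> x) = 0"
proof -
  let ?e = "axis k (1::real)"
  define t where "t = (\<lambda>n. 1 / real (Suc n))"
  have t: "0 < t n" "t n \<le> 1" for n by (auto simp: t_def)
  obtain a where a: "\<And>x. x \<notin> cbox (-a) a \<Longrightarrow> \<phi> x = 0"
    using test_function_bounds[OF \<phi>] by metis
  obtain B where B: "\<And>x. \<bar>partial_deriv k \<phi> x\<bar> \<le> B"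
    using test_function_bounds[OF test_function_partial_deriv[OF \<phi>]] by metis
  have line: "((\<lambda>s. \<phi> (x + s *\<^sub>R ?e)) has_real_derivative partial_deriv k \<phi> (x + s *\<^sub>R ?e)) (at s)" for x s
  proof -
    have d: "(\<phi> has_derivative frechet_derivative \<phi> (at (x + s *\<^sub>R ?e))) (at (x + s *\<^sub>R ?e))"
      using test_function_differentiable[OF \<phi>] by (simp add: differentiable_on_def frechet_derivative_works[symmetric])
    have "((\<lambda>s. x + s *\<^sub>R ?e) has_derivative (\<lambda>h. h *\<^sub>R ?e)) (at s)"
      by (auto intro!: derivative_eq_intros)
    from has_derivative_compose[OF this d]
    have "((\<lambda>s. \<phi> (x + s *\<^sub>R ?e)) has_derivative (\<lambda>h. frechet_derivative \<phi> (at (x + s *\<^sub>R ?e)) (h *\<^sub>R ?e))) (at s)" .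
    moreover have "frechet_derivative \<phi> (at (x + s *\<^sub>R ?e)) (h *\<^sub>R ?e) = partial_deriv k \<phi> (x + s *\<^sub>R ?e) * h" for h
      using linear_scale[OF has_derivative_linear[OF d], of h ?e] by (simp add: partial_deriv_def mult.commute)
    ultimately show ?thesis by (simp add: has_field_derivative_def)
  qed
  \<comment> \<open>The box is enlarged by 1 in every direction because the steps \<open>t n\<close>
    are at most 1.\<close>
  define b where "b = (\<chi> i. \<bar>a $ i\<bar> + 1)"
  define D where "D = (\<lambda>n x. (\<phi> (x + t n *\<^sub>R ?e) - \<phi> x) / t n)"
  have D0: "D n x = 0" if x: "x \<notin> cbox (-b) b" for n x
  proof -
    obtain j where "x $ j < - b $ j \<or> b $ j < x $ j" using x by (auto simp: mem_box_cart not_le)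
    then have j: "x $ j < - (\<bar>a $ j\<bar> + 1) \<or> \<bar>a $ j\<bar> + 1 < x $ j" by (simp add: b_def)
    have e: "0 \<le> (t n *\<^sub>R ?e) $ j" "(t n *\<^sub>R ?e) $ j \<le> 1" using t[of n] by (auto simp: axis_def)
    have "x $ j < - a $ j \<or> a $ j < x $ j" using j by auto
    then have "x \<notin> cbox (-a) a" by (auto simp: mem_box_cart not_le)
    moreover have "(x + t n *\<^sub>R ?e) $ j < - a $ j \<or> a $ j < (x + t n *\<^sub>R ?e) $ j"
      using j e unfolding vector_add_component by auto
    then have "x + t n *\<^sub>R ?e \<notin> cbox (-a) a" by (auto simp: mem_box_cart not_le)
    ultimately show ?thesis by (simp add: D_def a)
  qed
  have DB: "\<bar>D n x\<bar> \<le> B" for n x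
  proof -
    obtain z where "\<phi> (x + t n *\<^sub>R ?e) - \<phi> (x + 0 *\<^sub>R ?e) = (t n - 0) * partial_deriv k \<phi> (x + z *\<^sub>R ?e)"
      using MVT2[of 0 "t n" "\<lambda>s. \<phi> (x + s *\<^sub>R ?e)" "\<lambda>s. partial_deriv k \<phi> (x + s *\<^sub>R ?e)"] line t[of n] by blast
    then have "D n x = partial_deriv k \<phi> (x + z *\<^sub>R ?e)" using t[of n] by (simp add: D_def)
    then show ?thesis using B by simp
  qed
  have \<phi>i: "integrable lebesgue \<phi>"
  proof -
    have "integrable lebesgue (indicat_real K)" if "compact K" for K :: "(real^'n) set"
      using lmeasurable_compact[OF that] by (intro integrable_real_indicator) (auto simp: fmeasurable_def)
    then have "locally_integrable (\<lambda>x::real^'n. 1::real)"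
      by (simp add: locally_integrable_def set_integrable_def)
    from integrable_locally_times_test[OF this \<phi>] show ?thesis by simp
  qed
  have sh: "integrable lebesgue (\<lambda>x. \<phi> (x + v))" "(LINT x|lebesgue. \<phi> (x + v)) = (LINT x|lebesgue. \<phi> x)" for v
    using lebesgue_affine_integral(2,3)[OF _ test_function_measurable[OF \<phi>], of 1 v] \<phi>i by simp_all
  have D_int: "(LINT x|lebesgue. D n x) = 0" for n
    using sh[of "t n *\<^sub>R ?e"] \<phi>i by (simp add: D_def)
  have "(\<lambda>n. LINT x|lebesgue. D n x) \<longlonglongrightarrow> (LINT x|lebesgue. partial_deriv k \<phi> x)"
  proof (rule integral_dominated_convergence[where w = "\<lambda>x. B * indicat_real (cbox (-b) b) x"])
    show "partial_deriv k \<phi> \<in> borel_measurable lebesgue"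
      by (rule test_function_measurable[OF test_function_partial_deriv[OF \<phi>]])
    show "D n \<in> borel_measurable lebesgue" for n
      unfolding D_def
      by (intro borel_measurable_divide borel_measurable_diff borel_measurable_const
          borel_measurable_integrable[OF sh(1)] borel_measurable_integrable[OF \<phi>i])
    have "integrable lebesgue (indicat_real (cbox (-b) b))"
      by (intro integrable_real_indicator) (auto simp: emeasure_lborel_cbox_eq)
    then show "integrable lebesgue (\<lambda>x. B * indicat_real (cbox (-b) b) x)" by (rule integrable_mult_right)
    show "AE x in lebesgue. norm (D n x) \<le> B * indicat_real (cbox (-b) b) x" for n
      using D0 DB by (intro AE_I2) (auto simp: indicator_def)
    have "(\<lambda>n. D n x) \<longlonglongrightarrow> partial_deriv k \<phi> x" for x
    proof -
      have "((\<lambda>s. (\<phi> (x + s *\<^sub>R ?e) - \<phi> x) / s) \<longlongrightarrow> partial_deriv k \<phi> x) (at 0)"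
        using line[of x 0] by (simp add: DERIV_def)
      moreover have "filterlim t (at 0) sequentially"
      proof -
        have "t \<longlonglongrightarrow> 0" unfolding t_def by (intro LIMSEQ_Suc lim_1_over_n)
        moreover have "\<forall>\<^sub>F n in sequentially. t n \<in> UNIV \<and> t n \<noteq> 0"
          using t by (simp add: less_imp_neq[symmetric])
        ultimately show ?thesis unfolding filterlim_at by blast
      qed
      ultimately show ?thesis unfolding D_def by (rule filterlim_compose)
    qed
    then show "AE x in lebesgue. (\<lambda>n. D n x) \<longlonglongrightarrow> partial_deriv k \<phi> x" by simp
  qed
  then have "(\<lambda>n::nat. 0) \<longlonglongrightarrow> (LINT x|lebesgue. partial_deriv k \<phi> x)" unfolding D_int .
  then show ?thesis by (simp add: LIMSEQ_const_iff)
qed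

lemma test_function_mult:
  assumes "test_function \<phi>" "test_function \<psi>"
  shows "test_function (\<lambda>x. \<phi> x * \<psi> x)"
proof -
  have "bounded {x. \<phi> x * \<psi> x \<noteq> 0}"
    by (rule bounded_subset[of "{x. \<phi> x \<noteq> 0}"]) (use assms in \<open>auto simp: test_function_def compact_closure\<close>)
  then show ?thesis using assms by (simp add: test_function_def compact_closure C_class_mult)
qed

text \<open>Integration by parts: the integral of the derivative of the product
  \<open>\<psi> x * \<phi> x\<close> vanishes, and the product rule separates the two terms.\<close>

lemma test_function_H1:
  fixes \<psi> :: "real^'n::finite \<Rightarrow> real"
  assumes \<psi>: "test_function \<psi>"
  shows "\<psi> \<in> H1"
proof -
  define g where "g = (\<lambda>x. \<chi> k. partial_deriv k \<psi> x)"
  have gk: "(\<lambda>x. g x $ k) = partial_deriv k \<psi>" for k by (simp add: g_def)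
  have gm: "g \<in> borel_measurable lebesgue"
  proof (rule continuous_measurable_lebesgue)
    show "continuous_on UNIV g"
      unfolding g_def by (intro continuous_on_vec_lambda test_function_continuous test_function_partial_deriv \<psi>)
  qed
  have "integrable lebesgue (\<lambda>x. \<Sum>k\<in>UNIV. (partial_deriv k \<psi> x)\<^sup>2)"
    by (rule Bochner_Integration.integrable_sum)
      (use test_function_square_integrable[OF test_function_partial_deriv[OF \<psi>]] in \<open>simp add: square_integrable_def\<close>)
  moreover have "(norm (g x))\<^sup>2 = (\<Sum>k\<in>UNIV. (partial_deriv k \<psi> x)\<^sup>2)" for x
    by (simp add: norm_vec_def L2_set_def g_def sum_nonneg)
  ultimately have g2: "square_integrable g" using gm by (simp add: square_integrable_def)
  have \<psi>2: "square_integrable \<psi>" by (rule test_function_square_integrable[OF \<psi>])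
  have "has_weak_gradient \<psi> g"
    unfolding has_weak_gradient_def
  proof (intro conjI allI impI square_integrable_locally \<psi>2 g2)
    fix \<phi> :: "real^'n \<Rightarrow> real" and k assume \<phi>: "test_function \<phi>"
    have d: "(\<eta> has_derivative frechet_derivative \<eta> (at x)) (at x)" if "test_function \<eta>" for \<eta> :: "real^'n \<Rightarrow> real" and x
      using test_function_differentiable[OF that] by (simp add: differentiable_on_def frechet_derivative_works[symmetric])
    have "partial_deriv k (\<lambda>x. \<psi> x * \<phi> x) x = \<psi> x * partial_deriv k \<phi> x + partial_deriv k \<psi> x * \<phi> x" for x
      by (subst partial_deriv_eq[OF has_derivative_mult[OF d[OF \<psi>] d[OF \<phi>]]]) (simp add: partial_deriv_def)
    then have "(LINT x|lebesgue. \<psi> x * partial_deriv k \<phi> x + partial_deriv k \<psi> x * \<phi> x) = 0"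
      using integral_partial_deriv_test_function[OF test_function_mult[OF \<psi> \<phi>], of k] by simp
    moreover have "integrable lebesgue (\<lambda>x. \<psi> x * partial_deriv k \<phi> x)" "integrable lebesgue (\<lambda>x. partial_deriv k \<psi> x * \<phi> x)"
      by (intro integrable_locally_times_test square_integrable_locally test_function_square_integrable
          test_function_partial_deriv \<psi> \<phi>)+
    ultimately show "(LINT x|lebesgue. \<psi> x * partial_deriv k \<phi> x) = - (LINT x|lebesgue. g x $ k * \<phi> x)"
      by (simp add: g_def)
  qed
  from H1_I(1)[OF this g2 \<psi>2] show ?thesis .
qed

lemma box_bump_pos:
  assumes "x \<in> box a b"
  shows "box_bump n a b x > 0"
  unfolding box_bump_def
proof (rule prod_pos)
  fix j
  have "a $ j < x $ j" "x $ j < b $ j" using assms by (auto simp: mem_box_cart)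
  then show "interval_bump n (a $ j) (b $ j) (x $ j) > 0"
    by (simp add: interval_bump_def exp_bump_def)
qed

section \<open>Energy bound and vanishing of components with large mass\<close>

context cubic_system
begin

text \<open>The j-th equation is tested with its own solution and every product is split by
  Cauchy-Schwarz. The factor from \<open>u j\<close> is measured at its own scale
  \<open>lam j\<close>, which supplies the decay; those from the other components only at the common
  scale \<open>c\<close>. Summation over \<open>k\<close> restores \<open>Q u\<close>.\<close>

lemma component_estimate:
  assumes u: "weak_solution u" and j: "j \<in> {1..d}"
    and c: "c > 0" "\<And>k. k \<in> {1..d} \<Longrightarrow> c \<le> lam k"
  shows "ip (lam j) (u j) (u j) \<le> b * (8 * (osc_const TYPE('n) ^ 4 + 1)) *
     sqrt ((1 / sqrt c * (1 / sqrt (lam j))) ^ (4 - CARD('n))) * ip (lam j) (u j) (u j) * Q u"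
proof -
  define K where "K = 8 * (osc_const TYPE('n) ^ 4 + 1)"
  define p where "p = 4 - CARD('n)"
  define q where "q = (\<lambda>k. ip (lam k) (u k) (u k))"
  have K: "K > 0" using osc_const_pos[where 'n = 'n] by (simp add: K_def add_pos_pos)
  have uV: "u \<in> V" using u by (simp add: weak_solution_def)
  have q0: "q k \<ge> 0" if "k \<in> {1..d}" for k unfolding q_def using lam_pos[OF that] by (intro ip_nonneg) simp
  have L4: "(LINT x|lebesgue. (u k x) ^ 4) \<le> K * (1 / sqrt m) ^ p * (q k)\<^sup>2"
    if k: "k \<in> {1..d}" and m: "0 < m" "m \<le> lam k" for k m
  proof -
    note uk = V_H1[OF uV k]
    have "(LINT x|lebesgue. (u k x) ^ 4) \<le> K * (1 / sqrt m) ^ p *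
        ((LINT x|lebesgue. (norm (weak_grad (u k) x))\<^sup>2) + (LINT x|lebesgue. (u k x)\<^sup>2) / (1 / sqrt m)\<^sup>2)\<^sup>2"
      unfolding K_def p_def by (rule Sobolev_L4(2)[OF weak_grad_H1[OF uk] _ dim]) (use m in simp)
    also have "(LINT x|lebesgue. (norm (weak_grad (u k) x))\<^sup>2) + (LINT x|lebesgue. (u k x)\<^sup>2) / (1 / sqrt m)\<^sup>2 = ip m (u k) (u k)"
      using m by (simp add: ip_self[OF uk] power_divide mult.commute)
    also have "K * (1 / sqrt m) ^ p * (ip m (u k) (u k))\<^sup>2 \<le> K * (1 / sqrt m) ^ p * (q k)\<^sup>2"
      unfolding q_def using K m ip_mono[OF uk m(2)] by (intro mult_left_mono power_mono ip_nonneg) auto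
    finally show ?thesis .
  qed
  have pair: "(LINT x|lebesgue. (u j x)\<^sup>2 * (u k x)\<^sup>2) \<le> K * sqrt ((1 / sqrt c * (1 / sqrt (lam j))) ^ p) * (q j * q k)"
    if k: "k \<in> {1..d}" for k
  proof (rule power2_le_imp_le)
    have "(LINT x|lebesgue. (u j x)\<^sup>2 * (u k x)\<^sup>2)\<^sup>2 \<le> (LINT x|lebesgue. (u j x) ^ 4) * (LINT x|lebesgue. (u k x) ^ 4)"
      by (rule H1_square_product_integrable(2)[OF V_H1[OF uV j] V_H1[OF uV k]])
    also have "\<dots> \<le> (K * (1 / sqrt (lam j)) ^ p * (q j)\<^sup>2) * (K * (1 / sqrt c) ^ p * (q k)\<^sup>2)"
      using K lam_pos[OF j] c(1)
      by (intro mult_mono L4 j k c) (auto intro!: integral_nonneg_AE mult_nonneg_nonneg)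
    also have "\<dots> = (K * sqrt ((1 / sqrt c * (1 / sqrt (lam j))) ^ p) * (q j * q k))\<^sup>2"
    proof -
      have nn: "0 \<le> (1 / sqrt c * (1 / sqrt (lam j))) ^ p" using c(1) lam_pos[OF j] by simp
      show ?thesis
        unfolding power_mult_distrib[of "K * sqrt ((1 / sqrt c * (1 / sqrt (lam j))) ^ p)"]
          power_mult_distrib[of K] real_sqrt_pow2[OF nn]
        by (simp only: power_mult_distrib power2_eq_square mult_ac)
    qed
    finally show "(LINT x|lebesgue. (u j x)\<^sup>2 * (u k x)\<^sup>2)\<^sup>2 \<le> (K * sqrt ((1 / sqrt c * (1 / sqrt (lam j))) ^ p) * (q j * q k))\<^sup>2" .
    show "0 \<le> K * sqrt ((1 / sqrt c * (1 / sqrt (lam j))) ^ p) * (q j * q k)"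
      using K c(1) lam_pos[OF j] q0[OF j] q0[OF k] by simp
  qed
  have i: "integrable lebesgue (\<lambda>x. coup j k * ((u j x)\<^sup>2 * (u k x)\<^sup>2))" if "k \<in> {1..d}" for k
    by (rule integrable_mult_right[OF H1_square_product_integrable(1)[OF V_H1[OF uV j] V_H1[OF uV that]]])
  have tri_eq: "tri (at_pt u x) (at_pt (single j (u j)) x) = (\<Sum>k=1..d. coup j k * ((u j x)\<^sup>2 * (u k x)\<^sup>2))" for x
  proof -
    have "tri (at_pt u x) (at_pt (single j (u j)) x)
        = (\<Sum>i=1..d. if i = j then (\<Sum>k=1..d. coup j k * ((u j x)\<^sup>2 * (u k x)\<^sup>2)) else 0)"
      unfolding tri_def by (intro sum.cong) (auto simp: single_def power2_eq_square)
    then show ?thesis using j by simp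
  qed
  have "q j = T u (single j (u j))"
    using u j V_H1[OF uV j] by (simp add: weak_solution_def q_def)
  also have "\<dots> = (\<Sum>k=1..d. LINT x|lebesgue. coup j k * ((u j x)\<^sup>2 * (u k x)\<^sup>2))"
    unfolding T_def tri_eq by (rule Bochner_Integration.integral_sum) (rule i)
  also have "\<dots> \<le> (\<Sum>k=1..d. b * (K * sqrt ((1 / sqrt c * (1 / sqrt (lam j))) ^ p) * (q j * q k)))"
  proof (rule sum_mono)
    fix k assume k: "k \<in> {1..d}"
    have "0 \<le> (LINT x|lebesgue. (u j x)\<^sup>2 * (u k x)\<^sup>2)" by (auto intro!: integral_nonneg_AE)
    then show "(LINT x|lebesgue. coup j k * ((u j x)\<^sup>2 * (u k x)\<^sup>2)) \<le> b * (K * sqrt ((1 / sqrt c * (1 / sqrt (lam j))) ^ p) * (q j * q k))"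
      unfolding integral_mult_right_zero using pair[OF k] coup_bounds[OF j, of k] b_pos by (intro mult_mono) auto
  qed
  also have "\<dots> = b * K * sqrt ((1 / sqrt c * (1 / sqrt (lam j))) ^ p) * q j * Q u"
    by (simp add: Q_def q_def sum_distrib_left mult_ac)
  finally show ?thesis by (simp only: q_def K_def p_def)
qed

text \<open>Dilation by \<open>sqrt (lam 2)\<close> makes gradient and mass terms scale alike. Of
  the quartic part only the cross term \<open>2 * b\<close> of the two equal components is kept,
  whence a bound proportional to \<open>1 / b\<close> and free of the \<open>mu i\<close>.\<close>

lemma test_vector_quotient:
  fixes \<psi> :: "real^'n \<Rightarrow> real"
  assumes d2: "2 \<le> d" and \<psi>: "test_function \<psi>" and E: "E = (LINT x|lebesgue. (\<psi> x) ^ 4)" "E > 0"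
    and le: "lam 1 \<le> lam 2"
  obtains \<Psi> where "\<Psi> \<in> V" "B \<Psi> > 0"
    "(Q \<Psi>)\<^sup>2 / B \<Psi> \<le> 2 * (ip 1 \<psi> \<psi>)\<^sup>2 / E * ((sqrt (lam 2)) ^ 4 / (b * (sqrt (lam 2)) ^ CARD('n)))"
proof -
  define s where "s = sqrt (lam 2)"
  have l2: "lam 2 > 0" using lam_pos[of 2] d2 by simp
  have s: "s > 0" "s\<^sup>2 = lam 2" using l2 by (simp_all add: s_def)
  define A where "A = ip 1 \<psi> \<psi>"
  have \<psi>H: "\<psi> \<in> H1" by (rule test_function_H1[OF \<psi>])
  define G where "G = (LINT x|lebesgue. (norm (weak_grad \<psi> x))\<^sup>2)"
  define U where "U = (LINT x|lebesgue. (\<psi> x)\<^sup>2)"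
  have GU: "G \<ge> 0" "U \<ge> 0" by (auto simp: G_def U_def intro!: integral_nonneg_AE)
  have A: "A = G + U" by (simp add: A_def ip_self[OF \<psi>H] G_def U_def)
  define f where "f = (\<lambda>x. \<psi> (s *\<^sub>R x + 0))"
  have f: "f \<in> H1" unfolding f_def by (rule H1_affine(1)[OF \<psi>H]) (use s in simp)
  define \<Psi> where "\<Psi> = (\<lambda>i::nat. if i = 1 \<or> i = 2 then f else (\<lambda>x. 0))"
  have \<Psi>: "\<Psi> \<in> V" by (rule V_I) (auto simp: \<Psi>_def f zero_H1)
  have sum12: "(\<Sum>i=1..d. if i = 1 \<or> i = 2 then g i else 0) = g 1 + g 2" for g :: "nat \<Rightarrow> real"
  proof -
    have "(\<Sum>i=1..d. if i = 1 \<or> i = 2 then g i else 0) = (\<Sum>i\<in>{1, 2}. if i = 1 \<or> i = 2 then g i else 0)"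
      by (rule sum.mono_neutral_right) (use d2 in auto)
    then show ?thesis by simp
  qed
  have ipf: "ip m f f \<le> s\<^sup>2 * A / s ^ CARD('n)" if m: "0 \<le> m" "m \<le> s\<^sup>2" for m
  proof -
    have "ip m f f = (s\<^sup>2 * G + m * U) / s ^ CARD('n)"
      unfolding f_def G_def U_def by (rule ip_affine_self[OF \<psi>H s(1)])
    also have "\<dots> \<le> (s\<^sup>2 * G + s\<^sup>2 * U) / s ^ CARD('n)"
      using m GU s by (intro divide_right_mono add_mono mult_right_mono) auto
    finally show ?thesis by (simp add: A distrib_left)
  qed
  have "Q \<Psi> = (\<Sum>i=1..d. if i = 1 \<or> i = 2 then ip (lam i) f f else 0)"
    unfolding Q_def by (intro sum.cong) (auto simp: \<Psi>_def ip_zero_right)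
  also have "\<dots> = ip (lam 1) f f + ip (lam 2) f f" by (rule sum12)
  also have "\<dots> \<le> s\<^sup>2 * A / s ^ CARD('n) + s\<^sup>2 * A / s ^ CARD('n)"
    using le l2 lam_pos[of 1] d_pos by (intro add_mono ipf) (auto simp: s(2))
  finally have QP: "Q \<Psi> \<le> 2 * (s\<^sup>2 * A / s ^ CARD('n))" by (simp only: mult_2)
  have f4: "(LINT x|lebesgue. (f x) ^ 4) = E / s ^ CARD('n)"
    using lebesgue_affine_integral(3)[of s "\<lambda>x. (\<psi> x) ^ 4" 0] s(1) borel_measurable_power[OF test_function_measurable[OF \<psi>], of 4]
    by (simp add: f_def E(1) divide_inverse_commute)
  have quart: "2 * b * (f x) ^ 4 \<le> quart (at_pt \<Psi> x)" for x
  proof -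
    have "quart (at_pt \<Psi> x) = (\<Sum>i=1..d. if i = 1 \<or> i = 2 then (\<Sum>j=1..d. if j = 1 \<or> j = 2 then coup i j * (f x) ^ 4 else 0) else 0)"
      unfolding quart_def by (intro sum.cong refl) (auto simp: \<Psi>_def power4_eq_xxxx power2_eq_square intro!: sum.cong)
    also have "\<dots> = coup 1 1 * (f x) ^ 4 + coup 1 2 * (f x) ^ 4 + (coup 2 1 * (f x) ^ 4 + coup 2 2 * (f x) ^ 4)"
      unfolding sum12 by (rule refl)
    finally have "quart (at_pt \<Psi> x) = mu 1 * (f x) ^ 4 + mu 2 * (f x) ^ 4 + 2 * b * (f x) ^ 4" by (simp add: coup_def)
    moreover have "0 \<le> mu 1 * (f x) ^ 4" "0 \<le> mu 2 * (f x) ^ 4"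
      using mu_pos[of 1] mu_pos[of 2] d2 by auto
    ultimately show ?thesis by linarith
  qed
  have "2 * b * (E / s ^ CARD('n)) = (LINT x|lebesgue. 2 * b * (f x) ^ 4)" by (simp add: f4)
  also have "\<dots> \<le> B \<Psi>"
    unfolding B_def by (rule integral_mono[OF integrable_mult_right[OF H1_quartic_integrable[OF f]] quart_integrable[OF \<Psi>] quart])
  finally have BP: "2 * b * (E / s ^ CARD('n)) \<le> B \<Psi>" .
  have pos: "0 < 2 * b * (E / s ^ CARD('n))" using b_pos E(2) s(1) by simp
  show thesis
  proof
    show "\<Psi> \<in> V" by (rule \<Psi>)
    show "B \<Psi> > 0" using BP pos by linarith
    have "(Q \<Psi>)\<^sup>2 / B \<Psi> \<le> (2 * (s\<^sup>2 * A / s ^ CARD('n)))\<^sup>2 / (2 * b * (E / s ^ CARD('n)))"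
      by (intro frac_le power_mono QP BP pos Q_nonneg) auto
    also have "\<dots> = 2 * A\<^sup>2 / E * (s ^ 4 / (b * s ^ CARD('n)))"
      using s(1) E(2) b_pos by (simp add: field_simps power2_eq_square power4_eq_xxxx)
    finally show "(Q \<Psi>)\<^sup>2 / B \<Psi> \<le> 2 * (ip 1 \<psi> \<psi>)\<^sup>2 / E * ((sqrt (lam 2)) ^ 4 / (b * (sqrt (lam 2)) ^ CARD('n)))"
      by (simp add: A_def s_def)
  qed
qed

lemma ground_state_minimal:
  assumes u: "u \<in> (ground_states d lam mu (\<lambda>_ _. b) :: (nat \<Rightarrow> real^'n \<Rightarrow> real) set)"
    and \<Psi>: "\<Psi> \<in> V" "B \<Psi> > 0"
  shows "weak_solution u" "Q u \<le> (Q \<Psi>)\<^sup>2 / B \<Psi>"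
proof -
  let ?F = "energy d lam mu (\<lambda>_ _. b) :: (nat \<Rightarrow> real^'n \<Rightarrow> real) \<Rightarrow> real"
  let ?N = "nonzero_critical_points d lam mu (\<lambda>_ _. b) :: (nat \<Rightarrow> real^'n \<Rightarrow> real) set"
  have N: "weak_solution z" if "z \<in> ?N" for z
    using that critical_weak_solution by (simp add: nonzero_critical_points_def)
  have uN: "u \<in> ?N" and Fu: "?F u = (INF w\<in>?N. ?F w)" using u by (auto simp: ground_states_def)
  show wu: "weak_solution u" by (rule N[OF uN])
  obtain W where W: "weak_solution W" "\<not> null_vec d W" "Q W \<le> (Q \<Psi>)\<^sup>2 / B \<Psi>"
    by (rule weak_solution_exists[OF \<Psi>])
  have WN: "W \<in> ?N" using W(2) weak_solution_critical[OF W(1)] by (simp add: nonzero_critical_points_def)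
  have "0 \<le> ?F z" if "z \<in> ?N" for z
    using weak_solution_energy(2)[OF N[OF that]] Q_nonneg[of z] by simp
  then have "bdd_below (?F ` ?N)" by (rule bdd_belowI2)
  then have "?F u \<le> ?F W" unfolding Fu by (rule cINF_lower[OF _ WN])
  then show "Q u \<le> (Q \<Psi>)\<^sup>2 / B \<Psi>"
    using W(3) by (simp add: weak_solution_energy(2)[OF wu] weak_solution_energy(2)[OF W(1)])
qed

lemma large_component_null:
  fixes \<psi> :: "real^'n \<Rightarrow> real"
  assumes d2: "2 \<le> d" and mono: "\<And>k. k \<in> {1..d} \<Longrightarrow> lam 1 \<le> lam k"
    and \<psi>: "test_function \<psi>" and E: "E = (LINT x|lebesgue. (\<psi> x) ^ 4)" "E > 0"
    and r: "0 < r" "lam 1 = r * lam 2" and j: "j \<in> {1..d}"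
    and D: "D = 8 * (osc_const TYPE('n) ^ 4 + 1) * (2 * (ip 1 \<psi> \<psi>)\<^sup>2 / E) + 1"
    and large: "lam 2 * (D ^ 4 / r) \<le> lam j"
    and u: "u \<in> (ground_states d lam mu (\<lambda>_ _. b) :: (nat \<Rightarrow> real^'n \<Rightarrow> real) set)"
  shows "null_fun (u j)"
proof -
  define K where "K = 8 * (osc_const TYPE('n) ^ 4 + 1)"
  define C where "C = 2 * (ip 1 \<psi> \<psi>)\<^sup>2 / E"
  define s where "s = sqrt (lam 2)"
  define p where "p = 4 - CARD('n)"
  have K: "K > 0" using osc_const_pos[where 'n = 'n] by (simp add: K_def add_pos_pos)
  have C: "C \<ge> 0" using E(2) by (simp add: C_def)
  have D': "D = K * C + 1" unfolding D K_def C_def ..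
  have D1: "D \<ge> 1" unfolding D' using K C by simp
  have l2: "lam 2 > 0" using lam_pos[of 2] d2 by simp
  have l1: "lam 1 > 0" using lam_pos[of 1] d_pos by simp
  have s: "s > 0" using l2 by (simp add: s_def)
  obtain \<Psi> where \<Psi>: "\<Psi> \<in> V" "B \<Psi> > 0" and \<Psi>q: "(Q \<Psi>)\<^sup>2 / B \<Psi> \<le> C * (s ^ 4 / (b * s ^ CARD('n)))"
    unfolding C_def s_def by (rule test_vector_quotient[OF d2 \<psi> E mono]) (use d2 in auto)
  note gs = ground_state_minimal[OF u \<Psi>]
  have "s ^ 4 = s ^ p * s ^ CARD('n)" using dim by (simp add: p_def flip: power_add)
  then have Qu: "Q u \<le> C * (s ^ p / b)" using gs(2) \<Psi>q s by simp
  define q where "q = ip (lam j) (u j) (u j)"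
  \<comment> \<open>Merges the power of \<open>lam 2\<close> from the energy bound with the decay
    factor of the component estimate: their product is \<open>sqrt (\<theta> ^ p)\<close>.\<close>
  define \<theta> where "\<theta> = s * s * (1 / sqrt (lam 1) * (1 / sqrt (lam j)))"
  have lj: "lam j > 0" by (rule lam_pos[OF j])
  have \<theta>0: "\<theta> \<ge> 0" using s l1 lj by (simp add: \<theta>_def)
  have "\<theta> = lam 2 / sqrt (lam 1 * lam j)"
    using l2 by (simp add: \<theta>_def s_def real_sqrt_mult)
  also have "\<dots> \<le> lam 2 / (lam 2 * D\<^sup>2)"
  proof (rule divide_left_mono)
    \<comment> \<open>Here the threshold \<open>D ^ 4 / r\<close> originates:
      \<open>lam 1 = r * lam 2\<close> cancels \<open>r\<close>, and the square root in
      \<open>\<theta>\<close> leaves \<open>D\<^sup>2\<close>.\<close>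
    have "(lam 2 * D\<^sup>2)\<^sup>2 = lam 1 * (lam 2 * (D ^ 4 / r))"
      using r by (simp add: power2_eq_square power4_eq_xxxx)
    also have "\<dots> \<le> lam 1 * lam j" using large l1 by (intro mult_left_mono) auto
    finally show "lam 2 * D\<^sup>2 \<le> sqrt (lam 1 * lam j)" by (rule real_le_rsqrt)
  qed (use l1 l2 lj D1 in auto)
  also have "\<dots> = (1 / D)\<^sup>2" using l2 by (simp add: power_divide)
  finally have \<theta>D: "\<theta> \<le> (1 / D)\<^sup>2" .
  have "(1 / D)\<^sup>2 \<le> 1" using D1 by (intro power_le_one) auto
  then have \<theta>1: "\<theta> \<le> 1" using \<theta>D by linarith
  \<comment> \<open>Since \<open>p\<close> is at least 1 in these dimensions, the first power bounds
    all cases; the outer square root accounts for the second halving of the exponent of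
    \<open>D\<close>.\<close>
  have "\<theta> ^ p \<le> \<theta> ^ 1" using \<theta>0 \<theta>1 dim by (intro power_decreasing) (auto simp: p_def)
  then have "sqrt (\<theta> ^ p) \<le> sqrt ((1 / D)\<^sup>2)" using \<theta>D by (intro real_sqrt_le_mono) simp
  then have sq\<theta>: "sqrt (\<theta> ^ p) \<le> 1 / D" using D1 by simp
  define Z where "Z = sqrt ((1 / sqrt (lam 1) * (1 / sqrt (lam j))) ^ p)"
  have Z0: "Z \<ge> 0" using l1 lj by (simp add: Z_def)
  have "sqrt (\<theta> ^ p) = sqrt ((s ^ p)\<^sup>2 * (1 / sqrt (lam 1) * (1 / sqrt (lam j))) ^ p)"
    unfolding \<theta>_def by (simp only: power_mult_distrib power2_eq_square)
  then have sZ: "sqrt (\<theta> ^ p) = s ^ p * Z"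
    using s by (simp add: Z_def real_sqrt_mult)
  have q0: "q \<ge> 0" unfolding q_def using lj by (intro ip_nonneg) simp
  have "q \<le> b * K * Z * q * Q u"
    unfolding q_def K_def Z_def p_def by (rule component_estimate[OF gs(1) j l1 mono])
  also have "\<dots> \<le> b * K * Z * q * (C * (s ^ p / b))"
    using Qu b_pos K Z0 q0 by (intro mult_left_mono) auto
  also have "\<dots> = K * C * (s ^ p * Z) * q" using b_pos by simp
  also have "\<dots> \<le> K * C * (1 / D) * q"
    using sq\<theta> K C q0 unfolding sZ by (intro mult_right_mono mult_left_mono) auto
  \<comment> \<open>As \<open>D\<close> is \<open>K * C + 1\<close>, this says that \<open>q\<close>
    is at most zero.\<close>
  finally have "q * D \<le> K * C * q" using D1 by (simp add: field_simps)
  then have "q \<le> 0" unfolding D' by (simp add: algebra_simps)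
  then show ?thesis
    unfolding q_def by (intro ip_zero_imp_null[OF _ lj]) (use gs(1) j V_H1 in \<open>auto simp: weak_solution_def\<close>)
qed

end

theorem theorem1p2:
  fixes d :: nat and r :: real
  assumes "CARD('n::finite) \<in> {1, 2, 3}" and "d \<ge> 3" and "0 < r" and "r \<le> 1"
  shows "\<exists>Lam>1. \<forall>(lam :: nat \<Rightarrow> real) (mu :: nat \<Rightarrow> real) (b :: real).
           0 < lam 1 \<and> (\<forall>i\<in>{1..<d}. lam i \<le> lam (Suc i)) \<and> lam 1 / lam 2 = r
           \<and> (\<forall>i\<in>{1..d}. 0 < mu i) \<and> Max (mu ` {1..d}) < b
           \<longrightarrow> (\<forall>i\<in>{3..d}. lam 2 * Lam \<le> lam i \<longrightarrow>
                  (\<forall>u :: nat \<Rightarrow> real^'n \<Rightarrow> real. u \<in> ground_states d lam mu (\<lambda>_ _. b) \<longrightarrow>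
                     (\<forall>j\<in>{i..d}. null_fun (u j))))
             \<and> (map lam [2..<Suc d] \<notin> admissible Lam \<longrightarrow>
                  fully_nontrivial_ground_states d lam mu (\<lambda>_ _. b)
                    = ({} :: (nat \<Rightarrow> real^'n \<Rightarrow> real) set))"
proof -
  \<comment> \<open>One fixed bump on the unit cube, so that \<open>E\<close> and
    \<open>ip 1 \<psi> \<psi>\<close>, and with them \<open>D\<close>, depend on the dimension
    only.\<close>
  define \<psi> where "\<psi> = box_bump 0 0 (One :: real^'n)"
  have \<psi>: "test_function \<psi>" unfolding \<psi>_def by (rule test_function_box_bump)
  define E where "E = (LINT x|lebesgue. (\<psi> x) ^ 4)"
  have dim: "CARD('n) \<le> 3" using assms(1) by auto
  have \<psi>i: "integrable lebesgue (\<lambda>x. (\<psi> x) ^ 4)"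
    by (rule Sobolev_L4(1)[OF weak_grad_H1[OF test_function_H1[OF \<psi>]] zero_less_one dim])
  have E: "E > 0"
  proof (rule ccontr)
    assume "\<not> E > 0"
    moreover have "E \<ge> 0" unfolding E_def by (intro integral_nonneg_AE) auto
    ultimately have "E = 0" by simp
    then have "AE x in lebesgue. (\<psi> x) ^ 4 = 0"
      unfolding E_def by (subst (asm) integral_nonneg_eq_0_iff_AE[OF \<psi>i]) auto
    then have "AE x in lebesgue. x \<notin> box 0 (One :: real^'n)"
    proof eventually_elim
      case (elim x)
      then have "\<psi> x = 0" by simp
      then show ?case using box_bump_pos[of x 0 One 0] unfolding \<psi>_def by force
    qed
    then have "negligible (box 0 (One :: real^'n))"
      by (simp add: negligible_iff_null_sets AE_iff_null_sets)
    moreover have "box 0 (One :: real^'n) \<noteq> {}" by (simp add: box_ne_empty)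
    ultimately show False by (simp add: negligible_interval)
  qed
  define D where "D = 8 * (osc_const TYPE('n) ^ 4 + 1) * (2 * (ip 1 \<psi> \<psi>)\<^sup>2 / E) + 1"
  \<comment> \<open>The summand 1 secures \<open>Lam > 1\<close>, whatever the values of
    \<open>D\<close> and \<open>r\<close>.\<close>
  define Lam where "Lam = D ^ 4 / r + 1"
  have D1: "D \<ge> 1" using E osc_const_pos[where 'n = 'n] by (simp add: D_def)
  have "D ^ 4 / r > 0" using D1 assms(3) by simp
  then have Lam: "Lam > 1" "D ^ 4 / r \<le> Lam" by (simp_all add: Lam_def)
  \<comment> \<open>Stated from index 2 on: in the second claim the index of the largest
    \<open>lam\<close> is only known to lie in \<open>{2..d}\<close>.\<close>
  have main: "null_fun (u j)"
    if h: "0 < lam 1" "\<forall>i\<in>{1..<d}. lam i \<le> lam (Suc i)" "lam 1 / lam 2 = r"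
        "\<forall>i\<in>{1..d}. 0 < mu i" "Max (mu ` {1..d}) < b"
      and i: "i \<in> {2..d}" "lam 2 * Lam \<le> lam i"
      and u: "u \<in> ground_states d lam mu (\<lambda>_ _. b)" and j: "j \<in> {i..d}"
    for lam mu :: "nat \<Rightarrow> real" and b :: real and u :: "nat \<Rightarrow> real^'n \<Rightarrow> real" and i j
  proof -
    have mono: "lam a \<le> lam c" if "a \<le> c" "1 \<le> a" "c \<le> d" for a c
      using that
    proof (induction c rule: dec_induct)
      case (step k)
      then have "lam k \<le> lam (Suc k)" using h(2) by auto
      then show ?case using step by simp
    qed simp
    have pos: "0 < lam k" if "k \<in> {1..d}" for k
      using mono[of 1 k] h(1) that by (auto intro: less_le_trans)
    have l2: "0 < lam 2" using pos[of 2] assms(2) by simp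
    have mub: "mu k < b" if "k \<in> {1..d}" for k
      using h(5) Max_ge[of "mu ` {1..d}" "mu k"] that by fastforce
    interpret cubic_system "TYPE('n)" d lam mu b
      by unfold_locales (use dim assms(2) pos h(4) mub in auto)
    show ?thesis
    proof (rule large_component_null[OF _ _ \<psi> E_def E assms(3) _ _ D_def _ u])
      show "2 \<le> d" using assms(2) by simp
      show "lam 1 \<le> lam k" if "k \<in> {1..d}" for k using mono[of 1 k] that by simp
      show "lam 1 = r * lam 2" using h(3) l2 by (simp add: field_simps)
      show "j \<in> {1..d}" using i(1) j by auto
      have "lam 2 * (D ^ 4 / r) \<le> lam 2 * Lam" using Lam(2) l2 by (intro mult_left_mono) auto
      also have "\<dots> \<le> lam i" by (rule i(2))
      also have "\<dots> \<le> lam j" using mono[of i j] i(1) j by simp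
      finally show "lam 2 * (D ^ 4 / r) \<le> lam j" .
    qed
  qed
  show ?thesis
  proof (intro exI[of _ Lam] conjI allI impI ballI Lam(1))
    fix lam mu :: "nat \<Rightarrow> real" and b :: real and i j and u :: "nat \<Rightarrow> real^'n \<Rightarrow> real"
    assume h: "0 < lam 1 \<and> (\<forall>i\<in>{1..<d}. lam i \<le> lam (Suc i)) \<and> lam 1 / lam 2 = r
           \<and> (\<forall>i\<in>{1..d}. 0 < mu i) \<and> Max (mu ` {1..d}) < b"
      and i: "i \<in> {3..d}" "lam 2 * Lam \<le> lam i" "u \<in> ground_states d lam mu (\<lambda>_ _. b)" "j \<in> {i..d}"
    show "null_fun (u j)"
      by (rule main[of lam mu b i u j]) (use h i in auto)
  next
    fix lam mu :: "nat \<Rightarrow> real" and b :: real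
    assume h: "0 < lam 1 \<and> (\<forall>i\<in>{1..<d}. lam i \<le> lam (Suc i)) \<and> lam 1 / lam 2 = r
           \<and> (\<forall>i\<in>{1..d}. 0 < mu i) \<and> Max (mu ` {1..d}) < b"
      and na: "map lam [2..<Suc d] \<notin> admissible Lam"
    have set: "set (map lam [2..<Suc d]) = lam ` {2..d}" by auto
    have ne: "lam ` {2..d} \<noteq> {}" using assms(2) by simp
    have len: "2 \<le> length (map lam [2..<Suc d])" using assms(2) by (simp del: upt_Suc)
    \<comment> \<open>The list has length at least 2, so failure of admissibility can only come from
      the inequality.\<close>
    have "\<not> Max (lam ` {2..d}) < Lam * Min (lam ` {2..d})"
      using na len unfolding admissible_def mem_Collect_eq set by blast
    then have "Lam * Min (lam ` {2..d}) \<le> Max (lam ` {2..d})" by simp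
    moreover have "Max (lam ` {2..d}) \<in> lam ` {2..d}" using ne by (intro Max_in) auto
    then obtain i where i: "i \<in> {2..d}" "Max (lam ` {2..d}) = lam i" by auto
    have mono: "lam 2 \<le> lam k" if "2 \<le> k" "k \<le> d" for k
      using that
    proof (induction k rule: dec_induct)
      case (step k)
      then have "lam k \<le> lam (Suc k)" using h by auto
      then show ?case using step by simp
    qed simp
    then have "Min (lam ` {2..d}) = lam 2"
      using assms(2) by (intro Min_eqI) auto
    ultimately have big: "lam 2 * Lam \<le> lam i" using i(2) by (simp add: mult.commute)
    show "fully_nontrivial_ground_states d lam mu (\<lambda>_ _. b) = ({} :: (nat \<Rightarrow> real^'n \<Rightarrow> real) set)"
    proof (rule equals0I)
      fix u :: "nat \<Rightarrow> real^'n \<Rightarrow> real"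
      assume u: "u \<in> fully_nontrivial_ground_states d lam mu (\<lambda>_ _. b)"
      have "null_fun (u i)"
        by (rule main[of lam mu b i u i]) (use h i(1) big u in \<open>auto simp: fully_nontrivial_ground_states_def\<close>)
      then show False using u i(1) by (auto simp: fully_nontrivial_ground_states_def)
    qed
  qed
qed

end
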